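(* Let $r\geq 1$ be an integer and let $\alpha$ be one of the arithmetic functions $\omega$, $\Omega$, or $d_k$ (for a fixed integer $k\geq 2$). For each $n\geq 1$ and each finite field $\mathbb{F}_q$, let $a_1,\dots,a_r\in\mathbb{F}_q[T]$ be $r$ distinct polynomials (which may depend on $q$) with $\deg a_j<n$ for all $j$. Then the limit $\lim_{q\to\infty} q^{-n} S_\alpha(\vec a;n,q)$ (over prime powers $q$) satisfies $$\lim_{q\to\infty}\frac{1}{q^n}S_\alpha(\vec a;n,q)\sim \frac{c_r}{(\log n)^{(r-1)/2}},\qquad n\to\infty,\qquad c_r=\frac{1}{(2\pi)^{(r-1)/2}\sqrt{r}}.$$
   Context: $\mathbb{F}_q$ is the finite field with $q$ elements and $M_n\subset\mathbb{F}_q[T]$ is the set of monic polynomials of degree $n$. A prime of $\mathbb{F}_q[T]$ is a monic irreducible polynomial. For $f$ of positive degree, $\omega(f)$ is the number of distinct prime divisors of $f$, $\Omega(f)$ is the number of prime divisors counted with multiplicity, and for monic $f$, $d_k(f)$ is the number of $k$-tuples $(g_1,\dots,g_k)$ of monic polynomials with $f=g_1\cdots g_k$. For distinct $a_1,\dots,a_r\in\mathbb{F}_q[T]$ of degree $<n$, $S_\alpha(\vec a;n,q)=\#\{f\in M_n:\alpha(f+a_1)=\dots=\alpha(f+a_r)\}$.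
   Formalization: Existence of the limit over q is asserted for every n ≥ 1 except n = 2 with r ≥ 4, where it can fail (even q, shifts 0, 1, x, x+1: density 1/4 versus 1/8 for odd q); distinctness and the degree bound on the a_j are required only when r ≤ q^n, since otherwise no such a_j exist. *)

theory Defs
  imports
    "HOL-Algebra.Polynomial_Divisibility"
    "HOL-Number_Theory.Prime_Powers"
    "HOL-Library.Landau_Symbols"
begin

text \<open>
  The theorem lets the coefficient field vary, so fields are carrier-based rings and \<open>R[T]\<close> is
  \<^term>\<open>poly_ring R\<close>: a polynomial is the list of its coefficients, leading coefficient first,
  and the zero polynomial is \<^term>\<open>[]\<close>, whose \<^term>\<open>Polynomials.degree\<close> is \<open>0\<close>.
\<close>

definition monic_polys :: "'a ring \<Rightarrow> 'a list set" where
  "monic_polys R =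
     {f \<in> carrier (poly_ring R). f \<noteq> \<zero>\<^bsub>poly_ring R\<^esub> \<and> Polynomials.lead_coeff f = \<one>\<^bsub>R\<^esub>}"

definition monic_polys_deg :: "'a ring \<Rightarrow> nat \<Rightarrow> 'a list set" where
  "monic_polys_deg R n = {f \<in> monic_polys R. Polynomials.degree f = n}"

definition prime_polys :: "'a ring \<Rightarrow> 'a list set" where
  "prime_polys R = {p \<in> monic_polys R. pirreducible\<^bsub>R\<^esub> (carrier R) p}"

definition prime_divisors :: "'a ring \<Rightarrow> 'a list \<Rightarrow> 'a list set" where
  "prime_divisors R f = {p \<in> prime_polys R. p pdivides\<^bsub>R\<^esub> f}"

definition poly_multiplicity :: "'a ring \<Rightarrow> 'a list \<Rightarrow> 'a list \<Rightarrow> nat" where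
  "poly_multiplicity R p f = (GREATEST e::nat. (p [^]\<^bsub>poly_ring R\<^esub> e) pdivides\<^bsub>R\<^esub> f)"

definition small_omega :: "'a ring \<Rightarrow> 'a list \<Rightarrow> nat" where
  "small_omega R f = card (prime_divisors R f)"

definition big_omega :: "'a ring \<Rightarrow> 'a list \<Rightarrow> nat" where
  "big_omega R f = (\<Sum>p\<in>prime_divisors R f. poly_multiplicity R p f)"

definition divisor_fun :: "nat \<Rightarrow> 'a ring \<Rightarrow> 'a list \<Rightarrow> nat" where
  "divisor_fun k R f =
     card {g \<in> {1..k} \<rightarrow>\<^sub>E monic_polys R. f = (\<Otimes>\<^bsub>poly_ring R\<^esub>i\<in>{1..k}. g i)}"

definition shift_count ::
  "('a ring \<Rightarrow> 'a list \<Rightarrow> nat) \<Rightarrow> 'a ring \<Rightarrow> nat \<Rightarrow> (nat \<Rightarrow> 'a list) \<Rightarrow> nat \<Rightarrow> nat" where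
  "shift_count \<alpha> R r a n =
     card {f \<in> monic_polys_deg R n. \<forall>i\<in>{1..r}. \<forall>j\<in>{1..r}.
             \<alpha> R (f \<oplus>\<^bsub>poly_ring R\<^esub> a i) = \<alpha> R (f \<oplus>\<^bsub>poly_ring R\<^esub> a j)}"

text \<open>
  For \<open>n = 2\<close> and \<open>r \<ge> 4\<close> the normalised count need not converge along all prime powers. For even
  \<open>q\<close> and shifts \<open>0, 1, x, x + 1\<close> with \<open>x\<close> in \<open>F\<^sub>q\<close> but not in \<open>F\<^sub>2\<close>, the polynomial \<open>T\<^sup>2 + b T + c + a\<^sub>j\<close>
  (\<open>b \<noteq> 0\<close>) is irreducible iff \<open>Tr ((c + a\<^sub>j) / b\<^sup>2) = 1\<close>, and these four traces sum to \<open>0\<close>; the limit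
  is \<open>1/4\<close> over even \<open>q\<close> but \<open>1/8\<close> over odd \<open>q\<close>.
\<close>

definition prime_powers_at_top :: "nat filter" where
  "prime_powers_at_top = inf at_top (principal {q. primepow q})"

end

theory Submission
  imports
    Defs
    "HOL-Algebra.Algebraic_Closure_Type"
    "HOL-Analysis.Analysis"
    "HOL-Probability.Probability"
    "HOL-Combinatorics.Combinatorics"
    "HOL-Computational_Algebra.Computational_Algebra"
    "HOL-Real_Asymp.Real_Asymp"
begin

text \<open>
  Let \<open>f\<close> run over the monic polynomials of degree \<open>n\<close> over a field with \<open>q\<close> elements. If all \<open>f + a\<^sub>j\<close> are
  squarefree, then \<open>\<alpha> (f + a\<^sub>j)\<close> is an injective function of the number of cycles of the Frobenius permutation
  of the roots of \<open>f + a\<^sub>j\<close>. As \<open>q\<close> grows, these \<open>r\<close> permutations become independent and uniform, so the limit is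
  \<open>L n = (\<Sum>c. (stirling n c / n!) ^ r)\<close>.

  For \<open>n \<ge> 3\<close> equidistribution is proved by averaging over one-parameter families \<open>f\<^sub>b = base b + w b \<cdot> g\<close> which pass, for each
  \<open>j\<close> and each \<open>i \<le> n - 2\<close>, through a point where \<open>f\<^sub>b + a\<^sub>j\<close> has a root of multiplicity \<open>n - i\<close>, while the other
  \<open>f\<^sub>b + a\<^sub>k\<close> are squarefree there. The ramification at these points makes the monomials in the roots
  linearly independent with controlled weights, i.e. the splitting field of the family has full Galois group \<open>S\<^sub>n ^ r\<close>, and a Stepanov argument then
  bounds the number of \<open>b\<close> with a given Frobenius class from above by \<open>q / (n!) ^ r\<close> up to lower order terms. Upper bounds for a set of
  classes and for its complement together give the asymptotics. For \<open>n = 2\<close> and \<open>r \<le> 3\<close> the event depends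
  only on pair correlations of the number of roots, which are computed directly.

  Finally \<open>stirling n c / n!\<close> is the distribution of a sum of independent Bernoulli variables with parameters
  \<open>1 / k\<close>, \<open>k \<le> n\<close>, and a uniform local limit theorem for it yields the asymptotics of \<open>L n\<close>.
\<close>

hide_const (open) Polynomials.degree Polynomials.lead_coeff ring.coeff ring.monom Perm.order
no_notation vec_nth (infixl "$" 90)

text \<open>No characteristic is excluded, so ramification may be wild and inertia groups are out of
  control. Irreducibility is therefore drawn from Eisenstein's criterion alone, which ignores the
  characteristic: the roots are adjoined one at a time, and for the step after \<open>i\<close>
  roots of the \<open>j\<close>-th polynomial there is a node where those roots are simple and the
  remaining factor of degree \<open>n - i\<close> is Eisenstein. This costs
  \<open>r * (n - 1)\<close> nodes, which bounds the degree in the parameter. The case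
  \<open>i = 0\<close> is harder: \<open>(T - x) ^ n\<close> leaves no root to move, other shifts
  may have multiple roots at that node, and a linear factor has to be excluded by descent to the
  base field.

  Function fields and places are replaced by branches, tuples of power series solving the equations
  near a base point; irreducibility says that a coordinate function vanishing on one branch vanishes
  on all. Only an error tending to zero is wanted, so the Stepanov argument carries a free precision
  \<open>M0\<close>: the relative error is of order \<open>1 / M0\<close> once \<open>q\<close>
  exceeds a bound depending on \<open>M0\<close>.\<close>

section \<open>Eisenstein's criterion over power series\<close>

text \<open>The polynomial variable is given valuation \<open>1 / d\<close>. The weight
  \<open>d * subdegree + i\<close> of a term of index \<open>i < d\<close> determines
  \<open>i\<close> modulo \<open>d\<close>, so two terms never tie and the minimum is attained
  once.\<close>

lemma min_weight_coeff:
  fixes P :: "'w::field fps poly"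
  assumes "degree P < d" "P \<noteq> 0"
  obtains i0 where "coeff P i0 \<noteq> 0" "i0 \<le> degree P"
    "\<And>i. coeff P i \<noteq> 0 \<Longrightarrow> i \<noteq> i0 \<Longrightarrow> d * subdegree (coeff P i0) + i0 < d * subdegree (coeff P i) + i"
proof -
  define I where "I = {i. coeff P i \<noteq> 0}"
  have fin: "finite I" "I \<noteq> {}"
  proof -
    have "I \<subseteq> {..degree P}" by (auto simp: I_def le_degree)
    then show "finite I" using finite_subset by blast
    show "I \<noteq> {}" using assms(2) leading_coeff_neq_0[of P] unfolding I_def by blast
  qed
  define wt where "wt = (\<lambda>i. d * subdegree (coeff P i) + i)"
  obtain i0 where i0: "i0 \<in> I" "\<And>i. i \<in> I \<Longrightarrow> wt i0 \<le> wt i"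
    using fin arg_min_if_finite[of I wt] not_le_imp_less by blast

  have lt: "i < d" if "i \<in> I" for i using that assms(1) le_degree unfolding I_def by fastforce
  have "wt i0 < wt i" if "i \<in> I" "i \<noteq> i0" for i
  proof -
    have "wt i mod d = i" "wt i0 mod d = i0" using lt that i0(1) by (auto simp: wt_def)
    then show ?thesis using i0(2)[OF that(1)] that(2) by (metis le_neq_implies_less)
  qed
  then show ?thesis using that[of i0] i0(1) le_degree unfolding I_def wt_def by auto
qed

text \<open>Weights as in \<open>min_weight_coeff\<close>. A factor of degree below \<open>d\<close>
  has a unique term of least weight, hence so has the product of two such factors; but in an
  Eisenstein polynomial the constant and the leading term tie for the least weight. The multiplier
  \<open>l\<close> admits factorisations with cleared denominators, as they come from a function
  field.\<close>

lemma eisenstein_fps: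
  fixes E P Q :: "'w::field fps poly"
  assumes d: "degree E = d" and lc: "coeff E d = 1" and low: "\<And>m. m < d \<Longrightarrow> coeff E m $ 0 = 0"
    and c0: "coeff E 0 $ 1 \<noteq> 0" and eq: "smult l E = P * Q" and l: "l \<noteq> 0"
    and dP: "0 < degree P" "degree P < d"
  shows False
proof -
  have E0: "E \<noteq> 0" using lc by auto
  have PQ: "P \<noteq> 0" "Q \<noteq> 0" using eq E0 l by auto
  have "degree P + degree Q = d" using eq d l PQ by (metis degree_mult_eq degree_smult_eq)
  then have dQ: "degree Q < d" using dP by simp
  obtain i0 where i0: "coeff P i0 \<noteq> 0" "i0 \<le> degree P"
    "\<And>i. coeff P i \<noteq> 0 \<Longrightarrow> i \<noteq> i0 \<Longrightarrow> d * subdegree (coeff P i0) + i0 < d * subdegree (coeff P i) + i"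
    using min_weight_coeff[OF dP(2) PQ(1)] by blast
  obtain j0 where j0: "coeff Q j0 \<noteq> 0" "j0 \<le> degree Q"
    "\<And>i. coeff Q i \<noteq> 0 \<Longrightarrow> i \<noteq> j0 \<Longrightarrow> d * subdegree (coeff Q j0) + j0 < d * subdegree (coeff Q i) + i"
    using min_weight_coeff[OF dQ PQ(2)] by blast
  define w where "w = d * subdegree (coeff P i0) + i0 + (d * subdegree (coeff Q j0) + j0)"
  \<comment> \<open>Any product other than that of the two minimal terms has weight above
    \<open>w\<close>, so it contributes nothing at weight \<open>w\<close> or below.\<close>
  have term0: "(coeff P i * coeff Q (m - i)) $ k = 0"
    if "i \<le> m" "d * k + m \<le> w" "(i, m - i) \<noteq> (i0, j0)" for i m k
  proof (rule ccontr)
    assume nz: "(coeff P i * coeff Q (m - i)) $ k \<noteq> 0"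
    then have nz2: "coeff P i \<noteq> 0" "coeff Q (m - i) \<noteq> 0" by auto
    have "subdegree (coeff P i * coeff Q (m - i)) \<le> k" using nz by (rule subdegree_leI)
    then have le: "subdegree (coeff P i) + subdegree (coeff Q (m - i)) \<le> k" using nz2 by simp
    have "w < d * subdegree (coeff P i) + i + (d * subdegree (coeff Q (m - i)) + (m - i))"
    proof (cases "i = i0")
      case True
      then have "m - i \<noteq> j0" using that(3) by simp
      then show ?thesis using j0(3)[OF nz2(2)] unfolding w_def True by linarith
    next
      case False
      have "d * subdegree (coeff Q j0) + j0 \<le> d * subdegree (coeff Q (m - i)) + (m - i)"
        using j0(3)[OF nz2(2)] by (cases "m - i = j0") auto
      then show ?thesis using i0(3)[OF nz2(1) False] unfolding w_def by linarith
    qed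
    also have "\<dots> = d * (subdegree (coeff P i) + subdegree (coeff Q (m - i))) + m"
      using that(1) by (simp add: algebra_simps)
    also have "\<dots> \<le> d * k + m" using le by simp
    finally show False using that(2) by simp
  qed
  have coeff_eq: "l * coeff E m = (\<Sum>i\<le>m. coeff P i * coeff Q (m - i))" for m
    using arg_cong[OF eq, of "\<lambda>p. coeff p m"] by (simp add: coeff_mult)
  have zero: "(l * coeff E m) $ k = 0" if "m \<noteq> i0 + j0" "d * k + m \<le> w" for m k
    unfolding coeff_eq fps_sum_nth
  proof (intro sum.neutral ballI)
    fix i assume "i \<in> {..m}"
    then show "(coeff P i * coeff Q (m - i)) $ k = 0"
      using that by (intro term0) auto
  qed
  have l0: "l $ subdegree l \<noteq> 0" using l by simp
  \<comment> \<open>Both end terms of \<open>l * E\<close> have leading weight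
    \<open>d * Suc (subdegree l)\<close>, and at least one of them sits at an index other than
    \<open>i0 + j0\<close>, where nothing of weight up to \<open>w\<close> occurs.\<close>
  have W: "w < d * Suc (subdegree l)"
  proof (cases "i0 + j0 = 0")
    case True
    then have ne: "d \<noteq> i0 + j0" using dP by simp
    have "(l * coeff E d) $ subdegree l \<noteq> 0" using lc l0 by simp
    then have "\<not> d * subdegree l + d \<le> w" using zero[OF ne, of "subdegree l"] by blast
    then show ?thesis by simp
  next
    case False
    have "subdegree (coeff E 0) = 1" using low[of 0] dP c0 by (intro subdegreeI) auto
    moreover have "coeff E 0 \<noteq> 0" using c0 by auto
    ultimately have "(l * coeff E 0) $ Suc (subdegree l) \<noteq> 0"
      using nth_subdegree_nonzero[of "l * coeff E 0"] l by simp
    then have "\<not> d * Suc (subdegree l) + 0 \<le> w" using zero[of 0 "Suc (subdegree l)"] False by metis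
    then show ?thesis by simp
  qed
  \<comment> \<open>The product of the minimal terms survives at weight \<open>w\<close>, whereas
    the Eisenstein condition puts every term of \<open>l * E\<close> at weight
    \<open>d * Suc (subdegree l)\<close> or more.\<close>
  define m0 where "m0 = i0 + j0"
  define k1 where "k1 = subdegree (coeff P i0) + subdegree (coeff Q j0)"
  have wk: "d * k1 + m0 = w" unfolding w_def k1_def m0_def by (simp add: algebra_simps)
  have "(l * coeff E m0) $ k1 = (\<Sum>i\<in>{i0}. (coeff P i * coeff Q (m0 - i)) $ k1)"
    unfolding coeff_eq fps_sum_nth
  proof (rule sum.mono_neutral_right)
    show "\<forall>i\<in>{..m0} - {i0}. (coeff P i * coeff Q (m0 - i)) $ k1 = 0"
    proof
      fix i assume "i \<in> {..m0} - {i0}"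
      then show "(coeff P i * coeff Q (m0 - i)) $ k1 = 0"
        using wk by (intro term0) auto
    qed
  qed (auto simp: m0_def)
  also have "\<dots> \<noteq> 0" using i0(1) j0(1) by (simp add: m0_def k1_def)
  finally have nz: "(l * coeff E m0) $ k1 \<noteq> 0" .
  then have Em: "coeff E m0 \<noteq> 0" by auto
  have sd: "subdegree l + subdegree (coeff E m0) \<le> k1"
    using subdegree_leI[OF nz] l Em by simp
  have "m0 \<le> d" using Em d le_degree by blast
  then consider "m0 < d" | "m0 = d" using le_neq_implies_less by blast
  then show False
  proof cases
    case 1
    then have "subdegree (coeff E m0) \<ge> 1" using low[of m0] Em by (metis One_nat_def Suc_leI gr0I nth_subdegree_nonzero)
    then have "Suc (subdegree l) \<le> k1" using sd by simp
    then have le: "d * Suc (subdegree l) \<le> d * k1" by (rule mult_le_mono2)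
    have "w < d * k1 + m0" using less_le_trans[OF W le] by simp
    then show False using wk by simp
  next
    case 2
    have le: "d * subdegree l \<le> d * k1" using sd by (intro mult_le_mono2) simp
    have "w < d * subdegree l + d" using W by simp
    also have "\<dots> \<le> d * k1 + d" using le by (rule add_right_mono)
    also have "\<dots> = w" using wk 2 by simp
    finally show False by simp
  qed
qed

text \<open>Translation by \<open>x\<close> moves the multiple root of the reduction to the origin,
  and the new constant coefficient is the value at \<open>x\<close>.\<close>

lemma eisenstein_fps_shift:
  fixes E P Q :: "'w::field fps poly"
  assumes d: "degree E = d" and lc: "coeff E d = 1" and low: "map_poly (\<lambda>p. p $ 0) E = [:-x, 1:] ^ d"
    and c0: "poly E (fps_const x) $ 1 \<noteq> 0" and eq: "smult l E = P * Q" and l: "l \<noteq> 0"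
    and dP: "0 < degree P" "degree P < d"
  shows False
proof -
  define S where "S = [:fps_const x, 1:]"
  have dS: "degree S = 1" by (simp add: S_def)
  have "smult l (E \<circ>\<^sub>p S) = (P \<circ>\<^sub>p S) * (Q \<circ>\<^sub>p S)"
    using arg_cong[OF eq, of "\<lambda>p. p \<circ>\<^sub>p S"] by (simp add: pcompose_mult pcompose_smult)
  moreover have "degree (E \<circ>\<^sub>p S) = d" "degree (P \<circ>\<^sub>p S) = degree P" using dS d by (auto simp: degree_pcompose)
  moreover have "coeff (E \<circ>\<^sub>p S) d = 1"
    using lead_coeff_comp[of S E] dS d lc by (simp add: S_def degree_pcompose)
  moreover have "coeff (E \<circ>\<^sub>p S) 0 $ 1 \<noteq> 0"
    using c0 by (simp add: S_def poly_pcompose flip: poly_0_coeff_0)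
  moreover have "coeff (E \<circ>\<^sub>p S) m $ 0 = 0" if "m < d" for m
  proof -
    have hom: "map_poly (\<lambda>p. p $ 0) (p + q) = map_poly (\<lambda>p. p $ 0) p + map_poly (\<lambda>p. p $ 0) (q :: 'w fps poly)" for p q
      by (rule poly_eqI) (simp add: coeff_map_poly)
    have homm: "map_poly (\<lambda>p. p $ 0) (p * q) = map_poly (\<lambda>p. p $ 0) p * map_poly (\<lambda>p. p $ 0) (q :: 'w fps poly)" for p q
      by (rule poly_eqI) (simp add: coeff_map_poly coeff_mult fps_sum_nth)
    have homc: "map_poly (\<lambda>p. p $ 0) (p \<circ>\<^sub>p q) = map_poly (\<lambda>p. p $ 0) p \<circ>\<^sub>p map_poly (\<lambda>p. p $ 0) (q :: 'w fps poly)" for p q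
      by (induction p) (auto simp: hom homm pcompose_pCons map_poly_pCons)
    have pw: "[:- x, 1:] ^ d \<circ>\<^sub>p [:x, 1:] = monom 1 d"
    proof (induction d)
      case (Suc d)
      have "[:- x, 1:] ^ Suc d \<circ>\<^sub>p [:x, 1:] = ([:- x, 1:] \<circ>\<^sub>p [:x, 1:]) * ([:- x, 1:] ^ d \<circ>\<^sub>p [:x, 1:])"
        by (simp only: power_Suc pcompose_mult)
      also have "[:- x, 1:] \<circ>\<^sub>p [:x, 1:] = monom 1 1" by (simp add: pcompose_pCons monom_Suc monom_0)
      finally show ?case using Suc by (simp add: mult_monom)
    qed (simp add: monom_0 one_pCons)
    have "map_poly (\<lambda>p. p $ 0) S = [:x, 1:]" by (simp add: S_def map_poly_pCons)
    then have "map_poly (\<lambda>p. p $ 0) (E \<circ>\<^sub>p S) = monom 1 d" using homc low pw by metis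
    then have "coeff (map_poly (\<lambda>p. p $ 0) (E \<circ>\<^sub>p S)) m = 0" using that by simp
    then show ?thesis by (simp add: coeff_map_poly)
  qed
  ultimately show False using eisenstein_fps[of "E \<circ>\<^sub>p S" d l "P \<circ>\<^sub>p S" "Q \<circ>\<^sub>p S"] l dP by metis
qed

section \<open>Branches: power series expansions of the roots above a base point\<close>

text \<open>A base point \<open>c\<close> on the parameter line and, for the root number
  \<open>i\<close> of the \<open>j\<close>-th polynomial, stored at index \<open>j * n + i\<close>,
  its expansion in the local parameter at \<open>c\<close>.\<close>

type_synonym 'w br = "'w \<times> (nat \<Rightarrow> 'w fps)"

text \<open>\<open>H j\<close> is a polynomial in the root variable whose coefficients are
  polynomials in the parameter. Being monic with coefficients of degree at most \<open>D\<close>, it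
  forces every root to have pole order at most \<open>D\<close> at infinity, measured in the
  parameter.\<close>

locale curve =
  fixes n D :: nat and H :: "nat \<Rightarrow> 'w::field poly poly"
  assumes n_pos: "0 < n" and degree_H: "degree (H j) = n" and monic_H: "coeff (H j) n = 1"
    and degree_coeff_H: "degree (coeff (H j) m) \<le> D"
begin

definition Hc :: "'w \<Rightarrow> nat \<Rightarrow> 'w fps poly" where
  "Hc c j = map_poly (\<lambda>p. fps_of_poly (p \<circ>\<^sub>p [:c, 1:])) (H j)"

lemma coeff_Hc: "coeff (Hc c j) m = fps_of_poly (coeff (H j) m \<circ>\<^sub>p [:c, 1:])"
  by (simp add: Hc_def coeff_map_poly)

lemma coeff_Hc_n [simp]: "coeff (Hc c j) n = 1"
  by (simp add: coeff_Hc monic_H pcompose_1)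

lemma degree_Hc [simp]: "degree (Hc c j) = n"
proof (rule antisym)
  show "degree (Hc c j) \<le> n" by (rule degree_le) (auto simp: coeff_Hc coeff_eq_0 degree_H)
  show "n \<le> degree (Hc c j)" by (rule le_degree) simp
qed

lemma Hc_nonzero [simp]: "Hc c j \<noteq> 0"
  by (metis coeff_0 coeff_Hc_n one_neq_zero)

text \<open>Partial branches: only the first \<open>s\<close> entries are required to be roots.
  Truncated subtraction makes the condition empty for later blocks, and \<open>min\<close> caps it
  for complete ones. Divisibility, rather than vanishing, keeps track of multiplicities.\<close>

definition pb :: "nat \<Rightarrow> 'w br \<Rightarrow> bool" where
  "pb s y \<longleftrightarrow> (\<forall>j. (\<Prod>i<min n (s - j * n). [:- snd y (j * n + i), 1:]) dvd Hc (fst y) j)"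

text \<open>Polynomial functions of the parameter and of the first \<open>s\<close> roots. The
  weight bounds the pole order at infinity: 1 for the parameter, \<open>D\<close> for a root. The
  functions are defined for all pairs of a base point and a sequence, so that one function can be
  evaluated on branches over different base points.\<close>

inductive gen :: "nat \<Rightarrow> nat \<Rightarrow> ('w br \<Rightarrow> 'w fps) \<Rightarrow> bool" where
  gen_const: "gen s 0 (\<lambda>_. fps_const a)"
| gen_base: "gen s 1 (\<lambda>y. fps_const (fst y) + fps_X)"
| gen_var: "i < s \<Longrightarrow> gen s D (\<lambda>y. snd y i)"
| gen_add: "gen s w u \<Longrightarrow> gen s w v \<Longrightarrow> gen s w (\<lambda>y. u y + v y)"
| gen_mult: "gen s w u \<Longrightarrow> gen s w' v \<Longrightarrow> gen s (w + w') (\<lambda>y. u y * v y)"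
| gen_mono: "gen s w u \<Longrightarrow> w \<le> w' \<Longrightarrow> gen s w' u"

lemma gen_zero: "gen s w (\<lambda>_. 0)"
  using gen_mono[OF gen_const[of s 0], of w] by simp

lemma gen_one: "gen s w (\<lambda>_. 1)"
  using gen_mono[OF gen_const[of s 1], of w] by simp

lemma gen_neg: "gen s w u \<Longrightarrow> gen s w (\<lambda>y. - u y)"
  using gen_mult[OF gen_const[of s "-1"], of w u] by (simp flip: fps_const_neg)

lemma gen_diff: "gen s w u \<Longrightarrow> gen s w v \<Longrightarrow> gen s w (\<lambda>y. u y - v y)"
  using gen_add[OF _ gen_neg, of s w u v] by simp

lemma gen_sum: "(\<And>i. i \<in> A \<Longrightarrow> gen s w (u i)) \<Longrightarrow> gen s w (\<lambda>y. \<Sum>i\<in>A. u i y)"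
  by (induction A rule: infinite_finite_induct) (auto intro: gen_zero gen_add)

lemma gen_prod: "(\<And>i. i \<in> A \<Longrightarrow> gen s (w i) (u i)) \<Longrightarrow> gen s (\<Sum>i\<in>A. w i) (\<lambda>y. \<Prod>i\<in>A. u i y)"
  by (induction A rule: infinite_finite_induct) (auto intro: gen_one gen_mult)

lemma gen_power: "gen s w u \<Longrightarrow> gen s (k * w) (\<lambda>y. u y ^ k)"
  by (induction k) (auto intro: gen_one gen_mult)

lemma gen_mono_var: "gen s w u \<Longrightarrow> s \<le> s' \<Longrightarrow> gen s' w u"
  by (induction rule: gen.induct) (auto intro: gen.intros)

lemma gen_poly: "gen s (degree p) (\<lambda>y. fps_of_poly (p \<circ>\<^sub>p [:fst y, 1:]))"
proof -
  have "gen s w (\<lambda>y. fps_of_poly (p \<circ>\<^sub>p [:fst y, 1:]))" if "degree p \<le> w" for w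
    using that
  proof (induction p arbitrary: w)
    case 0
    then show ?case by (simp add: gen_zero)
  next
    case (pCons a p)
    have eq: "fps_of_poly (pCons a p \<circ>\<^sub>p [:fst y, 1:]) =
        fps_const a + (fps_const (fst y) + fps_X) * fps_of_poly (p \<circ>\<^sub>p [:fst y, 1:])" for y :: "'w br"
      by (simp add: pcompose_pCons fps_of_poly_add fps_of_poly_mult fps_of_poly_pCons fps_of_poly_const)
    show ?case
    proof (cases "p = 0")
      case True
      then show ?thesis using gen_mono[OF gen_const[of s a], of w] by (simp add: fps_of_poly_const)
    next
      case False
      then obtain w' where w: "w = Suc w'" "degree p \<le> w'" using pCons.prems by (cases w) auto
      have "gen s w (\<lambda>y. (fps_const (fst y) + fps_X) * fps_of_poly (p \<circ>\<^sub>p [:fst y, 1:]))"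
        using gen_mult[OF gen_base pCons.IH[OF w(2)]] w by simp
      then show ?thesis unfolding eq using gen_mono[OF gen_const[of s a], of w] by (auto intro: gen_add)
    qed
  qed
  then show ?thesis by simp
qed

text \<open>What remains of \<open>H j\<close> after its first \<open>i\<close> roots are removed.
  Synthetic division gives coefficients that are polynomial expressions in the entries of
  \<open>y\<close> even when these are not roots, as membership in \<open>gen\<close>
  demands.\<close>

primrec RS :: "nat \<Rightarrow> nat \<Rightarrow> 'w br \<Rightarrow> 'w fps poly" where
  "RS j 0 y = Hc (fst y) j"
| "RS j (Suc i) y = synthetic_div (RS j i y) (snd y (j * n + i))"

lemma degree_RS: "degree (RS j i y) = n - i"
  by (induction i) (auto simp: degree_synthetic_div)

lemma coeff_synthetic_div:
  fixes p :: "'a::comm_ring_1 poly"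
  shows "coeff (synthetic_div p c) m = coeff p (Suc m) + c * coeff (synthetic_div p c) (Suc m)"
proof -
  have "coeff ([:- c, 1:] * q + [:a:]) (Suc m) = coeff q m - c * coeff q (Suc m)" for q a
    by simp
  from this[of "synthetic_div p c" "poly p c"] show ?thesis
    unfolding synthetic_div_correct' by simp
qed

lemma coeff_RS_lead: "i \<le> n \<Longrightarrow> coeff (RS j i y) (n - i) = 1"
proof (induction i)
  case (Suc i)
  have "coeff (RS j (Suc i) y) (Suc (n - Suc i)) = 0"
    by (rule coeff_eq_0) (subst degree_RS, simp)
  then show ?case using Suc coeff_synthetic_div[of "RS j i y" "snd y (j * n + i)" "n - Suc i"]
    by (simp add: Suc_diff_Suc)
qed simp

text \<open>Synthetic division computes coefficients downwards from the leading one, and each step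
  multiplies by one root; so an index \<open>m\<close> at distance \<open>n - i - m\<close> from the
  top costs that many times \<open>D\<close>.\<close>

lemma gen_RS: "i \<le> n \<Longrightarrow> m \<le> n - i \<Longrightarrow> gen (j * n + i) (D * (n - i - m)) (\<lambda>y. coeff (RS j i y) m)"
proof (induction i arbitrary: m)
  case 0
  show ?case
  proof (cases "m = n")
    case True
    then show ?thesis by (simp add: gen_one)
  next
    case False
    then have "D * 1 \<le> D * (n - m)" using 0 by (intro mult_le_mono2) simp
    then have "degree (coeff (H j) m) \<le> D * (n - m)"
      using degree_coeff_H[of j m] le_trans by (metis mult.right_neutral)
    then show ?thesis using gen_mono[OF gen_poly] by (simp add: coeff_Hc)
  qed
next
  case (Suc i)
  note IH = Suc.IH
  show ?case using Suc.prems(2)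
  proof (induction "n - Suc i - m" arbitrary: m)
    case 0
    then have "m = n - Suc i" by simp
    then show ?case using coeff_RS_lead[OF Suc.prems(1), of j] by (simp add: gen_one)
  next
    case (Suc k)
    have 1: "gen (j * n + Suc i) (D * (n - Suc i - m)) (\<lambda>y. coeff (RS j i y) (Suc m))"
      using gen_mono_var[OF IH[of "Suc m"], of "j * n + Suc i"] Suc.prems \<open>Suc i \<le> n\<close> by (simp add: Suc_diff_Suc)
    have 2: "gen (j * n + Suc i) (D + D * (n - Suc i - Suc m)) (\<lambda>y. snd y (j * n + i) * coeff (RS j (Suc i) y) (Suc m))"
      using Suc.hyps by (intro gen_mult gen_var Suc.hyps(1)) auto
    have 3: "D + D * (n - Suc i - Suc m) = D * (n - Suc i - m)"
    proof -
      have "n - Suc i - Suc m = k" using Suc.hyps(2) by simp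
      then show ?thesis unfolding Suc.hyps(2)[symmetric] by simp
    qed
    have eq: "(\<lambda>y. coeff (RS j (Suc i) y) m) = (\<lambda>y. coeff (RS j i y) (Suc m) + snd y (j * n + i) * coeff (RS j (Suc i) y) (Suc m))"
      unfolding RS.simps by (intro ext, rule coeff_synthetic_div)
    show ?case by (subst eq) (rule gen_add[OF 1 2[unfolded 3]])
  qed
qed

lemma RS_factor:
  assumes "(\<Prod>i'<i. [:- snd y (j * n + i'), 1:]) dvd Hc (fst y) j"
  shows "Hc (fst y) j = (\<Prod>i'<i. [:- snd y (j * n + i'), 1:]) * RS j i y"
  using assms
proof (induction i)
  case (Suc i)
  let ?x = "snd y (j * n + i)"
  have "(\<Prod>i'<i. [:- snd y (j * n + i'), 1:]) dvd Hc (fst y) j"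
    using Suc.prems unfolding prod.lessThan_Suc by (rule dvd_mult_left)
  then have eq: "Hc (fst y) j = (\<Prod>i'<i. [:- snd y (j * n + i'), 1:]) * RS j i y" by (rule Suc.IH)
  have nz: "(\<Prod>i'<i. [:- snd y (j * n + i'), 1:]) \<noteq> 0" by simp
  have "[:- ?x, 1:] dvd RS j i y"
    using Suc.prems nz unfolding eq prod.lessThan_Suc by (subst (asm) dvd_times_left_cancel_iff) auto
  then have "poly (RS j i y) ?x = 0" by (simp add: poly_eq_0_iff_dvd)
  then have "[:- ?x, 1:] * RS j (Suc i) y + 0 = RS j i y"
    using synthetic_div_correct'[of ?x "RS j i y"] by (simp only: RS.simps pCons_0_0)
  then have st: "[:- ?x, 1:] * RS j (Suc i) y = RS j i y" by (simp only: add_0_right)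
  show ?case unfolding prod.lessThan_Suc mult.assoc st by (rule eq)
qed simp

end

section \<open>Irreducibility as transfer of vanishing between branches\<close>

context curve begin

definition gen' :: "nat \<Rightarrow> ('w br \<Rightarrow> 'w fps) \<Rightarrow> bool" where
  "gen' s u \<longleftrightarrow> (\<exists>w. gen s w u)"

lemma gen'_add: "gen' s u \<Longrightarrow> gen' s v \<Longrightarrow> gen' s (\<lambda>y. u y + v y)"
  unfolding gen'_def
proof (elim exE)
  fix w w' assume *: "gen s w u" "gen s w' v"
  have "gen s (max w w') (\<lambda>y. u y + v y)"
    by (rule gen_add[OF gen_mono[OF *(1)] gen_mono[OF *(2)]]) auto
  then show "\<exists>w. gen s w (\<lambda>y. u y + v y)" ..
qed

lemma gen'_mult: "gen' s u \<Longrightarrow> gen' s v \<Longrightarrow> gen' s (\<lambda>y. u y * v y)"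
  unfolding gen'_def using gen_mult by blast

lemma gen'_const: "gen' s (\<lambda>_. fps_const a)"
  unfolding gen'_def using gen_const by blast

lemma gen'_zero: "gen' s (\<lambda>_. 0)"
  unfolding gen'_def using gen_zero by blast

lemma gen'_one: "gen' s (\<lambda>_. 1)"
  unfolding gen'_def using gen_one by blast

lemma gen'_neg: "gen' s u \<Longrightarrow> gen' s (\<lambda>y. - u y)"
  unfolding gen'_def using gen_neg by blast

lemma gen'_diff: "gen' s u \<Longrightarrow> gen' s v \<Longrightarrow> gen' s (\<lambda>y. u y - v y)"
  using gen'_add[OF _ gen'_neg, of s u v] by simp

lemma gen'_sum: "(\<And>i. i \<in> A \<Longrightarrow> gen' s (u i)) \<Longrightarrow> gen' s (\<lambda>y. \<Sum>i\<in>A. u i y)"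
  by (induction A rule: infinite_finite_induct) (auto intro: gen'_zero gen'_add)

lemma gen'_prod: "(\<And>i. i \<in> A \<Longrightarrow> gen' s (u i)) \<Longrightarrow> gen' s (\<lambda>y. \<Prod>i\<in>A. u i y)"
  by (induction A rule: infinite_finite_induct) (auto intro: gen'_one gen'_mult)

lemma gen'_power: "gen' s u \<Longrightarrow> gen' s (\<lambda>y. u y ^ k)"
  by (induction k) (auto intro: gen'_one gen'_mult)

text \<open>Polynomials whose coefficients are coordinate functions; degrees are bounded on branches only.\<close>

definition GP :: "nat \<Rightarrow> nat \<Rightarrow> ('w br \<Rightarrow> 'w fps poly) \<Rightarrow> bool" where
  "GP s a P \<longleftrightarrow> (\<forall>m. gen' s (\<lambda>y. coeff (P y) m)) \<and> (\<forall>y. pb s y \<longrightarrow> degree (P y) \<le> a)"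

lemma GPI: "(\<And>m. gen' s (\<lambda>y. coeff (P y) m)) \<Longrightarrow> (\<And>y. pb s y \<Longrightarrow> degree (P y) \<le> a) \<Longrightarrow> GP s a P"
  unfolding GP_def by blast

lemma GP_degree: "GP s a P \<Longrightarrow> pb s y \<Longrightarrow> degree (P y) \<le> a"
  unfolding GP_def by blast

lemma GP_add: "GP s a P \<Longrightarrow> GP s a Q \<Longrightarrow> GP s a (\<lambda>y. P y + Q y)"
  unfolding GP_def by (auto intro: gen'_add degree_add_le)

lemma GP_mult: "GP s a P \<Longrightarrow> GP s b Q \<Longrightarrow> GP s (a + b) (\<lambda>y. P y * Q y)"
  by (rule GPI, unfold coeff_mult)
    (auto intro!: gen'_sum gen'_mult order_trans[OF degree_mult_le] add_mono simp: GP_def simp del: split_paired_All)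

lemma GP_monom: "gen' s u \<Longrightarrow> GP s k (\<lambda>y. monom (u y) k)"
proof (rule GPI)
  fix m assume "gen' s u"
  then show "gen' s (\<lambda>y. coeff (monom (u y) k) m)" by (cases "k = m") (auto simp: gen'_zero)
qed (rule degree_monom_le)

lemma GP_smult: "gen' s u \<Longrightarrow> GP s a P \<Longrightarrow> GP s a (\<lambda>y. smult (u y) (P y))"
  unfolding GP_def by (auto intro: gen'_mult order_trans[OF degree_smult_le])

lemma GP_zero: "GP s a (\<lambda>y. 0)"
  unfolding GP_def by (auto simp: gen'_zero)

lemma GP_mono: "GP s a P \<Longrightarrow> a \<le> b \<Longrightarrow> GP s b P"
  unfolding GP_def using le_trans by blast

lemma GP_coeff: "GP s a P \<Longrightarrow> gen' s (\<lambda>y. coeff (P y) m)"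
  unfolding GP_def by auto

lemma GP_diff: "GP s a P \<Longrightarrow> GP s a Q \<Longrightarrow> GP s a (\<lambda>y. P y - Q y)"
  unfolding GP_def by (auto intro: gen'_diff degree_diff_le)

text \<open>Coordinate functions have no inverses, so each division step multiplies by the leading
  coefficient of \<open>P\<close> instead. A single choice of \<open>N\<close>, \<open>Q\<close>,
  \<open>R\<close> serves all branches at once, which is what allows a conclusion on one branch to
  be carried to another.\<close>

lemma GP_pseudo_division:
  assumes "GP s \<delta> P" "0 < \<delta>" "GP s a A"
  shows "\<exists>N Q R b. GP s b Q \<and> GP s (\<delta> - 1) R \<and>
    (\<forall>y. smult (coeff (P y) \<delta> ^ N) (A y) = P y * Q y + R y)"
  using assms(3)
proof (induction a arbitrary: A rule: less_induct)
  case (less a)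
  show ?case
  proof (cases "a < \<delta>")
    case True
    then have "GP s (\<delta> - 1) A" using less.prems GP_mono by simp
    then show ?thesis using GP_zero[of s 0] by (intro exI[of _ 0] exI[of _ "\<lambda>_. 0"] exI[of _ A]) auto
  next
    case False
    define M where "M = (\<lambda>y. monom (coeff (A y) a) (a - \<delta>))"
    define A1 where "A1 = (\<lambda>y. smult (coeff (P y) \<delta>) (A y) - M y * P y)"
    have M: "GP s (a - \<delta>) M" unfolding M_def by (rule GP_monom, rule GP_coeff, rule less.prems)
    have MP: "GP s a (\<lambda>y. M y * P y)" using GP_mult[OF M assms(1)] False by simp
    have "GP s a A1" unfolding A1_def by (intro GP_diff GP_smult MP less.prems GP_coeff[OF assms(1)])
    moreover have "degree (A1 y) \<le> a - 1" if "pb s y" for y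
    proof -
      have "coeff (A1 y) a = 0"
        using False by (simp add: A1_def M_def coeff_monom_mult)
      moreover have "degree (A1 y) \<le> a" by (rule GP_degree[OF \<open>GP s a A1\<close> that])
      ultimately have "coeff (A1 y) k = 0" if "k > a - 1" for k
        using that coeff_eq_0[of "A1 y" k] by (cases "k = a") auto
      then show ?thesis by (intro degree_le) auto
    qed
    ultimately have "GP s (a - 1) A1" unfolding GP_def by blast
    moreover have "a - 1 < a" using False assms(2) by simp
    ultimately obtain N Q R b where *: "GP s b Q" "GP s (\<delta> - 1) R"
      "\<And>y. smult (coeff (P y) \<delta> ^ N) (A1 y) = P y * Q y + R y" using less.IH by blast
    define Q' where "Q' = (\<lambda>y. Q y + smult (coeff (P y) \<delta> ^ N) (M y))"
    have "GP s (max b (a - \<delta>)) Q'" unfolding Q'_def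
      by (intro GP_add GP_smult gen'_power GP_coeff[OF assms(1)] GP_mono[OF *(1)] GP_mono[OF M]) auto
    moreover have "smult (coeff (P y) \<delta> ^ Suc N) (A y) = P y * Q' y + R y" for y
    proof -
      have "smult (coeff (P y) \<delta> ^ Suc N) (A y) = smult (coeff (P y) \<delta> ^ N) (A1 y + M y * P y)"
        by (simp add: A1_def mult.commute)
      also have "\<dots> = P y * Q' y + R y" by (simp add: smult_add_right *(3) Q'_def algebra_simps)
      finally show ?thesis .
    qed
    ultimately show ?thesis using *(2) by blast
  qed
qed

lemma GP_RS: "i \<le> n \<Longrightarrow> GP (j * n + i) (n - i) (RS j i)"
  unfolding GP_def
proof (intro conjI allI impI)
  fix m assume "i \<le> n"
  show "gen' (j * n + i) (\<lambda>y. coeff (RS j i y) m)"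
  proof (cases "m \<le> n - i")
    case True
    then show ?thesis using gen_RS[OF \<open>i \<le> n\<close>] unfolding gen'_def by blast
  next
    case False
    then show ?thesis by (simp add: coeff_eq_0 degree_RS gen'_zero)
  qed
qed (simp add: degree_RS)

text \<open>Irreducibility of the curve cut out by the first \<open>s\<close> root variables: all
  branches, over whatever base point, satisfy the same polynomial relations.\<close>

definition Claim :: "nat \<Rightarrow> bool" where
  "Claim s \<longleftrightarrow> (\<forall>u y y'. gen' s u \<longrightarrow> pb s y \<longrightarrow> pb s y' \<longrightarrow> u y = 0 \<longrightarrow> u y' = 0)"

lemma ClaimD: "Claim s \<Longrightarrow> gen' s u \<Longrightarrow> pb s y \<Longrightarrow> pb s y' \<Longrightarrow> u y = 0 \<Longrightarrow> u y' = 0"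
  unfolding Claim_def by blast

lemma pb_mono: "pb s y \<Longrightarrow> s' \<le> s \<Longrightarrow> pb s' y"
  unfolding pb_def
proof
  fix j assume *: "\<forall>j. (\<Prod>i<min n (s - j * n). [:- snd y (j * n + i), 1:]) dvd Hc (fst y) j" "s' \<le> s"
  have "(\<Prod>i<min n (s' - j * n). [:- snd y (j * n + i), 1:]) dvd (\<Prod>i<min n (s - j * n). [:- snd y (j * n + i), 1:])"
    by (rule prod_dvd_prod_subset) (use *(2) in auto)
  then show "(\<Prod>i<min n (s' - j * n). [:- snd y (j * n + i), 1:]) dvd Hc (fst y) j"
    using *(1) dvd_trans by blast
qed

lemma pb_factor:
  assumes "pb (j * n + i) y" "i \<le> n"
  shows "Hc (fst y) j = (\<Prod>i'<i. [:- snd y (j * n + i'), 1:]) * RS j i y"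
  using assms RS_factor[where i=i and y=y and j=j] unfolding pb_def by (metis add_diff_cancel_left' min.absorb2)

lemma pb_root:
  assumes "pb (Suc (j * n + i)) y" "i < n"
  shows "poly (RS j i y) (snd y (j * n + i)) = 0"
proof -
  have "Hc (fst y) j = (\<Prod>i'<Suc i. [:- snd y (j * n + i'), 1:]) * RS j (Suc i) y"
    using pb_factor[of j "Suc i" y] assms by simp
  moreover have "Hc (fst y) j = (\<Prod>i'<i. [:- snd y (j * n + i'), 1:]) * RS j i y"
    using pb_factor[of j i y] pb_mono[OF assms(1), of "j * n + i"] assms(2) by simp
  ultimately have "(\<Prod>i'<i. [:- snd y (j * n + i'), 1:]) * RS j i y
     = (\<Prod>i'<i. [:- snd y (j * n + i'), 1:]) * ([:- snd y (j * n + i), 1:] * RS j (Suc i) y)"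
    by (simp only: prod.lessThan_Suc mult.assoc)
  moreover have "(\<Prod>i'<i. [:- snd y (j * n + i'), 1:]) \<noteq> 0" by simp
  ultimately have "RS j i y = [:- snd y (j * n + i), 1:] * RS j (Suc i) y" using mult_left_cancel by blast
  then show ?thesis by (metis poly_eq_0_iff_dvd dvd_triv_left)
qed

lemma gen'_as_poly:
  assumes "gen (Suc s) w u"
  shows "\<exists>a A. GP s a A \<and> (\<forall>y. u y = poly (A y) (snd y s))"
  using assms
proof (induction "Suc s" w u rule: gen.induct)
  case (gen_const a)
  show ?case by (rule exI[of _ 0], rule exI[of _ "\<lambda>_. monom (fps_const a) 0"])
     (auto intro!: GP_monom gen'_const simp: poly_monom)
next
  case gen_base
  have "gen' s (\<lambda>y. fps_const (fst y) + fps_X)" unfolding gen'_def using gen.gen_base by blast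
  then show ?case by (intro exI[of _ 0] exI[of _ "\<lambda>y. monom (fps_const (fst y) + fps_X) 0"])
     (auto intro!: GP_monom simp: poly_monom)
next
  case (gen_var i)
  show ?case
  proof (cases "i < s")
    case True
    then have "gen' s (\<lambda>y. snd y i)" unfolding gen'_def using gen.gen_var by blast
    then show ?thesis by (intro exI[of _ 0] exI[of _ "\<lambda>y. monom (snd y i) 0"])
       (auto intro!: GP_monom simp: poly_monom)
  next
    case False
    then have "i = s" using gen_var by simp
    then show ?thesis using GP_monom[OF gen'_one, of s 1]
      by (intro exI[of _ 1] exI[of _ "\<lambda>y. monom 1 1"]) (auto simp: poly_monom)
  qed
next
  case (gen_add w u v)
  then obtain a A b B where *: "GP s a A" "\<And>y. u y = poly (A y) (snd y s)"
      "GP s b B" "\<And>y. v y = poly (B y) (snd y s)" by meson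
  then show ?case by (intro exI[of _ "max a b"] exI[of _ "\<lambda>y. A y + B y"] conjI GP_add)
     (auto elim: GP_mono)
next
  case (gen_mult w u w' v)
  then obtain a A b B where *: "GP s a A" "\<And>y. u y = poly (A y) (snd y s)"
      "GP s b B" "\<And>y. v y = poly (B y) (snd y s)" by meson
  then show ?case by (intro exI[of _ "a + b"] exI[of _ "\<lambda>y. A y * B y"] conjI GP_mult) auto
qed auto

text \<open>Adjunction of one root. If the residual polynomial is irreducible over the functions of
  the first \<open>s\<close> roots, it is, up to a multiplier, the minimal polynomial of the next
  root on every branch, and all relations for that root are multiples of it. The last hypothesis is
  irreducibility with denominators cleared by \<open>l\<close>.\<close>

lemma Claim_step:
  assumes cl: "Claim s" and s: "s = j * n + i" "i < n"
    and irr: "\<And>\<delta> P Q l. 0 < \<delta> \<Longrightarrow> \<delta> < n - i \<Longrightarrow> GP s \<delta> P \<Longrightarrow> GP s (n - i - \<delta>) Q \<Longrightarrow> gen' s l \<Longrightarrow>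
        (\<And>y. pb s y \<Longrightarrow> l y \<noteq> 0) \<Longrightarrow> (\<And>y. pb s y \<Longrightarrow> degree (P y) = \<delta> \<and> degree (Q y) = n - i - \<delta>) \<Longrightarrow>
        (\<And>y. pb s y \<Longrightarrow> smult (l y) (RS j i y) = P y * Q y) \<Longrightarrow> False"
  shows "Claim (Suc s)"
  unfolding Claim_def
proof (intro allI impI)
  fix u y y' assume u: "gen' (Suc s) u" and y: "pb (Suc s) y" and y': "pb (Suc s) y'" and uy: "u y = 0"
  have ys: "pb s y" "pb s y'" using pb_mono y y' by auto
  have nz: "v z' \<noteq> 0" if "gen' s v" "pb s z" "v z \<noteq> 0" "pb s z'" for v z z'
    using ClaimD[OF cl that(1,4,2)] that(3) by blast
  \<comment> \<open>Degrees of polynomials over the functions of the first \<open>s\<close> roots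
    that annihilate the next root on \<open>y\<close> and keep their leading coefficient there. The
    least one gives a minimal polynomial.\<close>
  define S where "S = {\<delta>. \<exists>P. GP s \<delta> P \<and> coeff (P y) \<delta> \<noteq> 0 \<and> poly (P y) (snd y s) = 0}"
  have "n - i \<in> S" unfolding S_def
    using GP_RS[of i j] pb_root[of j i y] s y coeff_RS_lead[of i j y] by (auto intro!: exI[of _ "RS j i"])
  define \<delta> where "\<delta> = (LEAST d. d \<in> S)"
  have \<delta>S: "\<delta> \<in> S" and \<delta>le: "\<delta> \<le> n - i" using \<open>n - i \<in> S\<close> LeastI Least_le unfolding \<delta>_def by metis+
  have \<delta>min: "d \<notin> S" if "d < \<delta>" for d using not_less_Least that unfolding \<delta>_def by blast
  obtain P where P: "GP s \<delta> P" "coeff (P y) \<delta> \<noteq> 0" "poly (P y) (snd y s) = 0" using \<delta>S S_def by blast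
  have \<delta>0: "0 < \<delta>"
  proof (rule ccontr)
    assume "\<not> 0 < \<delta>"
    then have "degree (P y) = 0" using GP_degree[OF P(1) ys(1)] by simp
    then obtain c where "P y = [:c:]" using degree_eq_zeroE by blast
    then show False using P \<open>\<not> 0 < \<delta>\<close> by simp
  qed
  have Pnz: "coeff (P z) \<delta> \<noteq> 0" if "pb s z" for z
    using nz[OF GP_coeff[OF P(1)] ys(1) P(2) that] .
  have Pdeg: "degree (P z) = \<delta>" if "pb s z" for z
    using Pnz[OF that] P(1) that le_degree by (metis GP_def antisym)
  \<comment> \<open>The pseudo-remainder also annihilates the next root on \<open>y\<close> and has
    smaller degree, so by minimality it is zero on \<open>y\<close>, and by \<open>Claim s\<close>
    it is zero on all branches.\<close>
  have div: "\<exists>N Q b. GP s b Q \<and> (\<forall>z. pb s z \<longrightarrow> smult (coeff (P z) \<delta> ^ N) (A z) = P z * Q z)"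
    if A: "GP s a A" "poly (A y) (snd y s) = 0" for a A
  proof -
    obtain N Q R b where *: "GP s b Q" "GP s (\<delta> - 1) R"
      "\<And>z. smult (coeff (P z) \<delta> ^ N) (A z) = P z * Q z + R z"
      using GP_pseudo_division[OF P(1) \<delta>0 A(1)] by blast
    have "poly (R y) (snd y s) = 0" using arg_cong[OF *(3)[of y], of "\<lambda>p. poly p (snd y s)"] A(2) P(3) by simp
    have "R y = 0"
    proof (rule ccontr)
      assume "R y \<noteq> 0"
      define m where "m = degree (R y)"
      have m: "coeff (R y) m \<noteq> 0" using \<open>R y \<noteq> 0\<close> m_def by simp
      have "degree (R z) \<le> m" if "pb s z" for z
      proof (rule degree_le, intro allI impI)
        fix k assume "m < k"
        then have "coeff (R y) k = 0" unfolding m_def by (rule coeff_eq_0)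
        then show "coeff (R z) k = 0" using ClaimD[OF cl GP_coeff[OF *(2)] ys(1) that] by blast
      qed
      then have "GP s m R" using *(2) unfolding GP_def by blast
      then have "m \<in> S" unfolding S_def using m \<open>poly (R y) (snd y s) = 0\<close> by blast
      moreover have "m < \<delta>" using *(2) ys(1) \<delta>0 unfolding GP_def m_def by fastforce
      ultimately show False using \<delta>min by blast
    qed
    have "R z = 0" if "pb s z" for z
    proof (rule poly_eqI)
      fix k show "coeff (R z) k = coeff 0 k"
        using ClaimD[OF cl GP_coeff[OF *(2)] ys(1) that] \<open>R y = 0\<close> by simp
    qed
    then show ?thesis using * by (metis add.right_neutral)
  qed
  obtain N Q b where Q: "GP s b Q" "\<And>z. pb s z \<Longrightarrow> smult (coeff (P z) \<delta> ^ N) (RS j i z) = P z * Q z"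
    using div[OF GP_RS[of i j, folded s(1)] pb_root[of j i y, folded s(1)]] s(2) y by auto
  have Qdeg: "degree (Q z) = n - i - \<delta> \<and> Q z \<noteq> 0" if "pb s z" for z
  proof -
    have "RS j i z \<noteq> 0" using coeff_RS_lead[of i j z] s(2) by (metis coeff_0 less_imp_le one_neq_zero)
    then have "P z * Q z \<noteq> 0" using Q(2)[OF that] Pnz[OF that] by (metis power_not_zero smult_eq_0_iff)
    then have "degree (P z * Q z) = \<delta> + degree (Q z)" "Q z \<noteq> 0" using Pdeg[OF that] by (auto simp: degree_mult_eq)
    moreover have "degree (P z * Q z) = n - i"
      using Q(2)[OF that] Pnz[OF that] by (metis degree_RS degree_smult_eq power_not_zero)
    ultimately show ?thesis by simp
  qed
  \<comment> \<open>Irreducibility leaves a constant cofactor \<open>Q\<close>. Hence the next root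
    on \<open>y'\<close>, being a root of the residual polynomial, is a root of \<open>P\<close> as
    well.\<close>
  have "\<delta> = n - i"
  proof (rule ccontr)
    assume "\<delta> \<noteq> n - i"
    then have "\<delta> < n - i" using \<delta>le by simp
    moreover have "GP s (n - i - \<delta>) Q" using Q(1) Qdeg unfolding GP_def by simp
    ultimately show False
      using irr[OF \<delta>0 _ P(1), of Q "\<lambda>y. coeff (P y) \<delta> ^ N"] Q(2) Qdeg Pdeg Pnz
        gen'_power[OF GP_coeff[OF P(1)]] by (metis power_not_zero)
  qed
  then have "degree (Q y') = 0" "Q y' \<noteq> 0" using Qdeg[OF ys(2)] by auto
  then obtain q where q: "Q y' = [:q:]" "q \<noteq> 0" by (metis degree_eq_zeroE pCons_0_0)
  have Py': "poly (P y') (snd y' s) = 0"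
    using arg_cong[OF Q(2)[OF ys(2)], of "\<lambda>p. poly p (snd y' s)"] pb_root[of j i y'] s y' q by simp
  obtain a A where A: "GP s a A" "\<And>y. u y = poly (A y) (snd y s)"
    using u gen'_as_poly unfolding gen'_def by blast
  obtain N' Q' where "smult (coeff (P y') \<delta> ^ N') (A y') = P y' * Q' y'"
    using div[OF A(1)] A(2) uy ys(2) by metis
  from arg_cong[OF this, of "\<lambda>p. poly p (snd y' s)"] Py'
  have "coeff (P y') \<delta> ^ N' * u y' = 0" by (simp add: A(2))
  then show "u y' = 0" using Pnz[OF ys(2)] by simp
qed

text \<open>A function of the parameter alone is a polynomial, and its Taylor expansion at any
  single base point determines it.\<close>

lemma Claim_0: "Claim 0"
proof -
  have "\<exists>p. \<forall>y. u y = fps_of_poly (p \<circ>\<^sub>p [:fst y, 1:])" if "gen 0 w u" for w u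
    using that
  proof (induction "0::nat" w u rule: gen.induct)
    case (gen_const a)
    show ?case by (rule exI[of _ "[:a:]"]) (simp add: fps_of_poly_const)
  next
    case gen_base
    show ?case by (rule exI[of _ "[:0, 1:]"]) (simp add: pcompose_pCons fps_of_poly_pCons fps_of_poly_const)
  next
    case (gen_add w u v)
    then obtain p q where "\<And>y. u y = fps_of_poly (p \<circ>\<^sub>p [:fst y, 1:])" "\<And>y. v y = fps_of_poly (q \<circ>\<^sub>p [:fst y, 1:])" by metis
    then show ?case by (intro exI[of _ "p + q"]) (simp add: pcompose_add fps_of_poly_add)
  next
    case (gen_mult w u w' v)
    then obtain p q where "\<And>y. u y = fps_of_poly (p \<circ>\<^sub>p [:fst y, 1:])" "\<And>y. v y = fps_of_poly (q \<circ>\<^sub>p [:fst y, 1:])" by metis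
    then show ?case by (intro exI[of _ "p * q"]) (simp add: pcompose_mult fps_of_poly_mult)
  qed auto
  note poly_repr = this
  show ?thesis unfolding Claim_def
  proof (intro allI impI)
    fix u y y' assume "gen' 0 u" "u y = 0"
    then obtain p where p: "\<And>y. u y = fps_of_poly (p \<circ>\<^sub>p [:fst y, 1:])" using poly_repr gen'_def by metis
    then have "fps_of_poly (p \<circ>\<^sub>p [:fst y, 1:]) = fps_of_poly 0" using \<open>u y = 0\<close> by simp
    then have "p \<circ>\<^sub>p [:fst y, 1:] = 0" by (simp only: fps_of_poly_eq_iff)
    then have "p = 0" by (rule pcompose_eq_0) simp
    then show "u y' = 0" using p by simp
  qed
qed

end

lemma coeff_pcompose_scale:
  fixes p :: "'a::comm_ring_1 poly"
  shows "coeff (p \<circ>\<^sub>p [:0, v:]) m = coeff p m * v ^ m"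
proof (induction p arbitrary: m)
  case (pCons a p)
  have "pCons a p \<circ>\<^sub>p [:0, v:] = [:a:] + pCons 0 (smult v (p \<circ>\<^sub>p [:0, v:]))"
    by (simp add: pcompose_pCons)
  then show ?case using pCons.IH by (cases m) (simp_all add: ac_simps)
qed simp

section \<open>Normal forms in the monomials of the roots\<close>

context curve begin

definition bp :: "'w poly \<Rightarrow> 'w \<Rightarrow> 'w fps" where
  "bp p c = fps_of_poly (p \<circ>\<^sub>p [:c, 1:])"

lemma bp_add: "bp (p + q) c = bp p c + bp q c"
  by (simp add: bp_def pcompose_add fps_of_poly_add)

lemma bp_mult: "bp (p * q) c = bp p c * bp q c"
  by (simp add: bp_def pcompose_mult fps_of_poly_mult)

lemma bp_0 [simp]: "bp 0 c = 0" by (simp add: bp_def)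

lemma bp_1 [simp]: "bp 1 c = 1" by (simp add: bp_def pcompose_1)

lemma bp_minus: "bp (- p) c = - bp p c"
  by (simp add: bp_def pcompose_uminus fps_of_poly_uminus)

lemma bp_power: "bp (p ^ k) c = bp p c ^ k"
  by (induction k) (auto simp: bp_mult)

lemma bp_sum: "bp (\<Sum>i\<in>A. f i) c = (\<Sum>i\<in>A. bp (f i) c)"
  by (induction A rule: infinite_finite_induct) (auto simp: bp_add)

lemma bp_const: "bp [:a:] c = fps_const a"
  by (simp add: bp_def fps_of_poly_const)

lemma bp_X: "bp [:0, 1:] c = fps_const c + fps_X"
  by (simp add: bp_def pcompose_pCons fps_of_poly_pCons fps_of_poly_const)

lemma bp_eq_0_iff [simp]: "bp p c = 0 \<longleftrightarrow> p = 0"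
proof
  assume "bp p c = 0"
  then have "fps_of_poly (p \<circ>\<^sub>p [:c, 1:]) = fps_of_poly 0" by (simp add: bp_def)
  then have "p \<circ>\<^sub>p [:c, 1:] = 0" by (simp only: fps_of_poly_eq_iff)
  then show "p = 0" by (rule pcompose_eq_0) simp
qed simp

lemma gen_bp: "gen s (degree p) (\<lambda>y. bp p (fst y))"
  unfolding bp_def by (rule gen_poly)

text \<open>Exponents of the standard monomial basis of the splitting algebra: root number
  \<open>i\<close> of a block satisfies an equation of degree \<open>n - i\<close> over the earlier
  ones. There are \<open>n!\<close> exponent vectors per complete block.\<close>

definition E :: "nat \<Rightarrow> (nat \<Rightarrow> nat) set" where
  "E s = PiE {..<s} (\<lambda>i. {..<n - i mod n})"

definition mon :: "nat \<Rightarrow> (nat \<Rightarrow> nat) \<Rightarrow> 'w br \<Rightarrow> 'w fps" where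
  "mon s e y = (\<Prod>i<s. snd y i ^ e i)"

lemma finite_E [simp]: "finite (E s)"
  unfolding E_def by (intro finite_PiE) auto

lemma E_upd: "e \<in> E s \<Longrightarrow> i < s \<Longrightarrow> m < n - i mod n \<Longrightarrow> e(i := m) \<in> E s"
  unfolding E_def by (auto simp: PiE_iff extensional_def)

lemma E_bound: "e \<in> E s \<Longrightarrow> i < s \<Longrightarrow> e i < n - i mod n"
  unfolding E_def by (auto simp: PiE_iff)

lemma sum_E_Suc: "(\<Sum>e\<in>E (Suc s). f e) = (\<Sum>m<n - s mod n. \<Sum>e\<in>E s. f (e(s := m)))"
proof -
  have "E (Suc s) = (\<lambda>(m, e). e(s := m)) ` ({..<n - s mod n} \<times> E s)"
    unfolding E_def lessThan_Suc PiE_insert_eq by simp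
  moreover have "inj_on (\<lambda>(m, e). e(s := m)) ({..<n - s mod n} \<times> E s)"
  proof (rule inj_onI, clarsimp)
    fix m e m' e' assume e: "e \<in> E s" "e' \<in> E s" and eq: "e(s := m) = e'(s := m')"
    have "e x = e' x" for x
    proof (cases "x = s")
      case True
      then show ?thesis using e by (auto simp: E_def PiE_iff extensional_def)
    next
      case False
      then show ?thesis using fun_cong[OF eq, of x] by simp
    qed
    then show "m = m' \<and> e = e'" using fun_cong[OF eq, of s] by auto
  qed
  ultimately have "(\<Sum>e\<in>E (Suc s). f e) = (\<Sum>p\<in>{..<n - s mod n} \<times> E s. f ((\<lambda>(m, e). e(s := m)) p))"
    by (simp add: sum.reindex)
  then show ?thesis by (simp add: sum.cartesian_product split_def)
qed

lemma mon_Suc_upd: "e \<in> E s \<Longrightarrow> mon (Suc s) (e(s := m)) y = mon s e y * snd y s ^ m"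
  unfolding mon_def by simp

lemma mon_upd: "i < s \<Longrightarrow> mon s (e(i := m)) y = mon s (e(i := 0)) y * snd y i ^ m"
proof -
  assume i: "i < s"
  have "(\<Prod>k<s. snd y k ^ (e(i := m)) k) = snd y i ^ m * (\<Prod>k\<in>{..<s} - {i}. snd y k ^ (e(i := m)) k)" for m
    using i by (subst prod.remove[of _ i]) auto
  moreover have "(\<Prod>k\<in>{..<s} - {i}. snd y k ^ (e(i := m)) k) = (\<Prod>k\<in>{..<s} - {i}. snd y k ^ e k)" for m
    by (rule prod.cong) auto
  ultimately show ?thesis unfolding mon_def by (simp add: mult.commute)
qed

definition esum :: "nat \<Rightarrow> (nat \<Rightarrow> nat) \<Rightarrow> nat" where "esum s e = (\<Sum>i<s. e i)"

lemma esum_upd: "i < s \<Longrightarrow> esum s (e(i := m)) = esum s (e(i := 0)) + m"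
proof -
  assume i: "i < s"
  have "(\<Sum>k<s. (e(i := m)) k) = m + (\<Sum>k\<in>{..<s} - {i}. (e(i := m)) k)" for m
    using i by (subst sum.remove[of _ i]) auto
  moreover have "(\<Sum>k\<in>{..<s} - {i}. (e(i := m)) k) = (\<Sum>k\<in>{..<s} - {i}. e k)" for m
    by (rule sum.cong) auto
  ultimately show ?thesis unfolding esum_def by simp
qed

text \<open>The guard \<open>c e \<noteq> 0\<close> is needed because the zero polynomial has degree
  0, so that an absent heavy monomial would otherwise break the bound.\<close>

definition NFc :: "nat \<Rightarrow> nat \<Rightarrow> ((nat \<Rightarrow> nat) \<Rightarrow> 'w poly) \<Rightarrow> bool" where
  "NFc s w c \<longleftrightarrow> (\<forall>e\<in>E s. c e \<noteq> 0 \<longrightarrow> degree (c e) + D * esum s e \<le> w)"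

definition NFe :: "nat \<Rightarrow> ((nat \<Rightarrow> nat) \<Rightarrow> 'w poly) \<Rightarrow> 'w br \<Rightarrow> 'w fps" where
  "NFe s c y = (\<Sum>e\<in>E s. bp (c e) (fst y) * mon s e y)"

definition NF :: "nat \<Rightarrow> nat \<Rightarrow> ('w br \<Rightarrow> 'w fps) \<Rightarrow> bool" where
  "NF s w u \<longleftrightarrow> (\<exists>c. NFc s w c \<and> (\<forall>y. pb s y \<longrightarrow> u y = NFe s c y))"

lemma NF_cong: "NF s w u \<Longrightarrow> (\<And>y. pb s y \<Longrightarrow> v y = u y) \<Longrightarrow> NF s w v"
  unfolding NF_def by metis

lemma NF_mono: "NF s w u \<Longrightarrow> w \<le> w' \<Longrightarrow> NF s w' u"
  unfolding NF_def NFc_def using le_trans by blast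

lemma NF_add: assumes "NF s w u" "NF s w v" shows "NF s w (\<lambda>y. u y + v y)"
proof -
  obtain c d where c: "NFc s w c" "\<And>y. pb s y \<Longrightarrow> u y = NFe s c y"
    and d: "NFc s w d" "\<And>y. pb s y \<Longrightarrow> v y = NFe s d y" using assms unfolding NF_def by metis
  have "NFc s w (\<lambda>e. c e + d e)" unfolding NFc_def
  proof (intro ballI impI)
    fix e assume e: "e \<in> E s" "c e + d e \<noteq> 0"
    then consider "c e = 0" | "d e = 0" | "c e \<noteq> 0" "d e \<noteq> 0" by blast
    then show "degree (c e + d e) + D * esum s e \<le> w"
    proof cases
      case 3
      then have "degree (c e) + D * esum s e \<le> w" "degree (d e) + D * esum s e \<le> w"
        using c(1) d(1) e by (auto simp: NFc_def)
      moreover have "degree (c e + d e) \<le> max (degree (c e)) (degree (d e))" by (rule degree_add_le_max)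
      ultimately show ?thesis by linarith
    qed (use c(1) d(1) e in \<open>auto simp: NFc_def\<close>)
  qed
  moreover have "NFe s (\<lambda>e. c e + d e) y = NFe s c y + NFe s d y" for y
    unfolding NFe_def by (simp add: bp_add distrib_right sum.distrib)
  ultimately show ?thesis using c(2) d(2) unfolding NF_def by metis
qed

lemma NF_zero: "NF s w (\<lambda>y. 0)"
  unfolding NF_def by (intro exI[of _ "\<lambda>_. 0"]) (auto simp: NFc_def NFe_def)

lemma NF_sum: "(\<And>i. i \<in> A \<Longrightarrow> NF s w (u i)) \<Longrightarrow> NF s w (\<lambda>y. \<Sum>i\<in>A. u i y)"
  by (induction A rule: infinite_finite_induct) (auto intro: NF_zero NF_add)

lemma NF_mon: assumes "e \<in> E s" shows "NF s (D * esum s e) (mon s e)"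
proof -
  have "NFe s (\<lambda>e'. if e' = e then 1 else 0) y = mon s e y" for y
  proof -
    have "NFe s (\<lambda>e'. if e' = e then 1 else 0) y = (\<Sum>e'\<in>E s. if e' = e then mon s e' y else 0)"
      unfolding NFe_def by (rule sum.cong) auto
    then show ?thesis using assms by simp
  qed
  moreover have "NFc s (D * esum s e) (\<lambda>e'. if e' = e then 1 else 0)"
    by (auto simp: NFc_def)
  ultimately show ?thesis unfolding NF_def by metis
qed

lemma NF_bp: assumes "NF s w u" shows "NF s (degree p + w) (\<lambda>y. bp p (fst y) * u y)"
proof -
  obtain c where c: "NFc s w c" "\<And>y. pb s y \<Longrightarrow> u y = NFe s c y" using assms unfolding NF_def by metis
  have "NFc s (degree p + w) (\<lambda>e. p * c e)" unfolding NFc_def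
  proof (intro ballI impI)
    fix e assume e: "e \<in> E s" "p * c e \<noteq> 0"
    then have "degree (c e) + D * esum s e \<le> w" using c(1) by (auto simp: NFc_def)
    then show "degree (p * c e) + D * esum s e \<le> degree p + w" using degree_mult_le[of p "c e"] by linarith
  qed
  moreover have "NFe s (\<lambda>e. p * c e) y = bp p (fst y) * NFe s c y" for y
    unfolding NFe_def by (simp add: bp_mult sum_distrib_left mult.assoc)
  ultimately show ?thesis using c(2) unfolding NF_def by metis
qed

lemma pb_Suc_var_relation:
  assumes "pb (Suc i) y"
  shows "snd y i ^ (n - i mod n) = - (\<Sum>m<n - i mod n. coeff (RS (i div n) (i mod n) y) m * snd y i ^ m)"
proof -
  have i: "i div n * n + i mod n = i" by simp
  have lt: "i mod n < n" using n_pos by simp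
  let ?d = "n - i mod n"
  have "poly (RS (i div n) (i mod n) y) (snd y i) = 0"
    using pb_root[of "i div n" "i mod n" y] assms lt unfolding i by simp
  then have "(\<Sum>m\<le>?d. coeff (RS (i div n) (i mod n) y) m * snd y i ^ m) = 0"
    by (simp add: poly_altdef degree_RS)
  then have "(\<Sum>m<?d. coeff (RS (i div n) (i mod n) y) m * snd y i ^ m) + snd y i ^ ?d = 0"
    using coeff_RS_lead[of "i mod n" "i div n" y] lt by (simp add: lessThan_Suc_atMost[symmetric])
  then show ?thesis by (simp add: eq_neg_iff_add_eq_0 add.commute)
qed

text \<open>Reduction to the monomial basis never raises the weight: the top power of a root is
  replaced by lower powers \<open>m\<close> with coefficients of weight \<open>D\<close> times the
  number of lost factors. These coefficients involve earlier roots only, whence the induction on the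
  number of variables.\<close>

lemma NF_gen_mult:
  assumes "i \<le> s" "gen i w' g" "NF s w u"
  shows "NF s (w' + w) (\<lambda>y. g y * u y)"
  using assms
proof (induction i arbitrary: w' g w u)
  case 0
  show ?case using 0(2,3)
  proof (induction "0::nat" w' g arbitrary: w u rule: gen.induct)
    case (gen_const a)
    then show ?case using NF_bp[of s w u "[:a:]"] by (simp add: bp_const)
  next
    case gen_base
    then show ?case using NF_bp[of s w u "[:0, 1:]"] by (simp add: bp_X)
  next
    case (gen_add w1 g1 g2)
    then show ?case using NF_add[of s "w1 + w"] by (simp add: distrib_right)
  next
    case (gen_mult w1 g1 w2 g2)
    then show ?case by (simp add: mult.assoc add.assoc)
  next
    case (gen_mono w1 g w2)
    then show ?case using NF_mono[of s "w1 + w"] by simp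
  qed auto
next
  case (Suc i)
  have IH: "\<And>w' g w u. gen i w' g \<Longrightarrow> NF s w u \<Longrightarrow> NF s (w' + w) (\<lambda>y. g y * u y)"
    using Suc.IH Suc.prems(1) by simp
  have ils: "i < s" using Suc.prems(1) by simp
  let ?d = "n - i mod n"
  have dpos: "0 < ?d" using n_pos by simp
  have var_mon: "NF s (D + D * esum s e) (\<lambda>y. snd y i * mon s e y)" if e: "e \<in> E s" for e
  proof (cases "Suc (e i) < ?d")
    case True
    have "e(i := Suc (e i)) \<in> E s" using E_upd[OF e ils True] .
    moreover have "esum s (e(i := Suc (e i))) = Suc (esum s e)"
      using esum_upd[OF ils, of e "Suc (e i)"] esum_upd[OF ils, of e "e i"] by simp
    moreover have "mon s (e(i := Suc (e i))) y = snd y i * mon s e y" for y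
      using mon_upd[OF ils, of e "Suc (e i)" y] mon_upd[OF ils, of e "e i" y] by (simp add: ac_simps)
    ultimately show ?thesis using NF_cong[OF NF_mon[of "e(i := Suc (e i))" s], of "\<lambda>y. snd y i * mon s e y"]
      by simp
  next
    case False
    \<comment> \<open>The exponent of this root is already maximal, so its equation is applied; the
      coefficients that appear are multiplied in by the induction hypothesis on earlier
      roots.\<close>
    then have ed: "Suc (e i) = ?d" using E_bound[OF e ils] by simp
    define \<rho> where "\<rho> = (\<lambda>m y. coeff (RS (i div n) (i mod n) y) m)"
    have g\<rho>: "gen i (D * (?d - m)) (\<rho> m)" if "m < ?d" for m
      using gen_RS[of "i mod n" m "i div n"] that n_pos unfolding \<rho>_def by simp
    have "NF s (D + D * esum s e) (\<lambda>y. - \<rho> m y * mon s (e(i := m)) y)" if m: "m < ?d" for m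
    proof -
      have "esum s e = esum s (e(i := 0)) + e i" using esum_upd[OF ils, of e "e i"] by simp
      then have "(?d - m) + esum s (e(i := m)) = Suc (esum s e)"
        using m ed esum_upd[OF ils, of e m] by linarith
      then have "D * ((?d - m) + esum s (e(i := m))) = D * Suc (esum s e)" by (rule arg_cong)
      then have eq: "D * (?d - m) + D * esum s (e(i := m)) = D + D * esum s e"
        by (simp only: distrib_left mult_Suc_right)
      show ?thesis using IH[OF gen_neg[OF g\<rho>[OF m]] NF_mon[OF E_upd[OF e ils m]]] unfolding eq .
    qed
    then have "NF s (D + D * esum s e) (\<lambda>y. \<Sum>m<?d. - \<rho> m y * mon s (e(i := m)) y)" by (intro NF_sum) auto
    then show ?thesis
    proof (rule NF_cong)
      fix y assume "pb s y"
      then have "pb (Suc i) y" using pb_mono ils by simp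
      have "snd y i * mon s e y = mon s (e(i := 0)) y * snd y i ^ ?d"
        using mon_upd[OF ils, of e "e i" y] by (simp add: ed[symmetric] ac_simps)
      also have "\<dots> = (\<Sum>m<?d. - \<rho> m y * mon s (e(i := m)) y)"
        unfolding pb_Suc_var_relation[OF \<open>pb (Suc i) y\<close>] \<rho>_def
        by (subst mon_upd[OF ils]) (simp add: sum_distrib_left sum_negf ac_simps)
      finally show "snd y i * mon s e y = (\<Sum>m<?d. - \<rho> m y * mon s (e(i := m)) y)" .
    qed
  qed
  have var: "NF s (D + w) (\<lambda>y. snd y i * u y)" if u: "NF s w u" for w u
  proof -
    obtain c where c: "NFc s w c" "\<And>y. pb s y \<Longrightarrow> u y = NFe s c y" using u unfolding NF_def by metis
    have "NF s (D + w) (\<lambda>y. \<Sum>e\<in>E s. bp (c e) (fst y) * (snd y i * mon s e y))"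
    proof (rule NF_sum)
      fix e assume e: "e \<in> E s"
      show "NF s (D + w) (\<lambda>y. bp (c e) (fst y) * (snd y i * mon s e y))"
      proof (cases "c e = 0")
        case True
        then show ?thesis by (simp add: NF_zero)
      next
        case False
        then have "degree (c e) + D * esum s e \<le> w" using c(1) e by (auto simp: NFc_def)
        then show ?thesis using NF_mono[OF NF_bp[OF var_mon[OF e]]] by simp
      qed
    qed
    then show ?thesis
      by (rule NF_cong) (simp add: c(2) NFe_def sum_distrib_left mult.left_commute)
  qed
  show ?case using Suc.prems(2,3)
  proof (induction "Suc i" w' g arbitrary: w u rule: gen.induct)
    case (gen_const a)
    then show ?case using NF_bp[of s w u "[:a:]"] by (simp add: bp_const)
  next
    case gen_base
    then show ?case using NF_bp[of s w u "[:0, 1:]"] by (simp add: bp_X)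
  next
    case (gen_var i')
    then show ?case using var IH[OF gen.gen_var[of i' i]] by (cases "i' = i") auto
  next
    case (gen_add w1 g1 g2)
    then show ?case using NF_add[of s "w1 + w"] by (simp add: distrib_right)
  next
    case (gen_mult w1 g1 w2 g2)
    then show ?case by (simp add: mult.assoc add.assoc)
  next
    case (gen_mono w1 g w2)
    then show ?case using NF_mono[of s "w1 + w"] by simp
  qed
qed

lemma NF_gen: assumes "gen s w u" shows "NF s w u"
proof -
  define z where "z = restrict (\<lambda>_. 0::nat) {..<s}"
  have "z \<in> E s" using n_pos by (auto simp: z_def E_def)
  moreover have "mon s z y = 1" for y unfolding mon_def z_def by simp
  moreover have "esum s z = 0" unfolding esum_def z_def by simp
  ultimately have "NF s 0 (\<lambda>y. 1)" using NF_mon[of z s] by (metis (no_types, lifting) NF_cong mult_0_right)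
  then show ?thesis using NF_gen_mult[OF order_refl assms, of 0 "\<lambda>y. 1"] by simp
qed

end

section \<open>Relabelling of the roots by \<open>S_n ^ r\<close>, and invariant functions\<close>

context curve begin

definition G :: "nat \<Rightarrow> (nat \<Rightarrow> nat \<Rightarrow> nat) set" where
  "G r = PiE {..<r} (\<lambda>_. {p. p permutes {..<n}})"

definition act :: "nat \<Rightarrow> (nat \<Rightarrow> nat \<Rightarrow> nat) \<Rightarrow> nat \<Rightarrow> nat" where
  "act r \<tau> s = (if s div n < r then s div n * n + \<tau> (s div n) (s mod n) else s)"

definition tw :: "nat \<Rightarrow> (nat \<Rightarrow> nat \<Rightarrow> nat) \<Rightarrow> 'w br \<Rightarrow> 'w br" where
  "tw r \<tau> y = (fst y, \<lambda>s. snd y (act r \<tau> s))"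

lemma fst_tw [simp]: "fst (tw r \<tau> y) = fst y" by (simp add: tw_def)

lemma snd_tw [simp]: "snd (tw r \<tau> y) s = snd y (act r \<tau> s)" by (simp add: tw_def)

lemma finite_G [simp]: "finite (G r)"
  unfolding G_def by (intro finite_PiE finite_permutations) auto

lemma card_G: "card (G r) = fact n ^ r"
  unfolding G_def by (simp add: card_PiE card_permutations)

lemma G_permutes: "\<tau> \<in> G r \<Longrightarrow> j < r \<Longrightarrow> \<tau> j permutes {..<n}"
  unfolding G_def by auto

lemma G_lt: "\<tau> \<in> G r \<Longrightarrow> j < r \<Longrightarrow> i < n \<Longrightarrow> \<tau> j i < n"
  using G_permutes permutes_in_image by (metis lessThan_iff)

lemma act_block: "\<tau> \<in> G r \<Longrightarrow> j < r \<Longrightarrow> i < n \<Longrightarrow> act r \<tau> (j * n + i) = j * n + \<tau> j i"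
  unfolding act_def by simp

lemma div_less_iff: "s div n < r \<longleftrightarrow> s < r * n"
  using n_pos by (simp add: less_mult_imp_div_less div_less_iff_less_mult)

lemma act_lt: "\<tau> \<in> G r \<Longrightarrow> s < r * n \<Longrightarrow> act r \<tau> s < r * n \<and> act r \<tau> s div n = s div n \<and> act r \<tau> s mod n = \<tau> (s div n) (s mod n)"
proof -
  assume t: "\<tau> \<in> G r" and s: "s < r * n"
  have j: "s div n < r" using s div_less_iff by simp
  have m: "\<tau> (s div n) (s mod n) < n" using G_lt[OF t j] n_pos by simp
  have "act r \<tau> s div n = s div n" "act r \<tau> s mod n = \<tau> (s div n) (s mod n)" unfolding act_def using j m by simp_all
  then show ?thesis using j div_less_iff by metis
qed

definition gid :: "nat \<Rightarrow> nat \<Rightarrow> nat \<Rightarrow> nat" where "gid r = restrict (\<lambda>_. id) {..<r}"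

definition gcomp :: "nat \<Rightarrow> (nat \<Rightarrow> nat \<Rightarrow> nat) \<Rightarrow> (nat \<Rightarrow> nat \<Rightarrow> nat) \<Rightarrow> nat \<Rightarrow> nat \<Rightarrow> nat" where
  "gcomp r \<sigma> \<tau> = restrict (\<lambda>j. \<sigma> j \<circ> \<tau> j) {..<r}"

lemma gid_G: "gid r \<in> G r" unfolding G_def gid_def by (auto simp: permutes_id)

lemma gcomp_G: "\<sigma> \<in> G r \<Longrightarrow> \<tau> \<in> G r \<Longrightarrow> gcomp r \<sigma> \<tau> \<in> G r"
  unfolding G_def gcomp_def by (auto intro: permutes_compose)

lemma act_gid [simp]: "act r (gid r) s = s"
  unfolding act_def gid_def by auto

lemma tw_gid [simp]: "tw r (gid r) y = y"
  unfolding tw_def by simp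

lemma act_gcomp: "\<sigma> \<in> G r \<Longrightarrow> \<tau> \<in> G r \<Longrightarrow> act r (gcomp r \<sigma> \<tau>) s = act r \<sigma> (act r \<tau> s)"
proof (cases "s div n < r")
  case True
  assume "\<sigma> \<in> G r" "\<tau> \<in> G r"
  then have "\<tau> (s div n) (s mod n) < n" using G_lt[of \<tau> r "s div n" "s mod n"] n_pos True by simp
  then show ?thesis using True unfolding act_def gcomp_def by simp
qed (simp add: act_def)

lemma tw_tw: "\<sigma> \<in> G r \<Longrightarrow> \<tau> \<in> G r \<Longrightarrow> tw r \<tau> (tw r \<sigma> y) = tw r (gcomp r \<sigma> \<tau>) y"
  by (simp add: tw_def act_gcomp)

lemma gcomp_inj: "\<sigma> \<in> G r \<Longrightarrow> inj_on (gcomp r \<sigma>) (G r)"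
proof (rule inj_onI, rule ext)
  fix \<tau> \<tau>' j assume *: "\<sigma> \<in> G r" "\<tau> \<in> G r" "\<tau>' \<in> G r" "gcomp r \<sigma> \<tau> = gcomp r \<sigma> \<tau>'"
  show "\<tau> j = \<tau>' j"
  proof (cases "j < r")
    case True
    then have "\<sigma> j \<circ> \<tau> j = \<sigma> j \<circ> \<tau>' j" using fun_cong[OF *(4), of j] by (simp add: gcomp_def)
    moreover have "inj (\<sigma> j)" using G_permutes[OF *(1) True] permutes_inj by blast
    ultimately show ?thesis by (metis fun.inj_map_strong injD comp_apply ext)
  next
    case False
    then show ?thesis using *(2,3) by (auto simp: G_def PiE_iff extensional_def)
  qed
qed

lemma gcomp_bij: "\<sigma> \<in> G r \<Longrightarrow> bij_betw (gcomp r \<sigma>) (G r) (G r)"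
  unfolding bij_betw_def using gcomp_inj gcomp_G
  by (metis card_image card_subset_eq finite_G image_subsetI)

lemma prod_tw:
  assumes "\<sigma> \<in> G r"
  shows "(\<Prod>\<tau>\<in>G r. u (tw r \<tau> (tw r \<sigma> y))) = (\<Prod>\<tau>\<in>G r. u (tw r \<tau> y))"
proof -
  have "(\<Prod>\<tau>\<in>G r. u (tw r \<tau> (tw r \<sigma> y))) = (\<Prod>\<tau>\<in>G r. u (tw r (gcomp r \<sigma> \<tau>) y))"
    using assms by (intro prod.cong) (auto simp: tw_tw)
  then show ?thesis using prod.reindex_bij_betw[OF gcomp_bij[OF assms], of "\<lambda>\<tau>. u (tw r \<tau> y)"] by simp
qed

lemma pb_full_iff: "pb (r * n) y \<longleftrightarrow> (\<forall>j<r. Hc (fst y) j = (\<Prod>i<n. [:- snd y (j * n + i), 1:]))"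
proof
  assume pb: "pb (r * n) y"
  show "\<forall>j<r. Hc (fst y) j = (\<Prod>i<n. [:- snd y (j * n + i), 1:])"
  proof (intro allI impI)
    fix j assume j: "j < r"
    have "j * n + n \<le> r * n" using j by (metis Suc_leI add.commute mult_Suc mult_le_mono1)
    then have "Hc (fst y) j = (\<Prod>i<n. [:- snd y (j * n + i), 1:]) * RS j n y"
      using pb_factor[of j n y] pb_mono[OF pb] by simp
    moreover have "RS j n y = 1"
      using degree_RS[of j n y] coeff_RS_lead[of n j y] by (metis degree_eq_zeroE coeff_pCons_0 diff_self_eq_0 one_pCons order_refl)
    ultimately show "Hc (fst y) j = (\<Prod>i<n. [:- snd y (j * n + i), 1:])" by simp
  qed
next
  assume *: "\<forall>j<r. Hc (fst y) j = (\<Prod>i<n. [:- snd y (j * n + i), 1:])"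
  show "pb (r * n) y" unfolding pb_def
  proof
    fix j
    show "(\<Prod>i<min n (r * n - j * n). [:- snd y (j * n + i), 1:]) dvd Hc (fst y) j"
    proof (cases "j < r")
      case True
      have "(\<Prod>i<min n (r * n - j * n). [:- snd y (j * n + i), 1:]) dvd (\<Prod>i<n. [:- snd y (j * n + i), 1:])"
        by (rule prod_dvd_prod_subset) auto
      then show ?thesis using * True by simp
    qed simp
  qed
qed

lemma pb_tw: assumes "pb (r * n) y" "\<tau> \<in> G r" shows "pb (r * n) (tw r \<tau> y)"
  unfolding pb_full_iff
proof (intro allI impI)
  fix j assume j: "j < r"
  have "Hc (fst y) j = (\<Prod>i<n. [:- snd y (j * n + i), 1:])" using assms(1) j pb_full_iff by blast
  also have "\<dots> = (\<Prod>i<n. [:- snd y (j * n + \<tau> j i), 1:])"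
    using prod.permute[OF G_permutes[OF assms(2) j], of "\<lambda>i. [:- snd y (j * n + i), 1:]"] by (simp add: o_def)
  also have "\<dots> = (\<Prod>i<n. [:- snd (tw r \<tau> y) (j * n + i), 1:])"
    using assms(2) j by (intro prod.cong) (auto simp: act_block)
  finally show "Hc (fst (tw r \<tau> y)) j = (\<Prod>i<n. [:- snd (tw r \<tau> y) (j * n + i), 1:])" by simp
qed

lemma gen_tw:
  assumes "gen (r * n) w u" "\<tau> \<in> G r" shows "gen (r * n) w (\<lambda>y. u (tw r \<tau> y))"
  using assms(1)
proof (induction "r * n" w u rule: gen.induct)
  case (gen_var i)
  then show ?case using act_lt[OF assms(2), of i] gen.gen_var[of "act r \<tau> i" "r * n"] by simp
qed (auto intro: gen.intros)

definition sep :: "nat \<Rightarrow> 'w br \<Rightarrow> bool" where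
  "sep r y \<longleftrightarrow> (\<forall>j<r. inj_on (\<lambda>i. snd y (j * n + i)) {..<n})"

text \<open>A polynomial of degree below \<open>n - i\<close> in the variable \<open>i\<close> of a block takes the same value at
  the \<open>n - i\<close> conjugates that leave the earlier variables alone, so it is constant.\<close>

lemma invariant_const:
  assumes sep: "sep r y" and s: "s \<le> r * n"
    and inv: "\<And>\<tau>. \<tau> \<in> G r \<Longrightarrow> (\<Sum>e\<in>E s. c e * mon s e (tw r \<tau> y)) = v"
    and e: "e \<in> E s"
  shows "c e = (if e = restrict (\<lambda>_. 0) {..<s} then v else 0)"
  using s inv e
proof (induction s arbitrary: c v e)
  case 0
  have E0: "E 0 = {\<lambda>_. undefined}" unfolding E_def by simp
  then have "e = restrict (\<lambda>_. 0) {..<0}" using 0 by (auto simp: restrict_def)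
  moreover have "c e = v" using 0(2)[OF gid_G] 0(3) unfolding E0 by (simp add: mon_def)
  ultimately show ?case by metis
next
  case (Suc s)
  let ?d = "n - s mod n"
  let ?j = "s div n"
  have jr: "?j < r" using Suc.prems(1) div_less_iff by simp
  define q where "q = (\<lambda>\<tau> m. \<Sum>e\<in>E s. c (e(s := m)) * mon s e (tw r \<tau> y))"
  have eq: "(\<Sum>m<?d. q \<tau> m * snd (tw r \<tau> y) s ^ m) = v" if "\<tau> \<in> G r" for \<tau>
    using Suc.prems(2)[OF that] unfolding sum_E_Suc q_def sum_distrib_right
    by (simp add: mon_Suc_upd mult.assoc)
  have q: "q \<tau> m = (if m = 0 then v else 0)" if \<tau>: "\<tau> \<in> G r" and m: "m < ?d" for \<tau> m
  proof -
    define p where "p = (\<Sum>m<?d. monom (q \<tau> m) m) - [:v:]"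
    have root: "poly p (snd y (?j * n + \<tau> ?j k)) = 0" if k: "s mod n \<le> k" "k < n" for k
    proof -
      \<comment> \<open>Precomposition with a transposition brings the label \<open>k\<close> into
        the current place. Since \<open>k\<close> is not smaller than \<open>s mod n\<close>, the
        variables before \<open>s\<close> keep their values, so the same polynomial \<open>p\<close>
        vanishes at all conjugates of the current variable.\<close>
      define \<tau>' where "\<tau>' = \<tau>(?j := \<tau> ?j \<circ> Transposition.transpose (s mod n) k)"
      have "Transposition.transpose (s mod n) k permutes {..<n}" using k n_pos by (intro permutes_swap_id) auto
      then have \<tau>': "\<tau>' \<in> G r" using \<tau> jr unfolding \<tau>'_def G_def
        by (auto simp: PiE_iff extensional_def intro!: permutes_compose)
      have same: "act r \<tau>' i = act r \<tau> i" if "i < s" for i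
      proof (cases "i div n = ?j")
        case True
        have "i mod n < s mod n"
        proof (rule ccontr)
          assume "\<not> i mod n < s mod n"
          then have "i div n * n + i mod n \<ge> s div n * n + s mod n"
            unfolding True by (intro add_left_mono) simp
          then show False using that unfolding div_mult_mod_eq by simp
        qed
        then have "Transposition.transpose (s mod n) k (i mod n) = i mod n" using k by (simp add: Transposition.transpose_def)
        then show ?thesis using True by (simp add: act_def \<tau>'_def)
      next
        case False
        then show ?thesis by (simp add: act_def \<tau>'_def)
      qed
      then have "mon s e (tw r \<tau>' y) = mon s e (tw r \<tau> y)" for e unfolding mon_def by (intro prod.cong) auto
      then have "q \<tau>' = q \<tau>" unfolding q_def by simp
      moreover have "act r \<tau>' s = ?j * n + \<tau> ?j k" using jr by (simp add: act_def \<tau>'_def)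
      ultimately show ?thesis using eq[OF \<tau>'] unfolding p_def by (simp add: poly_sum poly_monom)
    qed
    have dp: "degree p < ?d"
    proof -
      have "degree (\<Sum>m<?d. monom (q \<tau> m) m) \<le> ?d - 1"
        by (rule degree_sum_le) (auto intro: order_trans[OF degree_monom_le])
      then have "degree p \<le> ?d - 1" unfolding p_def by (intro degree_diff_le) auto
      then show ?thesis using n_pos by (metis One_nat_def Suc_pred diff_is_0_eq less_Suc_eq_le mod_less_divisor not_less zero_less_diff)
    qed
    have "p = 0"
    proof (rule ccontr)
      assume "p \<noteq> 0"
      let ?R = "(\<lambda>k. snd y (?j * n + \<tau> ?j k)) ` {s mod n..<n}"
      have "inj_on (\<lambda>k. snd y (?j * n + \<tau> ?j k)) {s mod n..<n}"
      proof (rule inj_onI)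
        fix a b assume ab: "a \<in> {s mod n..<n}" "b \<in> {s mod n..<n}" "snd y (?j * n + \<tau> ?j a) = snd y (?j * n + \<tau> ?j b)"
        then have "\<tau> ?j a = \<tau> ?j b" using sep jr G_lt[OF \<tau> jr] unfolding sep_def inj_on_def by auto
        then show "a = b" using permutes_inj[OF G_permutes[OF \<tau> jr]] injD by metis
      qed
      then have "card ?R = ?d" by (simp add: card_image)
      moreover have "?R \<subseteq> {x. poly p x = 0}" using root by auto
      moreover have "card {x. poly p x = 0} \<le> degree p" by (rule card_poly_roots_bound[OF \<open>p \<noteq> 0\<close>])
      moreover have "finite {x. poly p x = 0}" by (rule poly_roots_finite[OF \<open>p \<noteq> 0\<close>])
      ultimately have "?d \<le> degree p" using card_mono le_trans by metis
      then show False using dp by simp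
    qed
    have "coeff (\<Sum>m<?d. monom (q \<tau> m) m) m = q \<tau> m"
      using m by (simp add: coeff_sum if_distrib sum.If_cases cong: if_cong)
    moreover have "(\<Sum>m<?d. monom (q \<tau> m) m) = [:v:]" using \<open>p = 0\<close> unfolding p_def by simp
    ultimately show ?thesis by (cases m) auto
  qed
  define e0 where "e0 = restrict e {..<s}"
  have "e \<in> PiE (insert s {..<s}) (\<lambda>i. {..<n - i mod n})" using Suc.prems(3) unfolding E_def lessThan_Suc .
  then have e0: "e0 \<in> E s" "e = e0(s := e s)" "e s < ?d"
    unfolding e0_def E_def by (auto simp: PiE_iff extensional_def restrict_def fun_eq_iff)
  have "c (e0(s := e s)) = (if e0 = restrict (\<lambda>_. 0) {..<s} then (if e s = 0 then v else 0) else 0)"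
  proof (rule Suc.IH[where c = "\<lambda>e'. c (e'(s := e s))"])
    show "s \<le> r * n" using Suc.prems(1) by simp
    fix \<tau> assume "\<tau> \<in> G r"
    then show "(\<Sum>e'\<in>E s. c (e'(s := e s)) * mon s e' (tw r \<tau> y)) = (if e s = 0 then v else 0)"
      using q[OF _ e0(3)] unfolding q_def by blast
  qed (rule e0(1))
  moreover have "e = restrict (\<lambda>_. 0) {..<Suc s} \<longleftrightarrow> e0 = restrict (\<lambda>_. 0) {..<s} \<and> e s = 0"
  proof -
    have ext: "e x = undefined" if "x \<ge> Suc s" for x using Suc.prems(3) that unfolding E_def by (auto simp: PiE_iff extensional_def)
    show ?thesis unfolding e0_def by (auto simp: fun_eq_iff restrict_def ext less_Suc_eq not_less)
  qed
  ultimately show ?case using e0(2) by auto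
qed

text \<open>In the normal form of an invariant function only the trivial monomial survives. So the
  function comes from the base, and it is even a polynomial in the parameter whose degree is bounded
  by the weight.\<close>

lemma invariant_poly:
  assumes y: "pb (r * n) y" "sep r y" and u: "gen (r * n) w u"
    and inv: "\<And>\<tau>. \<tau> \<in> G r \<Longrightarrow> u (tw r \<tau> y) = u y"
  obtains p where "degree p \<le> w" "u y = bp p (fst y)"
proof -
  obtain c where c: "NFc (r * n) w c" "\<And>y. pb (r * n) y \<Longrightarrow> u y = NFe (r * n) c y"
    using NF_gen[OF u] unfolding NF_def by metis
  let ?z = "restrict (\<lambda>_. 0::nat) {..<r * n}"
  have z: "?z \<in> E (r * n)" using n_pos by (auto simp: E_def)
  have "(\<Sum>e\<in>E (r * n). bp (c e) (fst y) * mon (r * n) e (tw r \<tau> y)) = u y" if "\<tau> \<in> G r" for \<tau>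
    using c(2)[OF pb_tw[OF y(1) that]] inv[OF that] unfolding NFe_def by simp
  then have "bp (c ?z) (fst y) = u y"
    using invariant_const[OF y(2) order_refl, of "\<lambda>e. bp (c e) (fst y)" "u y" ?z] z by simp
  moreover have "degree (c ?z) \<le> w" using c(1) z unfolding NFc_def by (cases "c ?z = 0") auto
  ultimately show ?thesis using that[of "c ?z"] by simp
qed

end

section \<open>Irreducibility of the residual polynomials at special branches\<close>

context curve begin

text \<open>The residual polynomial is Eisenstein at this branch after translation by
  \<open>x\<close>: its reduction is a pure power, and its value at \<open>x\<close> has a nonzero
  linear term in the local parameter.\<close>

definition eis :: "nat \<Rightarrow> nat \<Rightarrow> 'w br \<Rightarrow> bool" where
  "eis i j y \<longleftrightarrow> (\<exists>x. map_poly (\<lambda>p. p $ 0) (RS j i y) = [:-x, 1:] ^ (n - i) \<and>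
      poly (RS j i y) (fps_const x) $ 1 \<noteq> 0)"

lemma eis_irreducible:
  assumes "eis i j y" "i \<le> n" "smult l (RS j i y) = P * Q" "l \<noteq> 0" "0 < degree P" "degree P < n - i"
  shows False
  using assms eisenstein_fps_shift[OF degree_RS coeff_RS_lead] unfolding eis_def by blast

text \<open>At the totally degenerate branch \<kappa>' the earlier polynomials need not be
  squarefree, so Eisenstein there says nothing over the field of the earlier roots. Instead \<kappa>
  is used, where \<open>H j\<close> has one separated root \<open>Y\<close> and an irreducible
  cofactor \<open>F\<close>: a proper factorisation must contain a linear factor, and this factor
  vanishes at \<open>Y\<close> for every relabelling of the earlier roots. Taking norms,
  \<open>Y\<close> becomes rational over the base field, so \<open>H j\<close> has a rational root;
  this contradicts Eisenstein at \<kappa>', which is available over the base field.\<close>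

lemma first_root_irr:
  assumes n3: "3 \<le> n" and cl: "Claim (j * n)"
    and \<kappa>: "pb (j * n + 1) \<kappa>" "sep j \<kappa>" "eis 1 j \<kappa>" and \<kappa>': "eis 0 j \<kappa>'"
    and \<delta>: "0 < \<delta>" "\<delta> < n" and PQ: "GP (j * n) \<delta> P" "GP (j * n) (n - \<delta>) Q"
    and l: "\<And>y. pb (j * n) y \<Longrightarrow> l y \<noteq> 0"
    and deg: "\<And>y. pb (j * n) y \<Longrightarrow> degree (P y) = \<delta> \<and> degree (Q y) = n - \<delta>"
    and eq: "\<And>y. pb (j * n) y \<Longrightarrow> smult (l y) (Hc (fst y) j) = P y * Q y"
  shows False
proof -
  let ?s = "j * n"
  define Y where "Y = snd \<kappa> (j * n)"
  define F where "F = RS j 1 \<kappa>"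
  have pb\<kappa>: "pb ?s \<kappa>" using pb_mono \<kappa>(1) by simp
  have H: "Hc (fst \<kappa>) j = [:-Y, 1:] * F" using pb_factor[of j 1 \<kappa>] \<kappa>(1) n_pos unfolding Y_def F_def by simp
  have irrF: False if "smult a F = A * B" "a \<noteq> 0" "0 < degree A" "degree A < n - 1" for a A B
    by (rule eis_irreducible[OF \<kappa>(3) _ that(1)[unfolded F_def] that(2-4)]) (use n3 in simp)
  have lin0: "[:-Y, 1:] \<noteq> 0" by simp
  have split: "(\<exists>A'. A = [:-Y, 1:] * A' \<and> smult a F = A' * B) \<or> (\<exists>B'. B = [:-Y, 1:] * B' \<and> smult a F = A * B')"
    if "smult a (Hc (fst \<kappa>) j) = A * B" for a A B
  proof -
    have "poly A Y * poly B Y = 0" using arg_cong[OF that, of "\<lambda>p. poly p Y"] H by simp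
    then consider "poly A Y = 0" | "poly B Y = 0" by auto
    then show ?thesis
    proof cases
      case 1
      then obtain A' where A': "A = [:-Y, 1:] * A'" unfolding poly_eq_0_iff_dvd by auto
      have "[:-Y, 1:] * smult a F = [:-Y, 1:] * (A' * B)"
        using that unfolding H A' by (simp only: mult_smult_right mult.assoc)
      then have "smult a F = A' * B" using lin0 mult_left_cancel by blast
      then show ?thesis using A' by blast
    next
      case 2
      then obtain B' where B': "B = [:-Y, 1:] * B'" unfolding poly_eq_0_iff_dvd by auto
      have "[:-Y, 1:] * smult a F = [:-Y, 1:] * (A * B')"
        using that unfolding H B' by (simp only: mult_smult_right mult.left_commute)
      then have "smult a F = A * B'" using lin0 mult_left_cancel by blast
      then show ?thesis using B' by blast
    qed
  qed
  have degl: "degree ([:-Y, 1:] * A) = Suc (degree A)" if "A \<noteq> 0" for A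
    using that by (subst degree_mult_eq) auto
  have F0: "smult (l \<kappa>) F \<noteq> 0" using l[OF pb\<kappa>] H Hc_nonzero[of "fst \<kappa>" j] by auto
  have "\<exists>L R. GP ?s 1 L \<and> (\<forall>y. pb ?s y \<longrightarrow> degree (L y) = 1 \<and> smult (l y) (Hc (fst y) j) = L y * R y)"
    using split[OF eq[OF pb\<kappa>]]
  proof (elim disjE exE conjE)
    fix A' assume A': "P \<kappa> = [:-Y, 1:] * A'" "smult (l \<kappa>) F = A' * Q \<kappa>"
    have nz: "A' \<noteq> 0" using F0 A'(2) by auto
    have d: "\<delta> = Suc (degree A')" using deg[OF pb\<kappa>] A'(1) degl[OF nz] by simp
    have "degree A' < n - 1" using d \<delta> by linarith
    then have "degree A' = 0" using irrF[OF A'(2) l[OF pb\<kappa>]] not_gr0 by blast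
    then have "\<delta> = 1" using d by simp
    then show ?thesis using PQ deg eq by blast
  next
    fix B' assume B': "Q \<kappa> = [:-Y, 1:] * B'" "smult (l \<kappa>) F = P \<kappa> * B'"
    have nz: "B' \<noteq> 0" using F0 B'(2) by auto
    have d: "n - \<delta> = Suc (degree B')" using deg[OF pb\<kappa>] B'(1) degl[OF nz] by simp
    have "\<not> \<delta> < n - 1" using irrF[OF B'(2) l[OF pb\<kappa>]] deg[OF pb\<kappa>] \<delta> by auto
    then have "n - \<delta> = 1" using \<delta> by simp
    then show ?thesis using PQ(2) deg eq by (intro exI[of _ Q] exI[of _ P]) (auto simp: mult.commute)
  qed
  then obtain L R where L: "GP ?s 1 L" "\<And>y. pb ?s y \<Longrightarrow> degree (L y) = 1"
     "\<And>y. pb ?s y \<Longrightarrow> smult (l y) (Hc (fst y) j) = L y * R y" by blast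
  define p0 where "p0 = (\<lambda>y. coeff (L y) 0)"
  define p1 where "p1 = (\<lambda>y. coeff (L y) 1)"
  obtain w0 w1 where g0: "gen ?s w0 p0" and g1: "gen ?s w1 p1"
    using GP_coeff[OF L(1)] unfolding gen'_def p0_def p1_def by blast
  have Lform: "poly (L y) t = p0 y + p1 y * t" if "pb ?s y" for y t
    using L(2)[OF that] unfolding p0_def p1_def by (simp add: poly_altdef)
  have p1nz: "p1 y \<noteq> 0" if "pb ?s y" for y
    using L(2)[OF that] unfolding p1_def by (metis One_nat_def coeff_0 degree_0 leading_coeff_0_iff n_not_Suc_n)
  \<comment> \<open>If the linear factor missed \<open>Y\<close> on a relabelled branch, it would
    divide the irreducible \<open>F\<close> properly, its degree being \<open>1 < n - 1\<close>.
    This is where \<open>3 \<le> n\<close> enters.\<close>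
  have LY: "p0 (tw j \<tau> \<kappa>) = - Y * p1 (tw j \<tau> \<kappa>)" if \<tau>: "\<tau> \<in> G j" for \<tau>
  proof -
    let ?y = "tw j \<tau> \<kappa>"
    have pby: "pb ?s ?y" using pb_tw[OF pb\<kappa> \<tau>] .
    have "smult (l ?y) (Hc (fst \<kappa>) j) = L ?y * R ?y" using L(3)[OF pby] by simp
    from split[OF this] have "poly (L ?y) Y = 0"
    proof (elim disjE exE conjE)
      fix A' assume "L ?y = [:-Y, 1:] * A'"
      then show ?thesis by simp
    next
      fix B' assume B': "smult (l ?y) F = L ?y * B'"
      have "0 < degree (L ?y)" "degree (L ?y) < n - 1" unfolding L(2)[OF pby] using n3 by simp_all
      then show ?thesis using irrF[OF B' l[OF pby]] by blast
    qed
    then have "p0 ?y + p1 ?y * Y = 0" using Lform[OF pby, of Y] by simp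
    then have "p0 ?y = - (p1 ?y * Y)" by (rule eq_neg_iff_add_eq_0[THEN iffD2])
    then show ?thesis by (simp add: mult.commute)
  qed
  \<comment> \<open>\<open>v\<close> is the norm of the leading coefficient \<open>p1\<close>, and
    \<open>u\<close> is \<open>p0 * v / p1\<close> written without division. Thus
    \<open>Y = - u / v\<close>, and both take the same value on all relabellings of \<kappa>, hence
    are polynomials in the parameter there.\<close>
  define v where "v = (\<lambda>y. \<Prod>\<tau>\<in>G j. p1 (tw j \<tau> y))"
  define u where "u = (\<lambda>y. p0 y * (\<Prod>\<tau>\<in>G j - {gid j}. p1 (tw j \<tau> y)))"
  have vrem: "v y = p1 y * (\<Prod>\<tau>\<in>G j - {gid j}. p1 (tw j \<tau> y))" for y
    unfolding v_def using gid_G[of j] by (subst prod.remove[of _ "gid j"]) auto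
  have gv: "gen ?s (\<Sum>\<tau>\<in>G j. w1) v" unfolding v_def by (rule gen_prod) (rule gen_tw[OF g1])
  have gu: "gen ?s (w0 + (\<Sum>\<tau>\<in>G j - {gid j}. w1)) u" unfolding u_def
    by (rule gen_mult[OF g0], rule gen_prod, rule gen_tw[OF g1]) auto
  have vinv: "v (tw j \<sigma> \<kappa>) = v \<kappa>" if "\<sigma> \<in> G j" for \<sigma>
    unfolding v_def by (rule prod_tw[OF that])
  have uY: "u (tw j \<sigma> \<kappa>) = - Y * v \<kappa>" if "\<sigma> \<in> G j" for \<sigma>
  proof -
    have "u (tw j \<sigma> \<kappa>) = - Y * v (tw j \<sigma> \<kappa>)" unfolding vrem unfolding u_def LY[OF that] by (simp only: mult.assoc)
    then show ?thesis using vinv[OF that] by simp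
  qed
  have uY1: "u \<kappa> = - Y * v \<kappa>" using uY[OF gid_G] by simp
  obtain pv where pv: "v \<kappa> = bp pv (fst \<kappa>)" using invariant_poly[OF pb\<kappa> \<kappa>(2) gv vinv] by blast
  obtain pu where pu: "u \<kappa> = bp pu (fst \<kappa>)" using invariant_poly[OF pb\<kappa> \<kappa>(2) gu] uY uY1 by metis
  have "v \<kappa> \<noteq> 0" unfolding v_def using p1nz pb_tw[OF pb\<kappa>] by simp
  then have pv0: "pv \<noteq> 0" using pv by auto
  \<comment> \<open>The value of \<open>H j\<close> at \<open>- pu / pv\<close>, multiplied by
    \<open>pv ^ n\<close>. Its expansion at \<kappa> vanishes, so it is zero as a polynomial and can
    be evaluated at the base point of \<kappa>'.\<close>
  define hom where "hom = (\<Sum>m\<le>n. coeff (H j) m * (- pu) ^ m * pv ^ (n - m))"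
  have bphom: "bp hom c = (\<Sum>m\<le>n. coeff (Hc c j) m * (- bp pu c) ^ m * bp pv c ^ (n - m))" for c
    unfolding hom_def bp_sum bp_mult bp_power bp_minus by (simp add: coeff_Hc bp_def)
  have "bp hom (fst \<kappa>) = (\<Sum>m\<le>n. (coeff (Hc (fst \<kappa>) j) m * Y ^ m) * v \<kappa> ^ n)"
    unfolding bphom pu[symmetric] pv[symmetric] uY1
  proof (rule sum.cong)
    fix m assume "m \<in> {..n}"
    then have "v \<kappa> ^ m * v \<kappa> ^ (n - m) = v \<kappa> ^ n" by (simp add: power_add[symmetric])
    then show "coeff (Hc (fst \<kappa>) j) m * (- (- Y * v \<kappa>)) ^ m * v \<kappa> ^ (n - m) = coeff (Hc (fst \<kappa>) j) m * Y ^ m * v \<kappa> ^ n"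
      by (simp add: power_mult_distrib mult.assoc)
  qed simp
  also have "\<dots> = poly (Hc (fst \<kappa>) j) Y * v \<kappa> ^ n" by (simp add: poly_altdef sum_distrib_right)
  also have "\<dots> = 0" using H by simp
  finally have hom0: "hom = 0" by simp
  define c' where "c' = fst \<kappa>'"
  define U where "U = bp pu c'"
  define V where "V = bp pv c'"
  have V0: "V \<noteq> 0" using pv0 V_def by simp
  \<comment> \<open>This is \<open>V ^ n\<close> times \<open>H j\<close> at the variable divided by
    \<open>V\<close>; it has the root \<open>- U\<close>. Substituting \<open>V\<close> times the
    variable returns to \<open>H j\<close> and exhibits the linear factor
    \<open>[:U, V:]\<close>.\<close>
  define hh where "hh = (\<Sum>m\<le>n. monom (coeff (Hc c' j) m * V ^ (n - m)) m)"
  have coeff_hh: "coeff hh m = (if m \<le> n then coeff (Hc c' j) m * V ^ (n - m) else 0)" for m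
    unfolding hh_def by (simp add: coeff_sum if_distrib sum.If_cases cong: if_cong)
  have "poly hh (- U) = bp hom c'" unfolding bphom hh_def U_def V_def by (simp add: poly_sum poly_monom ac_simps)
  then have "poly hh (- U) = 0" using hom0 by simp
  then have "[:- (- U), 1:] dvd hh" by (rule poly_eq_0_iff_dvd[THEN iffD1])
  then obtain q where q: "hh = [:U, 1:] * q" by auto
  have "smult (V ^ n) (Hc c' j) = hh \<circ>\<^sub>p [:0, V:]"
  proof (rule poly_eqI)
    fix m show "coeff (smult (V ^ n) (Hc c' j)) m = coeff (hh \<circ>\<^sub>p [:0, V:]) m"
    proof (cases "m \<le> n")
      case True
      then have "V ^ n = V ^ (n - m) * V ^ m" by (simp add: power_add[symmetric])
      then show ?thesis using True by (simp add: coeff_pcompose_scale coeff_hh ac_simps)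
    next
      case False
      then show ?thesis by (simp add: coeff_pcompose_scale coeff_hh coeff_eq_0)
    qed
  qed
  also have "\<dots> = [:U, V:] * (q \<circ>\<^sub>p [:0, V:])"
    unfolding q pcompose_mult by (simp add: pcompose_pCons)
  finally have "smult (V ^ n) (RS j 0 \<kappa>') = [:U, V:] * (q \<circ>\<^sub>p [:0, V:])" unfolding c'_def by simp
  from eis_irreducible[OF \<kappa>' _ this] show False using V0 n3 by simp
qed

text \<open>Nodes with \<open>i \<le> n - 2\<close> are enough, since the last residual polynomial
  of each block is linear and has no proper factorisation. Node 0 of each block is asked to be
  Eisenstein only, without any condition on the earlier blocks.\<close>

theorem Claim_full:
  assumes n3: "3 \<le> n"
    and sp: "\<And>j i. j < r \<Longrightarrow> 1 \<le> i \<Longrightarrow> i \<le> n - 2 \<Longrightarrow> \<exists>\<kappa>. pb (j * n + i) \<kappa> \<and> sep j \<kappa> \<and> eis i j \<kappa>"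
    and sp0: "\<And>j. j < r \<Longrightarrow> \<exists>\<kappa>. eis 0 j \<kappa>"
  shows "Claim (r * n)"
proof -
  have "Claim s" if "s \<le> r * n" for s
    using that
  proof (induction s)
    case 0
    show ?case by (rule Claim_0)
  next
    case (Suc s)
    define j where "j = s div n"
    define i where "i = s mod n"
    have s: "s = j * n + i" "i < n" unfolding i_def j_def using n_pos by auto
    have j: "j < r" unfolding j_def using Suc.prems div_less_iff by simp
    have cl: "Claim s" using Suc by simp
    show ?case
    proof (rule Claim_step[OF cl s])
      fix \<delta> P Q l
      assume d: "0 < \<delta>" "\<delta> < n - i" and GP: "GP s \<delta> P" "GP s (n - i - \<delta>) Q"
        and l: "\<And>y. pb s y \<Longrightarrow> l y \<noteq> 0"
        and deg: "\<And>y. pb s y \<Longrightarrow> degree (P y) = \<delta> \<and> degree (Q y) = n - i - \<delta>"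
        and eq: "\<And>y. pb s y \<Longrightarrow> smult (l y) (RS j i y) = P y * Q y"
      show False
      proof (cases "i = 0")
        case True
        obtain \<kappa> where "pb (j * n + 1) \<kappa>" "sep j \<kappa>" "eis 1 j \<kappa>" using sp[OF j order_refl] n3 by fastforce
        moreover obtain \<kappa>' where "eis 0 j \<kappa>'" using sp0[OF j] by blast
        ultimately show False
          using first_root_irr[OF n3, of j \<kappa> \<kappa>' \<delta> P Q l] cl d GP l deg eq s True by simp
      next
        case False
        then have "1 \<le> i" "i \<le> n - 2" using d by auto
        then obtain \<kappa> where \<kappa>: "pb s \<kappa>" "eis i j \<kappa>" using sp[OF j] s by metis
        show False using eis_irreducible[OF \<kappa>(2) _ eq[OF \<kappa>(1)] l[OF \<kappa>(1)]] deg[OF \<kappa>(1)] d s by simp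
      qed
    qed
  qed
  then show ?thesis by simp
qed

end

section \<open>Counting zeros by norms; independence of the root monomials\<close>

lemma homogeneous_system_solution:
  fixes a :: "'b \<Rightarrow> 'i \<Rightarrow> 'w::field"
  assumes "finite J" "finite I" "card J < card I"
  shows "\<exists>x. (\<exists>i\<in>I. x i \<noteq> 0) \<and> (\<forall>j\<in>J. (\<Sum>i\<in>I. a j i * x i) = 0)"
  using assms
proof (induction J arbitrary: I a rule: finite_induct)
  case empty
  then obtain i where "i \<in> I" by (metis card.empty card_gt_0_iff ex_in_conv)
  then show ?case by (intro exI[of _ "\<lambda>_. 1"]) auto
next
  case (insert j J)
  show ?case
  proof (cases "\<forall>i\<in>I. a j i = 0")
    case True
    obtain x where "\<exists>i\<in>I. x i \<noteq> 0" "\<forall>j\<in>J. (\<Sum>i\<in>I. a j i * x i) = 0"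
      using insert.IH[of I a] insert.prems insert.hyps by auto
    then show ?thesis using True by (intro exI[of _ x]) auto
  next
    case False
    then obtain i0 where i0: "i0 \<in> I" "a j i0 \<noteq> 0" by auto
    define I' where "I' = I - {i0}"
    have I': "finite I'" "card J < card I'" "i0 \<notin> I'" "I = insert i0 I'"
      using insert.prems insert.hyps i0 unfolding I'_def by auto
    obtain x where x: "\<exists>i\<in>I'. x i \<noteq> 0" "\<forall>j'\<in>J. (\<Sum>i\<in>I'. (a j' i - a j' i0 * a j i / a j i0) * x i) = 0"
      using insert.IH[OF I'(1,2), of "\<lambda>j' i. a j' i - a j' i0 * a j i / a j i0"] by blast
    define S where "S = (\<Sum>i\<in>I'. a j i * x i)"
    define x' where "x' = x(i0 := - S / a j i0)"
    have sum: "(\<Sum>i\<in>I. a j' i * x' i) = (\<Sum>i\<in>I'. a j' i * x i) - a j' i0 * S / a j i0" for j'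
    proof -
      have "(\<Sum>i\<in>I'. a j' i * x' i) = (\<Sum>i\<in>I'. a j' i * x i)"
        using I'(3) by (intro sum.cong) (auto simp: x'_def)
      then show ?thesis using I' by (simp add: x'_def)
    qed
    have "(\<Sum>i\<in>I. a j' i * x' i) = 0" if "j' \<in> J" for j'
    proof -
      have "(\<Sum>i\<in>I'. (a j' i - a j' i0 * a j i / a j i0) * x i)
          = (\<Sum>i\<in>I'. a j' i * x i) - (\<Sum>i\<in>I'. a j' i0 / a j i0 * (a j i * x i))"
        by (simp add: sum_subtractf[symmetric] left_diff_distrib mult.assoc)
      also have "(\<Sum>i\<in>I'. a j' i0 / a j i0 * (a j i * x i)) = a j' i0 * S / a j i0"
        by (simp add: sum_distrib_left S_def sum_divide_distrib)
      finally show ?thesis using x(2) that sum by simp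
    qed
    moreover have "(\<Sum>i\<in>I. a j i * x' i) = 0" unfolding sum using i0(2) by (simp add: S_def)
    moreover have "\<exists>i\<in>I. x' i \<noteq> 0" using x(1) I' unfolding x'_def by auto
    ultimately show ?thesis by (intro exI[of _ x']) auto
  qed
qed

lemma sum_distinct_subdegree_nonzero:
  fixes f :: "'i \<Rightarrow> 'w::field fps"
  assumes "finite A" "A \<noteq> {}" "\<And>i. i \<in> A \<Longrightarrow> f i \<noteq> 0" "inj_on (\<lambda>i. subdegree (f i)) A"
  shows "(\<Sum>i\<in>A. f i) \<noteq> 0"
proof -
  obtain i0 where i0: "i0 \<in> A" "\<And>i. i \<in> A \<Longrightarrow> subdegree (f i0) \<le> subdegree (f i)"
    using arg_min_if_finite[OF assms(1,2), of "\<lambda>i. subdegree (f i)"] not_le_imp_less by blast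
  have "(\<Sum>i\<in>A. f i) $ subdegree (f i0) = (\<Sum>i\<in>{i0}. f i $ subdegree (f i0))"
    unfolding fps_sum_nth
  proof (rule sum.mono_neutral_right)
    show "\<forall>i\<in>A - {i0}. f i $ subdegree (f i0) = 0"
    proof
      fix i assume i: "i \<in> A - {i0}"
      then have "subdegree (f i) \<noteq> subdegree (f i0)" using assms(4) i0(1) by (auto dest: inj_onD)
      then have "subdegree (f i0) < subdegree (f i)" using i0(2)[of i] i by simp
      then show "f i $ subdegree (f i0) = 0" by (rule nth_less_subdegree_zero)
    qed
  qed (use assms i0 in auto)
  also have "\<dots> \<noteq> 0" using assms(3)[OF i0(1)] by simp
  finally show ?thesis by auto
qed

lemma CHAR_fps: "CHAR('w::field fps) = CHAR('w)"
proof (rule CHAR_eqI)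
  show "of_nat CHAR('w) = (0 :: 'w fps)" by (simp flip: fps_of_nat)
  show "CHAR('w) dvd k" if "of_nat k = (0 :: 'w fps)" for k
    using that by (simp add: of_nat_eq_0_iff_char_dvd flip: fps_of_nat)
qed

lemma sum_order_le_degree:
  fixes p :: "'w::field poly"
  assumes "p \<noteq> 0" "finite A" shows "(\<Sum>a\<in>A. Polynomial.order a p) \<le> degree p"
  using assms(2,1)
proof (induction A arbitrary: p rule: finite_induct)
  case (insert a A)
  define k where "k = Polynomial.order a p"
  obtain q where q: "p = [:-a, 1:] ^ k * q" using Polynomial.order_1[of a p] unfolding k_def by (elim dvdE)
  have q0: "q \<noteq> 0" "[:-a, 1:] ^ k \<noteq> 0" using insert.prems q by auto
  have "Polynomial.order b p = Polynomial.order b q" if "b \<in> A" for b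
  proof -
    have "b \<noteq> a" using that insert.hyps by auto
    then have "Polynomial.order b ([:-a, 1:] ^ k) = 0" by (intro Polynomial.order_0I) simp
    then show ?thesis using Polynomial.order_mult[of "[:-a, 1:] ^ k" q b] insert.prems unfolding q by simp
  qed
  then have "(\<Sum>b\<in>A. Polynomial.order b p) \<le> degree q" using insert.IH[OF q0(1)] by simp
  moreover have "degree p = k + degree q" unfolding q using q0 by (simp add: degree_mult_eq degree_power_eq)
  ultimately show ?case using insert.hyps by (simp add: k_def)
qed simp

context curve begin

lemma bp_subdegree_order: assumes "p \<noteq> 0" "m \<le> subdegree (bp p c)" shows "m \<le> Polynomial.order c p"
proof -
  have "monom 1 m dvd p \<circ>\<^sub>p [:c, 1:]"
  proof -
    have "coeff (p \<circ>\<^sub>p [:c, 1:]) k = 0" if "k < m" for k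
      using that assms(2) nth_less_subdegree_zero[of k "bp p c"] by (simp add: bp_def)
    then show ?thesis by (simp add: monom_1_dvd_iff')
  qed
  then obtain q where q: "p \<circ>\<^sub>p [:c, 1:] = monom 1 m * q" by auto
  have comp: "[:c, 1:] \<circ>\<^sub>p [:-c, 1:] = [:0, 1:]" by (simp add: pcompose_pCons)
  have "p = (p \<circ>\<^sub>p [:c, 1:]) \<circ>\<^sub>p [:-c, 1:]" unfolding pcompose_assoc[symmetric] comp by simp
  also have "\<dots> = (monom 1 m \<circ>\<^sub>p [:-c, 1:]) * (q \<circ>\<^sub>p [:-c, 1:])" unfolding q pcompose_mult ..
  also have "monom 1 m \<circ>\<^sub>p [:-c, 1:] = [:-c, 1:] ^ m"
    by (induction m) (simp_all add: monom_0 monom_Suc pcompose_pCons pcompose_1 flip: one_pCons)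
  finally show ?thesis using assms(1) by (metis dvd_triv_left Polynomial.order_divides)
qed

definition norm :: "nat \<Rightarrow> ('w br \<Rightarrow> 'w fps) \<Rightarrow> 'w br \<Rightarrow> 'w fps" where
  "norm r u y = (\<Prod>\<tau>\<in>G r. u (tw r \<tau> y))"

text \<open>The norm is invariant, hence a polynomial in the parameter on the branch
  \<open>y0\<close>; \<open>Claim\<close> then carries this identity to all full branches. The
  degree bound plays the part of the bound for the number of poles.\<close>

lemma norm_poly:
  assumes cl: "Claim (r * n)" and y0: "pb (r * n) y0" "sep r y0" and u: "gen (r * n) w u" "u y0 \<noteq> 0"
  obtains R where "R \<noteq> 0" "degree R \<le> card (G r) * w" "\<And>y. pb (r * n) y \<Longrightarrow> norm r u y = bp R (fst y)"
proof -
  have g: "gen (r * n) (card (G r) * w) (norm r u)"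
    using gen_prod[of "G r" "r * n" "\<lambda>_. w" "\<lambda>\<tau> y. u (tw r \<tau> y)"] gen_tw[OF u(1)] unfolding norm_def by simp
  obtain R where R: "degree R \<le> card (G r) * w" "norm r u y0 = bp R (fst y0)"
    using invariant_poly[OF y0 g] prod_tw unfolding norm_def by blast
  have "gen' (r * n) (\<lambda>y. norm r u y - bp R (fst y))"
    by (intro gen'_diff) (use g gen_bp in \<open>auto simp: gen'_def\<close>)
  then have all: "norm r u y = bp R (fst y)" if "pb (r * n) y" for y
    using ClaimD[OF cl _ y0(1) that] R(2) by fastforce
  have "u (tw r \<tau> y0) \<noteq> 0" if "\<tau> \<in> G r" for \<tau>
    using ClaimD[OF cl _ pb_tw[OF y0(1) that] y0(1)] u unfolding gen'_def by blast
  then have "norm r u y0 \<noteq> 0" unfolding norm_def by simp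
  then have "R \<noteq> 0" using R(2) by auto
  then show ?thesis using that R(1) all by blast
qed

lemma subdegree_prod: "finite A \<Longrightarrow> (\<And>i. i \<in> A \<Longrightarrow> f i \<noteq> (0::'w fps)) \<Longrightarrow> subdegree (\<Prod>i\<in>A. f i) = (\<Sum>i\<in>A. subdegree (f i))"
  by (induction A rule: finite_induct) auto

text \<open>A function has no more zeros than poles. Each relabelling of the branch above
  \<open>b\<close> on which \<open>u\<close> vanishes to order \<open>M\<close> adds
  \<open>M\<close> to the order of the norm at \<open>b\<close>, and the orders of the polynomial
  \<open>R\<close> sum to at most its degree.\<close>

lemma zeros_bound:
  assumes cl: "Claim (r * n)" and y0: "pb (r * n) y0" "sep r y0" and u: "gen (r * n) w u" "u y0 \<noteq> 0"
    and Z: "finite Z" "\<And>b. b \<in> Z \<Longrightarrow> pb (r * n) (Y b) \<and> fst (Y b) = b"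
    and M: "\<And>b \<tau>. b \<in> Z \<Longrightarrow> \<tau> \<in> G r \<Longrightarrow> S b \<tau> \<Longrightarrow> M \<le> subdegree (u (tw r \<tau> (Y b)))"
  shows "(\<Sum>b\<in>Z. card {\<tau>\<in>G r. S b \<tau>}) * M \<le> card (G r) * w"
proof -
  obtain R where R: "R \<noteq> 0" "degree R \<le> card (G r) * w" "\<And>y. pb (r * n) y \<Longrightarrow> norm r u y = bp R (fst y)"
    using norm_poly[OF cl y0 u] by blast
  have nz: "u (tw r \<tau> y) \<noteq> 0" if "\<tau> \<in> G r" "pb (r * n) y" for \<tau> y
    using ClaimD[OF cl _ pb_tw[OF that(2,1)] y0(1)] u unfolding gen'_def by blast
  have "card {\<tau>\<in>G r. S b \<tau>} * M \<le> Polynomial.order b R" if b: "b \<in> Z" for b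
  proof (rule bp_subdegree_order[OF R(1)])
    have "card {\<tau>\<in>G r. S b \<tau>} * M = (\<Sum>\<tau>\<in>{\<tau>\<in>G r. S b \<tau>}. M)" by simp
    also have "\<dots> \<le> (\<Sum>\<tau>\<in>{\<tau>\<in>G r. S b \<tau>}. subdegree (u (tw r \<tau> (Y b))))"
      using M b by (intro sum_mono) auto
    also have "\<dots> \<le> (\<Sum>\<tau>\<in>G r. subdegree (u (tw r \<tau> (Y b))))"
      by (rule sum_mono2) auto
    also have "\<dots> = subdegree (norm r u (Y b))"
      unfolding norm_def using nz Z(2)[OF b] by (subst subdegree_prod) auto
    also have "\<dots> = subdegree (bp R b)" using R(3) Z(2)[OF b] by simp
    finally show "card {\<tau>\<in>G r. S b \<tau>} * M \<le> subdegree (bp R b)" .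
  qed
  then have "(\<Sum>b\<in>Z. card {\<tau>\<in>G r. S b \<tau>} * M) \<le> (\<Sum>b\<in>Z. Polynomial.order b R)" by (rule sum_mono)
  also have "\<dots> \<le> degree R" by (rule sum_order_le_degree[OF R(1) Z(1)])
  finally show ?thesis using R(2) by (simp add: sum_distrib_right)
qed

lemma subdegree_gen_le:
  assumes cl: "Claim (r * n)" and y0: "pb (r * n) y0" "sep r y0" and u: "gen (r * n) w u" "u y0 \<noteq> 0"
  shows "subdegree (u y0) \<le> card (G r) * w"
proof -
  have "(\<Sum>b\<in>{fst y0}. card {\<tau>\<in>G r. \<tau> = gid r}) * subdegree (u y0) \<le> card (G r) * w"
    by (rule zeros_bound[OF cl y0 u, where Y = "\<lambda>_. y0" and S = "\<lambda>_ \<tau>. \<tau> = gid r"]) (use y0 in auto)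
  moreover have "{\<tau>\<in>G r. \<tau> = gid r} = {gid r}" using gid_G by auto
  ultimately show ?thesis by simp
qed

definition bas :: "nat \<Rightarrow> nat \<times> (nat \<Rightarrow> nat) \<Rightarrow> 'w br \<Rightarrow> 'w fps" where
  "bas s b y = (fps_const (fst y) + fps_X) ^ fst b * mon s (snd b) y"

definition emax :: "nat \<Rightarrow> nat" where "emax s = D * (s * n)"

lemma esum_le: "e \<in> E s \<Longrightarrow> D * esum s e \<le> emax s"
proof -
  assume e: "e \<in> E s"
  have "esum s e \<le> (\<Sum>i<s. n)" unfolding esum_def
  proof (rule sum_mono)
    fix i assume "i \<in> {..<s}"
    then show "e i \<le> n" using E_bound[OF e, of i] by simp
  qed
  then show ?thesis unfolding emax_def by simp
qed

lemma gen_bas: assumes "snd b \<in> E s" "fst b \<le> l" shows "gen s (l + emax s) (bas s b)"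
proof -
  have "gen s (\<Sum>i<s. snd b i * D) (mon s (snd b))"
    unfolding mon_def by (intro gen_prod gen_power gen_var) auto
  moreover have "(\<Sum>i<s. snd b i * D) \<le> emax s" using esum_le[OF assms(1)] by (simp add: esum_def sum_distrib_left mult.commute)
  ultimately have 1: "gen s (emax s) (mon s (snd b))" using gen_mono by blast
  have 2: "gen s l (\<lambda>y. (fps_const (fst y) + fps_X) ^ fst b)"
    using gen_mono[OF gen_power[OF gen_base, of s "fst b"], of l] assms(2) by simp
  show ?thesis unfolding bas_def by (rule gen_mult[OF 2 1])
qed

text \<open>By \<open>Claim\<close> a linear relation on one branch holds on all its relabellings.
  The corresponding normal form is then invariant with value zero, and
  \<open>invariant_const\<close> makes all its coefficients vanish. Fullness of the group is used
  here.\<close>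

lemma bas_independent:
  assumes cl: "Claim (r * n)" and y0: "pb (r * n) y0" "sep r y0"
    and z: "(\<Sum>b\<in>{..l} \<times> E (r * n). fps_const (x b) * bas (r * n) b y0) = 0"
    and b: "b \<in> {..l} \<times> E (r * n)"
  shows "x b = 0"
proof -
  let ?s = "r * n"
  define c where "c = (\<lambda>e. \<Sum>i\<le>l. smult (x (i, e)) ([:0, 1:] ^ i))"
  define u where "u = (\<lambda>y. \<Sum>b\<in>{..l} \<times> E ?s. fps_const (x b) * bas ?s b y)"
  have bpc: "bp (c e) a = (\<Sum>i\<le>l. fps_const (x (i, e)) * (fps_const a + fps_X) ^ i)" for e a
  proof -
    have "smult t p = [:t:] * p" for t :: 'w and p by simp
    then show ?thesis unfolding c_def bp_sum by (simp only: bp_mult bp_const bp_power bp_X)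
  qed
  have u: "u y = (\<Sum>e\<in>E ?s. bp (c e) (fst y) * mon ?s e y)" for y
    unfolding u_def bas_def bpc sum_distrib_right
    by (subst sum.swap) (simp add: sum.cartesian_product split_def mult.assoc)
  have "gen' ?s u" unfolding u_def
    by (intro gen'_sum gen'_mult gen'_const) (use gen_bas in \<open>force simp: gen'_def\<close>)
  moreover have "u y0 = 0" using z unfolding u_def .
  ultimately have "u (tw r \<tau> y0) = 0" if "\<tau> \<in> G r" for \<tau>
    using ClaimD[OF cl _ y0(1) pb_tw[OF y0(1) that]] by blast
  then have "bp (c e) (fst y0) = (if e = restrict (\<lambda>_. 0) {..<?s} then 0 else 0)" if "e \<in> E ?s" for e
    using invariant_const[OF y0(2) order_refl, of "\<lambda>e. bp (c e) (fst y0)" 0 e] that unfolding u by simp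
  then have "c (snd b) = 0" using b by fastforce
  moreover have "coeff (c (snd b)) (fst b) = x b"
  proof -
    have "[:0, 1:] ^ i = monom (1::'w) i" for i by (simp add: monom_altdef)
    then have "coeff (c (snd b)) (fst b) = (\<Sum>i\<le>l. if i = fst b then x (i, snd b) else 0)"
      unfolding c_def by (simp add: coeff_sum if_distrib cong: if_cong)
    then show ?thesis using b by auto
  qed
  ultimately show ?thesis by simp
qed

end

section \<open>Stepanov's auxiliary functions\<close>

context curve begin

text \<open>The base point is fixed by the \<open>q\<close>-power map, and this map acts on the
  constant terms of the branch, that is on the roots at the base point, as the relabelling
  \<sigma>.\<close>

definition frobbr :: "nat \<Rightarrow> nat \<Rightarrow> (nat \<Rightarrow> nat \<Rightarrow> nat) \<Rightarrow> 'w br \<Rightarrow> bool" where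
  "frobbr q r \<sigma> y \<longleftrightarrow> fst y ^ q = fst y \<and> (\<forall>s<r * n. (snd y s $ 0) ^ q = snd y (act r \<sigma> s) $ 0)"

lemma fps_power_nth_0: "(f ^ k :: 'w fps) $ 0 = (f $ 0) ^ k"
  by (induction k) auto

lemma fps_prod_nth_0: "(\<Prod>i\<in>A. f i :: 'w fps) $ 0 = (\<Prod>i\<in>A. f i $ 0)"
  by (induction A rule: infinite_finite_induct) auto

lemma bas_frob:
  assumes "frobbr q r \<sigma> y"
  shows "(bas (r * n) b y ^ q) $ 0 = bas (r * n) b (tw r \<sigma> y) $ 0"
proof -
  have "(fst y ^ i) ^ q = fst y ^ i" for i
    using assms unfolding frobbr_def by (metis power_mult mult.commute)
  moreover have "(\<Prod>i<r * n. (snd y i $ 0) ^ snd b i) ^ q = (\<Prod>i<r * n. (snd y (act r \<sigma> i) $ 0) ^ snd b i)"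
    unfolding prod_power_distrib
  proof (rule prod.cong)
    fix i assume "i \<in> {..<r * n}"
    then have "(snd y i $ 0) ^ q = snd y (act r \<sigma> i) $ 0" using assms by (simp add: frobbr_def)
    then show "((snd y i $ 0) ^ snd b i) ^ q = (snd y (act r \<sigma> i) $ 0) ^ snd b i"
      by (metis power_mult mult.commute)
  qed simp
  ultimately show ?thesis
    unfolding bas_def mon_def by (simp add: fps_power_nth_0 fps_prod_nth_0 power_mult_distrib)
qed

text \<open>The coefficients of the normal forms of the products \<open>\<Lambda> k \<nu> * bas b\<close>, twisted by \<open>\<sigma>\<close>, give a
  homogeneous linear system with fewer equations than unknowns.\<close>

lemma stepanov_core:
  assumes q: "prime CHAR('w)" "q = CHAR('w) ^ kk" and roots: "\<And>x::'w. \<exists>z. z ^ q = x"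
    and cl: "Claim (r * n)" and y0: "pb (r * n) y0" "sep r y0" and \<sigma>: "\<sigma> \<in> G r"
    and I: "finite I" "\<And>\<nu>. \<nu> \<in> I \<Longrightarrow> \<phi> \<nu> y0 \<noteq> 0" "inj_on (\<lambda>\<nu>. subdegree (\<phi> \<nu> y0) mod q) I"
    and \<Lambda>: "\<And>k \<nu>. k < K \<Longrightarrow> \<nu> \<in> I \<Longrightarrow> gen (r * n) w1 (\<Lambda> k \<nu>)"
    and cnt: "K * (w1 + m + emax (r * n) + 1) < card I * (m + 1)"
  shows "\<exists>x. (\<forall>k y. k < K \<longrightarrow> pb (r * n) y \<longrightarrow> frobbr q r \<sigma> y \<longrightarrow>
        (\<Sum>\<nu>\<in>I. \<Sum>b\<in>{..m} \<times> E (r * n). fps_const (x (\<nu>, b)) * \<Lambda> k \<nu> y * bas (r * n) b y ^ q) $ 0 = 0) \<and>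
      (\<Sum>\<nu>\<in>I. \<Sum>b\<in>{..m} \<times> E (r * n). fps_const (x (\<nu>, b)) * \<phi> \<nu> y0 * bas (r * n) b y0 ^ q) \<noteq> 0"
proof -
  let ?s = "r * n"
  let ?B = "{..m} \<times> E ?s"
  define W where "W = w1 + (m + emax ?s)"
  have g: "gen ?s W (\<lambda>y. \<Lambda> k \<nu> y * bas ?s b (tw r \<sigma> y))" if "k < K" "\<nu> \<in> I" "b \<in> ?B" for k \<nu> b
    unfolding W_def using that by (intro gen_mult \<Lambda> gen_tw[OF gen_bas \<sigma>]) auto
  have "\<forall>k \<nu> b. \<exists>c. k < K \<longrightarrow> \<nu> \<in> I \<longrightarrow> b \<in> ?B \<longrightarrow> NFc ?s W c \<and>
      (\<forall>y. pb ?s y \<longrightarrow> \<Lambda> k \<nu> y * bas ?s b (tw r \<sigma> y) = NFe ?s c y)"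
    using NF_gen[OF g] unfolding NF_def by blast
  then obtain C where C: "\<And>k \<nu> b. k < K \<Longrightarrow> \<nu> \<in> I \<Longrightarrow> b \<in> ?B \<Longrightarrow> NFc ?s W (C k \<nu> b) \<and>
      (\<forall>y. pb ?s y \<longrightarrow> \<Lambda> k \<nu> y * bas ?s b (tw r \<sigma> y) = NFe ?s (C k \<nu> b) y)" by metis
  have Cdeg: "degree (C k \<nu> b e) \<le> W" if "k < K" "\<nu> \<in> I" "b \<in> ?B" "e \<in> E ?s" for k \<nu> b e
    using C[OF that(1-3)] that(4) unfolding NFc_def by (cases "C k \<nu> b e = 0") force+
  \<comment> \<open>One equation for each condition \<open>k\<close>, basis monomial
    \<open>e\<close> and power \<open>d\<close> of the parameter; the number of monomials cancels
    against the same factor in the number of unknowns.\<close>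
  define J where "J = {..<K} \<times> E ?s \<times> {..W}"
  have Epos: "0 < card (E ?s)"
  proof -
    have "restrict (\<lambda>_. 0) {..<?s} \<in> E ?s" using n_pos by (auto simp: E_def)
    then show ?thesis by (metis card_gt_0_iff empty_iff finite_E)
  qed
  have "card J < card (I \<times> ?B)"
  proof -
    have "card J = K * (card (E ?s) * Suc W)" unfolding J_def by (simp add: card_cartesian_product)
    also have "\<dots> = card (E ?s) * (K * (w1 + m + emax ?s + 1))" by (simp add: W_def algebra_simps)
    also have "\<dots> < card (E ?s) * (card I * (m + 1))" using cnt Epos by (rule mult_less_mono2)
    also have "\<dots> = card (I \<times> ?B)" by (simp add: card_cartesian_product algebra_simps)
    finally show ?thesis .
  qed
  then obtain x where x: "\<exists>i\<in>I \<times> ?B. x i \<noteq> 0"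
     "\<forall>j\<in>J. (\<Sum>i\<in>I \<times> ?B. (case j of (k, e, d) \<Rightarrow> coeff (C k (fst i) (snd i) e) d) * x i) = 0"
    using homogeneous_system_solution[of J "I \<times> ?B" "\<lambda>j i. case j of (k, e, d) \<Rightarrow> coeff (C k (fst i) (snd i) e) d"] I(1)
    unfolding J_def by auto
  have comb: "(\<Sum>\<nu>\<in>I. \<Sum>b\<in>?B. smult (x (\<nu>, b)) (C k \<nu> b e)) = 0" if k: "k < K" and e: "e \<in> E ?s" for k e
  proof (rule poly_eqI)
    fix d
    have eq: "coeff (\<Sum>\<nu>\<in>I. \<Sum>b\<in>?B. smult (x (\<nu>, b)) (C k \<nu> b e)) d = (\<Sum>i\<in>I \<times> ?B. coeff (C k (fst i) (snd i) e) d * x i)"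
      by (simp add: coeff_sum sum.cartesian_product split_def mult.commute)
    show "coeff (\<Sum>\<nu>\<in>I. \<Sum>b\<in>?B. smult (x (\<nu>, b)) (C k \<nu> b e)) d = coeff 0 d"
    proof (cases "d \<le> W")
      case True
      then have "(k, e, d) \<in> J" using k e unfolding J_def by simp
      then show ?thesis using x(2) unfolding eq by fastforce
    next
      case False
      then have "coeff (C k (fst i) (snd i) e) d = 0" if "i \<in> I \<times> ?B" for i
        using Cdeg[OF k _ _ e, of "fst i" "snd i"] that by (intro coeff_eq_0) auto
      then show ?thesis unfolding eq by simp
    qed
  qed
  show ?thesis
  proof (intro exI[of _ x] conjI allI impI)
    fix k y assume k: "k < K" and y: "pb ?s y" and fr: "frobbr q r \<sigma> y"
    have "(\<Sum>\<nu>\<in>I. \<Sum>b\<in>?B. fps_const (x (\<nu>, b)) * \<Lambda> k \<nu> y * bas ?s b y ^ q) $ 0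
        = (\<Sum>\<nu>\<in>I. \<Sum>b\<in>?B. fps_const (x (\<nu>, b)) * (\<Lambda> k \<nu> y * bas ?s b (tw r \<sigma> y))) $ 0"
      by (simp add: fps_sum_nth bas_frob[OF fr] mult.assoc)
    also have "(\<Sum>\<nu>\<in>I. \<Sum>b\<in>?B. fps_const (x (\<nu>, b)) * (\<Lambda> k \<nu> y * bas ?s b (tw r \<sigma> y)))
        = (\<Sum>\<nu>\<in>I. \<Sum>b\<in>?B. \<Sum>e\<in>E ?s. bp (smult (x (\<nu>, b)) (C k \<nu> b e)) (fst y) * mon ?s e y)"
    proof (intro sum.cong refl)
      fix \<nu> b assume "\<nu> \<in> I" "b \<in> ?B"
      then have 1: "\<Lambda> k \<nu> y * bas ?s b (tw r \<sigma> y) = NFe ?s (C k \<nu> b) y" using C[OF k] y by blast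
      have "smult t p = [:t:] * p" for t :: 'w and p by simp
      then have 2: "bp (smult t p) c = fps_const t * bp p c" for t p c by (simp only: bp_mult bp_const)
      show "fps_const (x (\<nu>, b)) * (\<Lambda> k \<nu> y * bas ?s b (tw r \<sigma> y))
          = (\<Sum>e\<in>E ?s. bp (smult (x (\<nu>, b)) (C k \<nu> b e)) (fst y) * mon ?s e y)"
        unfolding 1 NFe_def 2 by (simp add: sum_distrib_left mult.assoc)
    qed
    also have "\<dots> = (\<Sum>\<nu>\<in>I. \<Sum>e\<in>E ?s. \<Sum>b\<in>?B. bp (smult (x (\<nu>, b)) (C k \<nu> b e)) (fst y) * mon ?s e y)"
      by (intro sum.cong refl sum.swap)
    also have "\<dots> = (\<Sum>e\<in>E ?s. \<Sum>\<nu>\<in>I. \<Sum>b\<in>?B. bp (smult (x (\<nu>, b)) (C k \<nu> b e)) (fst y) * mon ?s e y)"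
      by (rule sum.swap)
    also have "\<dots> = (\<Sum>e\<in>E ?s. bp (\<Sum>\<nu>\<in>I. \<Sum>b\<in>?B. smult (x (\<nu>, b)) (C k \<nu> b e)) (fst y) * mon ?s e y)"
      by (simp add: bp_sum sum_distrib_right)
    also have "\<dots> = 0" using comb[OF k] by simp
    finally show "(\<Sum>\<nu>\<in>I. \<Sum>b\<in>?B. fps_const (x (\<nu>, b)) * \<Lambda> k \<nu> y * bas ?s b y ^ q) $ 0 = 0" by simp
  next
    \<comment> \<open>With \<open>q\<close>-th roots of the coefficients, each inner sum becomes
      \<phi> \<nu> times a \<open>q\<close>-th power, whose order at \<open>y0\<close> is a multiple
      of \<open>q\<close>. As the orders of the \<phi> \<nu> are distinct modulo \<open>q\<close>,
      the nonzero terms cannot cancel.\<close>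
    define \<rho> where "\<rho> = (\<lambda>i. SOME z. z ^ q = x i)"
    have \<rho>: "\<rho> i ^ q = x i" for i unfolding \<rho>_def by (rule someI_ex[OF roots])
    have pF: "prime CHAR('w fps)" using q(1) by (simp add: CHAR_fps)
    have frob_sum: "(\<Sum>i\<in>A. f i :: 'w fps) ^ q = (\<Sum>i\<in>A. f i ^ q)" for A :: "(nat \<times> (nat \<Rightarrow> nat)) set" and f
      using freshmans_dream_sum'[OF pF, of q kk f A] q(2) by (simp add: CHAR_fps)
    define g where "g = (\<lambda>\<nu>. \<Sum>b\<in>?B. fps_const (\<rho> (\<nu>, b)) * bas ?s b y0)"
    have F: "(\<Sum>b\<in>?B. fps_const (x (\<nu>, b)) * \<phi> \<nu> y0 * bas ?s b y0 ^ q) = \<phi> \<nu> y0 * g \<nu> ^ q" for \<nu>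
      unfolding g_def frob_sum by (simp add: sum_distrib_left power_mult_distrib fps_const_power[symmetric] \<rho> ac_simps)
    define I' where "I' = {\<nu>\<in>I. g \<nu> \<noteq> 0}"
    have q0: "q > 0" using q(1,2) prime_gt_0_nat by simp
    have "I' \<noteq> {}"
    proof -
      obtain \<nu> b where nb: "\<nu> \<in> I" "b \<in> ?B" "x (\<nu>, b) \<noteq> 0" using x(1) by auto
      have "g \<nu> \<noteq> 0"
      proof
        assume "g \<nu> = 0"
        then have "\<rho> (\<nu>, b) = 0" using bas_independent[OF cl y0, where l=m and x="\<lambda>b. \<rho> (\<nu>, b)" and b=b] nb(2) unfolding g_def by simp
        then show False using \<rho>[of "(\<nu>, b)"] nb(3) q0 by (simp add: zero_power)
      qed
      then show ?thesis using nb(1) unfolding I'_def by blast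
    qed
    have "(\<Sum>\<nu>\<in>I'. \<phi> \<nu> y0 * g \<nu> ^ q) \<noteq> 0"
    proof (rule sum_distinct_subdegree_nonzero)
      show "finite I'" using I(1) I'_def by simp
      show "\<phi> \<nu> y0 * g \<nu> ^ q \<noteq> 0" if "\<nu> \<in> I'" for \<nu> using that I(2) I'_def by simp
      have sd: "subdegree (\<phi> \<nu> y0 * g \<nu> ^ q) mod q = subdegree (\<phi> \<nu> y0) mod q" if "\<nu> \<in> I'" for \<nu>
        using that I(2) I'_def by simp
      show "inj_on (\<lambda>\<nu>. subdegree (\<phi> \<nu> y0 * g \<nu> ^ q)) I'"
      proof (rule inj_onI)
        fix a b assume ab: "a \<in> I'" "b \<in> I'" "subdegree (\<phi> a y0 * g a ^ q) = subdegree (\<phi> b y0 * g b ^ q)"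
        then have "subdegree (\<phi> a y0) mod q = subdegree (\<phi> b y0) mod q" using sd by metis
        then show "a = b" using I(3) ab(1,2) unfolding inj_on_def I'_def by blast
      qed
    qed fact
    also have "(\<Sum>\<nu>\<in>I'. \<phi> \<nu> y0 * g \<nu> ^ q) = (\<Sum>\<nu>\<in>I. \<phi> \<nu> y0 * g \<nu> ^ q)"
      using I(1) q0 by (intro sum.mono_neutral_left) (auto simp: I'_def zero_power)
    finally show "(\<Sum>\<nu>\<in>I. \<Sum>b\<in>?B. fps_const (x (\<nu>, b)) * \<phi> \<nu> y0 * bas ?s b y0 ^ q) \<noteq> 0"
      unfolding F .
  qed
qed

text \<open>A space of functions realises at least as many orders of vanishing at \<open>y0\<close>
  as its dimension: otherwise linear algebra yields a nonzero member whose coefficients at all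
  realised orders are zero, including the one at its own order.\<close>

lemma many_orders:
  assumes cl: "Claim (r * n)" and y0: "pb (r * n) y0" "sep r y0"
  obtains I f where "finite I" "card (E (r * n)) * (l + 1) \<le> card I"
    "\<And>\<nu>. \<nu> \<in> I \<Longrightarrow> gen (r * n) (l + emax (r * n)) (f \<nu>) \<and> f \<nu> y0 \<noteq> 0 \<and> subdegree (f \<nu> y0) = \<nu>"
    "\<And>\<nu>. \<nu> \<in> I \<Longrightarrow> \<nu> \<le> card (G r) * (l + emax (r * n))"
proof -
  let ?s = "r * n"
  let ?B = "{..l} \<times> E ?s"
  define comb where "comb = (\<lambda>x y. \<Sum>b\<in>?B. fps_const (x b) * bas ?s b y)"
  have gc: "gen ?s (l + emax ?s) (comb x)" for x
  proof -
    have "gen ?s (0 + (l + emax ?s)) (\<lambda>y. fps_const (x b) * bas ?s b y)" if "b \<in> ?B" for b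
      using that by (intro gen_mult gen_const gen_bas) auto
    then show ?thesis unfolding comb_def by (intro gen_sum) simp
  qed
  define I where "I = {subdegree (comb x y0) | x. comb x y0 \<noteq> 0}"
  have bound: "\<nu> \<le> card (G r) * (l + emax ?s)" if "\<nu> \<in> I" for \<nu>
    using that subdegree_gen_le[OF cl y0 gc] unfolding I_def by auto
  then have fin: "finite I" using finite_nat_set_iff_bounded_le by blast
  have "card (E ?s) * (l + 1) \<le> card I"
  proof (rule ccontr)
    assume "\<not> ?thesis"
    then have "card I < card ?B" by (simp add: card_cartesian_product algebra_simps)
    then obtain x where x: "\<exists>b\<in>?B. x b \<noteq> 0" "\<forall>\<nu>\<in>I. (\<Sum>b\<in>?B. bas ?s b y0 $ \<nu> * x b) = 0"
      using homogeneous_system_solution[of I ?B "\<lambda>\<nu> b. bas ?s b y0 $ \<nu>"] fin by auto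
    have "comb x y0 \<noteq> 0" using x(1) bas_independent[OF cl y0, where l=l and x=x] unfolding comb_def by blast
    then have "subdegree (comb x y0) \<in> I" "comb x y0 $ subdegree (comb x y0) \<noteq> 0" unfolding I_def by auto
    moreover have "comb x y0 $ \<nu> = (\<Sum>b\<in>?B. bas ?s b y0 $ \<nu> * x b)" for \<nu>
      unfolding comb_def by (simp add: fps_sum_nth mult.commute)
    ultimately show False using x(2) by simp
  qed
  moreover have "\<forall>\<nu>\<in>I. \<exists>x. comb x y0 \<noteq> 0 \<and> subdegree (comb x y0) = \<nu>" unfolding I_def by blast
  then obtain xx where xx: "\<And>\<nu>. \<nu> \<in> I \<Longrightarrow> comb (xx \<nu>) y0 \<noteq> 0 \<and> subdegree (comb (xx \<nu>) y0) = \<nu>" by metis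
  ultimately show ?thesis using that[of I "\<lambda>\<nu>. comb (xx \<nu>)"] fin gc bound by blast
qed

end

lemma fps_deriv_poly:
  fixes P :: "'w::field fps poly"
  shows "fps_deriv (poly P z) = poly (map_poly fps_deriv P) z + poly (pderiv P) z * fps_deriv z"
proof (induction P)
  case (pCons a P)
  have "map_poly fps_deriv (pCons a P) = pCons (fps_deriv a) (map_poly fps_deriv P)"
    by (rule map_poly_pCons) simp
  then show ?case using pCons.IH by (simp add: pderiv_pCons algebra_simps)
qed simp

lemma poly_sum_bound:
  fixes p :: "'a::comm_ring_1 poly"
  assumes "degree p \<le> k" shows "poly p x = (\<Sum>i\<le>k. coeff p i * x ^ i)"
  unfolding poly_altdef using assms by (intro sum.mono_neutral_left) (auto simp: coeff_eq_0 not_le)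

lemma pderiv_prod_linear:
  fixes a :: "'i \<Rightarrow> 'a::idom"
  assumes "finite A" "k \<in> A"
  shows "poly (pderiv (\<Prod>i\<in>A. [:- a i, 1:])) (a k) = (\<Prod>i\<in>A - {k}. a k - a i)"
proof -
  have "(\<Prod>i\<in>A. [:- a i, 1:]) = [:- a k, 1:] * (\<Prod>i\<in>A - {k}. [:- a i, 1:])"
    using assms by (rule prod.remove)
  then have "poly (pderiv (\<Prod>i\<in>A. [:- a i, 1:])) (a k) = poly (\<Prod>i\<in>A - {k}. [:- a i, 1:]) (a k)"
    by (simp add: pderiv_mult pderiv_pCons del: mult_pCons_left)
  then show ?thesis by (simp add: poly_prod)
qed

text \<open>Since \<Delta> is a unit, the derivation \<Delta> d/dt detects orders of vanishing just
  as d/dt does, provided the positive integers below \<open>M\<close> are invertible; hence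
  \<open>M \<le> CHAR('w)\<close>.\<close>

lemma vanish_order_deriv:
  fixes f \<Delta> :: "'w::field fps"
  assumes "\<Delta> $ 0 \<noteq> 0" "M \<le> CHAR('w)" "\<And>k. k < M \<Longrightarrow> (((\<lambda>f. \<Delta> * fps_deriv f) ^^ k) f) $ 0 = 0"
  shows "\<forall>i<M. f $ i = 0"
  using assms(2,3)
proof (induction M arbitrary: f)
  case (Suc M)
  define g where "g = \<Delta> * fps_deriv f"
  have "((\<lambda>f. \<Delta> * fps_deriv f) ^^ k) g $ 0 = 0" if "k < M" for k
    using Suc.prems(2)[of "Suc k"] that unfolding g_def by (simp add: funpow_Suc_right o_def del: funpow.simps)
  then have g0: "\<forall>i<M. g $ i = 0" using Suc.IH Suc.prems(1) by simp
  have d0: "fps_deriv f $ i = 0" if "i < M" for i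
  proof (cases "fps_deriv f = 0")
    case False
    have "\<Delta> \<noteq> 0" "subdegree \<Delta> = 0" using assms(1) by auto
    then have sd: "subdegree g = subdegree (fps_deriv f)" "g \<noteq> 0" unfolding g_def using False by auto
    have "M \<le> subdegree g" using subdegree_geI[OF sd(2)] g0 by blast
    then have "i < subdegree (fps_deriv f)" using sd(1) that by linarith
    then show ?thesis by (rule nth_less_subdegree_zero)
  qed simp
  show ?case
  proof (intro allI impI)
    fix i assume i: "i < Suc M"
    show "f $ i = 0"
    proof (cases i)
      case 0
      then show ?thesis using Suc.prems(2)[of 0] by simp
    next
      case (Suc i')
      have "of_nat (Suc i') * f $ Suc i' = (0::'w)" using d0[of i'] i Suc by (simp add: fps_deriv_nth)
      moreover have "of_nat (Suc i') \<noteq> (0::'w)"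
      proof
        assume "of_nat (Suc i') = (0::'w)"
        then have "CHAR('w) dvd Suc i'" by (simp only: of_nat_eq_0_iff_char_dvd)
        then have "CHAR('w) \<le> Suc i'" by (rule dvd_imp_le) simp
        then show False using i Suc Suc.prems(1) by simp
      qed
      ultimately show ?thesis using Suc by simp
    qed
  qed
qed simp

context curve begin

definition blk :: "nat \<Rightarrow> nat \<Rightarrow> nat set" where
  "blk r s = {s'\<in>{..<r * n}. s' div n = s div n \<and> s' \<noteq> s}"

definition dl :: "nat \<Rightarrow> nat \<Rightarrow> 'w br \<Rightarrow> 'w fps" where
  "dl r s y = (\<Prod>s'\<in>blk r s. snd y s - snd y s')"

text \<open>Up to sign the product of the discriminants of the \<open>r\<close> polynomials. It is
  the denominator needed to differentiate any of the roots.\<close>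

definition \<Delta> :: "nat \<Rightarrow> 'w br \<Rightarrow> 'w fps" where
  "\<Delta> r y = (\<Prod>s<r * n. dl r s y)"

text \<open>A bound for the weight gained by one application of \<Delta> d/dt. The first summand
  pays for the derivative of the coefficients of \<open>H j\<close> evaluated at a root, the second
  for the differences of roots.\<close>

definition CC :: "nat \<Rightarrow> nat" where "CC r = D * (1 + n) + r * n * (r * n * D)"

lemma gen_dl: "s < r * n \<Longrightarrow> gen (r * n) (r * n * D) (dl r s)"
proof -
  assume s: "s < r * n"
  have "gen (r * n) (\<Sum>s'\<in>blk r s. D) (dl r s)" unfolding dl_def
    by (intro gen_prod gen_diff gen_var) (use s in \<open>auto simp: blk_def\<close>)
  moreover have "card (blk r s) \<le> r * n"
    using card_mono[of "{..<r * n}" "blk r s"] unfolding blk_def by fastforce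
  then have "(\<Sum>s'\<in>blk r s. D) \<le> r * n * D" using mult_le_mono1 by simp
  ultimately show ?thesis by (rule gen_mono)
qed

text \<open>Implicit differentiation: \<open>dl r s y\<close> is the derivative of the
  \<open>j\<close>-th polynomial in its root variable, evaluated at the root number
  \<open>s\<close>.\<close>

lemma deriv_var:
  assumes "pb (r * n) y" "s < r * n"
  shows "dl r s y * fps_deriv (snd y s) = - poly (map_poly fps_deriv (Hc (fst y) (s div n))) (snd y s)"
proof -
  let ?j = "s div n"
  have j: "?j < r" using assms(2) div_less_iff by simp
  have H: "Hc (fst y) ?j = (\<Prod>i<n. [:- snd y (?j * n + i), 1:])" using assms(1) j pb_full_iff by blast
  have k: "s mod n < n" "?j * n + s mod n = s" using n_pos by auto
  have root: "poly (Hc (fst y) ?j) (snd y s) = 0" unfolding H poly_prod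
    using k by (intro prod_zero) (auto intro!: bexI[of _ "s mod n"])
  have "poly (pderiv (Hc (fst y) ?j)) (snd y s) = (\<Prod>i\<in>{..<n} - {s mod n}. snd y s - snd y (?j * n + i))"
    using pderiv_prod_linear[of "{..<n}" "s mod n" "\<lambda>i. snd y (?j * n + i)"] k unfolding H by simp
  also have "\<dots> = dl r s y" unfolding dl_def
  proof (rule prod.reindex_bij_betw)
    show "bij_betw (\<lambda>i. ?j * n + i) ({..<n} - {s mod n}) (blk r s)"
      unfolding bij_betw_def
    proof (intro conjI inj_onI equalityI subsetI)
      fix x assume "x \<in> (\<lambda>i. ?j * n + i) ` ({..<n} - {s mod n})"
      then obtain i where i: "x = ?j * n + i" "i < n" "i \<noteq> s mod n" by auto
      have "x div n = ?j" using i by simp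
      moreover have "x mod n = i" using i by simp
      then have "x \<noteq> s" using i(3) by blast
      ultimately show "x \<in> blk r s" using j div_less_iff[of x r] unfolding blk_def by simp
    next
      fix x assume "x \<in> blk r s"
      then have "x div n = ?j" "x \<noteq> s" by (auto simp: blk_def)
      then have x: "x = ?j * n + x mod n" using div_mult_mod_eq[of x n] by simp
      then have "x mod n \<noteq> s mod n" using \<open>x \<noteq> s\<close> k(2) by auto
      then show "x \<in> (\<lambda>i. ?j * n + i) ` ({..<n} - {s mod n})" using n_pos x by (intro image_eqI[of _ _ "x mod n"]) auto
    qed auto
  qed
  finally have "poly (pderiv (Hc (fst y) ?j)) (snd y s) = dl r s y" .
  then show ?thesis using fps_deriv_poly[of "Hc (fst y) ?j" "snd y s"] root
    by (simp add: eq_neg_iff_add_eq_0 add.commute)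
qed

lemma fps_deriv_bp: "fps_deriv (bp p c) = bp (pderiv p) c"
  unfolding bp_def by (simp add: fps_of_poly_pderiv[symmetric] pderiv_pcompose pderiv_pCons)

lemma gen_\<Delta>: "gen (r * n) (CC r) (\<Delta> r)"
proof -
  have "gen (r * n) (\<Sum>s<r * n. r * n * D) (\<Delta> r)" unfolding \<Delta>_def by (intro gen_prod gen_dl) auto
  then show ?thesis by (rule gen_mono) (simp add: CC_def)
qed

lemma gen_deriv:
  assumes "gen (r * n) w u"
  shows "\<exists>u'. gen (r * n) (w + CC r) u' \<and> (\<forall>y. pb (r * n) y \<longrightarrow> u' y = \<Delta> r y * fps_deriv (u y))"
  using assms
proof (induction "r * n" w u rule: gen.induct)
  case (gen_const a)
  show ?case by (rule exI[of _ "\<lambda>_. 0"]) (simp add: gen_zero)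
next
  case gen_base
  show ?case by (rule exI[of _ "\<Delta> r"]) (use gen_mono[OF gen_\<Delta>] in simp)
next
  case (gen_var s)
  let ?j = "s div n"
  define R where "R = (\<lambda>y. \<Prod>s'\<in>{..<r * n} - {s}. dl r s' y)"
  define A where "A = (\<lambda>y. \<Sum>m\<le>n. bp (pderiv (coeff (H ?j) m)) (fst y) * snd y s ^ m)"
  have "gen (r * n) (\<Sum>s'\<in>{..<r * n} - {s}. r * n * D) R" unfolding R_def by (intro gen_prod gen_dl) auto
  moreover have "(\<Sum>s'\<in>{..<r * n} - {s}. r * n * D) \<le> r * n * (r * n * D)"
    using sum_mono2[of "{..<r * n}" "{..<r * n} - {s}" "\<lambda>_. r * n * D"] by simp
  ultimately have gR: "gen (r * n) (r * n * (r * n * D)) R" using gen_mono by blast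
  have gA: "gen (r * n) (D * (1 + n)) A" unfolding A_def
  proof (rule gen_sum)
    fix m assume "m \<in> {..n}"
    then have m: "m \<le> n" by simp
    have "degree (pderiv (coeff (H ?j) m)) \<le> D" 
      using degree_coeff_H[of ?j m] by (intro degree_le) (auto simp: coeff_pderiv coeff_eq_0)
    moreover have "m * D \<le> n * D" using m by simp
    ultimately have "degree (pderiv (coeff (H ?j) m)) + m * D \<le> D + n * D" by (rule add_mono)
    then have le: "degree (pderiv (coeff (H ?j) m)) + m * D \<le> D * (1 + n)" by (simp add: distrib_left mult.commute)
    show "gen (r * n) (D * (1 + n)) (\<lambda>y. bp (pderiv (coeff (H ?j) m)) (fst y) * snd y s ^ m)"
      by (rule gen_mono[OF gen_mult[OF gen_bp gen_power[OF gen.gen_var[OF gen_var(1)]]] le])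
  qed
  have "gen (r * n) (D * (1 + n) + r * n * (r * n * D)) (\<lambda>y. - A y * R y)" by (intro gen_mult gen_neg gA gR)
  then have "gen (r * n) (D + CC r) (\<lambda>y. - A y * R y)" by (rule gen_mono) (simp add: CC_def)
  moreover have "- A y * R y = \<Delta> r y * fps_deriv (snd y s)" if y: "pb (r * n) y" for y
  proof -
    have "poly (map_poly fps_deriv (Hc (fst y) ?j)) (snd y s) = A y"
    proof -
      have "degree (map_poly fps_deriv (Hc (fst y) ?j)) \<le> n"
        by (rule degree_le) (simp add: coeff_map_poly coeff_eq_0)
      then have "poly (map_poly fps_deriv (Hc (fst y) ?j)) (snd y s) = (\<Sum>m\<le>n. coeff (map_poly fps_deriv (Hc (fst y) ?j)) m * snd y s ^ m)"
        by (rule poly_sum_bound)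
      also have "\<dots> = A y" unfolding A_def
        by (intro sum.cong refl) (simp add: coeff_map_poly coeff_Hc fps_deriv_bp[symmetric] flip: bp_def)
      finally show ?thesis .
    qed
    then have 1: "dl r s y * fps_deriv (snd y s) = - A y" using deriv_var[OF y gen_var(1)] by simp
    have "\<Delta> r y = dl r s y * R y" unfolding \<Delta>_def R_def using gen_var(1) by (intro prod.remove) auto
    then have "\<Delta> r y * fps_deriv (snd y s) = (dl r s y * fps_deriv (snd y s)) * R y" by (simp only: ac_simps)
    then show ?thesis unfolding 1 by (rule sym)
  qed
  ultimately show ?case by blast
next
  case (gen_add w u v)
  then obtain u' v' where *: "gen (r * n) (w + CC r) u'" "\<And>y. pb (r * n) y \<Longrightarrow> u' y = \<Delta> r y * fps_deriv (u y)"
    "gen (r * n) (w + CC r) v'" "\<And>y. pb (r * n) y \<Longrightarrow> v' y = \<Delta> r y * fps_deriv (v y)" by blast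
  show ?case by (rule exI[of _ "\<lambda>y. u' y + v' y"]) (use * gen.gen_add in \<open>simp add: distrib_left\<close>)
next
  case (gen_mult w u w' v)
  then obtain u' v' where *: "gen (r * n) (w + CC r) u'" "\<And>y. pb (r * n) y \<Longrightarrow> u' y = \<Delta> r y * fps_deriv (u y)"
    "gen (r * n) (w' + CC r) v'" "\<And>y. pb (r * n) y \<Longrightarrow> v' y = \<Delta> r y * fps_deriv (v y)" by blast
  have "gen (r * n) (w + w' + CC r) (\<lambda>y. u y * v' y)" "gen (r * n) (w + w' + CC r) (\<lambda>y. u' y * v y)"
    using gen.gen_mult[OF gen_mult(1) *(3)] gen.gen_mult[OF *(1) gen_mult(3)] by (simp_all add: ac_simps)
  then have "gen (r * n) (w + w' + CC r) (\<lambda>y. u y * v' y + u' y * v y)" by (rule gen.gen_add)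
  then show ?case by (intro exI[of _ "\<lambda>y. u y * v' y + u' y * v y"]) (simp add: *(2,4) algebra_simps)
next
  case (gen_mono w u w')
  then obtain u' where "gen (r * n) (w + CC r) u'" "\<And>y. pb (r * n) y \<Longrightarrow> u' y = \<Delta> r y * fps_deriv (u y)" by blast
  then show ?case using gen.gen_mono[of "r * n" "w + CC r" u' "w' + CC r"] gen_mono(3) by auto
qed

lemma gen_deriv_iter:
  assumes "gen (r * n) w u"
  shows "\<exists>u'. gen (r * n) (w + k * CC r) u' \<and> (\<forall>y. pb (r * n) y \<longrightarrow> u' y = ((\<lambda>f. \<Delta> r y * fps_deriv f) ^^ k) (u y))"
proof (induction k)
  case 0
  show ?case by (rule exI[of _ u]) (use assms in simp)
next
  case (Suc k)
  then obtain v where v: "gen (r * n) (w + k * CC r) v" "\<And>y. pb (r * n) y \<Longrightarrow> v y = ((\<lambda>f. \<Delta> r y * fps_deriv f) ^^ k) (u y)" by blast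
  obtain v' where "gen (r * n) (w + k * CC r + CC r) v'" "\<And>y. pb (r * n) y \<Longrightarrow> v' y = \<Delta> r y * fps_deriv (v y)"
    using gen_deriv[OF v(1)] by blast
  then show ?case using v(2) by (intro exI[of _ v']) (simp add: algebra_simps)
qed

lemma deriv_iter_sum:
  assumes "\<And>i. i \<in> A \<Longrightarrow> fps_deriv (h i) = 0"
  shows "((\<lambda>f. d * fps_deriv f) ^^ k) (\<Sum>i\<in>A. f i * h i) = (\<Sum>i\<in>A. ((\<lambda>f. d * fps_deriv f) ^^ k) (f i) * (h i :: 'w fps))"
proof (induction k)
  case (Suc k)
  have "((\<lambda>f. d * fps_deriv f) ^^ Suc k) (\<Sum>i\<in>A. f i * h i)
     = d * fps_deriv (\<Sum>i\<in>A. ((\<lambda>f. d * fps_deriv f) ^^ k) (f i) * h i)" using Suc by simp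
  also have "\<dots> = (\<Sum>i\<in>A. d * fps_deriv (((\<lambda>f. d * fps_deriv f) ^^ k) (f i) * h i))"
    by (simp add: fps_deriv_sum sum_distrib_left)
  also have "\<dots> = (\<Sum>i\<in>A. ((\<lambda>f. d * fps_deriv f) ^^ Suc k) (f i) * h i)"
    by (intro sum.cong refl) (simp add: assms mult.assoc)
  finally show ?case .
qed simp

text \<open>The roots are distinct at the base point itself, not only as power series, so the base
  point is unramified for the first \<open>r\<close> polynomials.\<close>

definition sep0 :: "nat \<Rightarrow> 'w br \<Rightarrow> bool" where
  "sep0 r y \<longleftrightarrow> (\<forall>j<r. inj_on (\<lambda>i. snd y (j * n + i) $ 0) {..<n})"

lemma sep0_sep: "sep0 r y \<Longrightarrow> sep r y"
  unfolding sep0_def sep_def inj_on_def by metis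

lemma sep0_tw: assumes "sep0 r y" "\<tau> \<in> G r" shows "sep0 r (tw r \<tau> y)"
  unfolding sep0_def
proof (intro allI impI inj_onI)
  fix j a b assume j: "j < r" and ab: "a \<in> {..<n}" "b \<in> {..<n}" "snd (tw r \<tau> y) (j * n + a) $ 0 = snd (tw r \<tau> y) (j * n + b) $ 0"
  then have "snd y (j * n + \<tau> j a) $ 0 = snd y (j * n + \<tau> j b) $ 0" using assms(2) by (simp add: act_block)
  then have "\<tau> j a = \<tau> j b" using assms(1) j ab G_lt[OF assms(2) j] unfolding sep0_def inj_on_def by simp
  then show "a = b" using permutes_inj[OF G_permutes[OF assms(2) j]] injD by metis
qed

lemma sep0_\<Delta>: assumes "sep0 r y" shows "\<Delta> r y $ 0 \<noteq> 0"
proof -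
  have "(snd y s - snd y s') $ 0 \<noteq> 0" if "s < r * n" "s' \<in> blk r s" for s s'
  proof
    assume eq: "(snd y s - snd y s') $ 0 = 0"
    let ?j = "s div n"
    have j: "?j < r" using that div_less_iff by simp
    have d: "s' div n = ?j" "s' \<noteq> s" using that(2) unfolding blk_def by auto
    have inj: "inj_on (\<lambda>i. snd y (?j * n + i) $ 0) {..<n}" using assms j unfolding sep0_def by blast
    have s: "?j * n + s mod n = s" by simp
    have s': "?j * n + s' mod n = s'" unfolding d(1)[symmetric] by simp
    have "snd y (?j * n + s mod n) $ 0 = snd y (?j * n + s' mod n) $ 0" unfolding s s' using eq by simp
    then have "s mod n = s' mod n" using inj_onD[OF inj, of "s mod n" "s' mod n"] n_pos by simp
    then show False using s s' d(2) by simp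
  qed
  then show ?thesis unfolding \<Delta>_def dl_def by (simp add: fps_prod_nth_0 blk_def)
qed

end

context curve begin

text \<open>There are as many basis monomials as group elements. This equality makes the leading
  constant in the Stepanov bound equal to one.\<close>

lemma card_E: "card (E (r * n)) = fact n ^ r"
proof -
  have "card (E (r * n)) = (\<Prod>i<r * n. n - i mod n)" unfolding E_def by (simp add: card_PiE)
  also have "\<dots> = (\<Prod>m<r. \<Prod>i\<in>{m * n..<m * n + n}. n - i mod n)" by (simp add: prod.nat_group)
  also have "\<dots> = (\<Prod>m<r. fact n)"
  proof (rule prod.cong)
    fix m
    have "(\<Prod>i\<in>{m * n..<m * n + n}. n - i mod n) = (\<Prod>i\<in>{0 + m * n..<n + m * n}. n - i mod n)" by (simp add: add.commute)
    also have "\<dots> = (\<Prod>i=0..<n. n - (i + m * n) mod n)" by (rule prod.shift_bounds_nat_ivl)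
    also have "\<dots> = (\<Prod>i=0..<n. n - i)" by (intro prod.cong) auto
    also have "\<dots> = fact n" using fact_prod_rev[of n, where 'a = nat] by simp
    finally show "(\<Prod>i\<in>{m * n..<m * n + n}. n - i mod n) = fact n" .
  qed simp
  finally show ?thesis by simp
qed

text \<open>The derivatives of order below \<open>M\<close> of the auxiliary function are made to
  vanish. Since \<open>q\<close>-th powers are constants for the derivation, only the factors
  \<open>f \<nu>\<close> get differentiated, and each condition keeps the shape treated by
  \<open>stepanov_core\<close>.\<close>

lemma stepanov_large_char:
  assumes q: "prime CHAR('w)" "q = CHAR('w) ^ kk" "0 < kk" and roots: "\<And>x::'w. \<exists>z. z ^ q = x"
    and cl: "Claim (r * n)" and y0: "pb (r * n) y0" "sep r y0" and \<sigma>: "\<sigma> \<in> G r"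
    and M: "M \<le> CHAR('w)"
    and l: "card (G r) * (l + emax (r * n)) < q"
    and cnt: "M * (l + emax (r * n) + M * CC r + m + emax (r * n) + 1) < card (G r) * (l + 1) * (m + 1)"
    and Z: "finite Z" "\<And>b. b \<in> Z \<Longrightarrow> pb (r * n) (Y b) \<and> fst (Y b) = b \<and> sep0 r (Y b)"
  shows "(\<Sum>b\<in>Z. card {\<tau>\<in>G r. frobbr q r \<sigma> (tw r \<tau> (Y b))}) * M
      \<le> card (G r) * (l + emax (r * n) + q * (m + emax (r * n)))"
proof -
  let ?s = "r * n"
  let ?B = "{..m} \<times> E ?s"
  obtain I f where I: "finite I" "card (E ?s) * (l + 1) \<le> card I"
    and f: "\<And>\<nu>. \<nu> \<in> I \<Longrightarrow> gen ?s (l + emax ?s) (f \<nu>) \<and> f \<nu> y0 \<noteq> 0 \<and> subdegree (f \<nu> y0) = \<nu>"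
    and I2: "\<And>\<nu>. \<nu> \<in> I \<Longrightarrow> \<nu> \<le> card (G r) * (l + emax ?s)"
    using many_orders[OF cl y0, of l] by blast
  define w1 where "w1 = l + emax ?s + M * CC r"
  have "\<forall>k \<nu>. \<exists>u. k < M \<longrightarrow> \<nu> \<in> I \<longrightarrow> gen ?s w1 u \<and>
      (\<forall>y. pb ?s y \<longrightarrow> u y = ((\<lambda>h. \<Delta> r y * fps_deriv h) ^^ k) (f \<nu> y))"
  proof (intro allI)
    fix k \<nu>
    show "\<exists>u. k < M \<longrightarrow> \<nu> \<in> I \<longrightarrow> gen ?s w1 u \<and> (\<forall>y. pb ?s y \<longrightarrow> u y = ((\<lambda>h. \<Delta> r y * fps_deriv h) ^^ k) (f \<nu> y))"
    proof (cases "k < M \<and> \<nu> \<in> I")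
      case True
      then obtain u where u: "gen ?s (l + emax ?s + k * CC r) u"
        "\<forall>y. pb ?s y \<longrightarrow> u y = ((\<lambda>h. \<Delta> r y * fps_deriv h) ^^ k) (f \<nu> y)"
        using gen_deriv_iter[of r "l + emax ?s" "f \<nu>" k] f[of \<nu>] by blast
      have "gen ?s w1 u" using u(1) by (rule gen_mono) (use True in \<open>simp add: w1_def mult_le_mono1\<close>)
      then show ?thesis using u(2) by blast
    qed auto
  qed
  then obtain \<Lambda> where \<Lambda>: "\<And>k \<nu>. k < M \<Longrightarrow> \<nu> \<in> I \<Longrightarrow> gen ?s w1 (\<Lambda> k \<nu>) \<and>
      (\<forall>y. pb ?s y \<longrightarrow> \<Lambda> k \<nu> y = ((\<lambda>h. \<Delta> r y * fps_deriv h) ^^ k) (f \<nu> y))" by metis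
  have fnz: "\<And>\<nu>. \<nu> \<in> I \<Longrightarrow> f \<nu> y0 \<noteq> 0" using f by blast
  have g\<Lambda>: "\<And>k \<nu>. k < M \<Longrightarrow> \<nu> \<in> I \<Longrightarrow> gen ?s w1 (\<Lambda> k \<nu>)" using \<Lambda> by blast
  have inj: "inj_on (\<lambda>\<nu>. subdegree (f \<nu> y0) mod q) I"
  proof (rule inj_onI)
    fix a b assume ab: "a \<in> I" "b \<in> I" "subdegree (f a y0) mod q = subdegree (f b y0) mod q"
    have "a < q" "b < q" using I2[OF ab(1)] I2[OF ab(2)] l by linarith+
    then show "a = b" using ab f by simp
  qed
  have cnt': "M * (w1 + m + emax ?s + 1) < card I * (m + 1)"
  proof -
    have "M * (w1 + m + emax ?s + 1) < card (E ?s) * (l + 1) * (m + 1)"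
      using cnt unfolding w1_def card_E card_G by (simp add: add.assoc)
    also have "\<dots> \<le> card I * (m + 1)" using I(2) by (rule mult_le_mono1)
    finally show ?thesis .
  qed
  obtain x where x: "\<And>k y. k < M \<Longrightarrow> pb ?s y \<Longrightarrow> frobbr q r \<sigma> y \<Longrightarrow>
        (\<Sum>\<nu>\<in>I. \<Sum>b\<in>?B. fps_const (x (\<nu>, b)) * \<Lambda> k \<nu> y * bas ?s b y ^ q) $ 0 = 0"
      "(\<Sum>\<nu>\<in>I. \<Sum>b\<in>?B. fps_const (x (\<nu>, b)) * f \<nu> y0 * bas ?s b y0 ^ q) \<noteq> 0"
    using stepanov_core[where \<phi> = f and \<Lambda> = \<Lambda>, OF q(1,2) roots cl y0 \<sigma> I(1) fnz inj g\<Lambda> cnt'] by blast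
  define F where "F = (\<lambda>y. \<Sum>\<nu>\<in>I. \<Sum>b\<in>?B. fps_const (x (\<nu>, b)) * f \<nu> y * bas ?s b y ^ q)"
  have gF: "gen ?s (l + emax ?s + q * (m + emax ?s)) F" unfolding F_def
  proof (intro gen_sum)
    fix \<nu> b assume "\<nu> \<in> I" "b \<in> ?B"
    then have "gen ?s (0 + (l + emax ?s) + q * (m + emax ?s)) (\<lambda>y. fps_const (x (\<nu>, b)) * f \<nu> y * bas ?s b y ^ q)"
      using f by (intro gen_mult gen_const gen_power gen_bas) auto
    then show "gen ?s (l + emax ?s + q * (m + emax ?s)) (\<lambda>y. fps_const (x (\<nu>, b)) * f \<nu> y * bas ?s b y ^ q)" by simp
  qed
  have F0: "F y0 \<noteq> 0" using x(2) unfolding F_def .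
  have nz: "F y \<noteq> 0" if "pb ?s y" for y
    using ClaimD[OF cl _ that y0(1)] gF F0 unfolding gen'_def by blast
  have ord: "M \<le> subdegree (F y)" if y: "pb ?s y" "sep0 r y" "frobbr q r \<sigma> y" for y
  proof -
    have q0: "fps_deriv (g ^ q) = 0" for g :: "'w fps"
    proof -
      have "CHAR('w) dvd q" unfolding q(2) using q(3) by (simp add: dvd_power)
      then have "of_nat q = (0 :: 'w)" by (simp add: of_nat_eq_0_iff_char_dvd)
      then have "fps_const (of_nat q) = (0 :: 'w fps)" by simp
      then show ?thesis by (simp add: fps_deriv_power)
    qed
    have h0: "fps_deriv (fps_const (x i) * bas ?s (snd i) y ^ q) = 0" for i
      by (simp only: fps_deriv_mult_const_left q0 mult_zero_right)
    have "((\<lambda>h. \<Delta> r y * fps_deriv h) ^^ k) (F y) $ 0 = 0" if k: "k < M" for k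
    proof -
      have F1: "F y = (\<Sum>i\<in>I \<times> ?B. f (fst i) y * (fps_const (x i) * bas ?s (snd i) y ^ q))"
        unfolding F_def by (simp add: sum.cartesian_product split_def ac_simps)
      have "((\<lambda>h. \<Delta> r y * fps_deriv h) ^^ k) (F y)
          = (\<Sum>i\<in>I \<times> ?B. ((\<lambda>h. \<Delta> r y * fps_deriv h) ^^ k) (f (fst i) y) * (fps_const (x i) * bas ?s (snd i) y ^ q))"
        unfolding F1 by (rule deriv_iter_sum[where d = "\<Delta> r y" and f = "\<lambda>i. f (fst i) y" and k = k and A = "I \<times> ?B"
              and h = "\<lambda>i. fps_const (x i) * bas ?s (snd i) y ^ q", OF h0])
      also have "\<dots> = (\<Sum>i\<in>I \<times> ?B. fps_const (x i) * \<Lambda> k (fst i) y * bas ?s (snd i) y ^ q)"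
      proof (intro sum.cong refl)
        fix i assume "i \<in> I \<times> ?B"
        then have "fst i \<in> I" by auto
        then have e: "((\<lambda>h. \<Delta> r y * fps_deriv h) ^^ k) (f (fst i) y) = \<Lambda> k (fst i) y"
          using \<Lambda>[OF k, of "fst i"] y(1) by metis
        show "((\<lambda>h. \<Delta> r y * fps_deriv h) ^^ k) (f (fst i) y) * (fps_const (x i) * bas ?s (snd i) y ^ q)
            = fps_const (x i) * \<Lambda> k (fst i) y * bas ?s (snd i) y ^ q"
          unfolding e by (simp only: ac_simps)
      qed
      also have "\<dots> = (\<Sum>\<nu>\<in>I. \<Sum>b\<in>?B. fps_const (x (\<nu>, b)) * \<Lambda> k \<nu> y * bas ?s b y ^ q)"
        by (simp add: sum.cartesian_product split_def)
      finally show ?thesis using x(1)[OF k y(1,3)] by simp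
    qed
    then have "\<forall>i<M. F y $ i = 0" by (rule vanish_order_deriv[OF sep0_\<Delta>[OF y(2)] M])
    then show ?thesis using subdegree_geI[OF nz[OF y(1)]] by blast
  qed
  show ?thesis
  proof (rule zeros_bound[OF cl y0 gF F0 Z(1)])
    show "pb ?s (Y b) \<and> fst (Y b) = b" if "b \<in> Z" for b using Z(2)[OF that] by blast
    show "M \<le> subdegree (F (tw r \<tau> (Y b)))" if "b \<in> Z" "\<tau> \<in> G r" "frobbr q r \<sigma> (tw r \<tau> (Y b))" for b \<tau>
      using ord[OF pb_tw sep0_tw] Z(2)[OF that(1)] that(2,3) by blast
  qed
qed

text \<open>When the characteristic is too small for derivatives, multiplicity comes from the
  Frobenius map. With \<open>f \<nu> ^ P\<close> in place of \<open>f \<nu>\<close>, and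
  \<open>P\<close> dividing \<open>q\<close>, the auxiliary function is itself a \<open>P\<close>-th
  power, so one vanishing condition already gives order \<open>P\<close>.\<close>

lemma stepanov_small_char:
  assumes q: "prime CHAR('w)" "q = CHAR('w) ^ kk" and roots: "\<And>x::'w. \<And>k. k > 0 \<Longrightarrow> \<exists>z. z ^ k = x"
    and cl: "Claim (r * n)" and y0: "pb (r * n) y0" "sep r y0" and \<sigma>: "\<sigma> \<in> G r"
    and P: "P = CHAR('w) ^ \<mu>" "\<mu> \<le> kk"
    and l: "card (G r) * (P * (l + emax (r * n))) < q"
    and cnt: "P * (l + emax (r * n)) + m + emax (r * n) + 1 < card (G r) * (l + 1) * (m + 1)"
    and Z: "finite Z" "\<And>b. b \<in> Z \<Longrightarrow> pb (r * n) (Y b) \<and> fst (Y b) = b"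
  shows "(\<Sum>b\<in>Z. card {\<tau>\<in>G r. frobbr q r \<sigma> (tw r \<tau> (Y b))}) * P
      \<le> card (G r) * (P * (l + emax (r * n)) + q * (m + emax (r * n)))"
proof -
  let ?s = "r * n"
  let ?B = "{..m} \<times> E ?s"
  have P0: "0 < P" and q0: "0 < q" using P(1) q prime_gt_0_nat by auto
  obtain I f where I: "finite I" "card (E ?s) * (l + 1) \<le> card I"
    and f: "\<And>\<nu>. \<nu> \<in> I \<Longrightarrow> gen ?s (l + emax ?s) (f \<nu>) \<and> f \<nu> y0 \<noteq> 0 \<and> subdegree (f \<nu> y0) = \<nu>"
    and I2: "\<And>\<nu>. \<nu> \<in> I \<Longrightarrow> \<nu> \<le> card (G r) * (l + emax ?s)"
    using many_orders[OF cl y0, of l] by blast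
  define w1 where "w1 = P * (l + emax ?s)"
  define \<phi> where "\<phi> = (\<lambda>\<nu> y. f \<nu> y ^ P)"
  have g\<phi>: "gen ?s w1 (\<phi> \<nu>)" if "\<nu> \<in> I" for \<nu>
    unfolding w1_def \<phi>_def using f[OF that] by (intro gen_power) auto
  have fnz: "\<And>\<nu>. \<nu> \<in> I \<Longrightarrow> \<phi> \<nu> y0 \<noteq> 0" using f unfolding \<phi>_def by simp
  have inj: "inj_on (\<lambda>\<nu>. subdegree (\<phi> \<nu> y0) mod q) I"
  proof (rule inj_onI)
    fix a b assume ab: "a \<in> I" "b \<in> I" "subdegree (\<phi> a y0) mod q = subdegree (\<phi> b y0) mod q"
    have lt: "P * \<nu> < q" if "\<nu> \<in> I" for \<nu>
    proof -
      have "P * \<nu> \<le> P * (card (G r) * (l + emax ?s))" using I2[OF that] by (rule mult_le_mono2)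
      also have "\<dots> = card (G r) * (P * (l + emax ?s))" by (simp only: ac_simps)
      finally show ?thesis using l by linarith
    qed
    have "subdegree (\<phi> \<nu> y0) = P * \<nu>" if "\<nu> \<in> I" for \<nu> using f[OF that] unfolding \<phi>_def by simp
    then have "P * a = P * b" using ab lt by simp
    then show "a = b" using P0 by simp
  qed
  have cnt': "1 * (w1 + m + emax ?s + 1) < card I * (m + 1)"
  proof -
    have "1 * (w1 + m + emax ?s + 1) < card (E ?s) * (l + 1) * (m + 1)"
      using cnt unfolding w1_def card_E card_G by (simp add: add.assoc)
    also have "\<dots> \<le> card I * (m + 1)" using I(2) by (rule mult_le_mono1)
    finally show ?thesis .
  qed
  obtain x where x: "\<And>k y. k < (1::nat) \<Longrightarrow> pb ?s y \<Longrightarrow> frobbr q r \<sigma> y \<Longrightarrow>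
        (\<Sum>\<nu>\<in>I. \<Sum>b\<in>?B. fps_const (x (\<nu>, b)) * \<phi> \<nu> y * bas ?s b y ^ q) $ 0 = 0"
      "(\<Sum>\<nu>\<in>I. \<Sum>b\<in>?B. fps_const (x (\<nu>, b)) * \<phi> \<nu> y0 * bas ?s b y0 ^ q) \<noteq> 0"
    using stepanov_core[where \<phi> = \<phi> and \<Lambda> = "\<lambda>_. \<phi>", OF q(1,2) roots[OF q0] cl y0 \<sigma> I(1) fnz inj g\<phi> cnt'] by blast
  define F where "F = (\<lambda>y. \<Sum>\<nu>\<in>I. \<Sum>b\<in>?B. fps_const (x (\<nu>, b)) * \<phi> \<nu> y * bas ?s b y ^ q)"
  have gF: "gen ?s (w1 + q * (m + emax ?s)) F" unfolding F_def
  proof (intro gen_sum)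
    fix \<nu> b assume "\<nu> \<in> I" "b \<in> ?B"
    then have "gen ?s (0 + w1 + q * (m + emax ?s)) (\<lambda>y. fps_const (x (\<nu>, b)) * \<phi> \<nu> y * bas ?s b y ^ q)"
      using g\<phi> by (intro gen_mult gen_const gen_power gen_bas) auto
    then show "gen ?s (w1 + q * (m + emax ?s)) (\<lambda>y. fps_const (x (\<nu>, b)) * \<phi> \<nu> y * bas ?s b y ^ q)" by simp
  qed
  have F0: "F y0 \<noteq> 0" using x(2) unfolding F_def .
  have nz: "F y \<noteq> 0" if "pb ?s y" for y
    using ClaimD[OF cl _ that y0(1)] gF F0 unfolding gen'_def by blast
  have ord: "P \<le> subdegree (F y)" if y: "pb ?s y" "frobbr q r \<sigma> y" for y
  proof -
    define \<rho> where "\<rho> = (\<lambda>i. SOME z. z ^ P = x i)"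
    have \<rho>: "\<rho> i ^ P = x i" for i unfolding \<rho>_def by (rule someI_ex[OF roots[OF P0]])
    have "q = CHAR('w) ^ (kk - \<mu>) * P" unfolding q(2) P(1) using P(2) by (simp add: power_add[symmetric])
    then obtain q' where q': "q = q' * P" by blast
    have pF: "prime CHAR('w fps)" using q(1) by (simp add: CHAR_fps)
    have frob_sum: "(\<Sum>i\<in>A. g i :: 'w fps) ^ P = (\<Sum>i\<in>A. g i ^ P)" for A :: "(nat \<times> nat \<times> (nat \<Rightarrow> nat)) set" and g
      using freshmans_dream_sum'[OF pF, of P \<mu> g A] P(1) by (simp add: CHAR_fps)
    define g where "g = (\<Sum>i\<in>I \<times> ?B. fps_const (\<rho> i) * f (fst i) y * bas ?s (snd i) y ^ q')"
    have "F y = (\<Sum>i\<in>I \<times> ?B. (fps_const (\<rho> i) * f (fst i) y * bas ?s (snd i) y ^ q') ^ P)"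
      unfolding F_def \<phi>_def q' by (simp add: sum.cartesian_product split_def power_mult_distrib fps_const_power \<rho> power_mult)
    then have FP: "F y = g ^ P" unfolding g_def frob_sum .
    have "(g $ 0) ^ P = 0" using x(1)[of 0, OF _ y] FP fps_power_nth_0[of g P] unfolding F_def by simp
    then have "g $ 0 = 0" by simp
    moreover have "g \<noteq> 0" using nz[OF y(1)] FP P0 by (auto simp: zero_power)
    ultimately have "1 \<le> subdegree g" by (metis less_one not_le nth_subdegree_nonzero)
    then show ?thesis unfolding FP by simp
  qed
  show ?thesis
  proof (rule zeros_bound[OF cl y0 gF[unfolded w1_def] F0 Z(1)])
    show "pb ?s (Y b) \<and> fst (Y b) = b" if "b \<in> Z" for b using Z(2)[OF that] by blast
    show "P \<le> subdegree (F (tw r \<tau> (Y b)))" if "b \<in> Z" "\<tau> \<in> G r" "frobbr q r \<sigma> (tw r \<tau> (Y b))" for b \<tau>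
      using ord[OF pb_tw] Z(2)[OF that(1)] that(2,3) by blast
  qed
qed

end

text \<open>The sum of all the lower bounds for \<open>q\<close> met in
  \<open>stepanov_bound\<close>. \<open>N\<close> is the group order, \<open>e0\<close> the bound
  for the weight of a basis monomial, \<open>C\<close> the cost of one differentiation, and
  \<open>P1\<close> bounds the power of the characteristic chosen when the characteristic is
  small.\<close>

definition stepanov_threshold :: "nat \<Rightarrow> nat \<Rightarrow> nat \<Rightarrow> nat \<Rightarrow> nat" where
  "stepanov_threshold n D r M0 = (let N = fact n ^ r; e0 = D * (r * n * n); C = D * (1 + n) + r * n * (r * n * D); P1 = (N * M0)\<^sup>2
     in N * e0 + N * M0 * (2 * e0 + N * M0 * C + M0) + N * P1 * (2 * e0 + P1 * e0 + P1 + 2) + P1 + 2)"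

context curve begin

text \<open>Pairs of a point and a relabelling with Frobenius \<sigma> number at most
  \<open>q\<close> up to a relative error of order \<open>1 / M0\<close>. The required multiplicity
  \<open>N * M0\<close> is reached by derivatives if the characteristic allows, and otherwise by a
  power of the characteristic.\<close>

theorem stepanov_bound:
  assumes q: "prime CHAR('w)" "q = CHAR('w) ^ kk" "0 < kk" and roots: "\<And>x::'w. \<And>k. k > 0 \<Longrightarrow> \<exists>z. z ^ k = x"
    and cl: "Claim (r * n)" and \<sigma>: "\<sigma> \<in> G r"
    and M0: "0 < M0" and thr: "stepanov_threshold n D r M0 \<le> q"
    and Z: "finite Z" "\<And>b. b \<in> Z \<Longrightarrow> pb (r * n) (Y b) \<and> fst (Y b) = b \<and> sep0 r (Y b)"
  shows "(\<Sum>b\<in>Z. card {\<tau>\<in>G r. frobbr q r \<sigma> (tw r \<tau> (Y b))}) * M0 \<le> q * (M0 + 1 + D * (r * n * n))"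
proof (cases "Z = {}")
  case False
  then obtain b0 where b0: "b0 \<in> Z" by blast
  define y0 where "y0 = Y b0"
  have y0: "pb (r * n) y0" "sep r y0" using Z(2)[OF b0] sep0_sep unfolding y0_def by auto
  define N where "N = card (G r)"
  define e0 where "e0 = emax (r * n)"
  define S where "S = (\<Sum>b\<in>Z. card {\<tau>\<in>G r. frobbr q r \<sigma> (tw r \<tau> (Y b))})"
  have N: "N = fact n ^ r" "0 < N" unfolding N_def card_G by simp_all
  have e0: "e0 = D * (r * n * n)" unfolding e0_def emax_def by simp
  define P1 where "P1 = (N * M0)\<^sup>2"
  have thr': "N * e0 + N * M0 * (2 * e0 + N * M0 * CC r + M0) + N * P1 * (2 * e0 + P1 * e0 + P1 + 2) + P1 + 2 \<le> q"
    using thr unfolding stepanov_threshold_def Let_def P1_def N(1) e0 CC_def .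
  have "\<exists>M. N * M0 \<le> M \<and> S * M \<le> q * (1 + M + N * e0)"
  proof (cases "N * M0 \<le> CHAR('w)")
    case True
    \<comment> \<open>The largest degree for which all orders at \<open>y0\<close> stay below
      \<open>q\<close>, which makes them distinct modulo \<open>q\<close>.\<close>
    define l where "l = (q - 1) div N - e0"
    have "e0 * N \<le> q - 1" using thr' by (simp add: mult.commute[of e0])
    then have le: "e0 \<le> (q - 1) div N" by (simp only: less_eq_div_iff_mult_less_eq[OF N(2)])
    then have l: "l + e0 = (q - 1) div N" unfolding l_def by simp
    have "N * (l + e0) \<le> q - 1" unfolding l by (rule times_div_less_eq_dividend)
    then have l1: "N * (l + e0) < q" using thr' by linarith
    have l2: "q \<le> N * (l + 1) + N * e0"
    proof -
      have "q - 1 < N * ((q - 1) div N) + N" using dividend_less_times_div[OF N(2), of "q - 1"] by linarith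
      then have "q \<le> N * ((q - 1) div N) + N" by linarith
      then show ?thesis unfolding l[symmetric] by (simp add: algebra_simps)
    qed
    \<comment> \<open>With multiplicity \<open>N * M0\<close> and \<open>m = M0\<close> the main
      terms are \<open>N * M0 * (l + 1)\<close> equations against
      \<open>N * (M0 + 1) * (l + 1)\<close> unknowns; the surplus \<open>N * (l + 1)\<close> absorbs
      everything that does not grow with \<open>l\<close>.\<close>
    have cnt: "N * M0 * (l + e0 + N * M0 * CC r + M0 + e0 + 1) < N * (l + 1) * (M0 + 1)"
    proof -
      have "N * M0 * (2 * e0 + N * M0 * CC r + M0) < N * (l + 1)" using thr' l2 by linarith
      then show ?thesis by (simp add: algebra_simps)
    qed
    have "S * (N * M0) \<le> N * (l + e0 + q * (M0 + e0))"
      unfolding S_def N_def e0_def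
      by (rule stepanov_large_char[OF q roots[of q] cl y0 \<sigma> True[unfolded N_def] l1[unfolded N_def e0_def] cnt[unfolded N_def e0_def] Z])
        (use thr' in simp)
    also have "\<dots> = N * (l + e0) + q * (N * M0 + N * e0)" by (simp add: algebra_simps)
    also have "\<dots> \<le> q * (1 + N * M0 + N * e0)" using l1 by (simp add: algebra_simps)
    finally show ?thesis by blast
  next
    case False
    let ?p = "CHAR('w)"
    have p2: "2 \<le> ?p" using q(1) prime_ge_2_nat by blast
    \<comment> \<open>The least exponent whose power reaches \<open>N * M0\<close>. The previous
      power and the characteristic itself are both below \<open>N * M0\<close>, so this power is at
      most \<open>(N * M0)\<^sup>2\<close>, independently of \<open>q\<close>.\<close>
    define \<mu> where "\<mu> = (LEAST k. N * M0 \<le> ?p ^ k)"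
    define P where "P = ?p ^ \<mu>"
    have ex: "\<exists>k. N * M0 \<le> ?p ^ k"
    proof
      have "N * M0 < 2 ^ (N * M0)" by (rule less_exp)
      also have "\<dots> \<le> ?p ^ (N * M0)" using p2 by (rule power_mono) simp
      finally show "N * M0 \<le> ?p ^ (N * M0)" by simp
    qed
    have PM: "N * M0 \<le> P" unfolding P_def \<mu>_def using ex by (rule LeastI_ex)
    have \<mu>0: "\<mu> \<noteq> 0"
    proof
      assume "\<mu> = 0"
      then have "N * M0 \<le> 1" using PM unfolding P_def by simp
      then show False using False p2 by simp
    qed
    have "\<not> N * M0 \<le> ?p ^ (\<mu> - 1)" unfolding \<mu>_def by (rule not_less_Least) (use \<mu>0 \<mu>_def in simp)
    then have "?p ^ (\<mu> - 1) * ?p \<le> (N * M0) * (N * M0)" using False by (intro mult_le_mono) auto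
    then have PP1: "P \<le> P1" unfolding P_def P1_def power2_eq_square using \<mu>0 by (simp add: power_eq_if mult.commute)
    have "\<mu> \<le> kk"
    proof (rule ccontr)
      assume "\<not> \<mu> \<le> kk"
      then have "q < P" unfolding q(2) P_def using p2 by (simp add: power_strict_increasing)
      then show False using PP1 thr' by linarith
    qed
    have P0: "0 < P" using PM N(2) M0 by (metis less_le_trans nat_0_less_mult_iff)
    \<comment> \<open>Rounding \<open>P / N\<close> down keeps the cost \<open>N * m\<close> within
      \<open>P\<close>, while \<open>N * (m + 1)\<close> still exceeds \<open>P\<close>, which
      leaves unknowns to spare.\<close>
    define m where "m = P div N"
    have m1: "N * m \<le> P" unfolding m_def by simp
    have m2: "P + 1 \<le> N * (m + 1)" unfolding m_def using dividend_less_times_div[OF N(2), of P] by simp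
    have mP: "m \<le> P" unfolding m_def by simp
    define l where "l = (q - 1) div (N * P) - e0"
    have NP: "0 < N * P" using N(2) P0 by simp
    have big: "N * P * (2 * e0 + P * e0 + P + 1) \<le> q - 1"
    proof -
      have "N * P * (2 * e0 + P * e0 + P + 1) \<le> N * P1 * (2 * e0 + P1 * e0 + P1 + 2)"
        using PP1 by (intro mult_le_mono add_mono) auto
      then show ?thesis using thr' by linarith
    qed
    then have div: "2 * e0 + P * e0 + P + 1 \<le> (q - 1) div (N * P)"
      using NP by (simp add: less_eq_div_iff_mult_less_eq mult.commute)
    then have l: "l + e0 = (q - 1) div (N * P)" and lbig: "e0 + P * e0 + P + 1 \<le> l" unfolding l_def by auto
    have "N * P * (l + e0) \<le> q - 1" unfolding l by (rule times_div_less_eq_dividend)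
    then have "N * (P * (l + e0)) \<le> q - 1" by (simp only: mult.assoc)
    then have l1: "N * (P * (l + e0)) < q" using thr' by linarith
    have cnt: "P * (l + e0) + m + e0 + 1 < N * (l + 1) * (m + 1)"
    proof -
      have "P * (l + e0) + m + e0 + 1 < (P + 1) * (l + 1)" using lbig mP by (simp add: algebra_simps)
      also have "\<dots> \<le> N * (m + 1) * (l + 1)" using m2 by (rule mult_le_mono1)
      finally show ?thesis by (simp only: ac_simps)
    qed
    have "S * P \<le> N * (P * (l + e0) + q * (m + e0))"
      unfolding S_def N_def e0_def
      by (rule stepanov_small_char[OF q(1,2) roots cl y0 \<sigma> P_def \<open>\<mu> \<le> kk\<close> l1[unfolded N_def e0_def] cnt[unfolded N_def e0_def] Z(1)])
        (use Z(2) in auto)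
    also have "\<dots> = N * (P * (l + e0)) + q * (N * m) + q * (N * e0)" by (simp add: algebra_simps)
    also have "\<dots> \<le> q + q * P + q * (N * e0)" using l1 m1 by (intro add_mono mult_le_mono) auto
    finally have "S * P \<le> q * (1 + P + N * e0)" by (simp add: algebra_simps)
    then show ?thesis using PM by blast
  qed
  then obtain M where M: "N * M0 \<le> M" "S * M \<le> q * (1 + M + N * e0)" by blast
  have "S * M0 \<le> q * (M0 + 1 + e0)"
  proof (cases "S \<le> q")
    case True
    then have "S * M0 \<le> q * M0" by (rule mult_le_mono1)
    also have "\<dots> \<le> q * (M0 + 1 + e0)" by (rule mult_le_mono2) simp
    finally show ?thesis .
  next
    case False
    \<comment> \<open>The inequality is spent on the excess of \<open>S\<close> over
      \<open>q\<close> only; in this way the main term keeps the constant one although merely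
      \<open>N * M0 \<le> M\<close> is known.\<close>
    then obtain d where d: "S = q + d" using le_Suc_ex nat_le_linear by blast
    have "N * (d * M0) = d * (N * M0)" by simp
    also have "\<dots> \<le> d * M" using M(1) by (rule mult_le_mono2)
    also have "\<dots> \<le> q * (1 + N * e0)" using M(2) unfolding d by (simp add: algebra_simps)
    also have "\<dots> \<le> N * (q * (1 + e0))"
    proof -
      have "q \<le> N * q" using N(2) by simp
      then show ?thesis by (simp add: algebra_simps)
    qed
    finally have "d * M0 \<le> q * (1 + e0)" using N(2) by simp
    then show ?thesis unfolding d by (simp add: algebra_simps)
  qed
  then show ?thesis unfolding S_def e0 .
qed simp

end

section \<open>Hensel lifting and the construction of branches\<close>

lemma poly_add_expand:
  fixes P :: "'a::idom poly"
  shows "\<exists>R. poly P (x + h) = poly P x + h * poly (pderiv P) x + h\<^sup>2 * R"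
proof (induction P)
  case (pCons a P)
  then obtain R where R: "poly P (x + h) = poly P x + h * poly (pderiv P) x + h\<^sup>2 * R" by blast
  have "poly (pCons a P) (x + h) = a + (x + h) * (poly P x + h * poly (pderiv P) x + h\<^sup>2 * R)" by (simp add: R)
  also have "\<dots> = (a + x * poly P x) + h * (poly P x + x * poly (pderiv P) x) + h\<^sup>2 * (poly (pderiv P) x + x * R + h * R)"
    by (simp add: algebra_simps power2_eq_square)
  finally show ?case by (intro exI[of _ "poly (pderiv P) x + x * R + h * R"]) (simp add: pderiv_pCons algebra_simps)
qed simp

lemma poly_fps_nth_0: "poly (P :: 'w::field fps poly) z $ 0 = poly (map_poly (\<lambda>p. p $ 0) P) (z $ 0)"
  by (induction P) (auto simp: map_poly_pCons)

lemma map_poly_nth0_mult: "map_poly (\<lambda>p. p $ 0) (p * q) = map_poly (\<lambda>p. p $ 0) p * map_poly (\<lambda>p. p $ 0) (q :: 'w::field fps poly)"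
  by (rule poly_eqI) (simp add: coeff_map_poly coeff_mult fps_sum_nth)

lemma map_poly_nth0_prod: "map_poly (\<lambda>p. p $ 0) (\<Prod>i\<in>A. f i) = (\<Prod>i\<in>A. map_poly (\<lambda>p. p $ 0) (f i :: 'w::field fps poly))"
  by (induction A rule: infinite_finite_induct) (auto simp: map_poly_nth0_mult)

lemma pderiv_map_nth0: "pderiv (map_poly (\<lambda>p. p $ 0) P) = map_poly (\<lambda>p. p $ 0) (pderiv (P :: 'w::field fps poly))"
proof (rule poly_eqI)
  fix k show "coeff (pderiv (map_poly (\<lambda>p. p $ 0) P)) k = coeff (map_poly (\<lambda>p. p $ 0) (pderiv P)) k"
    by (simp add: coeff_map_poly coeff_pderiv flip: fps_of_nat)
qed

text \<open>One coefficient is corrected at a time: a change at order \<open>Suc m\<close> enters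
  that coefficient of the value linearly, through the nonzero constant term of the derivative, and
  leaves the earlier ones alone.\<close>

lemma hensel_fps:
  fixes P :: "'w::field fps poly"
  assumes root: "poly (map_poly (\<lambda>p. p $ 0) P) x0 = 0"
    and simple: "poly (pderiv (map_poly (\<lambda>p. p $ 0) P)) x0 \<noteq> 0"
  obtains z where "z $ 0 = x0" "poly P z = 0"
proof -
  define Q where "Q = (\<lambda>m z. z $ 0 = x0 \<and> (\<forall>i\<le>m. poly P z $ i = 0))"
  have "\<exists>f. \<forall>m. Q m (f m) \<and> (\<forall>i\<le>m. f (Suc m) $ i = f m $ i)"
  proof (rule dependent_nat_choice)
    show "\<exists>z. Q 0 z" by (rule exI[of _ "fps_const x0"]) (use root in \<open>simp add: Q_def poly_fps_nth_0\<close>)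
  next
    fix z m assume z: "Q m z"
    define d where "d = poly (pderiv P) z $ 0"
    have d: "d \<noteq> 0" using simple z unfolding d_def Q_def by (simp add: poly_fps_nth_0 pderiv_map_nth0)
    define a where "a = - (poly P z $ Suc m) / d"
    define h where "h = fps_const a * fps_X ^ Suc m"
    obtain R where R: "poly P (z + h) = poly P z + h * poly (pderiv P) z + h\<^sup>2 * R" using poly_add_expand by blast
    have h2: "(h\<^sup>2 * R) $ i = 0" if "i \<le> Suc m" for i
    proof -
      have "h\<^sup>2 * R = fps_X ^ (Suc m + Suc m) * (fps_const (a * a) * R)"
        unfolding h_def power2_eq_square power_add by (simp add: ac_simps flip: fps_const_mult)
      then show ?thesis using that by (simp only: fps_X_power_mult_nth) simp
    qed
    have h1: "(h * poly (pderiv P) z) $ i = (if i = Suc m then a * d else 0)" if "i \<le> Suc m" for i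
    proof -
      have "h * poly (pderiv P) z = fps_X ^ Suc m * (fps_const a * poly (pderiv P) z)" unfolding h_def by (simp only: ac_simps)
      then show ?thesis using that unfolding d_def by (simp only: fps_X_power_mult_nth) auto
    qed
    have hi: "h $ i = 0" if "i \<le> m" for i
      unfolding h_def using that by (simp only: fps_mult_left_const_nth fps_X_power_nth) simp
    have "Q (Suc m) (z + h)" unfolding Q_def
    proof (intro conjI allI impI)
      show "(z + h) $ 0 = x0" using z hi[of 0] by (simp add: Q_def)
      fix i assume i: "i \<le> Suc m"
      show "poly P (z + h) $ i = 0"
        using z i h1[OF i] h2[OF i] d unfolding R Q_def by (cases "i = Suc m") (auto simp: a_def)
    qed
    then show "\<exists>z'. Q (Suc m) z' \<and> (\<forall>i\<le>m. z' $ i = z $ i)" using hi by (intro exI[of _ "z + h"]) simp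
  qed
  then obtain f where f: "\<And>m. Q m (f m)" "\<And>m i. i \<le> m \<Longrightarrow> f (Suc m) $ i = f m $ i" by blast
  have stable: "f (m + k) $ i = f m $ i" if "i \<le> m" for m k i
    using that by (induction k) (auto simp: f(2))
  define z where "z = Abs_fps (\<lambda>i. f i $ i)"
  have zi: "z $ i = f m $ i" if "i \<le> m" for i m
    using stable[of i i "m - i"] that by (simp add: z_def)
  have "poly P z $ m = 0" for m
  proof -
    have "(z - f m) $ i = 0" if "i < Suc m" for i using zi[of i m] that by simp
    then obtain h where h: "z - f m = fps_X ^ Suc m * h"
    proof -
      have "z - f m = fps_X ^ Suc m * fps_shift (Suc m) (z - f m)"
      proof (rule fps_ext)
        fix i show "(z - f m) $ i = (fps_X ^ Suc m * fps_shift (Suc m) (z - f m)) $ i"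
          using \<open>\<And>i. i < Suc m \<Longrightarrow> (z - f m) $ i = 0\<close>[of i] by (simp only: fps_X_power_mult_nth fps_shift_nth) auto
      qed
      then show ?thesis using that by blast
    qed
    define d where "d = z - f m"
    obtain R where "poly P (f m + d) = poly P (f m) + d * poly (pderiv P) (f m) + d\<^sup>2 * R"
      using poly_add_expand by blast
    then have "poly P z = poly P (f m) + d * (poly (pderiv P) (f m) + d * R)"
      by (simp add: d_def power2_eq_square distrib_left mult.assoc add.assoc)
    also have "d * (poly (pderiv P) (f m) + d * R) = fps_X ^ Suc m * (h * (poly (pderiv P) (f m) + d * R))"
      unfolding mult.assoc[symmetric] h[folded d_def, symmetric] ..
    finally show ?thesis using f(1)[of m] unfolding Q_def by (simp add: fps_X_power_mult_nth del: power_Suc)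
  qed
  then have "poly P z = 0" by (intro fps_ext) simp
  moreover have "z $ 0 = x0" using f(1)[of 0] by (simp add: z_def Q_def)
  ultimately show ?thesis using that by blast
qed

lemma prod_distinct_roots_dvd:
  fixes p :: "'a::idom poly"
  assumes "finite A" "inj_on f A" "\<And>i. i \<in> A \<Longrightarrow> poly p (f i) = 0"
  shows "(\<Prod>i\<in>A. [:- f i, 1:]) dvd p"
  using assms
proof (induction A arbitrary: p rule: finite_induct)
  case (insert a A)
  have "[:- f a, 1:] dvd p" using insert.prems(2)[of a] unfolding poly_eq_0_iff_dvd by simp
  then obtain q where q: "p = [:- f a, 1:] * q" by (elim dvdE)
  have "poly q (f i) = 0" if "i \<in> A" for i
  proof -
    have "f i \<noteq> f a" using insert.prems(1) insert.hyps that unfolding inj_on_def by blast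
    then show ?thesis using insert.prems(2)[of i] that unfolding q by simp
  qed
  then have "(\<Prod>i\<in>A. [:- f i, 1:]) dvd q" using insert.IH[of q] insert.prems(1) by simp
  then have "[:- f a, 1:] * (\<Prod>i\<in>A. [:- f i, 1:]) dvd p" unfolding q by (rule mult_dvd_mono[OF dvd_refl])
  then show ?case unfolding prod.insert[OF insert.hyps] .
qed simp

lemma simple_root_prod:
  fixes f :: "nat \<Rightarrow> 'a::idom"
  assumes "inj_on f A" "finite A" "k \<in> A" "poly u (f k) \<noteq> 0"
  shows "poly (pderiv (u * (\<Prod>i\<in>A. [:- f i, 1:]))) (f k) \<noteq> 0"
proof -
  have "poly (\<Prod>i\<in>A. [:- f i, 1:]) (f k) = 0" using assms(2,3) by (auto simp: poly_prod)
  then have "poly (pderiv (u * (\<Prod>i\<in>A. [:- f i, 1:]))) (f k) = poly u (f k) * (\<Prod>i\<in>A - {k}. f k - f i)"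
    using pderiv_prod_linear[OF assms(2,3), of f] by (simp add: pderiv_mult)
  moreover have "(\<Prod>i\<in>A - {k}. f k - f i) \<noteq> 0" using assms(1-3) by (auto simp: inj_on_def)
  ultimately show ?thesis using assms(4) by simp
qed

context curve begin

definition Hev :: "'w \<Rightarrow> nat \<Rightarrow> 'w poly" where
  "Hev c j = map_poly (\<lambda>p. poly p c) (H j)"

lemma bp_nth_0: "bp p c $ 0 = poly p c"
  unfolding bp_def by (simp add: poly_pcompose flip: poly_0_coeff_0)

lemma Hc_nth0: "map_poly (\<lambda>p. p $ 0) (Hc c j) = Hev c j"
  by (rule poly_eqI) (simp add: coeff_map_poly coeff_Hc Hev_def bp_nth_0 flip: bp_def)

definition splits :: "'w \<Rightarrow> nat \<Rightarrow> bool" where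
  "splits c j \<longleftrightarrow> (\<exists>x. inj_on x {..<n} \<and> Hev c j = (\<Prod>i<n. [:- x i, 1:]))"

lemma lift_root:
  fixes k i :: nat
  assumes "Hev c j = u * (\<Prod>i<k. [:- x i, 1:])" "inj_on x {..<k}" "i < k" "poly u (x i) \<noteq> 0"
  shows "\<exists>z. z $ 0 = x i \<and> poly (Hc c j) z = 0"
proof -
  have "poly (\<Prod>i<k. [:- x i, 1:]) (x i) = 0" unfolding poly_prod
    by (rule prod_zero) (use assms(3) in \<open>auto intro!: bexI[of _ i]\<close>)
  then have "poly (Hev c j) (x i) = 0" unfolding assms(1) by simp
  moreover have "poly (pderiv (Hev c j)) (x i) \<noteq> 0"
    unfolding assms(1) using assms by (intro simple_root_prod) auto
  ultimately show ?thesis using hensel_fps[of "Hc c j" "x i"] unfolding Hc_nth0 by metis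
qed

lemma lift_roots:
  fixes k :: nat
  assumes "Hev c j = u * (\<Prod>i<k. [:- x i, 1:])" "inj_on x {..<k}" "\<And>i. i < k \<Longrightarrow> poly u (x i) \<noteq> 0"
  obtains z where "\<And>i. i < k \<Longrightarrow> z i $ 0 = x i" "(\<Prod>i<k. [:- z i, 1:]) dvd Hc c j"
proof -
  have "\<forall>i. \<exists>z. i < k \<longrightarrow> z $ 0 = x i \<and> poly (Hc c j) z = 0" using lift_root[OF assms(1,2) _ assms(3)] by blast
  then obtain z where z: "\<And>i. i < k \<Longrightarrow> z i $ 0 = x i \<and> poly (Hc c j) (z i) = 0" by metis
  have "inj_on z {..<k}"
  proof (rule inj_onI)
    fix a b assume "a \<in> {..<k}" "b \<in> {..<k}" "z a = z b"
    then have "x a = x b" using z by (metis lessThan_iff)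
    then show "a = b" using assms(2) \<open>a \<in> {..<k}\<close> \<open>b \<in> {..<k}\<close> by (meson inj_onD)
  qed
  then have "(\<Prod>i<k. [:- z i, 1:]) dvd Hc c j" by (rule prod_distinct_roots_dvd[OF finite_lessThan]) (use z in auto)
  then show ?thesis using that z by blast
qed

text \<open>Above a base point where the \<open>r\<close> fibres have distinct roots, every
  labelling of these roots lifts to a branch.\<close>

lemma full_branch_of_roots:
  assumes "\<And>j. j < r \<Longrightarrow> inj_on (\<lambda>i. x (j * n + i)) {..<n} \<and> Hev c j = (\<Prod>i<n. [:- x (j * n + i), 1:])"
  obtains y where "fst y = c" "pb (r * n) y" "sep0 r y" "\<And>s. s < r * n \<Longrightarrow> snd y s $ 0 = x s"
proof -
  have "\<forall>j. \<exists>z. j < r \<longrightarrow> (\<forall>i<n. z i $ 0 = x (j * n + i)) \<and> (\<Prod>i<n. [:- z i, 1:]) dvd Hc c j"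
  proof
    fix j
    show "\<exists>z. j < r \<longrightarrow> (\<forall>i<n. z i $ 0 = x (j * n + i)) \<and> (\<Prod>i<n. [:- z i, 1:]) dvd Hc c j"
    proof (cases "j < r")
      case True
      then show ?thesis using assms[OF True] lift_roots[where u = 1 and k = n and x = "\<lambda>i. x (j * n + i)" and c = c and j = j]
        by (metis mult_1 poly_1 one_neq_zero)
    qed simp
  qed
  then obtain z where z: "\<And>j i. j < r \<Longrightarrow> i < n \<Longrightarrow> z j i $ 0 = x (j * n + i)"
     "\<And>j. j < r \<Longrightarrow> (\<Prod>i<n. [:- z j i, 1:]) dvd Hc c j" by metis
  define y where "y = (c, \<lambda>s. z (s div n) (s mod n))"
  have yz: "snd y (j * n + i) = z j i" if "i < n" for j i using that by (simp add: y_def)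
  have "pb (r * n) y" unfolding pb_def
  proof
    fix j
    show "(\<Prod>i<min n (r * n - j * n). [:- snd y (j * n + i), 1:]) dvd Hc (fst y) j"
    proof (cases "j < r")
      case True
      have "(\<Prod>i<min n (r * n - j * n). [:- snd y (j * n + i), 1:]) dvd (\<Prod>i<n. [:- snd y (j * n + i), 1:])"
        by (rule prod_dvd_prod_subset) auto
      also have "(\<Prod>i<n. [:- snd y (j * n + i), 1:]) = (\<Prod>i<n. [:- z j i, 1:])" by (intro prod.cong) (auto simp: yz)
      also have "\<dots> dvd Hc (fst y) j" using z(2)[OF True] by (simp add: y_def)
      finally show ?thesis .
    qed simp
  qed
  moreover have xs: "snd y s $ 0 = x s" if "s < r * n" for s
  proof -
    have "s div n < r" using that div_less_iff by simp
    then show ?thesis using z(1)[of "s div n" "s mod n"] n_pos by (simp add: y_def)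
  qed
  moreover have "sep0 r y" unfolding sep0_def
  proof (intro allI impI)
    fix j assume j: "j < r"
    have "snd y (j * n + i) $ 0 = x (j * n + i)" if "i < n" for i using z(1)[OF j that] yz[OF that] by simp
    then have "inj_on (\<lambda>i. snd y (j * n + i) $ 0) {..<n} = inj_on (\<lambda>i. x (j * n + i)) {..<n}"
      by (intro inj_on_cong) simp
    then show "inj_on (\<lambda>i. snd y (j * n + i) $ 0) {..<n}" using assms[OF j] by simp
  qed
  ultimately show ?thesis using that[of y] by (simp add: y_def)
qed

text \<open>The earlier polynomials split with distinct roots at the node, so their roots lift. In
  block \<open>j\<close> only the \<open>i\<close> simple roots are lifted; dividing them out leaves
  a residual polynomial whose reduction is the pure power. Its value at \<open>x\<close> has no
  constant term, so the linear term of \<open>Hc c j\<close> at \<open>x\<close> is the one of the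
  residual polynomial times a constant.\<close>

lemma special_branch:
  assumes i: "i < n" and low: "\<And>j'. j' < j \<Longrightarrow> splits c j'"
    and H: "Hev c j = [:-x, 1:] ^ (n - i) * (\<Prod>k<i. [:- v k, 1:])" "inj_on v {..<i}" "x \<notin> v ` {..<i}"
    and d: "poly (Hc c j) (fps_const x) $ 1 \<noteq> 0"
  shows "\<exists>\<kappa>. pb (j * n + i) \<kappa> \<and> sep j \<kappa> \<and> eis i j \<kappa>"
proof -
  obtain xr where xr: "\<And>j'. j' < j \<Longrightarrow> inj_on (xr j') {..<n} \<and> Hev c j' = (\<Prod>i<n. [:- xr j' i, 1:])"
    using low unfolding splits_def by metis
  obtain y where y: "fst y = c" "pb (j * n) y" "sep0 j y"
  proof (rule full_branch_of_roots[of j "\<lambda>s. xr (s div n) (s mod n)" c])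
    fix j' assume j': "j' < j"
    have eq: "xr ((j' * n + i) div n) ((j' * n + i) mod n) = xr j' i" if "i < n" for i using that by simp
    show "inj_on (\<lambda>i. xr ((j' * n + i) div n) ((j' * n + i) mod n)) {..<n} \<and> Hev c j' = (\<Prod>i<n. [:- xr ((j' * n + i) div n) ((j' * n + i) mod n), 1:])"
    proof
      have "inj_on (\<lambda>i. xr ((j' * n + i) div n) ((j' * n + i) mod n)) {..<n} = inj_on (xr j') {..<n}"
        by (rule inj_on_cong) (simp add: eq)
      then show "inj_on (\<lambda>i. xr ((j' * n + i) div n) ((j' * n + i) mod n)) {..<n}" using xr[OF j'] by blast
      have "(\<Prod>i<n. [:- xr j' i, 1:]) = (\<Prod>i<n. [:- xr ((j' * n + i) div n) ((j' * n + i) mod n), 1:])"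
        by (rule prod.cong) (simp_all add: eq)
      then show "Hev c j' = (\<Prod>i<n. [:- xr ((j' * n + i) div n) ((j' * n + i) mod n), 1:])" using xr[OF j'] by simp
    qed
  qed blast
  obtain z where z: "\<And>k. k < i \<Longrightarrow> z k $ 0 = v k" "(\<Prod>k<i. [:- z k, 1:]) dvd Hc c j"
  proof (rule lift_roots[OF H(1,2)])
    fix k assume "k < i"
    then show "poly ([:-x, 1:] ^ (n - i)) (v k) \<noteq> 0" using H(3) by auto
  qed blast
  define \<kappa> where "\<kappa> = (c, \<lambda>s. if s < j * n then snd y s else z (s - j * n))"
  have k1: "snd \<kappa> (j * n + k) = z k" for k by (simp add: \<kappa>_def)
  have k2: "snd \<kappa> (j' * n + k) = snd y (j' * n + k)" if "j' < j" "k < n" for j' k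
  proof -
    have "j' * n + k < j * n" using div_less_iff[of "j' * n + k" j] that by simp
    then show ?thesis by (simp add: \<kappa>_def)
  qed
  have pb: "pb (j * n + i) \<kappa>" unfolding pb_def
  proof
    fix j'
    consider "j' < j" | "j' = j" | "j < j'" by linarith
    then show "(\<Prod>k<min n (j * n + i - j' * n). [:- snd \<kappa> (j' * n + k), 1:]) dvd Hc (fst \<kappa>) j'"
    proof cases
      case 1
      have "(\<Prod>k<min n (j * n + i - j' * n). [:- snd \<kappa> (j' * n + k), 1:]) dvd (\<Prod>k<n. [:- snd \<kappa> (j' * n + k), 1:])"
        by (rule prod_dvd_prod_subset) auto
      also have "(\<Prod>k<n. [:- snd \<kappa> (j' * n + k), 1:]) = (\<Prod>k<n. [:- snd y (j' * n + k), 1:])"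
        using k2[OF 1] by (intro prod.cong) auto
      also have "\<dots> = Hc (fst \<kappa>) j'" using y 1 unfolding pb_full_iff by (simp add: \<kappa>_def)
      finally show ?thesis .
    next
      case 2
      then show ?thesis using z(2) i k1 by (simp add: \<kappa>_def)
    next
      case 3
      then have "Suc j * n \<le> j' * n" by (intro mult_le_mono1) simp
      then have "j * n + i \<le> j' * n" using i by simp
      then show ?thesis by simp
    qed
  qed
  have "sep j \<kappa>" unfolding sep_def
  proof (intro allI impI)
    fix j' assume j': "j' < j"
    have "inj_on (\<lambda>k. snd \<kappa> (j' * n + k)) {..<n} = inj_on (\<lambda>k. snd y (j' * n + k)) {..<n}"
      using k2[OF j'] by (intro inj_on_cong) simp
    then show "inj_on (\<lambda>k. snd \<kappa> (j' * n + k)) {..<n}" using sep0_sep[OF y(3)] j' unfolding sep_def by simp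
  qed
  moreover have "eis i j \<kappa>"
  proof -
    let ?Z = "\<Prod>k<i. [:- z k, 1:]"
    have fac: "Hc c j = ?Z * RS j i \<kappa>" using pb_factor[OF pb] i k1 by (simp add: \<kappa>_def)
    have "map_poly (\<lambda>p. p $ 0) ?Z = (\<Prod>k<i. [:- v k, 1:])"
      unfolding map_poly_nth0_prod using z(1) by (intro prod.cong) (auto simp: map_poly_pCons)
    then have "(\<Prod>k<i. [:- v k, 1:]) * map_poly (\<lambda>p. p $ 0) (RS j i \<kappa>) = (\<Prod>k<i. [:- v k, 1:]) * [:-x, 1:] ^ (n - i)"
      using Hc_nth0[of c j] unfolding fac map_poly_nth0_mult H(1) by (simp only: mult.commute)
    moreover have "(\<Prod>k<i. [:- v k, 1:]) \<noteq> 0" by simp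
    ultimately have m0: "map_poly (\<lambda>p. p $ 0) (RS j i \<kappa>) = [:-x, 1:] ^ (n - i)" using mult_left_cancel by blast
    have "poly (RS j i \<kappa>) (fps_const x) $ 0 = 0" unfolding poly_fps_nth_0 m0 using i by (simp add: zero_power)
    then have "poly (Hc c j) (fps_const x) $ 1 = poly ?Z (fps_const x) $ 0 * poly (RS j i \<kappa>) (fps_const x) $ 1"
      unfolding fac by (simp add: fps_mult_nth)
    then show ?thesis unfolding eis_def using m0 d by auto
  qed
  ultimately show ?thesis using pb by blast
qed

lemma special_point_0:
  assumes "Hev c j = [:-x, 1:] ^ n" "poly (Hc c j) (fps_const x) $ 1 \<noteq> 0"
  shows "\<exists>\<kappa>. eis 0 j \<kappa>"
  unfolding eis_def using assms Hc_nth0[of c j] by (intro exI[of _ "(c, \<lambda>_. 0)"] exI[of _ x]) simp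

end

section \<open>Squarefree fibres and the choice of special polynomials\<close>

lemma monic_splits:
  fixes p :: "'w::alg_closed_field poly"
  assumes "coeff p n = 1" "degree p = n"
  shows "\<exists>x. p = (\<Prod>i<n. [:- x i, 1:])"
  using assms
proof (induction n arbitrary: p)
  case 0
  then obtain c where "p = [:c:]" using degree_eq_zeroE by blast
  then show ?case using 0 by (simp add: one_pCons)
next
  case (Suc n)
  then obtain z where "poly p z = 0" using alg_closed_imp_poly_has_root[of p] by auto
  then obtain q where q: "p = [:- z, 1:] * q" unfolding poly_eq_0_iff_dvd by (elim dvdE)
  have p0: "p \<noteq> 0" using Suc.prems by auto
  then have q0: "q \<noteq> 0" using q by auto
  have dq: "degree q = n" using Suc.prems q q0 degree_mult_eq[of "[:- z, 1:]" q] by simp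
  have "coeff q n = 1" using Suc.prems(1) coeff_eq_0[of q "Suc n"] dq unfolding q by simp
  then obtain x where x: "q = (\<Prod>i<n. [:- x i, 1:])" using Suc.IH dq by blast
  have "(\<Prod>i<n. [:- (x(n := z)) i, 1:]) = (\<Prod>i<n. [:- x i, 1:])" by (intro prod.cong) auto
  then have "p = (\<Prod>i<Suc n. [:- (x(n := z)) i, 1:])" unfolding q x by (simp add: mult.commute del: mult_pCons_left mult_pCons_right)
  then show ?case by blast
qed

text \<open>Double roots are looked for in the coefficient field only, so this expresses
  squarefreeness over an algebraically closed field. Polynomials over a finite field are therefore
  tested through \<open>ac_poly\<close>.\<close>

definition sqf :: "'w::field poly \<Rightarrow> bool" where
  "sqf p \<longleftrightarrow> (\<forall>z. poly p z = 0 \<longrightarrow> poly (pderiv p) z \<noteq> 0)"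

lemma sqf_inj:
  fixes x :: "nat \<Rightarrow> 'w::field"
  assumes "sqf (\<Prod>i<n. [:- x i, 1:])" shows "inj_on x {..<n}"
proof (rule inj_onI)
  fix a b assume ab: "a \<in> {..<n}" "b \<in> {..<n}" "x a = x b"
  have "poly (\<Prod>i<n. [:- x i, 1:]) (x a) = 0" unfolding poly_prod
    by (rule prod_zero) (use ab(1) in \<open>auto intro!: bexI[of _ a]\<close>)
  then have "poly (pderiv (\<Prod>i<n. [:- x i, 1:])) (x a) \<noteq> 0" using assms unfolding sqf_def by blast
  then have "(\<Prod>i\<in>{..<n} - {a}. x a - x i) \<noteq> 0"
    unfolding pderiv_prod_linear[OF finite_lessThan ab(1)] .
  then have "x a - x b \<noteq> 0" if "b \<noteq> a" using that ab(2) by (simp add: prod_zero_iff)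
  then show "a = b" using ab(3) by auto
qed

lemma sqf_splits:
  fixes p :: "'w::alg_closed_field poly"
  assumes "coeff p n = 1" "degree p = n" "sqf p"
  shows "\<exists>x. inj_on x {..<n} \<and> p = (\<Prod>i<n. [:- x i, 1:])"
  using monic_splits[OF assms(1,2)] assms(3) sqf_inj by blast

lemma degree_pderiv_less: "degree (pderiv (p :: 'w::field poly)) \<le> degree p - 1"
  by (rule degree_le) (auto simp: coeff_pderiv coeff_eq_0)

text \<open>A double root \<open>z\<close> of \<open>u * (T - y) + c\<close> is a critical point of
  \<open>T + c / u\<close> with critical value \<open>y\<close>. The numerator \<open>W\<close> of
  the derivative has degree \<open>2 * (n - 1)\<close> and leading coefficient 1 in every
  characteristic, so there are few critical values.\<close>

lemma few_nonsquarefree_shifts: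
  fixes u c :: "'w::field poly"
  assumes n: "2 \<le> n" and u: "coeff u (n - 1) = 1" "degree u = n - 1" and c: "degree c < n"
    and cop: "\<And>z. poly u z = 0 \<Longrightarrow> poly c z \<noteq> 0"
  shows "finite {y. \<not> sqf (u * [:-y, 1:] + c)} \<and> card {y. \<not> sqf (u * [:-y, 1:] + c)} \<le> 2 * n"
proof -
  define W where "W = u * u + pderiv c * u - pderiv u * c"
  have d1: "degree (pderiv c * u) < 2 * (n - 1)"
    using degree_mult_le[of "pderiv c" u] degree_pderiv_less[of c] u(2) c n by linarith
  have d2: "degree (pderiv u * c) < 2 * (n - 1)"
    using degree_mult_le[of "pderiv u" c] degree_pderiv_less[of u] u(2) c n by linarith
  have "coeff (u * u) ((n - 1) + (n - 1)) = 1" using coeff_mult_degree_sum[of u u] u by simp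
  then have cW: "coeff W (2 * (n - 1)) = 1" unfolding W_def using coeff_eq_0[OF d1] coeff_eq_0[OF d2] by (simp add: mult_2)
  then have W0: "W \<noteq> 0" by auto
  have "degree W \<le> 2 * (n - 1)" unfolding W_def
    by (intro degree_diff_le degree_add_le) (use d1 d2 degree_mult_le[of u u] u in auto)
  then have cardW: "card {z. poly W z = 0} \<le> 2 * n" using card_poly_roots_bound[OF W0] n by linarith
  have "{y. \<not> sqf (u * [:-y, 1:] + c)} \<subseteq> (\<lambda>z. z + poly c z / poly u z) ` {z. poly W z = 0}"
  proof
    fix y assume "y \<in> {y. \<not> sqf (u * [:-y, 1:] + c)}"
    then obtain z where z: "poly (u * [:-y, 1:] + c) z = 0" "poly (pderiv (u * [:-y, 1:] + c)) z = 0"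
      unfolding sqf_def by blast
    have e1: "poly u z * (z - y) = - poly c z" using z(1) by (simp add: eq_neg_iff_add_eq_0 algebra_simps)
    have e2: "poly (pderiv u) z * (z - y) + poly u z + poly (pderiv c) z = 0"
      using z(2) by (simp add: pderiv_add pderiv_mult pderiv_pCons algebra_simps del: mult_pCons_left mult_pCons_right)
    have "poly W z = poly u z * (poly (pderiv u) z * (z - y) + poly u z + poly (pderiv c) z)
        - poly (pderiv u) z * (poly u z * (z - y) + poly c z)"
      unfolding W_def by (simp add: algebra_simps)
    also have "\<dots> = 0" unfolding e1 e2 by simp
    finally have "poly W z = 0" .
    moreover have "poly u z \<noteq> 0" using e1 cop[of z] by auto
    then have "y = z + poly c z / poly u z" using e1 by (simp add: field_simps)
    ultimately show "y \<in> (\<lambda>z. z + poly c z / poly u z) ` {z. poly W z = 0}" by blast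
  qed
  moreover have "finite {z. poly W z = 0}" by (rule poly_roots_finite[OF W0])
  ultimately show ?thesis using cardW by (meson card_image_le card_mono finite_imageI finite_subset le_trans)
qed

abbreviation ac_poly :: "'k::field poly \<Rightarrow> 'k alg_closure poly" where "ac_poly \<equiv> map_poly to_ac"

lemma coeff_ac_poly [simp]: "coeff (ac_poly p) i = to_ac (coeff p i)"
  by (simp add: coeff_map_poly)

lemma degree_ac_poly [simp]: "degree (ac_poly p) = degree p"
  by (rule degree_map_poly) simp

lemma ac_poly_add: "ac_poly (p + q) = ac_poly p + ac_poly q"
  by (rule poly_eqI) simp

lemma ac_poly_mult: "ac_poly (p * q) = ac_poly p * ac_poly q"
  by (rule poly_eqI) (simp add: coeff_mult to_ac_sum)

lemma ac_poly_power: "ac_poly (p ^ k) = ac_poly p ^ k"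
  by (induction k) (auto simp: ac_poly_mult)

lemma ac_poly_prod: "ac_poly (\<Prod>i\<in>A. f i) = (\<Prod>i\<in>A. ac_poly (f i))"
  by (induction A rule: infinite_finite_induct) (auto simp: ac_poly_mult)

lemma ac_poly_sum: "ac_poly (\<Sum>i\<in>A. f i) = (\<Sum>i\<in>A. ac_poly (f i))"
  by (induction A rule: infinite_finite_induct) (auto simp: ac_poly_add)

lemma ac_poly_linear: "ac_poly [:a, b:] = [:to_ac a, to_ac b:]"
  by (simp add: map_poly_pCons)

lemma poly_ac_poly: "poly (ac_poly p) (to_ac x) = to_ac (poly p x)"
  by (induction p) (auto simp: map_poly_pCons)

lemma pderiv_ac_poly: "pderiv (ac_poly p) = ac_poly (pderiv p)"
  by (rule poly_eqI) (simp add: coeff_pderiv)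

lemma ac_poly_eq_iff: "ac_poly p = ac_poly q \<longleftrightarrow> p = q"
  by (metis coeff_ac_poly poly_eqI to_ac_eq_iff)

text \<open>All roots but one are placed where no member of \<open>A\<close> vanishes, so that their
  product \<open>u\<close> is coprime to each \<open>c\<close>; the last simple root
  \<open>y\<close> is then moved until all the sums are squarefree. For \<open>i = 0\<close> there
  would be no root left to move.\<close>

lemma special_poly_exists:
  fixes A :: "'k::field poly set"
  assumes n: "3 \<le> n" and i: "1 \<le> i" "i \<le> n - 2" and A: "finite A" "card A \<le> r"
    "\<And>c. c \<in> A \<Longrightarrow> c \<noteq> 0 \<and> degree c < n"
    and fin: "finite (UNIV :: 'k set)" and q: "2 * r * n + n < card (UNIV :: 'k set)"
  shows "\<exists>(x::'k) v. inj_on v {..<i} \<and> x \<notin> v ` {..<i} \<and>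
     (\<forall>c\<in>A. sqf (ac_poly ([:-x, 1:] ^ (n - i) * (\<Prod>k<i. [:- v k, 1:]) + c)))"
proof -
  define Fb where "Fb = (\<Union>c\<in>A. {z. poly c z = 0})"
  have "card Fb \<le> (\<Sum>c\<in>A. card {z. poly c z = 0})" unfolding Fb_def by (rule card_UN_le[OF A(1)])
  also have "\<dots> \<le> (\<Sum>c\<in>A. n)"
  proof (rule sum_mono)
    fix c assume "c \<in> A"
    then show "card {z. poly c z = 0} \<le> n" using A(3)[of c] card_poly_roots_bound[of c] by fastforce
  qed
  also have "\<dots> \<le> r * n" using A(2) by simp
  finally have Fb: "card Fb \<le> r * n" .
  have finF: "finite Fb" by (rule finite_subset[OF subset_UNIV fin])
  have "card (UNIV - Fb) \<ge> card (UNIV :: 'k set) - r * n" using Fb finF by (simp add: card_Diff_subset)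
  then have "i \<le> card (UNIV - Fb)" using q i by linarith
  then obtain W where W: "W \<subseteq> UNIV - Fb" "card W = i" "finite W" by (meson obtain_subset_with_card_n)
  obtain h where "bij_betw h {0..<i} W" using ex_bij_betw_nat_finite[OF W(3)] W(2) by blast
  then have hW: "inj_on h {..<i}" "h ` {..<i} = W" by (simp_all add: bij_betw_def lessThan_atLeast0)
  have h: "inj_on h {..<i}" "\<And>k. k < i \<Longrightarrow> h k \<notin> Fb" using hW W(1) by blast+
  define x where "x = h 0"
  define u where "u = [:-x, 1:] ^ (n - i) * (\<Prod>k<i - 1. [:- h (Suc k), 1:])"
  have du: "degree u = n - 1"
  proof -
    have "degree u = degree ([:-x, 1:] ^ (n - i)) + degree (\<Prod>k<i - 1. [:- h (Suc k), 1:])"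
      unfolding u_def by (rule degree_mult_eq) auto
    also have "degree ([:-x, 1:] ^ (n - i)) = n - i" by (simp add: degree_power_eq)
    also have "degree (\<Prod>k<i - 1. [:- h (Suc k), 1:]) = i - 1" by (subst degree_prod_eq_sum_degree) auto
    finally show ?thesis using i n by simp
  qed
  have lu: "coeff u (n - 1) = 1"
  proof -
    have "lead_coeff u = 1" unfolding u_def by (simp add: lead_coeff_mult lead_coeff_power lead_coeff_prod)
    then show ?thesis using du by simp
  qed
  have roots_u: "\<exists>k<i. z = to_ac (h k)" if "poly (ac_poly u) z = 0" for z
  proof -
    have "z = to_ac x \<or> (\<exists>k<i - 1. z = to_ac (h (Suc k)))"
      using that unfolding u_def by (auto simp: ac_poly_mult ac_poly_power ac_poly_prod ac_poly_linear poly_prod)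
    then show ?thesis
    proof
      assume "z = to_ac x"
      then show ?thesis using i unfolding x_def by (intro exI[of _ 0]) simp
    next
      assume "\<exists>k<i - 1. z = to_ac (h (Suc k))"
      then obtain k where "k < i - 1" "z = to_ac (h (Suc k))" by blast
      then show ?thesis using i by (intro exI[of _ "Suc k"]) simp
    qed
  qed
  define Bd where "Bd = (\<lambda>c. {y. \<not> sqf (ac_poly u * [:-y, 1:] + ac_poly c)})"
  have Bd: "finite (Bd c) \<and> card (Bd c) \<le> 2 * n" if c: "c \<in> A" for c
    unfolding Bd_def
  proof (rule few_nonsquarefree_shifts)
    show "degree (ac_poly c) < n" using A(3)[OF c] by simp
    fix z assume "poly (ac_poly u) z = 0"
    then obtain k where k: "k < i" "z = to_ac (h k)" using roots_u by blast
    then have "poly c (h k) \<noteq> 0" using h(2)[OF k(1)] c unfolding Fb_def by blast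
    then show "poly (ac_poly c) z \<noteq> 0" unfolding k(2) poly_ac_poly by simp
  qed (use n du lu in auto)
  define By where "By = h ` {..<i} \<union> (\<Union>c\<in>A. {y. to_ac y \<in> Bd c})"
  have "card (\<Union>c\<in>A. {y. to_ac y \<in> Bd c}) \<le> (\<Sum>c\<in>A. card {y. to_ac y \<in> Bd c})" by (rule card_UN_le[OF A(1)])
  also have "\<dots> \<le> (\<Sum>c\<in>A. 2 * n)"
  proof (rule sum_mono)
    fix c assume c: "c \<in> A"
    have "card {y. to_ac y \<in> Bd c} = card (to_ac ` {y. to_ac y \<in> Bd c})"
      by (rule card_image[symmetric]) (auto intro: inj_onI)
    also have "\<dots> \<le> card (Bd c)" by (rule card_mono) (use Bd[OF c] in auto)
    finally show "card {y. to_ac y \<in> Bd c} \<le> 2 * n" using Bd[OF c] by simp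
  qed
  also have "\<dots> \<le> r * (2 * n)" using A(2) by simp
  finally have "card (\<Union>c\<in>A. {y. to_ac y \<in> Bd c}) \<le> r * (2 * n)" .
  moreover have "card (h ` {..<i}) \<le> i" using card_image_le[of "{..<i}" h] by simp
  ultimately have "card By \<le> i + r * (2 * n)" unfolding By_def using card_Un_le[of "h ` {..<i}" "\<Union>c\<in>A. {y. to_ac y \<in> Bd c}"] by linarith
  moreover have "r * (2 * n) = 2 * r * n" by simp
  ultimately have "card By < card (UNIV :: 'k set)" using q i by linarith
  then obtain y where y: "y \<notin> By" using UNIV_eq_I[of By] by fastforce
  define v where "v = (\<lambda>k. if k < i - 1 then h (Suc k) else y)"
  have prod: "[:-x, 1:] ^ (n - i) * (\<Prod>k<i. [:- v k, 1:]) = u * [:-y, 1:]"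
  proof -
    have "(\<Prod>k<i. [:- v k, 1:]) = (\<Prod>k<Suc (i - 1). [:- v k, 1:])" using i by simp
    also have "\<dots> = (\<Prod>k<i - 1. [:- v k, 1:]) * [:- y, 1:]" by (simp add: v_def del: mult_pCons_left mult_pCons_right)
    also have "(\<Prod>k<i - 1. [:- v k, 1:]) = (\<Prod>k<i - 1. [:- h (Suc k), 1:])" by (intro prod.cong) (auto simp: v_def)
    finally show ?thesis unfolding u_def by (simp only: mult.assoc)
  qed
  have yh: "y \<noteq> h k" if "k < i" for k using y that unfolding By_def by blast
  have "inj_on v {..<i}"
  proof (rule inj_onI)
    fix a b assume ab: "a \<in> {..<i}" "b \<in> {..<i}" "v a = v b"
    consider "a < i - 1" "b < i - 1" | "a < i - 1" "b = i - 1" | "a = i - 1" "b < i - 1" | "a = b"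
      using ab(1,2) by force
    then show "a = b"
    proof cases
      case 1
      then have "h (Suc a) = h (Suc b)" "Suc a < i" "Suc b < i" using ab(3) by (auto simp: v_def)
      then have "Suc a = Suc b" using inj_onD[OF h(1), of "Suc a" "Suc b"] by simp
      then show ?thesis by simp
    next
      case 2
      then have "Suc a < i" "h (Suc a) = y" using ab(3) by (auto simp: v_def)
      then show ?thesis using yh[of "Suc a"] by simp
    next
      case 3
      then have "Suc b < i" "y = h (Suc b)" using ab(3) by (auto simp: v_def)
      then show ?thesis using yh[of "Suc b"] by simp
    qed
  qed
  moreover have "x \<notin> v ` {..<i}"
  proof
    assume "x \<in> v ` {..<i}"
    then obtain k where k: "k < i" "h 0 = v k" unfolding x_def by auto
    show False
    proof (cases "k < i - 1")
      case True
      then have "h 0 = h (Suc k)" "Suc k < i" using k by (auto simp: v_def)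
      then have "0 = Suc k" using inj_onD[OF h(1), of 0 "Suc k"] i by simp
      then show False by simp
    next
      case False
      then show False using k yh[of 0] i by (simp add: v_def)
    qed
  qed
  moreover have "sqf (ac_poly ([:-x, 1:] ^ (n - i) * (\<Prod>k<i. [:- v k, 1:]) + c))" if "c \<in> A" for c
  proof -
    have "sqf (ac_poly u * [:- to_ac y, 1:] + ac_poly c)" using y that unfolding By_def Bd_def by blast
    then show ?thesis unfolding prod ac_poly_add ac_poly_mult ac_poly_linear by (simp only: to_ac_minus to_ac_1)
  qed
  ultimately show ?thesis by blast
qed

section \<open>The Frobenius map on the roots\<close>

lemma finite_field_power_card:
  fixes x :: "'k::field" assumes fin: "finite (UNIV :: 'k set)"
  shows "x ^ card (UNIV :: 'k set) = x"
proof (cases "x = 0")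
  case True
  then show ?thesis using fin by (simp add: zero_power finite_UNIV_card_ge_0)
next
  case False
  let ?U = "UNIV - {0::'k}"
  have "bij_betw (\<lambda>y. x * y) ?U ?U"
    by (rule bij_betwI[of _ _ _ "\<lambda>y. y / x"]) (use False in auto)
  then have "(\<Prod>y\<in>?U. x * y) = (\<Prod>y\<in>?U. y)" by (rule prod.reindex_bij_betw)
  then have "x ^ card ?U * (\<Prod>y\<in>?U. y) = (\<Prod>y\<in>?U. y)" by (simp add: prod.distrib)
  moreover have "(\<Prod>y\<in>?U. y) \<noteq> 0" using fin by (simp add: prod_zero_iff)
  ultimately have 1: "x ^ card ?U = 1" by simp
  have "x ^ Suc (card ?U) = x" unfolding power_Suc 1 by simp
  then show ?thesis unfolding card_Suc_Diff1[OF fin UNIV_I, of 0] .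
qed

text \<open>The equation \<open>z ^ q = z\<close> has at most \<open>q\<close> solutions, and the
  elements of the finite field already provide \<open>q\<close> of them.\<close>

lemma fixed_iff_range_to_ac:
  fixes z :: "'k::field alg_closure" assumes fin: "finite (UNIV :: 'k set)"
  shows "z ^ card (UNIV :: 'k set) = z \<longleftrightarrow> z \<in> range to_ac"
proof -
  let ?q = "card (UNIV :: 'k set)"
  define p where "p = monom (1::'k alg_closure) ?q - monom 1 1"
  have "card {0::'k, 1} \<le> ?q" by (rule card_mono[OF fin]) simp
  then have q1: "1 < ?q" by simp
  have "coeff p ?q = 1" using q1 unfolding p_def by simp
  then have p0: "p \<noteq> 0" by auto
  have roots: "{z. poly p z = 0} = {z. z ^ ?q = z}" unfolding p_def by (auto simp: poly_monom)
  have "degree p \<le> ?q" unfolding p_def using q1 by (intro degree_diff_le) (auto intro: order_trans[OF degree_monom_le])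
  then have c: "card {z::'k alg_closure. z ^ ?q = z} \<le> ?q" using card_poly_roots_bound[OF p0] roots by simp
  have sub: "range (to_ac :: 'k \<Rightarrow> _) \<subseteq> {z. z ^ ?q = z}" by (auto simp: finite_field_power_card[OF fin] simp flip: to_ac_power)
  have "card (range (to_ac :: 'k \<Rightarrow> _)) = ?q" by (simp add: card_image inj_to_ac)
  then have le: "card {z::'k alg_closure. z ^ ?q = z} \<le> card (range (to_ac :: 'k \<Rightarrow> _))" using c by simp
  have "finite {z::'k alg_closure. z ^ ?q = z}" using poly_roots_finite[OF p0] roots by simp
  from card_seteq[OF this sub le] have "range (to_ac :: 'k \<Rightarrow> _) = {z. z ^ ?q = z}" .
  then show ?thesis by blast
qed

text \<open>Translation by one permutes the field; comparing the sums over all elements shows that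
  \<open>q\<close> is zero in the field, so the characteristic is the prime of which
  \<open>q\<close> is a power.\<close>

lemma primepow_card_CHAR:
  assumes fin: "finite (UNIV :: 'k::field set)" and pp: "primepow (card (UNIV :: 'k set))"
  obtains kk where "prime CHAR('k)" "card (UNIV :: 'k set) = CHAR('k) ^ kk" "0 < kk"
proof -
  have "CHAR('k) > 0" using fin finite_imp_CHAR_pos by blast
  then have pr: "prime CHAR('k)" by (rule prime_CHAR_semidom)
  obtain p k where pk: "prime p" "0 < k" "card (UNIV :: 'k set) = p ^ k" using pp unfolding primepow_def by blast
  have "of_nat (card (UNIV :: 'k set)) = (0 :: 'k)"
  proof -
    have "bij_betw (\<lambda>y::'k. y + 1) UNIV UNIV" by (rule bij_betwI[of _ _ _ "\<lambda>y. y - 1"]) auto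
    then have "(\<Sum>y\<in>(UNIV::'k set). y + 1) = (\<Sum>y\<in>UNIV. y)" by (rule sum.reindex_bij_betw)
    then show ?thesis by (simp add: sum.distrib)
  qed
  then have "CHAR('k) dvd p ^ k" unfolding pk(3) of_nat_eq_0_iff_char_dvd .
  then have "CHAR('k) = p" using pr pk(1) by (metis prime_dvd_power primes_dvd_imp_eq)
  then show ?thesis using that pr pk by blast
qed

text \<open>The set \<open>curve.G\<close>, restated so that it is available without a
  curve.\<close>

definition Gset :: "nat \<Rightarrow> nat \<Rightarrow> (nat \<Rightarrow> nat \<Rightarrow> nat) set" where
  "Gset n r = PiE {..<r} (\<lambda>_. {p. p permutes {..<n}})"

text \<open>\<open>x\<close> labels the roots of all shifts of \<open>f\<close>, and \<sigma>
  records how Frobenius acts in this labelling. Another labelling conjugates \<sigma>, so its cycle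
  counts depend on \<open>f\<close> and the shifts only.\<close>

definition lab :: "nat \<Rightarrow> nat \<Rightarrow> (nat \<Rightarrow> 'k::field poly) \<Rightarrow> 'k poly \<Rightarrow> (nat \<Rightarrow> nat \<Rightarrow> 'k alg_closure) \<Rightarrow> (nat \<Rightarrow> nat \<Rightarrow> nat) \<Rightarrow> bool" where
  "lab n r a f x \<sigma> \<longleftrightarrow> (\<forall>j<r. inj_on (x j) {..<n} \<and> ac_poly (f + a j) = (\<Prod>i<n. [:- x j i, 1:]) \<and>
      (\<forall>i<n. x j i ^ card (UNIV :: 'k set) = x j (\<sigma> j i)))"

lemma ac_poly_frob:
  fixes p :: "'k::field poly"
  assumes fin: "finite (UNIV :: 'k set)" and pp: "primepow (card (UNIV :: 'k set))"
  shows "poly (ac_poly p) (z ^ card (UNIV :: 'k set)) = poly (ac_poly p) z ^ card (UNIV :: 'k set)"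
proof -
  let ?q = "card (UNIV :: 'k set)"
  obtain kk where q: "prime CHAR('k)" "?q = CHAR('k) ^ kk" using primepow_card_CHAR[OF fin pp] by blast
  have q0: "0 < ?q" using fin by (simp add: finite_UNIV_card_ge_0)
  have add: "(a + b) ^ ?q = a ^ ?q + b ^ ?q" for a b :: "'k alg_closure"
    by (rule freshmans_dream'[of ?q kk]) (use q in simp_all)
  show ?thesis
  proof (induction p)
    case 0
    then show ?case using q0 by (simp add: zero_power)
  next
    case (pCons c p)
    have "to_ac c ^ ?q = to_ac c" using finite_field_power_card[OF fin, of c] by (simp flip: to_ac_power)
    then show ?case using pCons.IH by (simp add: map_poly_pCons add power_mult_distrib)
  qed
qed

lemma lab_exists:
  fixes f :: "'k::field poly"
  assumes fin: "finite (UNIV :: 'k set)" and pp: "primepow (card (UNIV :: 'k set))"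
    and x: "\<And>j. j < r \<Longrightarrow> inj_on (x j) {..<n} \<and> ac_poly (f + a j) = (\<Prod>i<n. [:- x j i, 1:])"
  shows "\<exists>\<sigma>\<in>Gset n r. lab n r a f x \<sigma>"
proof -
  let ?q = "card (UNIV :: 'k set)"
  obtain kk where q: "prime CHAR('k)" "?q = CHAR('k) ^ kk" using primepow_card_CHAR[OF fin pp] by blast
  have q0: "0 < ?q" using fin by (simp add: finite_UNIV_card_ge_0)
  have add: "(a + b) ^ ?q = a ^ ?q + b ^ ?q" for a b :: "'k alg_closure"
    by (rule freshmans_dream'[of ?q kk]) (use q in simp_all)
  have inj: "u = v" if "u ^ ?q = v ^ ?q" for u v :: "'k alg_closure"
  proof -
    have "u ^ ?q = (u - v) ^ ?q + v ^ ?q" using add[of "u - v" v] by simp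
    then have "(u - v) ^ ?q = 0" using that by simp
    then show ?thesis using q0 by simp
  qed
  have "\<exists>s. s permutes {..<n} \<and> (\<forall>i<n. x j i ^ ?q = x j (s i))" if j: "j < r" for j
  proof -
    have root: "poly (ac_poly (f + a j)) z = 0 \<longleftrightarrow> z \<in> x j ` {..<n}" for z
      using x[OF j] by (auto simp: poly_prod)
    have "x j i ^ ?q \<in> x j ` {..<n}" if "i < n" for i
    proof -
      have "poly (ac_poly (f + a j)) (x j i) = 0" using root that by blast
      then have "poly (ac_poly (f + a j)) (x j i ^ ?q) = 0" unfolding ac_poly_frob[OF fin pp] using q0 by (simp add: zero_power)
      then show ?thesis using root by blast
    qed
    then have "\<forall>i. \<exists>k. i < n \<longrightarrow> k < n \<and> x j i ^ ?q = x j k" by blast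
    then obtain s0 where s0: "\<And>i. i < n \<Longrightarrow> s0 i < n \<and> x j i ^ ?q = x j (s0 i)" by metis
    define s where "s = (\<lambda>i. if i < n then s0 i else i)"
    have "inj_on s {..<n}"
    proof (rule inj_onI)
      fix i k assume ik: "i \<in> {..<n}" "k \<in> {..<n}" "s i = s k"
      then have "x j i ^ ?q = x j k ^ ?q" using s0[of i] s0[of k] by (simp add: s_def)
      then have "x j i = x j k" by (rule inj)
      then show "i = k" using x[OF j] ik by (meson inj_onD)
    qed
    moreover have "s ` {..<n} \<subseteq> {..<n}" using s0 by (auto simp: s_def)
    ultimately have "bij_betw s {..<n} {..<n}" unfolding bij_betw_def using endo_inj_surj[of "{..<n}" s] by blast
    then have "s permutes {..<n}" by (rule bij_imp_permutes) (simp add: s_def)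
    then show ?thesis using s0 by (intro exI[of _ s]) (simp add: s_def)
  qed
  then obtain \<sigma> where \<sigma>: "\<And>j. j < r \<Longrightarrow> \<sigma> j permutes {..<n} \<and> (\<forall>i<n. x j i ^ ?q = x j (\<sigma> j i))" by metis
  have "restrict \<sigma> {..<r} \<in> Gset n r" using \<sigma> unfolding Gset_def by auto
  moreover have "lab n r a f x (restrict \<sigma> {..<r})" using \<sigma> x unfolding lab_def by simp
  ultimately show ?thesis by blast
qed

context curve begin

text \<open>Brings the Eisenstein condition into computable form: it is a derivative in the
  parameter, with the root variable held fixed at \<open>x\<close>.\<close>

lemma Hc_const_nth1: "poly (Hc c j) (fps_const x) $ 1 = poly (pderiv (poly (H j) [:x:])) c"
proof -
  have "poly (map_poly (\<lambda>p. bp p c) Q) (bp t c) = bp (poly Q t) c" for Q t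
    by (induction Q) (auto simp: map_poly_pCons bp_add bp_mult)
  then have "poly (Hc c j) (fps_const x) = bp (poly (H j) [:x:]) c"
    unfolding Hc_def bp_const[of x c, symmetric] bp_def[symmetric] by simp
  moreover have "bp p c $ 1 = poly (pderiv p) c" for p
    using fps_deriv_bp[of p c] bp_nth_0[of "pderiv p" c] by (metis fps_deriv_nth mult_1 of_nat_1 add_0 One_nat_def add.right_neutral plus_1_eq_Suc)
  ultimately show ?thesis by simp
qed

end

lemma coeff_sum_monom: "coeff (\<Sum>m<(n::nat). monom (f m) m) k = (if k < n then f k else 0)"
  by (simp add: coeff_sum)

lemma card_polys_deg_less:
  assumes fin: "finite (UNIV :: 'k::field set)"
  shows "finite {g::'k poly. degree g < n} \<and> (0 < n \<longrightarrow> card {g::'k poly. degree g < n} = card (UNIV :: 'k set) ^ n)"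
proof -
  have inj: "inj_on (\<lambda>g. restrict (coeff g) {..<n}) {g::'k poly. degree g < n}"
  proof (rule inj_onI, rule poly_eqI)
    fix g h :: "'k poly" and i
    assume gh: "g \<in> {g. degree g < n}" "h \<in> {g. degree g < n}" "restrict (coeff g) {..<n} = restrict (coeff h) {..<n}"
    show "coeff g i = coeff h i"
    proof (cases "i < n")
      case True
      then show ?thesis using fun_cong[OF gh(3), of i] by simp
    next
      case False
      then show ?thesis using gh(1,2) by (simp add: coeff_eq_0)
    qed
  qed
  have sub: "(\<lambda>g. restrict (coeff g) {..<n}) ` {g::'k poly. degree g < n} \<subseteq> PiE {..<n} (\<lambda>_. UNIV)"
    by (intro image_subsetI restrict_PiE_iff[THEN iffD2]) auto
  have finP: "finite (PiE {..<n} (\<lambda>_. UNIV :: 'k set))" by (intro finite_PiE) (use fin in auto)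
  have sup: "PiE {..<n} (\<lambda>_. UNIV) \<subseteq> (\<lambda>g. restrict (coeff g) {..<n}) ` {g::'k poly. degree g < n}" if n: "0 < n"
  proof
    fix h :: "nat \<Rightarrow> 'k" assume h: "h \<in> PiE {..<n} (\<lambda>_. UNIV)"
    define g where "g = (\<Sum>i<n. monom (h i) i)"
    have cg: "coeff g i = (if i < n then h i else 0)" for i
      unfolding g_def by (rule coeff_sum_monom)
    have "degree g \<le> n - 1" by (rule degree_le) (use n cg in auto)
    then have "degree g < n" using n by simp
    moreover have "h = restrict (coeff g) {..<n}" using h by (auto simp: cg PiE_iff extensional_def restrict_def)
    ultimately show "h \<in> (\<lambda>g. restrict (coeff g) {..<n}) ` {g. degree g < n}" by blast
  qed
  have "finite {g::'k poly. degree g < n}" using finite_imageD[OF finite_subset[OF sub finP] inj] .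
  moreover have "card {g::'k poly. degree g < n} = card (UNIV :: 'k set) ^ n" if "0 < n"
    using card_image[OF inj] sub sup[OF that] by (simp add: subset_antisym card_PiE)
  ultimately show ?thesis by blast
qed

lemma card_polys_value_le:
  fixes x y :: "'k::field"
  assumes fin: "finite (UNIV :: 'k set)" and n: "0 < n"
  shows "card {g::'k poly. degree g < n \<and> poly g x = y} \<le> card (UNIV :: 'k set) ^ (n - 1)"
proof -
  let ?q = "card (UNIV :: 'k set)"
  let ?F = "{g::'k poly. degree g < n \<and> poly g x = y}"
  have inj: "inj_on (\<lambda>(g, t). g + [:t:]) (?F \<times> UNIV)"
  proof (rule inj_onI)
    fix u v assume uv: "u \<in> ?F \<times> (UNIV :: 'k set)" "v \<in> ?F \<times> (UNIV :: 'k set)"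
      "(\<lambda>(g, t). g + [:t:]) u = (\<lambda>(g, t). g + [:t:]) v"
    then have e: "fst u + [:snd u:] = fst v + [:snd v:]" "poly (fst u) x = poly (fst v) x" by (auto simp: split_def)
    from arg_cong[OF e(1), of "\<lambda>p. poly p x"] e(2) have "snd u = snd v" by simp
    then show "u = v" using e(1) by (simp add: prod_eq_iff)
  qed
  have sub: "(\<lambda>(g, t). g + [:t:]) ` (?F \<times> UNIV) \<subseteq> {g. degree g < n}"
  proof (rule image_subsetI)
    fix u assume "u \<in> ?F \<times> (UNIV :: 'k set)"
    then have "degree (fst u + [:snd u:]) < n" using n by (intro degree_add_less) auto
    then show "(\<lambda>(g, t). g + [:t:]) u \<in> {g. degree g < n}" by (simp add: split_def)
  qed
  have finP: "finite {g::'k poly. degree g < n}" using card_polys_deg_less[OF fin, of n] by blast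
  have "card (?F \<times> (UNIV :: 'k set)) \<le> card {g::'k poly. degree g < n}"
    unfolding card_image[OF inj, symmetric] by (rule card_mono[OF finP sub])
  then have "card ?F * ?q \<le> ?q ^ n" using card_polys_deg_less[OF fin, of n] n by (simp add: card_cartesian_product)
  also have "\<dots> = ?q ^ (n - 1) * ?q" using n by (simp add: power_eq_if mult.commute)
  finally show ?thesis using fin by (simp add: finite_UNIV_card_ge_0)
qed

section \<open>One-parameter families through prescribed special polynomials\<close>

text \<open>\<open>SP\<close> indexes the nodes: at the parameter \<open>c s\<close> the family
  passes through \<open>fs s\<close>, a shift of which is to degenerate at the point
  \<open>x s\<close>. The polynomial \<open>g\<close> is a free direction, multiplied by a function
  that vanishes at all nodes; the family is averaged over it later.\<close>

locale shifted_curve =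
  fixes n r :: nat and a :: "nat \<Rightarrow> 'k::field poly" and SP :: "'s set" and c :: "'s \<Rightarrow> 'k"
    and fs :: "'s \<Rightarrow> 'k poly" and x :: "'s \<Rightarrow> 'k" and g :: "'k poly"
  assumes n3: "3 \<le> n" and fin: "finite (UNIV :: 'k set)" and pp: "primepow (card (UNIV :: 'k set))"
    and deg_a: "\<And>j. j < r \<Longrightarrow> degree (a j) < n" and finSP: "finite SP" and inj_c: "inj_on c SP"
    and fs: "\<And>s. s \<in> SP \<Longrightarrow> degree (fs s) = n \<and> coeff (fs s) n = 1"
    and deg_g: "degree g < n"
begin

definition lag :: "'s \<Rightarrow> 'k poly" where
  "lag s = smult (1 / (\<Prod>t\<in>SP - {s}. c s - c t)) (\<Prod>t\<in>SP - {s}. [:- c t, 1:])"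

definition ww :: "'k poly" where "ww = (\<Prod>t\<in>SP. [:- c t, 1:])"

definition fd :: "'s \<Rightarrow> 'k poly" where "fd s = fs s - monom 1 n"

definition base :: "'k \<Rightarrow> 'k poly" where
  "base b = monom 1 n + (\<Sum>s\<in>SP. smult (poly (lag s) b) (fd s))"

definition fam :: "'k \<Rightarrow> 'k poly" where "fam b = base b + smult (poly ww b) g"

text \<open>The locale \<open>curve\<close> asks for a polynomial at every index, so the shifts are
  continued by zero.\<close>

definition A :: "nat \<Rightarrow> 'k poly" where "A j = (if j < r then a j else 0)"

definition Hcoef :: "nat \<Rightarrow> nat \<Rightarrow> 'k poly" where
  "Hcoef j m = [:coeff (A j) m:] + (\<Sum>s\<in>SP. smult (coeff (fd s) m) (lag s)) + smult (coeff g m) ww"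

definition HH :: "nat \<Rightarrow> 'k alg_closure poly poly" where
  "HH j = monom 1 n + (\<Sum>m<n. monom (ac_poly (Hcoef j m)) m)"

lemma coeff_HH: "coeff (HH j) m = (if m = n then 1 else if m < n then ac_poly (Hcoef j m) else 0)"
  unfolding HH_def by (simp only: coeff_add coeff_sum_monom coeff_monom) auto

lemma degree_lag: "degree (lag s) \<le> card SP"
proof -
  have "degree (\<Prod>t\<in>SP - {s}. [:- c t, 1:]) = card (SP - {s})" by (subst degree_prod_eq_sum_degree) auto
  then have "degree (lag s) \<le> card (SP - {s})" unfolding lag_def using degree_smult_le by metis
  then show ?thesis using card_mono[OF finSP, of "SP - {s}"] by auto
qed

lemma degree_ww: "degree ww = card SP"
  unfolding ww_def by (subst degree_prod_eq_sum_degree) auto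

lemma degree_Hcoef: "degree (Hcoef j m) \<le> card SP"
  unfolding Hcoef_def
  by (intro degree_add_le degree_sum_le finSP order_trans[OF degree_smult_le])
    (auto simp: degree_lag degree_ww)

lemma curve_HH: "curve n (card SP) HH"
proof -
  have 1: "coeff (HH j) n = 1" for j by (simp add: coeff_HH)
  have 2: "degree (HH j) = n" for j
    by (intro antisym degree_le le_degree) (auto simp: coeff_HH)
  have 3: "degree (coeff (HH j) m) \<le> card SP" for j m using degree_Hcoef by (simp add: coeff_HH)
  show ?thesis unfolding curve_def using n3 1 2 3 by simp
qed

lemma degree_fd: "s \<in> SP \<Longrightarrow> degree (fd s) < n"
proof -
  assume s: "s \<in> SP"
  have "degree (fd s) \<le> n - 1"
  proof (rule degree_le, intro allI impI)
    fix i assume "n - 1 < i"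
    then show "coeff (fd s) i = 0" using fs[OF s] by (cases "i = n") (auto simp: fd_def coeff_eq_0)
  qed
  then show ?thesis using n3 by simp
qed

lemma degree_A: "degree (A j) < n"
  using deg_a n3 by (simp add: A_def)

lemma coeff_fam: "coeff (fam b + A j) m = (if m = n then 1 else if m < n then poly (Hcoef j m) b else 0)"
proof -
  have *: "coeff (fam b + A j) m = (if m = n then 1 else 0) + (\<Sum>s\<in>SP. poly (lag s) b * coeff (fd s) m) + poly ww b * coeff g m + coeff (A j) m"
    by (simp add: fam_def base_def coeff_sum)
  show ?thesis
  proof (cases "m < n")
    case True
    then show ?thesis unfolding * Hcoef_def by (simp add: poly_sum mult.commute)
  next
    case False
    then have nm: "n \<le> m" by simp
    have "coeff g m = 0" "coeff (A j) m = 0" "\<And>s. s \<in> SP \<Longrightarrow> coeff (fd s) m = 0"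
      using less_le_trans[OF deg_g nm] less_le_trans[OF degree_A[of j] nm] less_le_trans[OF degree_fd nm]
      by (simp_all add: coeff_eq_0)
    then show ?thesis unfolding * using False by simp
  qed
qed

lemma Hev_HH: "map_poly (\<lambda>p. poly p (to_ac b)) (HH j) = ac_poly (fam b + A j)"
  by (rule poly_eqI) (simp add: coeff_map_poly coeff_HH coeff_fam poly_ac_poly del: coeff_add)

lemma degree_fam: "degree (fam b + A j) = n \<and> coeff (fam b + A j) n = 1"
proof
  show "degree (fam b + A j) = n" by (intro antisym degree_le le_degree) (auto simp: coeff_fam simp del: coeff_add)
  show "coeff (fam b + A j) n = 1" by (simp add: coeff_fam del: coeff_add)
qed

lemma lag_nodes: "s \<in> SP \<Longrightarrow> t \<in> SP \<Longrightarrow> poly (lag s) (c t) = (if s = t then 1 else 0)"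
proof -
  assume st: "s \<in> SP" "t \<in> SP"
  have nz: "(\<Prod>u\<in>SP - {s}. c s - c u) \<noteq> 0" using inj_c st finSP by (auto simp: inj_on_def)
  show ?thesis
  proof (cases "s = t")
    case True
    then show ?thesis using nz by (simp add: lag_def poly_prod)
  next
    case False
    then have "(\<Prod>u\<in>SP - {s}. c t - c u) = 0" using st finSP by (intro prod_zero) auto
    then show ?thesis using False by (simp add: lag_def poly_prod)
  qed
qed

lemma fam_node: "s \<in> SP \<Longrightarrow> fam (c s) = fs s"
proof -
  assume s: "s \<in> SP"
  have "poly ww (c s) = 0" unfolding ww_def poly_prod using s finSP by (intro prod_zero) auto
  moreover have "(\<Sum>t\<in>SP. smult (poly (lag t) (c s)) (fd t)) = fd s"
  proof -
    have "(\<Sum>t\<in>SP. smult (poly (lag t) (c s)) (fd t)) = (\<Sum>t\<in>SP. if t = s then fd t else 0)"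
      using s by (intro sum.cong) (auto simp: lag_nodes)
    then show ?thesis using s finSP by simp
  qed
  ultimately show ?thesis by (simp add: fam_def base_def fd_def)
qed

text \<open>The derivative in the parameter, at node \<open>s\<close>, of the value at
  \<open>x s\<close> is \<open>dval0 s + poly g (x s) * dval1 s\<close>. It does not involve the
  shift, which is constant along the family, and it depends on \<open>g\<close> through one value
  only.\<close>

definition dval0 :: "'s \<Rightarrow> 'k" where
  "dval0 s = (\<Sum>t\<in>SP. poly (fd t) (x s) * poly (pderiv (lag t)) (c s))"

definition dval1 :: "'s \<Rightarrow> 'k" where "dval1 s = poly (pderiv ww) (c s)"

lemma dval1_nz: "s \<in> SP \<Longrightarrow> dval1 s \<noteq> 0"
  unfolding dval1_def ww_def using pderiv_prod_linear[OF finSP, of s c] inj_c finSP by (auto simp: inj_on_def)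

lemma poly_deg_sum: "degree p < n \<Longrightarrow> (\<Sum>m<n. coeff p m * z ^ m) = poly p z" for p :: "'k poly"
proof -
  assume "degree p < n"
  then have "poly p z = (\<Sum>m\<le>n - 1. coeff p m * z ^ m)" by (intro poly_sum_bound) simp
  moreover have "{..n - 1} = {..<n}" using n3 by auto
  ultimately show ?thesis by simp
qed

lemma deriv_HH:
  "poly (pderiv (poly (HH j) [:to_ac z:])) (to_ac b)
     = to_ac ((\<Sum>t\<in>SP. poly (fd t) z * poly (pderiv (lag t)) b) + poly g z * poly (pderiv ww) b)"
proof -
  have "poly (HH j) [:to_ac z:] = ac_poly ([:z:] ^ n + (\<Sum>m<n. Hcoef j m * [:z:] ^ m))"
    unfolding HH_def by (simp add: poly_sum poly_monom ac_poly_add ac_poly_sum ac_poly_mult ac_poly_power map_poly_pCons)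
  then have 1: "poly (pderiv (poly (HH j) [:to_ac z:])) (to_ac b) = to_ac (poly (pderiv ([:z:] ^ n + (\<Sum>m<n. Hcoef j m * [:z:] ^ m))) b)"
    by (simp only: pderiv_ac_poly poly_ac_poly)
  have zp: "[:z:] ^ m = [:z ^ m:]" for m by (induction m) (auto simp: one_pCons)
  have ps: "pderiv (\<Sum>m\<in>M. f m) = (\<Sum>m\<in>M. pderiv (f m))" for M :: "'i set" and f :: "'i \<Rightarrow> 'k poly"
    by (induction M rule: infinite_finite_induct) (auto simp: pderiv_add)
  have "pderiv (Hcoef j m * [:z ^ m:]) = smult (z ^ m) ((\<Sum>s\<in>SP. smult (coeff (fd s) m) (pderiv (lag s))) + smult (coeff g m) (pderiv ww))" for m
  proof -
    have "pderiv (Hcoef j m) = (\<Sum>s\<in>SP. smult (coeff (fd s) m) (pderiv (lag s))) + smult (coeff g m) (pderiv ww)"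
      unfolding Hcoef_def by (simp add: pderiv_add pderiv_smult ps pderiv_pCons)
    then show ?thesis by (simp add: pderiv_smult mult.commute)
  qed
  then have "poly (pderiv ([:z:] ^ n + (\<Sum>m<n. Hcoef j m * [:z:] ^ m))) b
     = (\<Sum>m<n. z ^ m * ((\<Sum>s\<in>SP. coeff (fd s) m * poly (pderiv (lag s)) b) + coeff g m * poly (pderiv ww) b))"
    unfolding zp by (simp add: pderiv_add ps poly_sum pderiv_pCons)
  also have "\<dots> = (\<Sum>s\<in>SP. (\<Sum>m<n. coeff (fd s) m * z ^ m) * poly (pderiv (lag s)) b) + (\<Sum>m<n. coeff g m * z ^ m) * poly (pderiv ww) b"
    unfolding distrib_left sum.distrib sum_distrib_left sum_distrib_right
    by (subst (2) sum.swap) (simp add: ac_simps)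
  also have "\<dots> = (\<Sum>s\<in>SP. poly (fd s) z * poly (pderiv (lag s)) b) + poly g z * poly (pderiv ww) b"
    using degree_fd deg_g by (simp add: poly_deg_sum)
  finally show ?thesis using 1 by simp
qed

end

context curve begin

lemma branch_of_splits:
  assumes "\<And>j. j < r \<Longrightarrow> splits c j"
  shows "\<exists>y. fst y = c \<and> pb (r * n) y \<and> sep0 r y"
proof -
  obtain xr where xr: "\<And>j. j < r \<Longrightarrow> inj_on (xr j) {..<n} \<and> Hev c j = (\<Prod>i<n. [:- xr j i, 1:])"
    using assms unfolding splits_def by metis
  have "inj_on (\<lambda>i. xr ((j * n + i) div n) ((j * n + i) mod n)) {..<n} \<and>
      Hev c j = (\<Prod>i<n. [:- xr ((j * n + i) div n) ((j * n + i) mod n), 1:])" if j: "j < r" for j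
  proof
    have eq: "xr ((j * n + i) div n) ((j * n + i) mod n) = xr j i" if "i < n" for i using that by simp
    have "inj_on (\<lambda>i. xr ((j * n + i) div n) ((j * n + i) mod n)) {..<n} = inj_on (xr j) {..<n}"
      by (rule inj_on_cong) (simp add: eq)
    then show "inj_on (\<lambda>i. xr ((j * n + i) div n) ((j * n + i) mod n)) {..<n}" using xr[OF j] by blast
    have "(\<Prod>i<n. [:- xr j i, 1:]) = (\<Prod>i<n. [:- xr ((j * n + i) div n) ((j * n + i) mod n), 1:])"
      by (rule prod.cong) (simp_all add: eq)
    then show "Hev c j = (\<Prod>i<n. [:- xr ((j * n + i) div n) ((j * n + i) mod n), 1:])" using xr[OF j] by simp
  qed
  then show ?thesis using full_branch_of_roots[of r "\<lambda>s. xr (s div n) (s mod n)" c] by blast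
qed

end

context shifted_curve begin

text \<open>Each point of \<open>Z\<close> carries \<open>fact n ^ r\<close> labellings, and by
  hypothesis the Frobenius tuple of each of them lies in \<open>T\<close>. A single tuple accounts
  for little more than \<open>q\<close> pairs of a point and a labelling.\<close>

lemma good_bound:
  assumes spec: "\<And>j i. j < r \<Longrightarrow> 1 \<le> i \<Longrightarrow> i \<le> n - 2 \<Longrightarrow> \<exists>s\<in>SP. \<exists>v. fs s + a j = [:- x s, 1:] ^ (n - i) * (\<Prod>k<i. [:- v k, 1:]) \<and>
        inj_on v {..<i} \<and> x s \<notin> v ` {..<i} \<and> (\<forall>j'<j. sqf (ac_poly (fs s + a j')))"
    and spec0: "\<And>j. j < r \<Longrightarrow> \<exists>s\<in>SP. fs s + a j = [:- x s, 1:] ^ n"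
    and good: "\<And>s. s \<in> SP \<Longrightarrow> dval0 s + poly g (x s) * dval1 s \<noteq> 0"
    and T: "T \<subseteq> Gset n r" and M0: "0 < M0"
    and thr: "stepanov_threshold n (card SP) r M0 \<le> card (UNIV :: 'k set)"
    and Z: "\<And>b j. b \<in> Z \<Longrightarrow> j < r \<Longrightarrow> sqf (ac_poly (fam b + a j))"
      "\<And>b y \<sigma>. b \<in> Z \<Longrightarrow> \<sigma> \<in> Gset n r \<Longrightarrow> lab n r a (fam b) y \<sigma> \<Longrightarrow> \<sigma> \<in> T"
  shows "fact n ^ r * card Z * M0 \<le> card T * (card (UNIV :: 'k set) * (M0 + 1 + card SP * (r * n * n)))"
proof -
  let ?q = "card (UNIV :: 'k set)"
  interpret C: curve n "card SP" HH by (rule curve_HH)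
  have finZ: "finite Z" by (rule finite_subset[OF subset_UNIV fin])
  have GG: "C.G r = Gset n r" unfolding C.G_def Gset_def ..
  have Hev: "C.Hev (to_ac b) j = ac_poly (fam b + A j)" for b j unfolding C.Hev_def by (rule Hev_HH)
  have Aj: "A j = a j" if "j < r" for j using that by (simp add: A_def)
  have spl: "C.splits (to_ac b) j" if "j < r" "sqf (ac_poly (fam b + a j))" for b j
  proof -
    have "sqf (ac_poly (fam b + A j))" using that Aj by simp
    moreover have "coeff (ac_poly (fam b + A j)) n = 1" "degree (ac_poly (fam b + A j)) = n"
      using degree_fam[of b j] by (simp_all del: coeff_add)
    ultimately show ?thesis unfolding C.splits_def Hev using sqf_splits by blast
  qed
  have dnz: "poly (C.Hc (to_ac (c s)) j) (fps_const (to_ac (x s))) $ 1 \<noteq> 0" if "s \<in> SP" for s j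
    unfolding C.Hc_const_nth1 deriv_HH using good[OF that] unfolding dval0_def dval1_def by (simp only: to_ac_eq_0_iff not_False_eq_True)
  have lin: "ac_poly [:- z, 1:] = [:- to_ac z, 1:]" for z :: 'k unfolding ac_poly_linear by simp
  have cl: "C.Claim (r * n)"
  proof (rule C.Claim_full[OF n3])
    fix j i assume j: "j < r" and i: "1 \<le> i" "i \<le> n - 2"
    obtain s v where s: "s \<in> SP" "fs s + a j = [:- x s, 1:] ^ (n - i) * (\<Prod>k<i. [:- v k, 1:])"
      "inj_on v {..<i}" "x s \<notin> v ` {..<i}" "\<And>j'. j' < j \<Longrightarrow> sqf (ac_poly (fs s + a j'))"
      using spec[OF j i] by blast
    show "\<exists>\<kappa>. C.pb (j * n + i) \<kappa> \<and> C.sep j \<kappa> \<and> C.eis i j \<kappa>"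
    proof (rule C.special_branch[where c = "to_ac (c s)" and x = "to_ac (x s)" and v = "\<lambda>k. to_ac (v k)"])
      show "i < n" using i n3 by linarith
      show "C.splits (to_ac (c s)) j'" if "j' < j" for j'
        using spl[of j' "c s"] s(5)[OF that] that j fam_node[OF s(1)] by simp
      show "C.Hev (to_ac (c s)) j = [:- to_ac (x s), 1:] ^ (n - i) * (\<Prod>k<i. [:- to_ac (v k), 1:])"
        unfolding Hev fam_node[OF s(1)] Aj[OF j] s(2) ac_poly_mult ac_poly_power ac_poly_prod lin ..
      show "inj_on (\<lambda>k. to_ac (v k)) {..<i}" using s(3) by (simp add: inj_on_def)
      show "to_ac (x s) \<notin> (\<lambda>k. to_ac (v k)) ` {..<i}" using s(4) by auto
      show "poly (C.Hc (to_ac (c s)) j) (fps_const (to_ac (x s))) $ 1 \<noteq> 0" by (rule dnz[OF s(1)])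
    qed
  next
    fix j assume j: "j < r"
    obtain s where s: "s \<in> SP" "fs s + a j = [:- x s, 1:] ^ n" using spec0[OF j] by blast
    have "C.Hev (to_ac (c s)) j = [:- to_ac (x s), 1:] ^ n"
      unfolding Hev fam_node[OF s(1)] Aj[OF j] s(2) ac_poly_power lin ..
    then show "\<exists>\<kappa>. C.eis 0 j \<kappa>" using C.special_point_0 dnz[OF s(1)] by blast
  qed
  have "\<forall>b. \<exists>y. b \<in> Z \<longrightarrow> fst y = to_ac b \<and> C.pb (r * n) y \<and> C.sep0 r y"
    using C.branch_of_splits[OF spl[OF _ Z(1)]] by blast
  then obtain Y0 where Y0: "\<And>b. b \<in> Z \<Longrightarrow> fst (Y0 b) = to_ac b \<and> C.pb (r * n) (Y0 b) \<and> C.sep0 r (Y0 b)" by metis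
  define Y where "Y = (\<lambda>z. Y0 (of_ac z))"
  obtain kk where kk: "prime CHAR('k alg_closure)" "?q = CHAR('k alg_closure) ^ kk" "0 < kk"
    using primepow_card_CHAR[OF fin pp] by (metis CHAR_alg_closure)
  \<comment> \<open>The constant terms of the relabelled branch label the roots of the fibre at
    \<open>b\<close>. The Frobenius tuple of this labelling belongs to \<open>T\<close> by the
    assumption on \<open>Z\<close>.\<close>
  have frob: "\<exists>\<sigma>\<in>T. C.frobbr ?q r \<sigma> (C.tw r \<tau> (Y0 b))" if b: "b \<in> Z" and \<tau>: "\<tau> \<in> C.G r" for b \<tau>
  proof -
    define y where "y = C.tw r \<tau> (Y0 b)"
    have y: "fst y = to_ac b" "C.pb (r * n) y" "C.sep0 r y"
      using Y0[OF b] C.pb_tw[OF _ \<tau>] C.sep0_tw[OF _ \<tau>] unfolding y_def by auto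
    define xx where "xx = (\<lambda>j i. snd y (j * n + i) $ 0)"
    have fac: "inj_on (xx j) {..<n} \<and> ac_poly (fam b + a j) = (\<Prod>i<n. [:- xx j i, 1:])" if j: "j < r" for j
    proof
      show "inj_on (xx j) {..<n}" using y(3) j unfolding C.sep0_def xx_def by blast
      have "C.Hc (to_ac b) j = (\<Prod>i<n. [:- snd y (j * n + i), 1:])" using y(1,2) j C.pb_full_iff by metis
      then have "C.Hev (to_ac b) j = (\<Prod>i<n. map_poly (\<lambda>p. p $ 0) [:- snd y (j * n + i), 1:])"
        unfolding C.Hc_nth0[symmetric] by (simp only: map_poly_nth0_prod)
      also have "\<dots> = (\<Prod>i<n. [:- xx j i, 1:])" unfolding xx_def by (intro prod.cong) (auto simp: map_poly_pCons)
      finally show "ac_poly (fam b + a j) = (\<Prod>i<n. [:- xx j i, 1:])" unfolding Hev Aj[OF j] .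
    qed
    from lab_exists[where r=r and x=xx and n=n and f="fam b" and a=a, OF fin pp fac] obtain \<sigma> where \<sigma>: "\<sigma> \<in> Gset n r" "lab n r a (fam b) xx \<sigma>" by blast
    have "C.frobbr ?q r \<sigma> y" unfolding C.frobbr_def
    proof (intro conjI allI impI)
      show "fst y ^ ?q = fst y" unfolding y(1) using finite_field_power_card[OF fin, of b] by (simp flip: to_ac_power)
      fix s assume s: "s < r * n"
      have j: "s div n < r" using s C.div_less_iff by simp
      have m: "s mod n < n" using n3 by simp
      have e: "s div n * n + s mod n = s" by simp
      have "xx (s div n) (s mod n) ^ ?q = xx (s div n) (\<sigma> (s div n) (s mod n))" using \<sigma>(2) j m unfolding lab_def by blast
      then show "(snd y s $ 0) ^ ?q = snd y (C.act r \<sigma> s) $ 0" unfolding xx_def e C.act_def using j by simp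
    qed
    then show ?thesis using Z(2)[OF b \<sigma>] unfolding y_def by blast
  qed
  have Tfin: "finite T" using T finite_subset C.finite_G GG by metis
  have bound: "(\<Sum>b\<in>Z. card {\<tau>\<in>C.G r. C.frobbr ?q r \<sigma> (C.tw r \<tau> (Y0 b))}) * M0 \<le> ?q * (M0 + 1 + card SP * (r * n * n))"
    if "\<sigma> \<in> T" for \<sigma>
  proof -
    have "(\<Sum>z\<in>to_ac ` Z. card {\<tau>\<in>C.G r. C.frobbr ?q r \<sigma> (C.tw r \<tau> (Y z))}) * M0 \<le> ?q * (M0 + 1 + card SP * (r * n * n))"
    proof (rule C.stepanov_bound[OF kk _ cl _ M0 thr])
      show "\<exists>z. z ^ k = w" if "0 < k" for w :: "'k alg_closure" and k using nth_root_exists[OF that] by blast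
      show "\<sigma> \<in> C.G r" using that T GG by blast
      show "finite (to_ac ` Z)" using finZ by simp
      show "C.pb (r * n) (Y z) \<and> fst (Y z) = z \<and> C.sep0 r (Y z)" if "z \<in> to_ac ` Z" for z
        using that Y0 unfolding Y_def by auto
    qed
    moreover have "(\<Sum>z\<in>to_ac ` Z. card {\<tau>\<in>C.G r. C.frobbr ?q r \<sigma> (C.tw r \<tau> (Y z))})
        = (\<Sum>b\<in>Z. card {\<tau>\<in>C.G r. C.frobbr ?q r \<sigma> (C.tw r \<tau> (Y0 b))})"
      by (subst sum.reindex) (auto simp: Y_def intro: inj_onI)
    ultimately show ?thesis by simp
  qed
  have "fact n ^ r * card Z = (\<Sum>b\<in>Z. card (C.G r))" by (simp add: C.card_G)
  also have "\<dots> \<le> (\<Sum>b\<in>Z. \<Sum>\<sigma>\<in>T. card {\<tau>\<in>C.G r. C.frobbr ?q r \<sigma> (C.tw r \<tau> (Y0 b))})"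
  proof (rule sum_mono)
    fix b assume b: "b \<in> Z"
    have "C.G r \<subseteq> (\<Union>\<sigma>\<in>T. {\<tau>\<in>C.G r. C.frobbr ?q r \<sigma> (C.tw r \<tau> (Y0 b))})" using frob[OF b] by blast
    then have "card (C.G r) \<le> card (\<Union>\<sigma>\<in>T. {\<tau>\<in>C.G r. C.frobbr ?q r \<sigma> (C.tw r \<tau> (Y0 b))})"
      by (intro card_mono) (use Tfin in auto)
    also have "\<dots> \<le> (\<Sum>\<sigma>\<in>T. card {\<tau>\<in>C.G r. C.frobbr ?q r \<sigma> (C.tw r \<tau> (Y0 b))})" by (rule card_UN_le[OF Tfin])
    finally show "card (C.G r) \<le> (\<Sum>\<sigma>\<in>T. card {\<tau>\<in>C.G r. C.frobbr ?q r \<sigma> (C.tw r \<tau> (Y0 b))})" .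
  qed
  also have "\<dots> = (\<Sum>\<sigma>\<in>T. \<Sum>b\<in>Z. card {\<tau>\<in>C.G r. C.frobbr ?q r \<sigma> (C.tw r \<tau> (Y0 b))})" by (rule sum.swap)
  finally have "fact n ^ r * card Z * M0 \<le> (\<Sum>\<sigma>\<in>T. \<Sum>b\<in>Z. card {\<tau>\<in>C.G r. C.frobbr ?q r \<sigma> (C.tw r \<tau> (Y0 b))}) * M0"
    by (rule mult_le_mono1)
  also have "\<dots> = (\<Sum>\<sigma>\<in>T. (\<Sum>b\<in>Z. card {\<tau>\<in>C.G r. C.frobbr ?q r \<sigma> (C.tw r \<tau> (Y0 b))}) * M0)" by (rule sum_distrib_right)
  also have "\<dots> \<le> (\<Sum>\<sigma>\<in>T. ?q * (M0 + 1 + card SP * (r * n * n)))" by (rule sum_mono[OF bound])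
  also have "\<dots> = card T * (?q * (M0 + 1 + card SP * (r * n * n)))" by simp
  finally show ?thesis .
qed

end

text \<open>For a parameter \<open>b\<close> that is not a node,
  \<open>g \<mapsto> base b + ww b * g\<close> is a bijection onto the monic polynomials of degree
  \<open>n\<close>. So the pairs of \<open>b\<close> and \<open>g\<close> that hit \<A> can be
  counted along the curves, where \<open>good_bound\<close> applies. The directions \<open>g\<close>
  for which some node fails to be Eisenstein form a fraction of order \<open>1 / q\<close> and are
  counted trivially.\<close>

theorem frobenius_type_upper_bound:
  fixes a :: "nat \<Rightarrow> 'k::field poly"
  assumes n3: "3 \<le> n" and fin: "finite (UNIV :: 'k set)" and pp: "primepow (card (UNIV :: 'k set))"
    and deg_a: "\<And>j. j < r \<Longrightarrow> degree (a j) < n" and inj_a: "inj_on a {..<r}"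
    and big: "2 * r * n + n < card (UNIV :: 'k set)" and M0: "0 < M0"
    and thr: "stepanov_threshold n (r * (n - 1)) r M0 \<le> card (UNIV :: 'k set)"
    and T: "T \<subseteq> Gset n r"
    and \<A>: "\<And>f. f \<in> \<A> \<Longrightarrow> degree f = n \<and> coeff f n = 1"
      "\<And>f j. f \<in> \<A> \<Longrightarrow> j < r \<Longrightarrow> sqf (ac_poly (f + a j))"
      "\<And>f y \<sigma>. f \<in> \<A> \<Longrightarrow> \<sigma> \<in> Gset n r \<Longrightarrow> lab n r a f y \<sigma> \<Longrightarrow> \<sigma> \<in> T"
  shows "fact n ^ r * ((card (UNIV :: 'k set) - r * (n - 1)) * card \<A>) * M0
     \<le> card (UNIV :: 'k set) ^ n * (card T * (card (UNIV :: 'k set) * (M0 + 1 + r * (n - 1) * (r * n * n))))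
      + fact n ^ r * (r * (n - 1) * card (UNIV :: 'k set) ^ n) * M0"
proof -
  let ?q = "card (UNIV :: 'k set)"
  define SP where "SP = {..<r} \<times> {..<n - 1}"
  have cS: "card SP = r * (n - 1)" unfolding SP_def by (simp add: card_cartesian_product)
  have finSP: "finite SP" unfolding SP_def by simp
  have "r * (n - 1) \<le> r * n" by (intro mult_le_mono2) simp
  then have "card SP \<le> ?q" using big cS by linarith
  then obtain c :: "nat \<times> nat \<Rightarrow> 'k" where c: "inj_on c SP"
    using card_le_inj[OF finSP fin] by blast
  \<comment> \<open>For \<open>i = 0\<close> nothing is demanded: the special polynomial is
    \<open>(T - x) ^ n\<close> for an arbitrary \<open>x\<close>.\<close>
  have "\<exists>x v. (1 \<le> i \<longrightarrow> inj_on v {..<i} \<and> x \<notin> v ` {..<i} \<and>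
      (\<forall>j'<j. sqf (ac_poly ([:-x, 1:] ^ (n - i) * (\<Prod>k<i. [:- v k, 1:]) + (a j' - a j)))))" if ji: "(j, i) \<in> SP" for j i
  proof (cases "1 \<le> i")
    case True
    define D where "D = (\<lambda>j'. a j' - a j) ` {..<j}"
    have jr: "j < r" "i \<le> n - 2" using ji unfolding SP_def by auto
    have "card D \<le> r" using card_image_le[of "{..<j}" "\<lambda>j'. a j' - a j"] jr unfolding D_def by simp
    moreover have "d \<noteq> 0 \<and> degree d < n" if "d \<in> D" for d
    proof -
      obtain j' where j': "j' < j" "d = a j' - a j" using \<open>d \<in> D\<close> unfolding D_def by blast
      have "a j' \<noteq> a j" using inj_onD[OF inj_a, of j' j] j' jr by auto
      moreover have "degree (a j' - a j) < n" using deg_a[of j'] deg_a[of j] j' jr by (intro degree_diff_less) auto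
      ultimately show ?thesis using j' by simp
    qed
    moreover have "finite D" unfolding D_def by simp
    ultimately obtain x v where xv: "inj_on v {..<i}" "x \<notin> v ` {..<i}"
      "\<forall>d\<in>D. sqf (ac_poly ([:-x, 1:] ^ (n - i) * (\<Prod>k<i. [:- v k, 1:]) + d))"
      using special_poly_exists[OF n3 True jr(2), of D r] fin big by blast
    then have "\<forall>j'<j. sqf (ac_poly ([:-x, 1:] ^ (n - i) * (\<Prod>k<i. [:- v k, 1:]) + (a j' - a j)))" unfolding D_def by blast
    then show ?thesis using xv by blast
  qed simp
  then have "\<forall>s\<in>SP. \<exists>x v. (1 \<le> snd s \<longrightarrow> inj_on v {..<snd s} \<and> x \<notin> v ` {..<snd s} \<and>
      (\<forall>j'<fst s. sqf (ac_poly ([:-x, 1:] ^ (n - snd s) * (\<Prod>k<snd s. [:- v k, 1:]) + (a j' - a (fst s))))))" by auto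
  then obtain x v where xv: "\<And>s. s \<in> SP \<Longrightarrow> 1 \<le> snd s \<Longrightarrow> inj_on (v s) {..<snd s} \<and> x s \<notin> v s ` {..<snd s} \<and>
      (\<forall>j'<fst s. sqf (ac_poly ([:-x s, 1:] ^ (n - snd s) * (\<Prod>k<snd s. [:- v s k, 1:]) + (a j' - a (fst s)))))"
    by metis
  define pp' where "pp' = (\<lambda>s. [:-x s, 1:] ^ (n - snd s) * (\<Prod>k<snd s. [:- v s k, 1:]))"
  \<comment> \<open>Subtracting the own shift makes the \<open>fst s\<close>-th shift of
    \<open>fs s\<close> equal to the degenerate polynomial; the other shifts then differ from it by
    the nonzero \<open>a j' - a j\<close>.\<close>
  define fs where "fs = (\<lambda>s. pp' s - a (fst s))"
  have dp: "degree (pp' s) = n \<and> coeff (pp' s) n = 1" if "s \<in> SP" for s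
  proof
    have le: "snd s \<le> n" using that unfolding SP_def by auto
    have "degree (pp' s) = degree ([:-x s, 1:] ^ (n - snd s)) + degree (\<Prod>k<snd s. [:- v s k, 1:])"
      unfolding pp'_def by (rule degree_mult_eq) auto
    also have "degree ([:-x s, 1:] ^ (n - snd s)) = n - snd s" by (simp add: degree_power_eq)
    also have "degree (\<Prod>k<snd s. [:- v s k, 1:]) = snd s" by (subst degree_prod_eq_sum_degree) auto
    finally show d: "degree (pp' s) = n" using le by simp
    have "lead_coeff (pp' s) = 1" unfolding pp'_def by (simp add: lead_coeff_mult lead_coeff_power lead_coeff_prod)
    then show "coeff (pp' s) n = 1" using d by simp
  qed
  have monic_diff: "degree (p - h) = n \<and> coeff (p - h) n = 1" if "degree p = n" "coeff p n = 1" "degree h < n" for p h :: "'k poly"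
  proof
    show "coeff (p - h) n = 1" using that by (simp add: coeff_eq_0)
    then show "degree (p - h) = n" using that by (intro antisym le_degree) (auto intro!: degree_diff_le)
  qed
  have fsd: "degree (fs s) = n \<and> coeff (fs s) n = 1" if "s \<in> SP" for s
    unfolding fs_def using dp[OF that] deg_a[of "fst s"] that unfolding SP_def by (intro monic_diff) auto
  define Pn where "Pn = {g::'k poly. degree g < n}"
  have SC: "shifted_curve n r a SP c fs g" if "g \<in> Pn" for g
    using that unfolding Pn_def by unfold_locales (use n3 fin pp deg_a finSP c fsd in auto)
  define base where "base = shifted_curve.base n SP c fs"
  define ww where "ww = shifted_curve.ww SP c"
  define fam where "fam = (\<lambda>g b. base b + smult (poly ww b) g)"
  have famC: "shifted_curve.fam n SP c fs g b = fam g b" if "g \<in> Pn" for g b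
    unfolding fam_def base_def ww_def by (rule shifted_curve.fam_def[OF SC[OF that]])
  define d0 where "d0 = shifted_curve.dval0 n SP c fs x"
  define d1 where "d1 = shifted_curve.dval1 SP c"
  have Pn0: "0 \<in> Pn" unfolding Pn_def using n3 by simp
  have finP: "finite Pn" and cardP: "card Pn = ?q ^ n" using card_polys_deg_less[OF fin, of n] n3 unfolding Pn_def by auto
  have d1nz: "d1 s \<noteq> 0" if "s \<in> SP" for s unfolding d1_def by (rule shifted_curve.dval1_nz[OF SC[OF Pn0] that])
  \<comment> \<open>The Eisenstein condition at \<open>s\<close> is affine in
    \<open>poly g (x s)\<close> with nonzero slope \<open>d1 s\<close>, so it fails for exactly one
    value.\<close>
  define bad where "bad = (\<Union>s\<in>SP. {g. degree g < n \<and> poly g (x s) = - d0 s / d1 s})"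
  have "card bad \<le> (\<Sum>s\<in>SP. card {g::'k poly. degree g < n \<and> poly g (x s) = - d0 s / d1 s})"
    unfolding bad_def by (rule card_UN_le[OF finSP])
  also have "\<dots> \<le> (\<Sum>s\<in>SP. ?q ^ (n - 1))" by (rule sum_mono, rule card_polys_value_le[OF fin]) (use n3 in simp)
  finally have cbad: "card bad \<le> r * (n - 1) * ?q ^ (n - 1)" by (simp add: cS)
  have bad_sub: "bad \<subseteq> Pn" unfolding bad_def Pn_def by blast
  define Zg where "Zg = (\<lambda>g. {b. b \<notin> c ` SP \<and> fam g b \<in> \<A>})"
  define K where "K = card T * (?q * (M0 + 1 + r * (n - 1) * (r * n * n)))"
  have good: "fact n ^ r * card (Zg g) * M0 \<le> K" if g: "g \<in> Pn" "g \<notin> bad" for g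
  proof -
    interpret S: shifted_curve n r a SP c fs x g by (rule SC[OF g(1)])
    have famg: "S.fam b = fam g b" for b by (rule famC[OF g(1)])
    show ?thesis unfolding K_def cS[symmetric]
    proof (rule S.good_bound[OF _ _ _ T M0])
      show "stepanov_threshold n (card SP) r M0 \<le> ?q" using thr cS by simp
      show "sqf (ac_poly (S.fam b + a j))" if "b \<in> Zg g" "j < r" for b j
        using that \<A>(2) unfolding famg Zg_def by blast
      show "\<sigma> \<in> T" if "b \<in> Zg g" "\<sigma> \<in> Gset n r" "lab n r a (S.fam b) y \<sigma>" for b y \<sigma>
        using that \<A>(3) unfolding famg Zg_def by blast
      show "S.dval0 s + poly g (x s) * S.dval1 s \<noteq> 0" if s: "s \<in> SP" for s
      proof
        assume "S.dval0 s + poly g (x s) * S.dval1 s = 0"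
        then have "poly g (x s) = - d0 s / d1 s" using d1nz[OF s] unfolding d0_def d1_def
          by (metis add.commute add_eq_0_iff nonzero_eq_divide_eq)
        then show False using g s unfolding bad_def Pn_def by blast
      qed
      show "\<exists>s\<in>SP. \<exists>v. fs s + a j = [:- x s, 1:] ^ (n - i) * (\<Prod>k<i. [:- v k, 1:]) \<and>
          inj_on v {..<i} \<and> x s \<notin> v ` {..<i} \<and> (\<forall>j'<j. sqf (ac_poly (fs s + a j')))"
        if j: "j < r" and i: "1 \<le> i" "i \<le> n - 2" for j i
      proof (intro bexI[of _ "(j, i)"] exI[of _ "v (j, i)"] conjI allI impI)
        show sS: "(j, i) \<in> SP" using j i n3 unfolding SP_def by auto
        show "fs (j, i) + a j = [:- x (j, i), 1:] ^ (n - i) * (\<Prod>k<i. [:- v (j, i) k, 1:])"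
          unfolding fs_def pp'_def by simp
        show "inj_on (v (j, i)) {..<i}" "x (j, i) \<notin> v (j, i) ` {..<i}" using xv[OF sS] i by auto
        fix j' assume "j' < j"
        then have "sqf (ac_poly (pp' (j, i) + (a j' - a j)))" using xv[OF sS] i unfolding pp'_def by simp
        moreover have "fs (j, i) + a j' = pp' (j, i) + (a j' - a j)" unfolding fs_def by simp
        ultimately show "sqf (ac_poly (fs (j, i) + a j'))" by (simp only:)
      qed
      show "\<exists>s\<in>SP. fs s + a j = [:- x s, 1:] ^ n" if j: "j < r" for j
      proof (intro bexI[of _ "(j, 0)"])
        show "(j, 0) \<in> SP" using j n3 unfolding SP_def by auto
        show "fs (j, 0) + a j = [:- x (j, 0), 1:] ^ n" unfolding fs_def pp'_def by simp
      qed
    qed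
  qed
  have card\<A>: "card \<A> \<le> card {g\<in>Pn. fam g b \<in> \<A>}" if b: "b \<notin> c ` SP" for b
  proof (rule card_inj_on_le[where f = "\<lambda>f. smult (1 / poly ww b) (f - base b)"])
    interpret S: shifted_curve n r a SP c fs x 0 by (rule SC[OF Pn0])
    have w: "poly ww b \<noteq> 0" unfolding ww_def S.ww_def poly_prod using b finSP by auto
    have "degree (S.fam b + S.A r) = n \<and> coeff (S.fam b + S.A r) n = 1" by (rule S.degree_fam)
    then have bs: "degree (base b) = n" "coeff (base b) n = 1"
      using famC[OF Pn0, of b] unfolding fam_def S.A_def by simp_all
    have inv: "fam (smult (1 / poly ww b) (f - base b)) b = f" for f
      unfolding fam_def using w by simp
    show "inj_on (\<lambda>f. smult (1 / poly ww b) (f - base b)) \<A>" by (rule inj_on_inverseI[where g = "\<lambda>g. fam g b"]) (rule inv)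
    show "(\<lambda>f. smult (1 / poly ww b) (f - base b)) ` \<A> \<subseteq> {g\<in>Pn. fam g b \<in> \<A>}"
    proof (rule image_subsetI)
      fix f assume f: "f \<in> \<A>"
      have "degree (f - base b) \<le> n - 1"
      proof (rule degree_le, intro allI impI)
        fix i assume "n - 1 < i"
        then show "coeff (f - base b) i = 0" using \<A>(1)[OF f] bs by (cases "i = n") (auto simp: coeff_eq_0)
      qed
      then have "degree (smult (1 / poly ww b) (f - base b)) < n" using n3 degree_smult_le[of "1 / poly ww b" "f - base b"] by linarith
      then show "smult (1 / poly ww b) (f - base b) \<in> {g\<in>Pn. fam g b \<in> \<A>}" using inv[of f] f unfolding Pn_def by simp
    qed
    show "finite {g\<in>Pn. fam g b \<in> \<A>}" using finP by simp
  qed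
  have cB: "card (UNIV - c ` SP) = ?q - r * (n - 1)"
    using card_image[OF c] cS finSP by (simp add: card_Diff_subset)
  have finU: "finite (UNIV - c ` SP)" by (rule finite_subset[OF subset_UNIV fin])
  have "(?q - r * (n - 1)) * card \<A> = (\<Sum>b\<in>UNIV - c ` SP. card \<A>)" by (simp add: cB)
  also have "\<dots> \<le> (\<Sum>b\<in>UNIV - c ` SP. card {g\<in>Pn. fam g b \<in> \<A>})" by (rule sum_mono) (use card\<A> in auto)
  also have "\<dots> = (\<Sum>b\<in>UNIV - c ` SP. \<Sum>g\<in>Pn. if fam g b \<in> \<A> then 1 else 0)"
    using finP by (simp add: sum.If_cases Int_def)
  also have "\<dots> = (\<Sum>g\<in>Pn. \<Sum>b\<in>UNIV - c ` SP. if fam g b \<in> \<A> then 1 else 0)" by (rule sum.swap)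
  also have "\<dots> = (\<Sum>g\<in>Pn. card (Zg g))"
  proof (rule sum.cong)
    fix g
    have "(UNIV - c ` SP) \<inter> {b. fam g b \<in> \<A>} = Zg g" unfolding Zg_def by blast
    then show "(\<Sum>b\<in>UNIV - c ` SP. if fam g b \<in> \<A> then 1 else 0) = card (Zg g)" using finU by (simp add: sum.If_cases)
  qed simp
  finally have "fact n ^ r * ((?q - r * (n - 1)) * card \<A>) * M0 \<le> fact n ^ r * (\<Sum>g\<in>Pn. card (Zg g)) * M0"
    by (intro mult_le_mono1 mult_le_mono2)
  also have "\<dots> = (\<Sum>g\<in>Pn. fact n ^ r * card (Zg g) * M0)" by (simp add: sum_distrib_left sum_distrib_right)
  also have "\<dots> \<le> (\<Sum>g\<in>Pn. K + (if g \<in> bad then fact n ^ r * ?q * M0 else 0))"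
  proof (rule sum_mono)
    fix g assume g: "g \<in> Pn"
    show "fact n ^ r * card (Zg g) * M0 \<le> K + (if g \<in> bad then fact n ^ r * ?q * M0 else 0)"
    proof (cases "g \<in> bad")
      case True
      have "card (Zg g) \<le> ?q" by (rule card_mono[OF fin subset_UNIV])
      then have "fact n ^ r * card (Zg g) * M0 \<le> fact n ^ r * ?q * M0" by (intro mult_le_mono1 mult_le_mono2)
      then show ?thesis unfolding if_P[OF True] by (rule trans_le_add2)
    next
      case False
      then show ?thesis using good[OF g] by simp
    qed
  qed
  also have "\<dots> = ?q ^ n * K + card bad * (fact n ^ r * ?q * M0)"
  proof -
    have "Pn \<inter> {g. g \<in> bad} = bad" using bad_sub by blast
    then show ?thesis using finP by (simp add: sum.distrib cardP sum.If_cases)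
  qed
  also have "\<dots> \<le> ?q ^ n * K + (r * (n - 1) * ?q ^ (n - 1)) * (fact n ^ r * ?q * M0)"
    by (intro add_left_mono mult_le_mono1 cbad)
  also have "(r * (n - 1) * ?q ^ (n - 1)) * (fact n ^ r * ?q * M0) = fact n ^ r * (r * (n - 1) * (?q * ?q ^ (n - 1))) * M0"
    by (simp only: ac_simps)
  also have "?q * ?q ^ (n - 1) = ?q ^ n" using n3 by (simp add: power_eq_if)
  finally show ?thesis unfolding K_def .
qed

section \<open>The arithmetic functions on squarefree polynomials\<close>

text \<open>The polynomials \<open>c\<close> with \<open>p dvd c * b\<close> form an ideal,
  generated by a member \<open>d\<close> of least degree. As \<open>d\<close> divides the
  irreducible \<open>p\<close>, it is a unit, and then \<open>p dvd b\<close>, or it is associated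
  to \<open>p\<close>, and then \<open>p dvd a\<close>.\<close>

lemma irreducible_poly_prime_elem:
  fixes p :: "'k::field poly"
  assumes p: "irreducible p"
  shows "prime_elem p"
proof (rule prime_elemI)
  show p0: "p \<noteq> 0" using p by auto
  show "\<not> p dvd 1" using p by (rule irreducible_not_unit)
  fix a b assume ab: "p dvd a * b"
  define I where "I = {c. p dvd c * b}"
  have "p \<in> I \<and> p \<noteq> 0" using p0 unfolding I_def by simp
  then obtain d where d: "d \<in> I" "d \<noteq> 0" "\<And>c. c \<in> I \<Longrightarrow> c \<noteq> 0 \<Longrightarrow> degree d \<le> degree c"
    using ex_has_least_nat[of "\<lambda>c. c \<in> I \<and> c \<noteq> 0" p degree] by blast
  have dv: "d dvd c" if "c \<in> I" for c
  proof (rule ccontr)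
    assume nd: "\<not> d dvd c"
    then have m0: "c mod d \<noteq> 0" by (simp add: dvd_eq_mod_eq_0)
    have "c mod d = c - (c div d) * d" by (simp add: minus_div_mult_eq_mod)
    then have "c mod d * b = c * b - (c div d) * (d * b)" by (simp only: left_diff_distrib mult.assoc)
    moreover have "p dvd c * b - (c div d) * (d * b)" using that d(1) unfolding I_def by (simp add: dvd_diff)
    ultimately have "c mod d \<in> I" unfolding I_def by simp
    then have "degree d \<le> degree (c mod d)" using d(3) m0 by blast
    moreover have "degree (c mod d) < degree d" using degree_mod_less[OF d(2), of c] m0 by blast
    ultimately show False by simp
  qed
  have "d dvd p" by (rule dv) (simp add: I_def)
  then obtain e where e: "p = d * e" by blast
  have "d dvd 1 \<or> e dvd 1" using irreducibleD[OF p e] .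
  then show "p dvd a \<or> p dvd b"
  proof
    assume "d dvd 1"
    then obtain u where u: "1 = d * u" by blast
    have "b = u * (d * b)" using u by (simp add: mult.assoc[symmetric] mult.commute[of u d])
    then show ?thesis using d(1) unfolding I_def by (metis dvd_mult mem_Collect_eq)
  next
    assume "e dvd 1"
    then have "p dvd d" unfolding e by (metis dvd_refl mult_unit_dvd_iff)
    moreover have "d dvd a" by (rule dv) (use ab in \<open>simp add: I_def\<close>)
    ultimately show ?thesis using dvd_trans by blast
  qed
qed

definition mirr :: "'k::field poly \<Rightarrow> bool" where
  "mirr p \<longleftrightarrow> irreducible p \<and> lead_coeff p = 1"

definition pdivs :: "'k::field poly \<Rightarrow> 'k poly set" where
  "pdivs f = {p. mirr p \<and> p dvd f}"

definition somega :: "'k::field poly \<Rightarrow> nat" where "somega f = card (pdivs f)"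

definition bomega :: "'k::field poly \<Rightarrow> nat" where
  "bomega f = (\<Sum>p\<in>pdivs f. GREATEST e. p ^ e dvd f)"

definition divtuples :: "nat \<Rightarrow> 'k::field poly \<Rightarrow> (nat \<Rightarrow> 'k poly) set" where
  "divtuples k f = {g \<in> {1..k} \<rightarrow>\<^sub>E {h. lead_coeff h = 1}. f = (\<Prod>i\<in>{1..k}. g i)}"

definition divf :: "nat \<Rightarrow> 'k::field poly \<Rightarrow> nat" where "divf k f = card (divtuples k f)"

lemma mirr_prime: "mirr p \<Longrightarrow> prime_elem p"
  unfolding mirr_def using irreducible_poly_prime_elem by blast

lemma monic_unit:
  assumes "(p::'k::field poly) dvd 1" "lead_coeff p = 1" shows "p = 1"
proof -
  obtain c where c: "p = [:c:]" using assms(1) is_unit_poly_iff by blast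
  then have "c = 1" using assms(2) by simp
  then show ?thesis using c unfolding one_pCons by (simp only:)
qed

lemma mirr_dvd_eq:
  assumes p: "mirr p" and q: "mirr q" and d: "p dvd q" shows "p = q"
proof -
  obtain c where c: "q = p * c" using d by blast
  have "\<not> p dvd 1" using p unfolding mirr_def using irreducible_not_unit by blast
  then have "c dvd 1" using q irreducibleD[OF _ c] unfolding mirr_def by blast
  moreover have "lead_coeff c = 1" using p q unfolding mirr_def c lead_coeff_mult by simp
  ultimately have "c = 1" by (rule monic_unit)
  then show ?thesis using c by simp
qed

lemma mirr_dvd_prod:
  assumes "finite Ps" "\<And>p. p \<in> Ps \<Longrightarrow> mirr p" "mirr p" "p dvd \<Prod>Ps" shows "p \<in> Ps"
  using assms
proof (induction Ps rule: finite_induct)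
  case empty
  then show ?case using irreducible_not_unit unfolding mirr_def by auto
next
  case (insert x F)
  then have "p dvd x * \<Prod>F" by simp
  then have "p dvd x \<or> p dvd \<Prod>F" using prime_elem_dvd_mult_iff[OF mirr_prime[OF insert.prems(2)]] by blast
  then show ?case
  proof
    assume "p dvd x"
    then show ?thesis using mirr_dvd_eq[OF insert.prems(2), of x] insert.prems(1) by simp
  qed (use insert in simp)
qed

lemma pdivs_prod:
  assumes "finite Ps" "\<And>p. p \<in> Ps \<Longrightarrow> mirr p" shows "pdivs (\<Prod>Ps) = Ps"
proof
  show "pdivs (\<Prod>Ps) \<subseteq> Ps" unfolding pdivs_def using mirr_dvd_prod[OF assms] by blast
  show "Ps \<subseteq> pdivs (\<Prod>Ps)" unfolding pdivs_def using assms dvd_prodI[OF assms(1), of _ "\<lambda>p. p"] by blast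
qed

lemma multiplicity_prod:
  assumes Ps: "finite Ps" "\<And>p. p \<in> Ps \<Longrightarrow> mirr p" and p: "p \<in> Ps"
  shows "(GREATEST e. p ^ e dvd \<Prod>Ps) = 1"
proof (rule Greatest_equality)
  have e: "\<Prod>Ps = p * \<Prod>(Ps - {p})" using prod.remove[OF Ps(1) p] .
  show "p ^ 1 dvd \<Prod>Ps" unfolding e by simp
  fix k assume k: "p ^ k dvd \<Prod>Ps"
  show "k \<le> 1"
  proof (rule ccontr)
    assume "\<not> k \<le> 1"
    then have "p ^ 2 dvd p ^ k" by (intro le_imp_power_dvd) simp
    then have "p * p dvd p * \<Prod>(Ps - {p})" using k unfolding e power2_eq_square by (rule dvd_trans)
    moreover have "p \<noteq> 0" using Ps(2)[OF p] unfolding mirr_def by auto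
    ultimately have "p dvd \<Prod>(Ps - {p})" by simp
    then have "p \<in> Ps - {p}" using mirr_dvd_prod[of "Ps - {p}" p] Ps p by auto
    then show False by simp
  qed
qed

lemma divf_one: "divf k (1::'k::field poly) = 1"
proof -
  have "divtuples k (1::'k poly) = {\<lambda>i\<in>{1..k}. 1}"
  proof (intro equalityI subsetI)
    fix g assume g: "g \<in> divtuples k (1::'k poly)"
    have "g i = 1" if i: "i \<in> {1..k}" for i
    proof (rule monic_unit)
      have "g i dvd (\<Prod>i\<in>{1..k}. g i)" by (rule dvd_prodI[OF _ i]) simp
      then show "g i dvd 1" using g unfolding divtuples_def by simp
      show "lead_coeff (g i) = 1" using g i unfolding divtuples_def PiE_iff by blast
    qed
    then have "g = (\<lambda>i\<in>{1..k}. 1)" using g unfolding divtuples_def by (auto simp: PiE_iff extensional_def restrict_def)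
    then show "g \<in> {\<lambda>i\<in>{1..k}. 1}" by simp
  next
    fix g :: "nat \<Rightarrow> 'k poly" assume "g \<in> {\<lambda>i\<in>{1..k}. 1}"
    then show "g \<in> divtuples k 1" unfolding divtuples_def by (auto simp: PiE_iff extensional_def)
  qed
  then show ?thesis unfolding divf_def by simp
qed

text \<open>A factorisation of \<open>p * f\<close> arises from one of \<open>f\<close> by choosing
  the slot that receives \<open>p\<close>. The slot can be recovered because \<open>p\<close>
  divides no factor of \<open>f\<close>.\<close>

lemma divf_mult_prime:
  assumes p: "mirr p" and nd: "\<not> p dvd f"
  shows "divf k (p * f) = k * divf k f"
proof -
  define h where "h = (\<lambda>u :: nat \<times> (nat \<Rightarrow> 'a poly). (snd u)(fst u := p * snd u (fst u)))"
  have p0: "p \<noteq> 0" using p unfolding mirr_def by auto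
  have ndi: "\<not> p dvd g j" if "g \<in> divtuples k f" "j \<in> {1..k}" for g j
  proof
    assume "p dvd g j"
    moreover have "g j dvd f" using that dvd_prodI[of "{1..k}" j g] unfolding divtuples_def by simp
    ultimately show False using nd dvd_trans by blast
  qed
  have "bij_betw h ({1..k} \<times> divtuples k f) (divtuples k (p * f))"
    unfolding bij_betw_def
  proof (intro conjI equalityI)
    show "inj_on h ({1..k} \<times> divtuples k f)"
    proof (rule inj_onI)
      fix u v assume u: "u \<in> {1..k} \<times> divtuples k f" and v: "v \<in> {1..k} \<times> divtuples k f" and e: "h u = h v"
      have fs: "fst u = fst v"
      proof (rule ccontr)
        assume ne: "fst u \<noteq> fst v"
        have "p * snd u (fst u) = snd v (fst u)" using fun_cong[OF e, of "fst u"] ne unfolding h_def by simp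
        then have "p dvd snd v (fst u)" by (metis dvd_triv_left)
        then show False using ndi[of "snd v" "fst u"] u v by auto
      qed
      have "snd u j = snd v j" for j
      proof (cases "j = fst u")
        case True
        then show ?thesis using fun_cong[OF e, of j] fs p0 unfolding h_def by simp
      next
        case False
        then show ?thesis using fun_cong[OF e, of j] fs unfolding h_def by simp
      qed
      then show "u = v" using fs by (simp add: prod_eq_iff fun_eq_iff)
    qed
    show "h ` ({1..k} \<times> divtuples k f) \<subseteq> divtuples k (p * f)"
    proof (rule image_subsetI)
      fix u assume u: "u \<in> {1..k} \<times> divtuples k f"
      then have i: "fst u \<in> {1..k}" and g: "snd u \<in> divtuples k f" by auto
      have "(\<Prod>j\<in>{1..k}. h u j) = (p * snd u (fst u)) * (\<Prod>j\<in>{1..k} - {fst u}. h u j)"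
        using prod.remove[OF _ i, of "h u"] unfolding h_def by simp
      also have "(\<Prod>j\<in>{1..k} - {fst u}. h u j) = (\<Prod>j\<in>{1..k} - {fst u}. snd u j)"
        by (rule prod.cong) (auto simp: h_def)
      also have "p * snd u (fst u) * \<dots> = p * (\<Prod>j\<in>{1..k}. snd u j)"
        using prod.remove[OF _ i, of "snd u"] by (simp add: mult.assoc)
      also have "\<dots> = p * f" using g unfolding divtuples_def by simp
      finally have "(\<Prod>j\<in>{1..k}. h u j) = p * f" .
      moreover have "h u \<in> {1..k} \<rightarrow>\<^sub>E {h. lead_coeff h = 1}"
        using g i p unfolding divtuples_def h_def mirr_def PiE_iff extensional_def by (auto simp: lead_coeff_mult)
      ultimately show "h u \<in> divtuples k (p * f)" unfolding divtuples_def by simp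
    qed
    show "divtuples k (p * f) \<subseteq> h ` ({1..k} \<times> divtuples k f)"
    proof
      fix g assume g: "g \<in> divtuples k (p * f)"
      have "p dvd (\<Prod>i\<in>{1..k}. g i)" using g dvd_triv_left[of p f] unfolding divtuples_def by simp
      moreover have "\<exists>i\<in>A. p dvd g i" if "finite A" "p dvd (\<Prod>i\<in>A. g i)" for A
        using that
      proof (induction A rule: finite_induct)
        case empty
        then show ?case using p irreducible_not_unit unfolding mirr_def by auto
      next
        case (insert y A)
        then show ?case using prime_elem_dvd_mult_iff[OF mirr_prime[OF p]] by auto
      qed
      ultimately obtain i where i: "i \<in> {1..k}" "p dvd g i" by blast
      then obtain c where c: "g i = p * c" by blast
      define g' where "g' = g(i := c)"
      have lc: "lead_coeff c = 1"
      proof -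
        have "lead_coeff (g i) = 1" using g i(1) unfolding divtuples_def PiE_iff by blast
        then show ?thesis using p unfolding c lead_coeff_mult mirr_def by simp
      qed
      have hg: "h (i, g') = g" unfolding h_def g'_def using c by (auto simp: fun_eq_iff)
      have "p * f = (\<Prod>j\<in>{1..k}. g j)" using g unfolding divtuples_def by simp
      also have "\<dots> = p * c * (\<Prod>j\<in>{1..k} - {i}. g j)" using prod.remove[OF _ i(1), of g] c by simp
      also have "(\<Prod>j\<in>{1..k} - {i}. g j) = (\<Prod>j\<in>{1..k} - {i}. g' j)" by (rule prod.cong) (auto simp: g'_def)
      also have "p * c * \<dots> = p * (\<Prod>j\<in>{1..k}. g' j)" using prod.remove[OF _ i(1), of g'] by (simp add: g'_def mult.assoc)
      finally have "f = (\<Prod>j\<in>{1..k}. g' j)" using p0 by simp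
      moreover have "g' \<in> {1..k} \<rightarrow>\<^sub>E {h. lead_coeff h = 1}"
        using g i(1) lc unfolding divtuples_def g'_def PiE_iff extensional_def by auto
      ultimately have "(i, g') \<in> {1..k} \<times> divtuples k f" using i(1) unfolding divtuples_def by simp
      then show "g \<in> h ` ({1..k} \<times> divtuples k f)" using hg by (metis imageI)
    qed
  qed
  then have "card ({1..k} \<times> divtuples k f) = card (divtuples k (p * f))" by (rule bij_betw_same_card)
  then show ?thesis unfolding divf_def by (simp add: card_cartesian_product)
qed

lemma divf_prod:
  assumes "finite Ps" "\<And>p. p \<in> Ps \<Longrightarrow> mirr p" shows "divf k (\<Prod>Ps) = k ^ card Ps"
  using assms
proof (induction Ps rule: finite_induct)
  case empty
  then show ?case by (simp add: divf_one)
next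
  case (insert x F)
  have "\<not> x dvd \<Prod>F" using mirr_dvd_prod[of F x] insert by auto
  then show ?case using divf_mult_prime[of x "\<Prod>F" k] insert by simp
qed

text \<open>Squarefree monic polynomials are presented as products of finite sets of monic
  irreducibles. Injectivity of \<open>h\<close> turns equality of values into equality of the
  numbers of factors; \<open>h\<close> is the identity or \<open>c \<mapsto> k ^ c\<close>, the
  latter injective for \<open>2 \<le> k\<close>.\<close>

definition nice :: "('k::field poly \<Rightarrow> nat) \<Rightarrow> bool" where
  "nice \<alpha> \<longleftrightarrow> (\<exists>h. inj h \<and> (\<forall>Ps. finite Ps \<longrightarrow> (\<forall>p\<in>Ps. mirr p) \<longrightarrow> \<alpha> (\<Prod>Ps) = h (card Ps)))"

lemma nice_somega: "nice somega"
  unfolding nice_def somega_def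
proof (intro exI[of _ id] conjI allI impI)
  fix Ps :: "'a poly set" assume Ps: "finite Ps" "\<forall>p\<in>Ps. mirr p"
  have "pdivs (\<Prod>Ps) = Ps" by (rule pdivs_prod[OF Ps(1)]) (use Ps(2) in blast)
  then show "card (pdivs (\<Prod>Ps)) = id (card Ps)" by simp
qed simp

lemma nice_bomega: "nice bomega"
  unfolding nice_def
proof (intro exI[of _ id] conjI allI impI)
  fix Ps :: "'a poly set" assume Ps: "finite Ps" "\<forall>p\<in>Ps. mirr p"
  have "bomega (\<Prod>Ps) = (\<Sum>p\<in>Ps. GREATEST e. p ^ e dvd \<Prod>Ps)" unfolding bomega_def using Ps pdivs_prod by metis
  also have "\<dots> = (\<Sum>p\<in>Ps. 1)" by (rule sum.cong[OF refl]) (use multiplicity_prod[of Ps] Ps in blast)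
  finally show "bomega (\<Prod>Ps) = id (card Ps)" by simp
qed simp

lemma nice_divf: "2 \<le> k \<Longrightarrow> nice (divf k)"
  unfolding nice_def
  by (intro exI[of _ "\<lambda>c. k ^ c"] conjI allI impI divf_prod) (auto intro!: injI)

section \<open>Frobenius cycles and irreducible factors\<close>

text \<open>Raising the coefficients of the product to the \<open>q\<close>-th power permutes its
  linear factors. The coefficients are therefore fixed by Frobenius and lie in the finite
  field.\<close>

lemma frobenius_closed_poly:
  fixes x :: "nat \<Rightarrow> 'k::field alg_closure"
  assumes fin: "finite (UNIV :: 'k set)" and pp: "primepow (card (UNIV :: 'k set))"
    and s: "bij_betw s C C" and x: "\<And>i. i \<in> C \<Longrightarrow> x i ^ card (UNIV :: 'k set) = x (s i)"
  shows "\<exists>g::'k poly. ac_poly g = (\<Prod>i\<in>C. [:- x i, 1:])"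
proof -
  let ?q = "card (UNIV :: 'k set)"
  obtain kk where q: "prime CHAR('k)" "?q = CHAR('k) ^ kk" using primepow_card_CHAR[OF fin pp] by blast
  have q0: "0 < ?q" using fin by (simp add: finite_UNIV_card_ge_0)
  have add: "(a + b) ^ ?q = a ^ ?q + b ^ ?q" for a b :: "'k alg_closure"
    by (rule freshmans_dream'[of ?q kk]) (use q in simp_all)
  have sm: "sum f A ^ ?q = (\<Sum>i\<in>A. f i ^ ?q)" for A and f :: "nat \<Rightarrow> 'k alg_closure"
    by (rule freshmans_dream_sum'[of ?q kk]) (use q in simp_all)
  have neg: "(- a) ^ ?q = - (a ^ ?q)" for a :: "'k alg_closure"
  proof -
    have "(- a + a) ^ ?q = (- a) ^ ?q + a ^ ?q" by (rule add)
    then have "(- a) ^ ?q + a ^ ?q = 0" using q0 by (simp add: zero_power)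
    then show ?thesis by (rule eq_neg_iff_add_eq_0[THEN iffD2])
  qed
  define F where "F = map_poly (\<lambda>z :: 'k alg_closure. z ^ ?q)"
  have cF: "coeff (F p) i = coeff p i ^ ?q" for p i unfolding F_def by (rule coeff_map_poly) (simp add: q0 zero_power)
  have Fm: "F (a * b) = F a * F b" for a b
    by (rule poly_eqI) (simp add: cF coeff_mult sm power_mult_distrib)
  have F1: "F 1 = 1" by (rule poly_eqI) (simp add: cF q0 zero_power)
  have Fp: "F (\<Prod>i\<in>A. f i) = (\<Prod>i\<in>A. F (f i))" for A and f :: "nat \<Rightarrow> 'k alg_closure poly"
    by (induction A rule: infinite_finite_induct) (auto simp: F1 Fm)
  have Fl: "F [:- z, 1:] = [:- (z ^ ?q), 1:]" for z
    by (rule poly_eqI) (auto simp: cF coeff_pCons neg q0 zero_power split: nat.splits)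
  define G where "G = (\<Prod>i\<in>C. [:- x i, 1:])"
  have "F G = (\<Prod>i\<in>C. [:- x (s i), 1:])" unfolding G_def Fp Fl by (rule prod.cong) (auto simp: x)
  also have "\<dots> = G" unfolding G_def by (rule prod.reindex_bij_betw[OF s])
  finally have "coeff G i ^ ?q = coeff G i" for i using cF[of G i] by simp
  then have "\<forall>i. \<exists>c. coeff G i = to_ac c" using fixed_iff_range_to_ac[OF fin] by (metis imageE)
  then obtain c where c: "\<And>i. coeff G i = to_ac (c i)" by metis
  define g where "g = (\<Sum>m<Suc (degree G). monom (c m) m)"
  have "ac_poly g = G"
  proof (rule poly_eqI)
    fix i
    show "coeff (ac_poly g) i = coeff G i"
      unfolding coeff_ac_poly g_def coeff_sum_monom using c[of i] coeff_eq_0[of G i] by auto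
  qed
  then show ?thesis unfolding G_def by blast
qed

lemma orbit_eq_of_mem:
  assumes "permutation f" "y \<in> orbit f x" shows "orbit f y = orbit f x"
proof -
  have "x \<in> orbit f y" by (rule orbit_swap[OF permutation_self_in_orbit[OF assms(1)] assms(2)])
  then show ?thesis using assms(2) orbit_trans by (metis subsetI subset_antisym)
qed

text \<open>For a permutation of \<open>{..<n}\<close> this is the number of cycles, fixed points
  included.\<close>

definition ncyc :: "nat \<Rightarrow> (nat \<Rightarrow> nat) \<Rightarrow> nat" where
  "ncyc n s = card (orbit s ` {..<n})"

lemma permutes_lessThan_permutation: "s permutes {..<n::nat} \<Longrightarrow> permutation s"
  using permutation_permutes finite_lessThan by blast

text \<open>The irreducible factors are the products over the cycles of Frobenius. Such a product is
  defined over the finite field, and the roots of a nonconstant divisor of it are closed under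
  Frobenius, hence exhaust the cycle.\<close>

lemma labelled_factorization:
  fixes f :: "'k::field poly"
  assumes fin: "finite (UNIV :: 'k set)" and pp: "primepow (card (UNIV :: 'k set))"
    and x: "inj_on x {..<n}" "ac_poly f = (\<Prod>i<n. [:- x i, 1:])"
    and s: "s permutes {..<n}" "\<And>i. i < n \<Longrightarrow> x i ^ card (UNIV :: 'k set) = x (s i)"
  shows "\<exists>Ps. finite Ps \<and> (\<forall>p\<in>Ps. mirr p) \<and> f = \<Prod>Ps \<and> card Ps = ncyc n s"
proof -
  let ?q = "card (UNIV :: 'k set)"
  have q0: "0 < ?q" using fin by (simp add: finite_UNIV_card_ge_0)
  note perm = permutes_lessThan_permutation[OF s(1)]
  define Os where "Os = orbit s ` {..<n}"
  have Csub: "C \<subseteq> {..<n}" if "C \<in> Os" for C using that permutes_orbit_subset[OF s(1)] unfolding Os_def by auto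
  have Cmem: "orbit s i = C" if "C \<in> Os" "i \<in> C" for C i
    using that orbit_eq_of_mem[OF perm] unfolding Os_def by auto
  have Cne: "C \<noteq> {}" if "C \<in> Os" for C using that orbit_nonempty[of s] unfolding Os_def by blast
  have Cbij: "bij_betw s C C" if C: "C \<in> Os" for C
  proof -
    have "s ` C \<subseteq> C"
    proof (rule image_subsetI)
      fix i assume "i \<in> C"
      then show "s i \<in> C" using Cmem[OF C] orbit.base[of s i] by simp
    qed
    moreover have "inj_on s C" using permutes_inj_on[OF s(1)] .
    ultimately show ?thesis unfolding bij_betw_def using endo_inj_surj finite_subset[OF Csub[OF C]] by blast
  qed
  have "\<forall>C\<in>Os. \<exists>g::'k poly. ac_poly g = (\<Prod>i\<in>C. [:- x i, 1:])"
    using frobenius_closed_poly[OF fin pp Cbij] s(2) Csub by (metis lessThan_iff subsetD)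
  then obtain P where P: "\<And>C. C \<in> Os \<Longrightarrow> ac_poly (P C :: 'k poly) = (\<Prod>i\<in>C. [:- x i, 1:])" by metis
  have finC: "finite C" if "C \<in> Os" for C using finite_subset[OF Csub[OF that]] by simp
  have rootP: "poly (ac_poly (P C)) z = 0 \<longleftrightarrow> z \<in> x ` C" if "C \<in> Os" for C z
    unfolding P[OF that] poly_prod using finC[OF that] by auto
  have degP: "degree (P C) = card C \<and> lead_coeff (P C) = 1" if C: "C \<in> Os" for C
  proof -
    have d: "degree (ac_poly (P C)) = card C" unfolding P[OF C] by (simp add: degree_prod_eq_sum_degree)
    have "lead_coeff (ac_poly (P C)) = 1" unfolding P[OF C] by (simp add: lead_coeff_prod)
    then have "to_ac (lead_coeff (P C)) = to_ac 1" by (simp del: to_ac_eq_iff)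
    then show ?thesis using d by (simp only: degree_ac_poly to_ac_eq_iff)
  qed
  have big: "card C \<le> degree a" if C: "C \<in> Os" and a: "a dvd P C" "\<not> a dvd 1" for C a
  proof -
    have P0: "P C \<noteq> 0" using degP[OF C] by auto
    then have a0: "a \<noteq> 0" using a(1) by auto
    have "degree a \<noteq> 0"
    proof
      assume "degree a = 0"
      then obtain d where d: "a = [:d:]" using degree_eq_zeroE by blast
      then have "a dvd 1" using a0 by (simp add: is_unit_poly_iff dvd_field_iff)
      then show False using a(2) by blast
    qed
    then have "0 < degree (ac_poly a)" by simp
    then obtain z where z: "poly (ac_poly a) z = 0" using alg_closed_imp_poly_has_root by blast
    have sub: "ac_poly a dvd ac_poly (P C)" using a(1) by (auto elim!: dvdE simp: ac_poly_mult)
    then have "poly (ac_poly (P C)) z = 0" using z by (auto elim!: dvdE)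
    then obtain i where i: "i \<in> C" "z = x i" using rootP[OF C] by blast
    have all: "poly (ac_poly a) (x j) = 0" if "j \<in> orbit s i" for j
      using that
    proof induction
      case base
      have "poly (ac_poly a) (x i ^ ?q) = 0" using z i unfolding ac_poly_frob[OF fin pp] by (simp add: q0 zero_power)
      then show ?case using s(2)[of i] i(1) Csub[OF C] by auto
    next
      case (step y)
      have "poly (ac_poly a) (x y ^ ?q) = 0" using step.IH unfolding ac_poly_frob[OF fin pp] by (simp add: q0 zero_power)
      moreover have "y < n" using step.hyps Cmem[OF C i(1)] Csub[OF C] by auto
      ultimately show ?case using s(2)[of y] by auto
    qed
    have "x ` C \<subseteq> {z. poly (ac_poly a) z = 0}" using all Cmem[OF C i(1)] by auto
    moreover have "ac_poly a \<noteq> 0" using a0 by (metis degree_ac_poly \<open>0 < degree (ac_poly a)\<close> degree_0 less_irrefl)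
    ultimately have "card (x ` C) \<le> degree (ac_poly a)"
      using card_mono[OF poly_roots_finite, of "ac_poly a" "x ` C"] card_poly_roots_bound[of "ac_poly a"] by linarith
    moreover have "card (x ` C) = card C" by (rule card_image) (rule inj_on_subset[OF x(1) Csub[OF C]])
    ultimately show ?thesis by simp
  qed
  have irr: "mirr (P C)" if C: "C \<in> Os" for C
    unfolding mirr_def
  proof (intro conjI irreducibleI)
    have P0: "P C \<noteq> 0" using degP[OF C] by auto
    show "P C \<noteq> 0" by (rule P0)
    have cpos: "0 < card C" using Cne[OF C] finC[OF C] by (simp add: card_gt_0_iff)
    show "\<not> P C dvd 1" using degP[OF C] cpos by (auto simp: is_unit_poly_iff)
    show "lead_coeff (P C) = 1" using degP[OF C] by blast
    fix a b assume ab: "P C = a * b"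
    show "a dvd 1 \<or> b dvd 1"
    proof (rule ccontr)
      assume "\<not> ?thesis"
      then have "card C \<le> degree a" "card C \<le> degree b" using big[OF C, of a] big[OF C, of b] ab by simp_all
      moreover have "degree a + degree b = card C" using degP[OF C] P0 unfolding ab by (metis degree_mult_eq mult_zero_left mult_zero_right)
      ultimately show False using cpos by simp
    qed
  qed
  have injP: "inj_on P Os"
  proof (rule inj_onI)
    fix C D assume CD: "C \<in> Os" "D \<in> Os" "P C = P D"
    then have "x ` C = x ` D" using rootP[OF CD(1)] rootP[OF CD(2)] by auto
    then show "C = D" using inj_on_image_eq_iff[OF x(1) Csub[OF CD(1)] Csub[OF CD(2)]] by blast
  qed
  have finO: "finite Os" unfolding Os_def by simp
  have UO: "\<Union>Os = {..<n}"
  proof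
    show "\<Union>Os \<subseteq> {..<n}" using Csub by blast
    show "{..<n} \<subseteq> \<Union>Os" using permutation_self_in_orbit[OF perm] unfolding Os_def by blast
  qed
  have "ac_poly (\<Prod>C\<in>Os. P C) = (\<Prod>C\<in>Os. \<Prod>i\<in>C. [:- x i, 1:])"
    unfolding ac_poly_prod by (rule prod.cong) (use P in auto)
  also have "\<dots> = (\<Prod>i\<in>\<Union>Os. [:- x i, 1:])"
  proof (rule prod.Union_disjoint[symmetric, unfolded comp_def])
    show "\<forall>A\<in>Os. finite A" using finC by blast
    show "\<forall>A\<in>Os. \<forall>B\<in>Os. A \<noteq> B \<longrightarrow> A \<inter> B = {}" using Cmem by blast
  qed
  also have "\<dots> = ac_poly f" using UO x(2) by simp
  finally have "f = (\<Prod>C\<in>Os. P C)" unfolding ac_poly_eq_iff by simp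
  also have "\<dots> = \<Prod>(P ` Os)" using prod.reindex[OF injP, of "\<lambda>p. p"] by simp
  finally have "f = \<Prod>(P ` Os)" .
  moreover have "card (P ` Os) = ncyc n s" using card_image[OF injP] unfolding ncyc_def Os_def by simp
  ultimately show ?thesis using irr finO by (intro exI[of _ "P ` Os"]) auto
qed

section \<open>Cycle counts and Stirling numbers\<close>

text \<open>The composition inserts the new point \<open>n\<close> into a cycle of \<open>p\<close>,
  immediately before \<open>b\<close>. The cycles of both permutations therefore correspond to each
  other under \<Phi>.\<close>

lemma ncyc_insert:
  assumes p: "p permutes {..<n}" and b: "b < n"
  shows "ncyc (Suc n) (Transposition.transpose n b \<circ> p) = ncyc n p"
proof -
  define \<sigma> where "\<sigma> = Transposition.transpose n b \<circ> p"
  have pn: "p n = n" using p by (simp add: permutes_not_in)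
  have plt: "p i < n" if "i < n" for i using permutes_in_image[OF p, of i] that by simp
  have \<sigma>n: "\<sigma> n = b" unfolding \<sigma>_def by (simp add: pn)
  have \<sigma>i: "\<sigma> i = (if p i = b then n else p i)" if "i < n" for i
    unfolding \<sigma>_def using plt[OF that] by (auto simp: Transposition.transpose_def)
  have "\<sigma> permutes {..<Suc n}" unfolding \<sigma>_def
    using permutes_compose[OF permutes_subset[OF p, of "{..<Suc n}"] permutes_swap_id[of n "{..<Suc n}" b]] b by auto
  then have perm: "permutation \<sigma>" by (rule permutes_lessThan_permutation)
  define \<Phi> where "\<Phi> = (\<lambda>A. if b \<in> A then insert n A else A)"
  have sub: "orbit p i \<subseteq> {..<n}" if "i < n" for i using permutes_orbit_subset[OF p] that by simp
  have orb: "orbit \<sigma> i = \<Phi> (orbit p i)" if i: "i < n" for i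
  proof
    show "orbit \<sigma> i \<subseteq> \<Phi> (orbit p i)"
    proof
      fix y assume "y \<in> orbit \<sigma> i"
      then show "y \<in> \<Phi> (orbit p i)"
      proof induction
        case base
        show ?case using \<sigma>i[OF i] orbit.base[of p i] unfolding \<Phi>_def by auto
      next
        case (step y)
        show ?case
        proof (cases "y = n")
          case True
          then have "b \<in> orbit p i" using step.IH sub[OF i] unfolding \<Phi>_def by (auto split: if_splits)
          then show ?thesis using True \<sigma>n unfolding \<Phi>_def by simp
        next
          case False
          then have y: "y \<in> orbit p i" using step.IH unfolding \<Phi>_def by (auto split: if_splits)
          then have "y < n" using sub[OF i] by auto
          then show ?thesis using \<sigma>i[of y] orbit.step[OF y] unfolding \<Phi>_def by auto
        qed
      qed
    qed
    have s1: "y \<in> orbit \<sigma> i" if "y \<in> orbit p i" for y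
      using that
    proof induction
      case base
      show ?case
      proof (cases "p i = b")
        case True
        then have "\<sigma> (\<sigma> i) = p i" using \<sigma>i[OF i] \<sigma>n by simp
        then show ?thesis using orbit.step[OF orbit.base[of \<sigma> i]] by simp
      next
        case False
        then show ?thesis using \<sigma>i[OF i] orbit.base[of \<sigma> i] by simp
      qed
    next
      case (step y)
      have y: "y < n" using step.hyps sub[OF i] by auto
      show ?case
      proof (cases "p y = b")
        case True
        then have "\<sigma> (\<sigma> y) = p y" using \<sigma>i[OF y] \<sigma>n by simp
        then show ?thesis using orbit.step[OF orbit.step[OF step.IH]] by simp
      next
        case False
        then show ?thesis using \<sigma>i[OF y] orbit.step[OF step.IH] by simp
      qed
    qed
    have "n \<in> orbit \<sigma> i" if "b \<in> orbit p i"
    proof -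
      have "orbit \<sigma> b = orbit \<sigma> i" by (rule orbit_eq_of_mem[OF perm s1[OF that]])
      moreover have "orbit \<sigma> b = orbit \<sigma> n" using orbit.base[of \<sigma> n] \<sigma>n orbit_eq_of_mem[OF perm] by simp
      ultimately show ?thesis using permutation_self_in_orbit[OF perm, of n] by simp
    qed
    then show "\<Phi> (orbit p i) \<subseteq> orbit \<sigma> i" using s1 unfolding \<Phi>_def by auto
  qed
  have "orbit \<sigma> n = orbit \<sigma> b" using orbit.base[of \<sigma> n] \<sigma>n orbit_eq_of_mem[OF perm] by simp
  then have "orbit \<sigma> ` {..<Suc n} = orbit \<sigma> ` {..<n}" using b by (auto simp: lessThan_Suc)
  also have "\<dots> = \<Phi> ` (orbit p ` {..<n})" using orb by (auto simp: image_image)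
  finally have "ncyc (Suc n) \<sigma> = card (\<Phi> ` (orbit p ` {..<n}))" unfolding ncyc_def by simp
  also have "\<dots> = ncyc n p" unfolding ncyc_def
  proof (rule card_image, rule inj_onI)
    fix A B assume AB: "A \<in> orbit p ` {..<n}" "B \<in> orbit p ` {..<n}" "\<Phi> A = \<Phi> B"
    then have "n \<notin> A" "n \<notin> B" using sub by auto
    then show "A = B" using AB(3) unfolding \<Phi>_def by (auto split: if_splits)
  qed
  finally show ?thesis unfolding \<sigma>_def .
qed

lemma ncyc_fixed:
  assumes p: "p permutes {..<n}" shows "ncyc (Suc n) p = Suc (ncyc n p)"
proof -
  have "orbit p n = {n}" using p by (simp add: orbit_eq_singleton_iff permutes_not_in)
  moreover have "orbit p i \<subseteq> {..<n}" if "i < n" for i using permutes_orbit_subset[OF p] that by simp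
  ultimately have "orbit p ` {..<Suc n} = insert {n} (orbit p ` {..<n})" "{n} \<notin> orbit p ` {..<n}"
    by (auto simp: lessThan_Suc)
  then show ?thesis unfolding ncyc_def by simp
qed

text \<open>A permutation of \<open>Suc n\<close> points either fixes the last point, which adds a
  cycle, or arises by inserting it at one of \<open>n\<close> places, which adds none. This is the
  recurrence of the Stirling numbers.\<close>

lemma card_ncyc_eq_stirling: "card {s. s permutes {..<n} \<and> ncyc n s = c} = stirling n c"
proof (induction n arbitrary: c)
  case 0
  have "{s. s permutes {..<0::nat} \<and> ncyc 0 s = c} = (if c = 0 then {id} else {})"
    by (auto simp: ncyc_def)
  then show ?case by (cases c) auto
next
  case (Suc n)
  define A where "A = (\<lambda>c. {s. s permutes {..<n} \<and> ncyc n s = c})"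
  define h where "h = (\<lambda>u :: nat \<times> (nat \<Rightarrow> nat). Transposition.transpose n (fst u) \<circ> snd u)"
  define B where "B = {p. p permutes {..<n} \<and> Suc (ncyc n p) = c}"
  have finA: "finite (A c)" for c unfolding A_def by (rule finite_subset[OF _ finite_permutations[of "{..<n}"]]) auto
  have finB: "finite B" unfolding B_def by (rule finite_subset[OF _ finite_permutations[of "{..<n}"]]) auto
  have hn: "h (b, p) n = b" if "p permutes {..<n}" for b p unfolding h_def using that by (simp add: permutes_not_in)
  have hh: "Transposition.transpose n b \<circ> h (b, p) = p" for b p unfolding h_def by (simp add: o_assoc)
  have inj: "inj_on h ({..<n} \<times> A c)"
  proof (rule inj_onI)
    fix u v assume uv: "u \<in> {..<n} \<times> A c" "v \<in> {..<n} \<times> A c" "h u = h v"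
    obtain b p where u: "u = (b, p)" by (cases u)
    obtain b' p' where v: "v = (b', p')" by (cases v)
    have bb: "b = b'" using hn[of p b] hn[of p' b'] uv unfolding u v A_def by auto
    have "p = Transposition.transpose n b \<circ> h u" unfolding u hh ..
    also have "\<dots> = p'" unfolding uv(3) bb unfolding v hh ..
    finally show "u = v" using bb u v by simp
  qed
  have eq: "{s. s permutes {..<Suc n} \<and> ncyc (Suc n) s = c} = h ` ({..<n} \<times> A c) \<union> B"
  proof (intro equalityI subsetI)
    fix s assume s: "s \<in> {s. s permutes {..<Suc n} \<and> ncyc (Suc n) s = c}"
    then have "s \<in> {p. p permutes insert n {..<n}}" by (simp add: lessThan_Suc)
    then obtain b p where bp: "s = Transposition.transpose n b \<circ> p" "b \<in> insert n {..<n}" "p permutes {..<n}"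
      unfolding permutes_insert by auto
    show "s \<in> h ` ({..<n} \<times> A c) \<union> B"
    proof (cases "b = n")
      case True
      then have "s = p" using bp(1) by simp
      then show ?thesis using s bp(3) ncyc_fixed[OF bp(3)] unfolding B_def by simp
    next
      case False
      then have b: "b < n" using bp(2) by simp
      then have "(b, p) \<in> {..<n} \<times> A c" using s bp ncyc_insert[OF bp(3) b] unfolding A_def by simp
      then show ?thesis using bp(1) unfolding h_def by (metis (no_types, lifting) UnI1 fst_conv image_eqI snd_conv)
    qed
  next
    fix s assume "s \<in> h ` ({..<n} \<times> A c) \<union> B"
    then show "s \<in> {s. s permutes {..<Suc n} \<and> ncyc (Suc n) s = c}"
    proof
      assume "s \<in> h ` ({..<n} \<times> A c)"
      then obtain b p where bp: "s = Transposition.transpose n b \<circ> p" "b < n" "p permutes {..<n}" "ncyc n p = c"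
        unfolding h_def A_def by auto
      have "s permutes {..<Suc n}" unfolding bp(1)
        using permutes_compose[OF permutes_subset[OF bp(3), of "{..<Suc n}"] permutes_swap_id[of n "{..<Suc n}" b]] bp(2) by auto
      then show ?thesis using ncyc_insert[OF bp(3,2)] bp(1,4) by simp
    next
      assume "s \<in> B"
      then show ?thesis using ncyc_fixed permutes_subset[of s "{..<n}" "{..<Suc n}"] unfolding B_def by auto
    qed
  qed
  have disj: "h ` ({..<n} \<times> A c) \<inter> B = {}"
  proof (rule ccontr)
    assume "h ` ({..<n} \<times> A c) \<inter> B \<noteq> {}"
    then obtain b p where bp: "b < n" "p permutes {..<n}" "h (b, p) permutes {..<n}" unfolding A_def B_def by auto
    then have "h (b, p) n = n" by (simp add: permutes_not_in)
    then show False using hn[OF bp(2)] bp(1) by simp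
  qed
  have "card {s. s permutes {..<Suc n} \<and> ncyc (Suc n) s = c} = card (h ` ({..<n} \<times> A c)) + card B"
    unfolding eq by (rule card_Un_disjoint) (use finA finB disj in auto)
  also have "card (h ` ({..<n} \<times> A c)) = n * stirling n c"
    using card_image[OF inj] Suc.IH[of c] unfolding A_def by (simp add: card_cartesian_product)
  finally have *: "card {s. s permutes {..<Suc n} \<and> ncyc (Suc n) s = c} = n * stirling n c + card B" .
  show ?case
  proof (cases c)
    case 0
    then have "B = {}" unfolding B_def by simp
    then show ?thesis using * 0 by (cases n) auto
  next
    case (Suc k)
    then have "B = {p. p permutes {..<n} \<and> ncyc n p = k}" unfolding B_def by simp
    then show ?thesis using * Suc Suc.IH[of k] by simp
  qed
qed

lemma ncyc_le: "ncyc n s \<le> n"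
  unfolding ncyc_def using card_image_le[of "{..<n}" "orbit s"] by simp

definition Seq :: "nat \<Rightarrow> nat \<Rightarrow> (nat \<Rightarrow> nat \<Rightarrow> nat) set" where
  "Seq n r = {\<sigma>\<in>Gset n r. \<forall>i<r. \<forall>j<r. ncyc n (\<sigma> i) = ncyc n (\<sigma> j)}"

lemma card_Gset: "card (Gset n r) = fact n ^ r"
  unfolding Gset_def by (simp add: card_PiE card_permutations)

lemma finite_Gset: "finite (Gset n r)"
  unfolding Gset_def by (intro finite_PiE) (auto simp: finite_permutations)

lemma card_Seq:
  assumes r: "1 \<le> r" shows "card (Seq n r) = (\<Sum>c\<le>n. stirling n c ^ r)"
proof -
  define A where "A = (\<lambda>c. {s. s permutes {..<n} \<and> ncyc n s = c})"
  have finA: "finite (A c)" for c unfolding A_def by (rule finite_subset[OF _ finite_permutations[of "{..<n}"]]) auto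
  have "Seq n r = (\<Union>c\<in>{..n}. PiE {..<r} (\<lambda>_. A c))"
  proof (intro equalityI subsetI)
    fix \<sigma> assume s: "\<sigma> \<in> Seq n r"
    have "\<sigma> j \<in> A (ncyc n (\<sigma> 0))" if "j < r" for j
    proof -
      have "\<sigma> j permutes {..<n}" using s that unfolding Seq_def Gset_def PiE_iff by blast
      moreover have "0 < r" using r by simp
      then have "ncyc n (\<sigma> j) = ncyc n (\<sigma> 0)" using s that unfolding Seq_def by blast
      ultimately show ?thesis unfolding A_def by blast
    qed
    moreover have "\<sigma> \<in> extensional {..<r}" using s unfolding Seq_def Gset_def PiE_iff by blast
    ultimately have "\<sigma> \<in> PiE {..<r} (\<lambda>_. A (ncyc n (\<sigma> 0)))" unfolding PiE_iff by blast
    then show "\<sigma> \<in> (\<Union>c\<in>{..n}. PiE {..<r} (\<lambda>_. A c))" using ncyc_le[of n "\<sigma> 0"] by blast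
  next
    fix \<sigma> assume "\<sigma> \<in> (\<Union>c\<in>{..n}. PiE {..<r} (\<lambda>_. A c))"
    then show "\<sigma> \<in> Seq n r" unfolding Seq_def Gset_def A_def by (auto simp: PiE_iff)
  qed
  then have "card (Seq n r) = (\<Sum>c\<in>{..n}. card (PiE {..<r} (\<lambda>_. A c)))"
  proof (simp only:, intro card_UN_disjoint ballI impI)
    show "finite {..n}" by simp
    show "finite (PiE {..<r} (\<lambda>_. A c))" for c :: nat using finA by (intro finite_PiE) auto
    fix c d :: nat assume "c \<noteq> d"
    show "PiE {..<r} (\<lambda>_. A c) \<inter> PiE {..<r} (\<lambda>_. A d) = {}"
    proof (rule ccontr)
      assume "PiE {..<r} (\<lambda>_. A c) \<inter> PiE {..<r} (\<lambda>_. A d) \<noteq> {}"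
      then obtain \<sigma> where \<sigma>: "\<sigma> \<in> PiE {..<r} (\<lambda>_. A c)" "\<sigma> \<in> PiE {..<r} (\<lambda>_. A d)" by blast
      have "0 \<in> {..<r}" using r by simp
      then have "\<sigma> 0 \<in> A c" "\<sigma> 0 \<in> A d" using PiE_mem[OF \<sigma>(1)] PiE_mem[OF \<sigma>(2)] by blast+
      then show False using \<open>c \<noteq> d\<close> unfolding A_def by simp
    qed
  qed
  also have "\<dots> = (\<Sum>c\<le>n. stirling n c ^ r)"
    by (rule sum.cong) (auto simp: card_PiE A_def card_ncyc_eq_stirling)
  finally show ?thesis .
qed

section \<open>Monic polynomials and the rarity of multiple roots\<close>

definition Mon :: "nat \<Rightarrow> 'k::field poly set" where
  "Mon n = {f. degree f = n \<and> coeff f n = 1}"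

lemma Mon_eq_image:
  assumes n: "0 < n" shows "(Mon n :: 'k::field poly set) = (\<lambda>g. monom 1 n + g) ` {g. degree g < n}"
proof (intro equalityI subsetI)
  fix f :: "'k poly" assume f: "f \<in> Mon n"
  have "degree (f - monom 1 n) \<le> n - 1"
  proof (rule degree_le, intro allI impI)
    fix i assume "n - 1 < i"
    then show "coeff (f - monom 1 n) i = 0" using f unfolding Mon_def by (cases "i = n") (auto simp: coeff_eq_0)
  qed
  then have "degree (f - monom 1 n) < n" using n by simp
  then show "f \<in> (\<lambda>g. monom 1 n + g) ` {g. degree g < n}" by (intro image_eqI[of _ _ "f - monom 1 n"]) auto
next
  fix f :: "'k poly" assume "f \<in> (\<lambda>g. monom 1 n + g) ` {g. degree g < n}"
  then obtain g where g: "f = monom 1 n + g" "degree g < n" by blast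
  then have c: "coeff f n = 1" by (simp add: coeff_eq_0)
  have "degree f \<le> n" unfolding g(1) by (rule degree_add_le) (use g(2) in \<open>auto simp: degree_monom_le\<close>)
  moreover have "n \<le> degree f" by (rule le_degree) (simp add: c)
  ultimately show "f \<in> Mon n" using c unfolding Mon_def by simp
qed

lemma card_Mon:
  assumes fin: "finite (UNIV :: 'k::field set)" and n: "0 < n"
  shows "finite (Mon n :: 'k poly set)" "card (Mon n :: 'k poly set) = card (UNIV :: 'k set) ^ n"
proof -
  have "inj_on (\<lambda>g :: 'k poly. monom 1 n + g) {g. degree g < n}" by (rule inj_onI) simp
  then show "card (Mon n :: 'k poly set) = card (UNIV :: 'k set) ^ n"
    unfolding Mon_eq_image[OF n] using card_polys_deg_less[OF fin, of n] n by (simp add: card_image)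
  show "finite (Mon n :: 'k poly set)" unfolding Mon_eq_image[OF n] using card_polys_deg_less[OF fin, of n] by simp
qed

lemma card_polys_coeff_zero:
  assumes fin: "finite (UNIV :: 'k::field set)" and m: "m < n"
  shows "card {g::'k poly. degree g < n \<and> coeff g m = 0} \<le> card (UNIV :: 'k set) ^ (n - 1)"
proof -
  let ?q = "card (UNIV :: 'k set)"
  let ?F = "{g::'k poly. degree g < n \<and> coeff g m = 0}"
  have q0: "0 < ?q" using fin by (simp add: finite_UNIV_card_ge_0)
  have inj: "inj_on (\<lambda>u. fst u + monom (snd u) m) (?F \<times> UNIV)"
  proof (rule inj_onI)
    fix u v assume uv: "u \<in> ?F \<times> (UNIV :: 'k set)" "v \<in> ?F \<times> (UNIV :: 'k set)"
      "fst u + monom (snd u) m = fst v + monom (snd v) m"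
    have "coeff (fst u) m = 0" "coeff (fst v) m = 0" using uv(1,2) by auto
    then have "snd u = snd v" using arg_cong[OF uv(3), of "\<lambda>p. coeff p m"] by simp
    then show "u = v" using uv(3) by (simp add: prod_eq_iff)
  qed
  have sub: "(\<lambda>u. fst u + monom (snd u) m) ` (?F \<times> UNIV) \<subseteq> {g. degree g < n}"
  proof (rule image_subsetI)
    fix u assume u: "u \<in> ?F \<times> (UNIV :: 'k set)"
    have "degree (monom (snd u) m) < n" using degree_monom_le[of "snd u" m] m by simp
    then show "fst u + monom (snd u) m \<in> {g. degree g < n}" using u by (auto intro: degree_add_less)
  qed
  have "card (?F \<times> (UNIV :: 'k set)) \<le> ?q ^ n"
    using card_inj_on_le[OF inj sub] card_polys_deg_less[OF fin, of n] m by simp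
  then have "card ?F * ?q \<le> ?q ^ (n - 1) * ?q" using m by (simp add: card_cartesian_product power_eq_if mult.commute)
  then show ?thesis using q0 by simp
qed

text \<open>Polynomials with zero linear coefficient are all given away. If that coefficient is
  nonzero, the derivative is nonzero in every characteristic and does not involve the constant term,
  so a double root forces the constant term to be one of at most \<open>n - 1\<close>
  values.\<close>

lemma card_nonsquarefree:
  assumes fin: "finite (UNIV :: 'k::field set)" and n: "2 \<le> n"
  shows "card {f\<in>Mon n :: 'k poly set. \<not> sqf (ac_poly f)} \<le> n * card (UNIV :: 'k set) ^ (n - 1)"
proof -
  let ?q = "card (UNIV :: 'k set)"
  define G where "G = {g::'k poly. degree g < n \<and> coeff g 1 = 0}"
  define H where "H = {g::'k poly. degree g < n \<and> coeff g 0 = 0 \<and> coeff g 1 \<noteq> 0}"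
  define m where "m = (\<lambda>h::'k poly. monom 1 n + h)"
  define bad where "bad = (\<lambda>h. {t. \<exists>z. poly (ac_poly (pderiv (m h))) z = 0 \<and> poly (ac_poly (m h)) z + to_ac t = 0})"
  have finD: "finite {g::'k poly. degree g < n}" using card_polys_deg_less[OF fin] by blast
  have finG: "finite G" "finite H" unfolding G_def H_def by (rule finite_subset[OF _ finD]; blast)+
  have cG: "card G \<le> ?q ^ (n - 1)" unfolding G_def by (rule card_polys_coeff_zero[OF fin]) (use n in simp)
  have "card H \<le> card {g::'k poly. degree g < n \<and> coeff g 0 = 0}"
    by (rule card_mono) (use finD in \<open>auto simp: H_def intro: finite_subset[OF _ finD]\<close>)
  also have "\<dots> \<le> ?q ^ (n - 1)" by (rule card_polys_coeff_zero[OF fin]) (use n in simp)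
  finally have cH: "card H \<le> ?q ^ (n - 1)" .
  have cb: "card (bad h) \<le> n - 1" if h: "h \<in> H" for h
  proof -
    have mM: "m h \<in> Mon n" unfolding m_def using Mon_eq_image[of n] n h unfolding H_def by auto
    have "coeff (pderiv (m h)) 0 = coeff h 1" unfolding coeff_pderiv m_def using n by simp
    then have p0: "ac_poly (pderiv (m h)) \<noteq> 0" using h unfolding H_def
      by (metis (mono_tags, lifting) coeff_0 coeff_ac_poly mem_Collect_eq to_ac_eq_0_iff)
    have "card (bad h) = card (to_ac ` bad h)" by (rule card_image[symmetric]) (auto intro: inj_onI)
    also have "\<dots> \<le> card ((\<lambda>z. - poly (ac_poly (m h)) z) ` {z. poly (ac_poly (pderiv (m h))) z = 0})"
    proof (rule card_mono)
      show "finite ((\<lambda>z. - poly (ac_poly (m h)) z) ` {z. poly (ac_poly (pderiv (m h))) z = 0})"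
        using poly_roots_finite[OF p0] by simp
      show "to_ac ` bad h \<subseteq> (\<lambda>z. - poly (ac_poly (m h)) z) ` {z. poly (ac_poly (pderiv (m h))) z = 0}"
        unfolding bad_def by (auto simp: add_eq_0_iff)
    qed
    also have "\<dots> \<le> card {z. poly (ac_poly (pderiv (m h))) z = 0}" by (rule card_image_le[OF poly_roots_finite[OF p0]])
    also have "\<dots> \<le> degree (pderiv (m h))" using card_poly_roots_bound[OF p0] by simp
    also have "\<dots> \<le> n - 1" using degree_pderiv_less[of "m h"] mM unfolding Mon_def by simp
    finally show ?thesis .
  qed
  have sub: "{f\<in>Mon n :: 'k poly set. \<not> sqf (ac_poly f)} \<subseteq> m ` G \<union> (\<Union>h\<in>H. (\<lambda>t. m h + [:t:]) ` bad h)"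
  proof
    fix f :: "'k poly" assume f: "f \<in> {f\<in>Mon n. \<not> sqf (ac_poly f)}"
    then obtain g where g: "f = m g" "degree g < n" using Mon_eq_image[of n] n unfolding m_def by auto
    show "f \<in> m ` G \<union> (\<Union>h\<in>H. (\<lambda>t. m h + [:t:]) ` bad h)"
    proof (cases "coeff g 1 = 0")
      case True
      then show ?thesis using g unfolding G_def by blast
    next
      case False
      define t where "t = coeff g 0"
      define h where "h = g - [:t:]"
      have "degree h < n" unfolding h_def by (rule degree_diff_less) (use g(2) n in auto)
      then have h: "h \<in> H" using False unfolding H_def h_def t_def by simp
      have fh: "f = m h + [:t:]" unfolding g(1) h_def m_def by simp
      obtain z where z: "poly (ac_poly f) z = 0" "poly (pderiv (ac_poly f)) z = 0" using f unfolding sqf_def by blast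
      have "pderiv f = pderiv (m h)" unfolding fh by (simp add: pderiv_add pderiv_pCons)
      then have "poly (ac_poly (pderiv (m h))) z = 0" using z(2) unfolding pderiv_ac_poly by simp
      moreover have "poly (ac_poly (m h)) z + to_ac t = 0" using z(1) unfolding fh ac_poly_add by (simp add: map_poly_pCons)
      ultimately have "t \<in> bad h" unfolding bad_def by blast
      then show ?thesis using h fh by blast
    qed
  qed
  have finb: "finite (bad h)" for h by (rule finite_subset[OF subset_UNIV fin])
  have "card {f\<in>Mon n :: 'k poly set. \<not> sqf (ac_poly f)} \<le> card (m ` G \<union> (\<Union>h\<in>H. (\<lambda>t. m h + [:t:]) ` bad h))"
    by (rule card_mono[OF _ sub]) (use finG finb in auto)
  also have "\<dots> \<le> card (m ` G) + card (\<Union>h\<in>H. (\<lambda>t. m h + [:t:]) ` bad h)" by (rule card_Un_le)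
  also have "\<dots> \<le> ?q ^ (n - 1) + (\<Sum>h\<in>H. n - 1)"
  proof (rule add_mono)
    show "card (m ` G) \<le> ?q ^ (n - 1)" using card_image_le[OF finG(1), of m] cG by linarith
    have "card (\<Union>h\<in>H. (\<lambda>t. m h + [:t:]) ` bad h) \<le> (\<Sum>h\<in>H. card ((\<lambda>t. m h + [:t:]) ` bad h))" by (rule card_UN_le[OF finG(2)])
    also have "\<dots> \<le> (\<Sum>h\<in>H. n - 1)" by (rule sum_mono) (use card_image_le[OF finb] cb le_trans in blast)
    finally show "card (\<Union>h\<in>H. (\<lambda>t. m h + [:t:]) ` bad h) \<le> (\<Sum>h\<in>H. n - 1)" .
  qed
  also have "\<dots> \<le> ?q ^ (n - 1) + ?q ^ (n - 1) * (n - 1)" using cH by simp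
  also have "\<dots> = n * ?q ^ (n - 1)" using n by (cases n) (auto simp: algebra_simps)
  finally show ?thesis .
qed

lemma Mon_shift: "(f :: 'k::field poly) \<in> Mon n \<Longrightarrow> degree a < n \<Longrightarrow> f + a \<in> Mon n"
  unfolding Mon_def by (auto simp: degree_add_eq_left coeff_eq_0)

lemma card_nonsquarefree_shifts:
  fixes a :: "nat \<Rightarrow> 'k::field poly"
  assumes fin: "finite (UNIV :: 'k set)" and n: "2 \<le> n" and a: "\<And>j. j < r \<Longrightarrow> degree (a j) < n"
  shows "card {f\<in>Mon n. \<exists>j<r. \<not> sqf (ac_poly (f + a j))} \<le> r * (n * card (UNIV :: 'k set) ^ (n - 1))"
proof -
  let ?B = "\<lambda>j. {f\<in>Mon n. \<not> sqf (ac_poly (f + a j))}"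
  have finM: "finite (Mon n :: 'k poly set)" using card_Mon(1)[OF fin] n by simp
  have "{f\<in>Mon n. \<exists>j<r. \<not> sqf (ac_poly (f + a j))} = (\<Union>j\<in>{..<r}. ?B j)" by auto
  then have "card {f\<in>Mon n. \<exists>j<r. \<not> sqf (ac_poly (f + a j))} \<le> (\<Sum>j<r. card (?B j))"
    using card_UN_le[of "{..<r}" ?B] by simp
  also have "\<dots> \<le> (\<Sum>j<r. n * card (UNIV :: 'k set) ^ (n - 1))"
  proof (rule sum_mono)
    fix j assume "j \<in> {..<r}"
    then have j: "j < r" by simp
    have "card (?B j) \<le> card {f\<in>Mon n :: 'k poly set. \<not> sqf (ac_poly f)}"
      by (rule card_inj_on_le[where f = "\<lambda>f. f + a j"]) (use Mon_shift a[OF j] finM in \<open>auto intro: inj_onI\<close>)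
    also have "\<dots> \<le> n * card (UNIV :: 'k set) ^ (n - 1)" by (rule card_nonsquarefree[OF fin n])
    finally show "card (?B j) \<le> n * card (UNIV :: 'k set) ^ (n - 1)" .
  qed
  finally show ?thesis by simp
qed

section \<open>Equidistribution for degree at least three\<close>

definition shifts_equal :: "('k::field poly \<Rightarrow> nat) \<Rightarrow> nat \<Rightarrow> (nat \<Rightarrow> 'k poly) \<Rightarrow> nat \<Rightarrow> 'k poly set" where
  "shifts_equal \<alpha> r a n = {f\<in>Mon n. \<forall>i<r. \<forall>j<r. \<alpha> (f + a i) = \<alpha> (f + a j)}"

text \<open>Of the \<open>3 + e\<close>, the part \<open>1 + e\<close> comes from the excess factor,
  and the other two units come from the at most \<open>S\<close> exceptional parameters and from the
  exceptional directions, since \<open>S * M \<le> q\<close>.\<close>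

lemma normalized_upper_bound:
  fixes N Q q M A T S e :: real
  assumes pos: "0 < N" "0 < Q" "0 < q" "0 < M" and "A \<le> Q" "T \<le> N" "0 \<le> A" "0 \<le> S" "0 \<le> e" "0 \<le> T" and S: "S * M \<le> q"
    and le: "N * ((q - S) * A) * M \<le> Q * (T * (q * (M + 1 + e))) + N * (S * Q) * M"
  shows "A / Q \<le> T / N + (3 + e) / M"
proof -
  define x where "x = A / Q"
  define t where "t = T / N"
  define u where "u = S / q"
  have x: "A = x * Q" "0 \<le> x" "x \<le> 1" using assms unfolding x_def by auto
  have t: "T = t * N" "0 \<le> t" "t \<le> 1" using assms unfolding t_def by auto
  have u: "S = u * q" "0 \<le> u" "u * M \<le> 1" using assms unfolding u_def by (auto simp: field_simps)
  have "(N * Q * q) * ((1 - u) * x * M) \<le> (N * Q * q) * (t * (M + 1 + e) + u * M)"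
    using le unfolding x(1) t(1) u(1) by (simp add: algebra_simps)
  then have "(1 - u) * x * M \<le> t * (M + 1 + e) + u * M" using pos by simp
  moreover have "t * (1 + e) \<le> 1 * (1 + e)" using t assms by (intro mult_right_mono) auto
  moreover have "x * (u * M) \<le> 1 * 1" using x u pos by (intro mult_mono) auto
  ultimately have "x * M \<le> t * M + (3 + e)" using u by (simp add: algebra_simps)
  then show ?thesis unfolding x_def[symmetric] t_def[symmetric] using pos by (simp add: field_simps)
qed

lemma nice_of_lab:
  fixes a :: "nat \<Rightarrow> 'k::field poly"
  assumes fin: "finite (UNIV :: 'k set)" and pp: "primepow (card (UNIV :: 'k set))"
    and h: "\<And>Ps. finite Ps \<Longrightarrow> (\<forall>p\<in>Ps. mirr p) \<Longrightarrow> \<alpha> (\<Prod>Ps) = h (card Ps)"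
    and \<sigma>: "\<sigma> \<in> Gset n r" "lab n r a f y \<sigma>" and j: "j < r"
  shows "\<alpha> (f + a j) = h (ncyc n (\<sigma> j))"
proof -
  have "\<sigma> j permutes {..<n}" using \<sigma>(1) j unfolding Gset_def PiE_iff by blast
  moreover have "inj_on (y j) {..<n}" "ac_poly (f + a j) = (\<Prod>i<n. [:- y j i, 1:])"
    "\<And>i. i < n \<Longrightarrow> y j i ^ card (UNIV :: 'k set) = y j (\<sigma> j i)" using \<sigma>(2) j unfolding lab_def by blast+
  ultimately obtain Ps where Ps: "finite Ps" "\<forall>p\<in>Ps. mirr p" "f + a j = \<Prod>Ps" "card Ps = ncyc n (\<sigma> j)"
    using labelled_factorization[OF fin pp, of "y j" n "f + a j" "\<sigma> j"] by blast
  show ?thesis unfolding Ps(3) using h[OF Ps(1,2)] Ps(4) by simp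
qed

text \<open>The two upper bounds, for the event and for its complement, have main terms adding up to
  1, and together with the non-squarefree part the counts exhaust all polynomials; so both bounds
  are sharp up to the errors. The non-squarefree shifts contribute one more \<open>1 / M0\<close>,
  whence the constant 4.\<close>

lemma shifts_equal_ge3:
  fixes a :: "nat \<Rightarrow> 'k::field poly"
  assumes n3: "3 \<le> n" and fin: "finite (UNIV :: 'k set)" and pp: "primepow (card (UNIV :: 'k set))"
    and deg_a: "\<And>j. j < r \<Longrightarrow> degree (a j) < n" and inj_a: "inj_on a {..<r}" and r: "1 \<le> r"
    and big: "2 * r * n + n < card (UNIV :: 'k set)" and M0: "0 < M0"
    and thr: "stepanov_threshold n (r * (n - 1)) r M0 \<le> card (UNIV :: 'k set)"
    and big2: "r * n * M0 \<le> card (UNIV :: 'k set)"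
    and nice: "nice \<alpha>"
  shows "\<bar>real (card (shifts_equal \<alpha> r a n)) / real (card (UNIV :: 'k set)) ^ n
           - real (card (Seq n r)) / real (fact n ^ r)\<bar> \<le> (4 + real (r * (n - 1) * (r * n * n))) / real M0"
proof -
  let ?q = "card (UNIV :: 'k set)"
  let ?e = "real (r * (n - 1) * (r * n * n))"
  have q0: "0 < ?q" using fin by (simp add: finite_UNIV_card_ge_0)
  have finM: "finite (Mon n :: 'k poly set)" "card (Mon n :: 'k poly set) = ?q ^ n" using card_Mon[OF fin] n3 by auto
  obtain h where h: "inj h" "\<And>Ps. finite Ps \<Longrightarrow> (\<forall>p\<in>Ps. mirr p) \<Longrightarrow> \<alpha> (\<Prod>Ps) = h (card Ps)"
    using nice unfolding nice_def by blast
  define Ev where "Ev = (\<lambda>f. \<forall>i<r. \<forall>j<r. \<alpha> (f + a i) = \<alpha> (f + a j))"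
  define ok where "ok = (\<lambda>f. \<forall>j<r. sqf (ac_poly (f + a j)))"
  have lab_iff: "\<sigma> \<in> Seq n r \<longleftrightarrow> Ev f" if "\<sigma> \<in> Gset n r" "lab n r a f y \<sigma>" for f y \<sigma>
    using nice_of_lab[where \<alpha> = \<alpha> and h = h, OF fin pp h(2) that] h(1) that(1) unfolding Ev_def Seq_def by (auto simp: inj_eq)
  have ub: "real (card \<A>) / real ?q ^ n \<le> real (card T) / real (fact n ^ r) + (3 + ?e) / real M0"
    if \<A>: "\<A> \<subseteq> {f\<in>Mon n. ok f}" and T: "T \<subseteq> Gset n r"
      and TT: "\<And>f y \<sigma>. f \<in> \<A> \<Longrightarrow> \<sigma> \<in> Gset n r \<Longrightarrow> lab n r a f y \<sigma> \<Longrightarrow> \<sigma> \<in> T" for \<A> T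
  proof -
    have "fact n ^ r * ((?q - r * (n - 1)) * card \<A>) * M0
     \<le> ?q ^ n * (card T * (?q * (M0 + 1 + r * (n - 1) * (r * n * n)))) + fact n ^ r * (r * (n - 1) * ?q ^ n) * M0"
    proof (rule frobenius_type_upper_bound[OF n3 fin pp deg_a inj_a big M0 thr T _ _ TT])
      show "degree f = n \<and> coeff f n = 1" if "f \<in> \<A>" for f using that \<A> unfolding Mon_def by blast
      show "sqf (ac_poly (f + a j))" if "f \<in> \<A>" "j < r" for f j using that \<A> unfolding ok_def by blast
    qed
    then have le: "real (fact n ^ r * ((?q - r * (n - 1)) * card \<A>) * M0)
     \<le> real (?q ^ n * (card T * (?q * (M0 + 1 + r * (n - 1) * (r * n * n)))) + fact n ^ r * (r * (n - 1) * ?q ^ n) * M0)"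
      by (simp only: of_nat_le_iff)
    have rn: "r * (n - 1) \<le> r * n" by (intro mult_le_mono2) simp
    have Sq: "r * (n - 1) \<le> ?q" using rn big by linarith
    have SM: "r * (n - 1) * M0 \<le> ?q" using mult_le_mono1[OF rn, of M0] big2 by linarith
    have cA: "card \<A> \<le> ?q ^ n" using card_mono[OF finM(1), of \<A>] \<A> finM(2) by auto
    have cT: "card T \<le> fact n ^ r" using card_mono[OF finite_Gset T] card_Gset by simp
    show ?thesis
    proof (rule normalized_upper_bound[where q = "real ?q" and S = "real (r * (n - 1))"])
      show "real (fact n ^ r) * ((real ?q - real (r * (n - 1))) * real (card \<A>)) * real M0
       \<le> real ?q ^ n * (real (card T) * (real ?q * (real M0 + 1 + ?e))) + real (fact n ^ r) * (real (r * (n - 1)) * real ?q ^ n) * real M0"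
        using le Sq by (simp only: of_nat_mult of_nat_add of_nat_diff of_nat_power of_nat_1)
      show "real (r * (n - 1)) * real M0 \<le> real ?q" using SM by (simp only: of_nat_mult[symmetric] of_nat_le_iff)
      show "real (card \<A>) \<le> real ?q ^ n" using cA by (simp only: of_nat_power[symmetric] of_nat_le_iff)
      show "real (card T) \<le> real (fact n ^ r)" using cT by (simp only: of_nat_le_iff)
    qed (use q0 M0 in auto)
  qed
  define A1 where "A1 = {f\<in>Mon n. ok f \<and> Ev f}"
  define A2 where "A2 = {f\<in>Mon n. ok f \<and> \<not> Ev f}"
  define A3 where "A3 = {f\<in>Mon n. \<exists>j<r. \<not> sqf (ac_poly (f + a j))}"
  have u1: "real (card A1) / real ?q ^ n \<le> real (card (Seq n r)) / real (fact n ^ r) + (3 + ?e) / real M0"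
    by (rule ub) (use lab_iff in \<open>auto simp: A1_def Seq_def\<close>)
  have "real (card A2) / real ?q ^ n \<le> real (card (Gset n r - Seq n r)) / real (fact n ^ r) + (3 + ?e) / real M0"
    by (rule ub) (use lab_iff in \<open>auto simp: A2_def\<close>)
  moreover have "real (card (Gset n r - Seq n r)) = real (fact n ^ r) - real (card (Seq n r))"
  proof -
    have s: "Seq n r \<subseteq> Gset n r" unfolding Seq_def by blast
    have "card (Gset n r - Seq n r) = fact n ^ r - card (Seq n r)"
      using card_Diff_subset[OF finite_subset[OF s finite_Gset] s] card_Gset by simp
    moreover have "card (Seq n r) \<le> fact n ^ r" using card_mono[OF finite_Gset s] card_Gset by simp
    ultimately show ?thesis by (simp only: of_nat_diff)
  qed
  ultimately have u2: "real (card A2) / real ?q ^ n \<le> 1 - real (card (Seq n r)) / real (fact n ^ r) + (3 + ?e) / real M0"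
    by (simp add: diff_divide_distrib)
  have "card A3 \<le> r * (n * ?q ^ (n - 1))" unfolding A3_def
    using card_nonsquarefree_shifts[OF fin _ deg_a] n3 by simp
  then have "card A3 * M0 \<le> r * (n * ?q ^ (n - 1)) * M0" by (rule mult_le_mono1)
  also have "\<dots> = (r * n * M0) * ?q ^ (n - 1)" by (simp only: mult.assoc mult.commute mult.left_commute)
  also have "\<dots> \<le> ?q * ?q ^ (n - 1)" by (rule mult_le_mono1[OF big2])
  also have "\<dots> = ?q ^ n" using n3 by (cases n) auto
  finally have "real (card A3 * M0) \<le> real (?q ^ n)" by (simp only: of_nat_le_iff)
  then have u3: "real (card A3) / real ?q ^ n \<le> 1 / real M0" using q0 M0 by (simp add: field_simps)
  have finA: "finite A1" "finite A2" "finite A3" unfolding A1_def A2_def A3_def using finM(1) by auto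
  have "Mon n = A1 \<union> A2 \<union> A3" unfolding A1_def A2_def A3_def ok_def by auto
  moreover have "(A1 \<union> A2) \<inter> A3 = {}" "A1 \<inter> A2 = {}" unfolding A1_def A2_def A3_def ok_def by auto
  ultimately have "?q ^ n = card A1 + card A2 + card A3"
    using finM(2) finA by (simp add: card_Un_disjoint)
  then have "real (?q ^ n) = real (card A1 + card A2 + card A3)" by (simp only:)
  then have eq2: "real (card A1) + real (card A2) + real (card A3) = real ?q ^ n" by simp
  have Q0: "real ?q ^ n > 0" using q0 by simp
  have tot: "real (card A1) / real ?q ^ n + real (card A2) / real ?q ^ n + real (card A3) / real ?q ^ n = 1"
    unfolding add_divide_distrib[symmetric] eq2 using Q0 by simp
  have sub: "A1 \<subseteq> shifts_equal \<alpha> r a n" "shifts_equal \<alpha> r a n \<subseteq> A1 \<union> A3"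
    unfolding A1_def A3_def shifts_equal_def Ev_def ok_def by blast+
  have finS: "finite (shifts_equal \<alpha> r a n)" using sub(2) finA finite_subset by blast
  have "card A1 \<le> card (shifts_equal \<alpha> r a n)" by (rule card_mono[OF finS sub(1)])
  then have l1: "real (card A1) / real ?q ^ n \<le> real (card (shifts_equal \<alpha> r a n)) / real ?q ^ n"
    by (intro divide_right_mono) auto
  have "card (shifts_equal \<alpha> r a n) \<le> card (A1 \<union> A3)" by (rule card_mono[OF _ sub(2)]) (use finA in simp)
  also have "\<dots> \<le> card A1 + card A3" by (rule card_Un_le)
  finally have "real (card (shifts_equal \<alpha> r a n)) \<le> real (card A1) + real (card A3)" by linarith
  then have "real (card (shifts_equal \<alpha> r a n)) / real ?q ^ n \<le> (real (card A1) + real (card A3)) / real ?q ^ n"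
    by (intro divide_right_mono) auto
  then have l2: "real (card (shifts_equal \<alpha> r a n)) / real ?q ^ n \<le> real (card A1) / real ?q ^ n + real (card A3) / real ?q ^ n"
    by (simp only: add_divide_distrib)
  have e4: "(4 + ?e) / real M0 = (3 + ?e) / real M0 + 1 / real M0" by (simp add: add_divide_distrib)
  show ?thesis unfolding e4 using u1 u2 u3 tot l1 l2 by linarith
qed

section \<open>Degrees one and two\<close>

lemma degree1_mirr:
  assumes "(f :: 'k::field poly) \<in> Mon 1" shows "mirr f"
  unfolding mirr_def
proof (intro conjI irreducibleI)
  have f: "degree f = 1" "coeff f 1 = 1" using assms unfolding Mon_def by auto
  show f0: "f \<noteq> 0" using f by auto
  show "\<not> f dvd 1" using f by (auto simp: is_unit_poly_iff)
  show "lead_coeff f = 1" using f by simp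
  fix a b assume ab: "f = a * b"
  have "a \<noteq> 0" "b \<noteq> 0" using ab f0 by auto
  then have "degree a + degree b = 1" using f(1) ab degree_mult_eq by metis
  then have "degree a = 0 \<or> degree b = 0" by arith
  then show "a dvd 1 \<or> b dvd 1" using \<open>a \<noteq> 0\<close> \<open>b \<noteq> 0\<close> by (auto simp: is_unit_iff_degree)
qed

lemma shifts_equal_1:
  fixes a :: "nat \<Rightarrow> 'k::field poly"
  assumes fin: "finite (UNIV :: 'k set)" and deg_a: "\<And>j. j < r \<Longrightarrow> degree (a j) < 1" and nice: "nice \<alpha>"
  shows "card (shifts_equal \<alpha> r a 1) = card (UNIV :: 'k set)"
proof -
  obtain h where h: "\<And>Ps. finite Ps \<Longrightarrow> (\<forall>p\<in>Ps. mirr p) \<Longrightarrow> \<alpha> (\<Prod>Ps) = h (card Ps)"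
    using nice unfolding nice_def by blast
  have "\<alpha> (f + a j) = h 1" if "f \<in> Mon 1" "j < r" for f j
    using h[of "{f + a j}"] degree1_mirr[OF Mon_shift[OF that(1) deg_a[OF that(2)]]] by simp
  then have "shifts_equal \<alpha> r a 1 = Mon 1" unfolding shifts_equal_def by auto
  then show ?thesis using card_Mon(2)[OF fin, of 1] by simp
qed

definition nroots :: "'k::field poly \<Rightarrow> nat" where "nroots f = card {x. poly f x = 0}"

lemma Mon2_iff: "(f :: 'k::field poly) \<in> Mon 2 \<longleftrightarrow> (\<exists>c b. f = [:c, b, 1:])"
proof
  assume f: "f \<in> Mon 2"
  have "f = [:coeff f 0, coeff f 1, 1:]"
  proof (rule poly_eqI)
    fix i
    show "coeff f i = coeff [:coeff f 0, coeff f 1, 1:] i"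
      using f unfolding Mon_def by (auto simp: coeff_pCons coeff_eq_0 numeral_2_eq_2 split: nat.splits)
  qed
  then show "\<exists>c b. f = [:c, b, 1:]" by blast
qed (auto simp: Mon_def numeral_2_eq_2)

lemma Mon2_factor:
  assumes f: "(f :: 'k::field poly) \<in> Mon 2" and s: "sqf (ac_poly f)"
  shows "\<exists>Ps. finite Ps \<and> (\<forall>p\<in>Ps. mirr p) \<and> f = \<Prod>Ps \<and> (card Ps = 2 \<and> nroots f = 2 \<or> card Ps = 1 \<and> nroots f = 0)"
proof (cases "\<exists>x. poly f x = 0")
  case True
  then obtain x where x: "poly f x = 0" by blast
  obtain c b where cb: "f = [:c, b, 1:]" using f Mon2_iff by blast
  define y where "y = - b - x"
  have fy: "f = [:-x, 1:] * [:-y, 1:]"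
  proof -
    have "c + x * (b + x) = 0" using x unfolding cb by simp
    then have "c = x * y" unfolding y_def by (simp add: algebra_simps eq_neg_iff_add_eq_0)
    then show ?thesis unfolding cb y_def by (simp add: algebra_simps)
  qed
  have xy: "x \<noteq> y"
  proof
    assume "x = y"
    then have "poly (ac_poly f) (to_ac x) = 0" "poly (pderiv (ac_poly f)) (to_ac x) = 0"
      unfolding pderiv_ac_poly poly_ac_poly fy by (simp_all add: pderiv_mult pderiv_pCons)
    then show False using s unfolding sqf_def by blast
  qed
  have m: "mirr [:-x, 1:]" "mirr [:-y, 1:]" by (intro degree1_mirr; simp add: Mon_def)+
  have ne: "[:-x, 1:] \<noteq> [:-y, 1:]" using xy by simp
  have "poly f z = (z - x) * (z - y)" for z unfolding fy poly_mult by simp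
  then have "{z. poly f z = 0} = {x, y}" by auto
  then have "nroots f = 2" unfolding nroots_def using xy by simp
  then show ?thesis using m ne fy by (intro exI[of _ "{[:-x, 1:], [:-y, 1:]}"]) simp
next
  case False
  have f2: "degree f = 2" "coeff f 2 = 1" using f unfolding Mon_def by auto
  have f0: "f \<noteq> 0" using f2 by auto
  have lin: False if g: "degree g = 1" "f = g * h" for g h :: "'k poly"
  proof -
    define c where "c = coeff g 0"
    define d where "d = coeff g 1"
    have gcd: "g = [:c, d:]" unfolding c_def d_def
      by (rule poly_eqI) (auto simp: coeff_pCons coeff_eq_0 g(1) split: nat.splits)
    have "d \<noteq> 0" using g(1) leading_coeff_0_iff[of g] unfolding d_def by auto
    then have "poly g (- c / d) = 0" unfolding gcd by simp
    then have "poly f (- c / d) = 0" using g(2) by simp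
    then show False using False by blast
  qed
  have "mirr f" unfolding mirr_def
  proof (intro conjI irreducibleI f0)
    show "\<not> f dvd 1" using f2 by (auto simp: is_unit_poly_iff)
    show "lead_coeff f = 1" using f2 by simp
    fix a b assume ab: "f = a * b"
    have n0: "a \<noteq> 0" "b \<noteq> 0" using ab f0 by auto
    then have "degree a + degree b = 2" using f2(1) ab degree_mult_eq by metis
    moreover have "degree a \<noteq> 1" using lin[of a b] ab by blast
    moreover have "degree b \<noteq> 1" using lin[of b a] ab by (auto simp: mult.commute)
    ultimately have "degree a = 0 \<or> degree b = 0" by arith
    then show "a dvd 1 \<or> b dvd 1" using n0 by (auto simp: is_unit_iff_degree)
  qed
  moreover have "nroots f = 0" using False unfolding nroots_def by simp
  ultimately show ?thesis by (intro exI[of _ "{f}"]) simp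
qed

lemma card_Mon2_value:
  fixes x u :: "'k::field"
  assumes fin: "finite (UNIV :: 'k set)"
  shows "card {f\<in>Mon 2. poly f x = u} = card (UNIV :: 'k set)"
proof -
  have bb: "bij_betw (\<lambda>b. [:u - x * (b + x), b, 1:]) UNIV {f\<in>Mon 2. poly f x = u}"
    unfolding bij_betw_def
  proof (intro conjI inj_onI equalityI subsetI)
    fix f assume f: "f \<in> {f\<in>Mon 2. poly f x = u}"
    then obtain c b where cb: "f = [:c, b, 1:]" using Mon2_iff[of f] by blast
    then have "c = u - x * (b + x)" using f by auto
    then show "f \<in> range (\<lambda>b. [:u - x * (b + x), b, 1:])" using cb by blast
  next
    fix f assume "f \<in> range (\<lambda>b. [:u - x * (b + x), b, 1:])"
    then obtain b where "f = [:u - x * (b + x), b, 1:]" by blast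
    then show "f \<in> {f\<in>Mon 2. poly f x = u}" using Mon2_iff[of f] by auto
  qed simp
  show ?thesis using bij_betw_same_card[OF bb] by simp
qed

lemma card_Mon2_two_values:
  fixes x y u v :: "'k::field"
  assumes "x \<noteq> y"
  shows "card {f\<in>Mon 2. poly f x = u \<and> poly f y = v} = 1"
proof -
  define b where "b = (u - v) / (x - y) - (x + y)"
  define c where "c = u - x * (b + x)"
  have xy: "x - y \<noteq> 0" using assms by simp
  have key: "c' + x * (b' + x) = u \<and> c' + y * (b' + y) = v \<longleftrightarrow> b' = b \<and> c' = c" for b' c'
  proof
    assume h: "c' + x * (b' + x) = u \<and> c' + y * (b' + y) = v"
    then have "(x - y) * (b' + (x + y)) = u - v" by (auto simp: algebra_simps)
    then have "b' + (x + y) = (u - v) / (x - y)" using xy by (simp add: eq_divide_eq mult.commute)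
    then have "b' = b" unfolding b_def by (simp add: algebra_simps)
    then show "b' = b \<and> c' = c" using h unfolding c_def by auto
  next
    assume h: "b' = b \<and> c' = c"
    have "(x - y) * (b + (x + y)) = u - v" unfolding b_def using xy by simp
    moreover have "c + y * (b + y) = u - (x - y) * (b + (x + y))" unfolding c_def by (simp add: algebra_simps)
    ultimately show "c' + x * (b' + x) = u \<and> c' + y * (b' + y) = v" using h unfolding c_def by simp
  qed
  have "{f\<in>Mon 2. poly f x = u \<and> poly f y = v} = {[:c, b, 1:]}"
  proof (intro equalityI subsetI)
    fix f assume f: "f \<in> {f\<in>Mon 2. poly f x = u \<and> poly f y = v}"
    then obtain c' b' where "f = [:c', b', 1:]" using Mon2_iff[of f] by blast
    then show "f \<in> {[:c, b, 1:]}" using f key[of c' b'] by auto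
  next
    fix f assume "f \<in> {[:c, b, 1:]}"
    then show "f \<in> {f\<in>Mon 2. poly f x = u \<and> poly f y = v}" using key[of c b] Mon2_iff[of f] by auto
  qed
  then show ?thesis by simp
qed

lemma sum_nroots:
  fixes a :: "'k::field poly"
  assumes fin: "finite (UNIV :: 'k set)"
  shows "(\<Sum>f\<in>Mon 2. nroots (f + a)) = card (UNIV :: 'k set) ^ 2"
proof -
  have finM: "finite (Mon 2 :: 'k poly set)" using card_Mon(1)[OF fin] by simp
  have "(\<Sum>f\<in>Mon 2. nroots (f + a)) = (\<Sum>f\<in>Mon 2. \<Sum>x\<in>UNIV. if poly f x = - poly a x then 1 else 0)"
    by (rule sum.cong) (auto simp: nroots_def fin sum.If_cases eq_neg_iff_add_eq_0)
  also have "\<dots> = (\<Sum>x\<in>UNIV. \<Sum>f\<in>Mon 2. if poly f x = - poly a x then 1 else 0)" by (rule sum.swap)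
  also have "\<dots> = (\<Sum>x\<in>(UNIV :: 'k set). card (UNIV :: 'k set))"
  proof (rule sum.cong)
    fix x :: 'k
    have "(\<Sum>f\<in>Mon 2. if poly f x = - poly a x then 1 else 0) = card {f\<in>Mon 2. poly f x = - poly a x}"
      using finM by (simp add: sum.If_cases Int_def)
    then show "(\<Sum>f\<in>Mon 2. if poly f x = - poly a x then 1 else 0) = card (UNIV :: 'k set)"
      using card_Mon2_value[OF fin] by simp
  qed simp
  finally show ?thesis by (simp add: power2_eq_square)
qed

text \<open>Two values at distinct points determine a monic quadratic. On the diagonal a solution
  needs \<open>a\<close> and \<open>b\<close> to agree at the point, which happens at most once
  because \<open>a - b\<close> is nonzero of degree at most one.\<close>

lemma sum_nroots_mult:
  fixes a b :: "'k::field poly"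
  assumes fin: "finite (UNIV :: 'k set)" and ab: "a \<noteq> b" "degree a < 2" "degree b < 2"
  shows "(\<Sum>f\<in>Mon 2. nroots (f + a) * nroots (f + b)) \<le> card (UNIV :: 'k set) ^ 2"
    "card (UNIV :: 'k set) ^ 2 \<le> (\<Sum>f\<in>Mon 2. nroots (f + a) * nroots (f + b)) + card (UNIV :: 'k set)"
proof -
  let ?q = "card (UNIV :: 'k set)"
  have finM: "finite (Mon 2 :: 'k poly set)" using card_Mon(1)[OF fin] by simp
  define N where "N = (\<lambda>u :: 'k \<times> 'k. card {f\<in>Mon 2. poly f (fst u) = - poly a (fst u) \<and> poly f (snd u) = - poly b (snd u)})"
  have "nroots (f + a) * nroots (f + b) = (\<Sum>u\<in>UNIV. if poly f (fst u) = - poly a (fst u) \<and> poly f (snd u) = - poly b (snd u) then 1 else 0)" for f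
  proof -
    have "{u. poly f (fst u) = - poly a (fst u) \<and> poly f (snd u) = - poly b (snd u)} = {x. poly (f + a) x = 0} \<times> {x. poly (f + b) x = 0}"
      by (auto simp: eq_neg_iff_add_eq_0)
    then show ?thesis using finite_Prod_UNIV[OF fin fin] unfolding nroots_def
      by (simp add: sum.If_cases card_cartesian_product)
  qed
  then have "(\<Sum>f\<in>Mon 2. nroots (f + a) * nroots (f + b)) = (\<Sum>f\<in>Mon 2. \<Sum>u\<in>UNIV. if poly f (fst u) = - poly a (fst u) \<and> poly f (snd u) = - poly b (snd u) then 1 else 0)"
    by (simp only:)
  also have "\<dots> = (\<Sum>u\<in>UNIV. \<Sum>f\<in>Mon 2. if poly f (fst u) = - poly a (fst u) \<and> poly f (snd u) = - poly b (snd u) then 1 else 0)" by (rule sum.swap)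
  also have "\<dots> = (\<Sum>u\<in>UNIV. N u)" unfolding N_def
    using finM by (intro sum.cong) (auto simp: sum.If_cases Int_def)
  finally have S: "(\<Sum>f\<in>Mon 2. nroots (f + a) * nroots (f + b)) = (\<Sum>u\<in>UNIV. N u)" .
  define D where "D = (\<lambda>x::'k. (x, x)) ` UNIV"
  have finU: "finite (UNIV :: ('k \<times> 'k) set)" using finite_Prod_UNIV[OF fin fin] .
  have off: "N u = 1" if "u \<in> UNIV - D" for u
    unfolding N_def by (rule card_Mon2_two_values) (use that in \<open>auto simp: D_def prod_eq_iff\<close>)
  have cD: "card D = ?q" unfolding D_def by (rule card_image) (auto intro: inj_onI)
  have cU: "card (UNIV :: ('k \<times> 'k) set) = ?q * ?q" by (simp add: card_prod)
  have offs: "(\<Sum>u\<in>UNIV - D. N u) = ?q * ?q - ?q"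
    using off cD cU finU by (simp add: card_Diff_subset finite_subset[OF subset_UNIV finU])
  have split: "(\<Sum>u\<in>UNIV. N u) = (\<Sum>u\<in>UNIV - D. N u) + (\<Sum>u\<in>D. N u)"
    by (rule sum.subset_diff[OF subset_UNIV finU])
  have qq: "?q \<le> ?q * ?q" by (cases ?q) auto
  show "?q ^ 2 \<le> (\<Sum>f\<in>Mon 2. nroots (f + a) * nroots (f + b)) + ?q"
    unfolding S split offs power2_eq_square by linarith
  have "(\<Sum>u\<in>D. N u) = (\<Sum>x\<in>UNIV. N (x, x))" unfolding D_def by (subst sum.reindex) (auto intro: inj_onI)
  also have "\<dots> \<le> (\<Sum>x\<in>UNIV. if poly (a - b) x = 0 then ?q else 0)"
  proof (rule sum_mono)
    fix x :: 'k
    show "N (x, x) \<le> (if poly (a - b) x = 0 then ?q else 0)"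
    proof (cases "poly (a - b) x = 0")
      case True
      then have "N (x, x) = card {f\<in>Mon 2. poly f x = - poly a x}" unfolding N_def by simp
      then show ?thesis using True card_Mon2_value[OF fin] by simp
    next
      case False
      then have emp: "{f\<in>Mon 2. poly f x = - poly a x \<and> poly f x = - poly b x} = {}" by auto
      have "N (x, x) = 0" unfolding N_def fst_conv snd_conv emp by simp
      then show ?thesis by simp
    qed
  qed
  also have "\<dots> = card {x. poly (a - b) x = 0} * ?q" using fin by (simp add: sum.If_cases)
  also have "\<dots> \<le> 1 * ?q"
  proof (rule mult_le_mono1)
    have "degree (a - b) < 2" by (rule degree_diff_less) (use ab in auto)
    moreover have "card {x. poly (a - b) x = 0} \<le> degree (a - b)" by (rule card_poly_roots_bound) (use ab in simp)
    ultimately show "card {x. poly (a - b) x = 0} \<le> 1" by linarith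
  qed
  finally show "(\<Sum>f\<in>Mon 2. nroots (f + a) * nroots (f + b)) \<le> ?q ^ 2"
    unfolding S split offs power2_eq_square using qq by linarith
qed

lemma nroots_le_2: "(f :: 'k::field poly) \<in> Mon 2 \<Longrightarrow> nroots f \<le> 2"
  unfolding nroots_def Mon_def using card_poly_roots_bound[of f] by (cases "f = 0") auto

text \<open>In the squarefree case \<open>e i f\<close> is a sign: 1 for two roots, -1 for none. Up
  to three signs, the event that all agree is expressed by pairwise products, and the sum of such a
  product over all \<open>f\<close> is at most \<open>q\<close> in absolute value; a fourth sign
  would bring in a product of four. The constant 13 is 12, from at most \<open>6 * q\<close>
  non-squarefree cases with discrepancy at most 2, plus 1 from the correlations.\<close>

lemma shifts_equal_2:
  fixes a :: "nat \<Rightarrow> 'k::field poly"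
  assumes fin: "finite (UNIV :: 'k set)" and deg_a: "\<And>j. j < r \<Longrightarrow> degree (a j) < 2" and inj_a: "inj_on a {..<r}"
    and r: "1 \<le> r" "r \<le> 3" and nice: "nice \<alpha>"
  shows "\<bar>real (card (shifts_equal \<alpha> r a 2)) / real (card (UNIV :: 'k set)) ^ 2 - 2 / 2 ^ r\<bar> \<le> 13 / real (card (UNIV :: 'k set))"
proof -
  let ?q = "card (UNIV :: 'k set)"
  have q0: "0 < ?q" using fin by (simp add: finite_UNIV_card_ge_0)
  have finM: "finite (Mon 2 :: 'k poly set)" "card (Mon 2 :: 'k poly set) = ?q ^ 2" using card_Mon[OF fin] by auto
  obtain h where h: "inj h" "\<And>Ps. finite Ps \<Longrightarrow> (\<forall>p\<in>Ps. mirr p) \<Longrightarrow> \<alpha> (\<Prod>Ps) = h (card Ps)"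
    using nice unfolding nice_def by blast
  define e where "e = (\<lambda>i f. real (nroots (f + a i)) - 1)"
  define Ev where "Ev = (\<lambda>f. \<forall>i<r. \<forall>j<r. \<alpha> (f + a i) = \<alpha> (f + a j))"
  define B where "B = {f\<in>Mon 2. \<exists>j<r. \<not> sqf (ac_poly (f + a j))}"
  define g where "g = (\<lambda>f. if r = 1 then 1 else if r = 2 then (1 + e 0 f * e 1 f) / 2
      else (1 + e 0 f * e 1 f + e 0 f * e 2 f + e 1 f * e 2 f) / 4)"
  have e1: "\<bar>e i f\<bar> \<le> 1" if "f \<in> Mon 2" "i < r" for i f
  proof -
    have "nroots (f + a i) \<le> 2" by (rule nroots_le_2[OF Mon_shift[OF that(1) deg_a[OF that(2)]]])
    then show ?thesis unfolding e_def by linarith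
  qed
  have ee: "\<bar>e i f * e j f\<bar> \<le> 1" if "f \<in> Mon 2" "i < r" "j < r" for i j f
    unfolding abs_mult using mult_mono[OF e1[OF that(1,2)] e1[OF that(1,3)]] by simp
  have good: "(e i f = 1 \<and> \<alpha> (f + a i) = h 2) \<or> (e i f = -1 \<and> \<alpha> (f + a i) = h 1)" if f: "f \<in> Mon 2" "f \<notin> B" and i: "i < r" for i f
  proof -
    have "sqf (ac_poly (f + a i))" using f i unfolding B_def by blast
    from Mon2_factor[OF Mon_shift[OF f(1) deg_a[OF i]] this]
    obtain Ps where Ps: "finite Ps" "\<forall>p\<in>Ps. mirr p" "f + a i = \<Prod>Ps"
      "card Ps = 2 \<and> nroots (f + a i) = 2 \<or> card Ps = 1 \<and> nroots (f + a i) = 0" by blast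
    have "\<alpha> (f + a i) = h (card Ps)" unfolding Ps(3) by (rule h(2)[OF Ps(1,2)])
    then show ?thesis using Ps(4) unfolding e_def by auto
  qed
  have h12: "h 1 \<noteq> h 2" using h(1) by (simp add: inj_eq)
  have rc: "r = 1 \<or> r = 2 \<or> r = 3" using r by auto
  have gi: "(if Ev f then 1 else 0) = g f" if f: "f \<in> Mon 2" "f \<notin> B" for f
    using rc
  proof (elim disjE)
    assume r1: "r = 1"
    then show ?thesis unfolding g_def Ev_def by simp
  next
    assume r2: "r = 2"
    have "Ev f \<longleftrightarrow> \<alpha> (f + a 0) = \<alpha> (f + a 1)" unfolding Ev_def r2 by (auto simp: numeral_2_eq_2 less_Suc_eq)
    then show ?thesis using good[OF f, of 0] good[OF f, of 1] h12 r2 unfolding g_def by auto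
  next
    assume r3: "r = 3"
    have "Ev f \<longleftrightarrow> \<alpha> (f + a 0) = \<alpha> (f + a 1) \<and> \<alpha> (f + a 0) = \<alpha> (f + a 2)"
      unfolding Ev_def r3 by (auto simp: numeral_3_eq_3 numeral_2_eq_2 less_Suc_eq)
    then show ?thesis using good[OF f, of 0] good[OF f, of 1] good[OF f, of 2] h12 r3 unfolding g_def by auto
  qed
  have gb: "\<bar>(if Ev f then 1 else 0) - g f\<bar> \<le> 2" if f: "f \<in> Mon 2" for f
    using rc
  proof (elim disjE)
    assume "r = 2"
    then show ?thesis using ee[OF f, of 0 1] unfolding g_def by auto
  next
    assume "r = 3"
    then show ?thesis using ee[OF f, of 0 1] ee[OF f, of 0 2] ee[OF f, of 1 2] unfolding g_def by auto
  qed (auto simp: g_def)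
  have "card (shifts_equal \<alpha> r a 2) = (\<Sum>f\<in>Mon 2. if Ev f then 1 else 0)"
    unfolding shifts_equal_def Ev_def using finM(1) by (simp add: sum.If_cases Int_def)
  then have c: "real (card (shifts_equal \<alpha> r a 2)) = (\<Sum>f\<in>Mon 2. if Ev f then 1 else 0)"
    unfolding of_nat_sum by (simp only: of_nat_sum) (intro sum.cong; simp)
  have "\<bar>real (card (shifts_equal \<alpha> r a 2)) - (\<Sum>f\<in>Mon 2. g f)\<bar> \<le> (\<Sum>f\<in>Mon 2. \<bar>(if Ev f then 1 else 0) - g f\<bar>)"
    unfolding c sum_subtractf[symmetric] by (rule sum_abs)
  also have "\<dots> \<le> (\<Sum>f\<in>Mon 2. if f \<in> B then 2 else 0)"
    by (rule sum_mono) (use gi gb in auto)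
  also have "\<dots> = 2 * real (card B)"
  proof -
    have "Mon 2 \<inter> {f. f \<in> B} = B" unfolding B_def by blast
    then show ?thesis using finM(1) by (simp add: sum.If_cases)
  qed
  also have "\<dots> \<le> 12 * real ?q"
  proof -
    have "card B \<le> r * (2 * ?q ^ (2 - 1))" unfolding B_def by (rule card_nonsquarefree_shifts[OF fin _ deg_a]) auto
    also have "\<dots> \<le> 3 * (2 * ?q ^ (2 - 1))" by (rule mult_le_mono1[OF r(2)])
    finally show ?thesis by simp
  qed
  finally have b1: "\<bar>real (card (shifts_equal \<alpha> r a 2)) - (\<Sum>f\<in>Mon 2. g f)\<bar> \<le> 12 * real ?q" .
  have P: "\<bar>\<Sum>f\<in>Mon 2. e i f * e j f\<bar> \<le> real ?q" if ij: "i < r" "j < r" "i \<noteq> j" for i j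
  proof -
    have ne: "a i \<noteq> a j" using inj_a ij by (auto dest: inj_onD)
    have "(\<Sum>f\<in>Mon 2. e i f * e j f) = (\<Sum>f\<in>Mon 2. real (nroots (f + a i) * nroots (f + a j)) - real (nroots (f + a i)) - real (nroots (f + a j)) + 1)"
      unfolding e_def by (rule sum.cong) (auto simp: algebra_simps)
    also have "\<dots> = real (\<Sum>f\<in>Mon 2. nroots (f + a i) * nroots (f + a j)) - real (\<Sum>f\<in>Mon 2. nroots (f + a i)) - real (\<Sum>f\<in>Mon 2. nroots (f + a j)) + real (card (Mon 2 :: 'k poly set))"
      unfolding of_nat_sum sum.distrib sum_subtractf by simp
    also have "\<dots> = real (\<Sum>f\<in>Mon 2. nroots (f + a i) * nroots (f + a j)) - real (?q ^ 2)"
      unfolding sum_nroots[OF fin] finM(2) by simp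
    finally have E: "(\<Sum>f\<in>Mon 2. e i f * e j f) = real (\<Sum>f\<in>Mon 2. nroots (f + a i) * nroots (f + a j)) - real (?q ^ 2)" .
    have "real (\<Sum>f\<in>Mon 2. nroots (f + a i) * nroots (f + a j)) \<le> real (?q ^ 2)"
      using sum_nroots_mult(1)[OF fin ne deg_a[OF ij(1)] deg_a[OF ij(2)]] by (simp only: of_nat_le_iff)
    moreover have "real (?q ^ 2) \<le> real ((\<Sum>f\<in>Mon 2. nroots (f + a i) * nroots (f + a j)) + ?q)"
      using sum_nroots_mult(2)[OF fin ne deg_a[OF ij(1)] deg_a[OF ij(2)]] by (simp only: of_nat_le_iff)
    ultimately show ?thesis unfolding E of_nat_add by linarith
  qed
  have b2: "\<bar>(\<Sum>f\<in>Mon 2. g f) - 2 / 2 ^ r * real (?q ^ 2)\<bar> \<le> real ?q"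
    using rc
  proof (elim disjE)
    assume "r = 1"
    then have "(\<Sum>f\<in>Mon 2. g f) = (\<Sum>f\<in>(Mon 2 :: 'k poly set). 1)" unfolding g_def by simp
    then show ?thesis using \<open>r = 1\<close> finM(2) by simp
  next
    assume r2: "r = 2"
    have "(\<Sum>f\<in>Mon 2. g f) = (\<Sum>f\<in>(Mon 2 :: 'k poly set). 1 / 2 + (1 / 2) * (e 0 f * e 1 f))" unfolding g_def using r2 by (simp add: add_divide_distrib)
    also have "\<dots> = (\<Sum>f\<in>(Mon 2 :: 'k poly set). 1 / 2) + (1 / 2) * (\<Sum>f\<in>Mon 2. e 0 f * e 1 f)" unfolding sum.distrib sum_distrib_left ..
    finally have "(\<Sum>f\<in>Mon 2. g f) = real (?q ^ 2) * (1 / 2) + (1 / 2) * (\<Sum>f\<in>Mon 2. e 0 f * e 1 f)" using finM(2) by simp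
    moreover have "\<bar>\<Sum>f\<in>Mon 2. e 0 f * e 1 f\<bar> \<le> real ?q" using P[of 0 1] r2 by simp
    ultimately show ?thesis using r2 by (simp add: power2_eq_square)
  next
    assume r3: "r = 3"
    have "(\<Sum>f\<in>Mon 2. g f) = (\<Sum>f\<in>(Mon 2 :: 'k poly set). 1 / 4 + (1 / 4) * (e 0 f * e 1 f) + (1 / 4) * (e 0 f * e 2 f) + (1 / 4) * (e 1 f * e 2 f))"
      unfolding g_def using r3 by (simp add: add_divide_distrib)
    also have "\<dots> = (\<Sum>f\<in>(Mon 2 :: 'k poly set). 1 / 4) + (1 / 4) * (\<Sum>f\<in>Mon 2. e 0 f * e 1 f) + (1 / 4) * (\<Sum>f\<in>Mon 2. e 0 f * e 2 f) + (1 / 4) * (\<Sum>f\<in>Mon 2. e 1 f * e 2 f)"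
      unfolding sum.distrib sum_distrib_left ..
    finally have "(\<Sum>f\<in>Mon 2. g f) = real (?q ^ 2) * (1 / 4) + (1 / 4) * (\<Sum>f\<in>Mon 2. e 0 f * e 1 f) + (1 / 4) * (\<Sum>f\<in>Mon 2. e 0 f * e 2 f) + (1 / 4) * (\<Sum>f\<in>Mon 2. e 1 f * e 2 f)" using finM(2) by simp
    moreover have "\<bar>\<Sum>f\<in>Mon 2. e 0 f * e 1 f\<bar> \<le> real ?q" "\<bar>\<Sum>f\<in>Mon 2. e 0 f * e 2 f\<bar> \<le> real ?q" "\<bar>\<Sum>f\<in>Mon 2. e 1 f * e 2 f\<bar> \<le> real ?q"
      using P[of 0 1] P[of 0 2] P[of 1 2] r3 by simp_all
    ultimately show ?thesis using r3 by (simp add: power2_eq_square)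
  qed
  define Cn where "Cn = real (card (shifts_equal \<alpha> r a 2))"
  define q where "q = real ?q"
  have qp: "0 < q" using q0 unfolding q_def by simp
  have "\<bar>Cn - 2 / 2 ^ r * q ^ 2\<bar> \<le> 13 * q" using b1 b2 unfolding Cn_def q_def of_nat_power by linarith
  then have "\<bar>Cn - 2 / 2 ^ r * q ^ 2\<bar> / q ^ 2 \<le> 13 * q / q ^ 2" by (rule divide_right_mono) simp
  moreover have "\<bar>Cn - 2 / 2 ^ r * q ^ 2\<bar> / q ^ 2 = \<bar>(Cn - 2 / 2 ^ r * q ^ 2) / q ^ 2\<bar>" by simp
  moreover have "(Cn - 2 / 2 ^ r * q ^ 2) / q ^ 2 = Cn / q ^ 2 - 2 / 2 ^ r" using qp by (simp add: diff_divide_distrib)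
  moreover have "13 * q / q ^ 2 = 13 / q" using qp by (simp add: power2_eq_square)
  ultimately show ?thesis unfolding Cn_def q_def by (simp only:)
qed

section \<open>The limit value and its rate, for all degrees\<close>

definition Llim :: "nat \<Rightarrow> nat \<Rightarrow> real" where
  "Llim n r = real (\<Sum>c\<le>n. stirling n c ^ r) / real (fact n ^ r)"

text \<open>Each size condition on \<open>q\<close> imposed for the precision \<open>M0\<close> is a
  summand, so that one inequality implies them all; the final \<open>M0\<close> serves degree
  two.\<close>

definition large_q :: "nat \<Rightarrow> nat \<Rightarrow> nat \<Rightarrow> nat" where
  "large_q n r M0 = stepanov_threshold n (r * (n - 1)) r M0 + 2 * r * n + n + 1 + r * n * M0 + M0"

theorem shifts_equal_asymptotics:
  fixes a :: "nat \<Rightarrow> 'k::field poly"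
  assumes fin: "finite (UNIV :: 'k set)" and pp: "primepow (card (UNIV :: 'k set))"
    and n: "1 \<le> n" "n = 2 \<Longrightarrow> r \<le> 3" and r: "1 \<le> r" and M0: "0 < M0"
    and deg_a: "\<And>j. j < r \<Longrightarrow> degree (a j) < n" and inj_a: "inj_on a {..<r}"
    and big: "large_q n r M0 \<le> card (UNIV :: 'k set)" and nice: "nice \<alpha>"
  shows "\<bar>real (card (shifts_equal \<alpha> r a n)) / real (card (UNIV :: 'k set)) ^ n - Llim n r\<bar>
     \<le> (13 + real (r * (n - 1) * (r * n * n))) / real M0"
proof -
  let ?q = "card (UNIV :: 'k set)"
  have q0: "0 < ?q" using fin by (simp add: finite_UNIV_card_ge_0)
  have qb: "stepanov_threshold n (r * (n - 1)) r M0 \<le> ?q" "2 * r * n + n < ?q" "r * n * M0 \<le> ?q" "M0 \<le> ?q"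
    using big unfolding large_q_def by linarith+
  consider "n = 1" | "n = 2" | "3 \<le> n" using n(1) by linarith
  then show ?thesis
  proof cases
    case 1
    have "Llim 1 r = 1" unfolding Llim_def using r by (simp add: atMost_Suc zero_power)
    then show ?thesis using shifts_equal_1[OF fin _ nice, of r a] deg_a q0 unfolding 1 by simp
  next
    case 2
    have "Llim 2 r = 2 / 2 ^ r" unfolding Llim_def using r by (simp add: numeral_2_eq_2 atMost_Suc zero_power)
    moreover have "\<bar>real (card (shifts_equal \<alpha> r a 2)) / real ?q ^ 2 - 2 / 2 ^ r\<bar> \<le> 13 / real ?q"
      by (rule shifts_equal_2[OF fin _ inj_a r n(2)[OF 2] nice]) (use deg_a 2 in auto)
    moreover have "13 / real ?q \<le> 13 / real M0" using qb(4) M0 by (intro divide_left_mono) auto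
    moreover have "13 / real M0 \<le> (13 + real (r * (n - 1) * (r * n * n))) / real M0" by (intro divide_right_mono) auto
    ultimately show ?thesis unfolding 2 by linarith
  next
    case 3
    have "\<bar>real (card (shifts_equal \<alpha> r a n)) / real ?q ^ n - real (card (Seq n r)) / real (fact n ^ r)\<bar>
      \<le> (4 + real (r * (n - 1) * (r * n * n))) / real M0"
      by (rule shifts_equal_ge3[OF 3 fin pp deg_a inj_a r qb(2) M0 qb(1,3) nice])
    moreover have "(4 + real (r * (n - 1) * (r * n * n))) / real M0 \<le> (13 + real (r * (n - 1) * (r * n * n))) / real M0"
      by (intro divide_right_mono) auto
    ultimately show ?thesis unfolding Llim_def card_Seq[OF r] by linarith
  qed
qed

section \<open>Transfer from carrier-based fields to types\<close>

locale field_rep = field R for R :: "'a ring" (structure) +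
  fixes \<phi> :: "'a \<Rightarrow> 'k::field"
  assumes bij: "bij_betw \<phi> (carrier R) UNIV"
    and hom_add: "\<And>x y. x \<in> carrier R \<Longrightarrow> y \<in> carrier R \<Longrightarrow> \<phi> (x \<oplus> y) = \<phi> x + \<phi> y"
    and hom_mult: "\<And>x y. x \<in> carrier R \<Longrightarrow> y \<in> carrier R \<Longrightarrow> \<phi> (x \<otimes> y) = \<phi> x * \<phi> y"
begin

abbreviation P where "P \<equiv> poly_ring R"

sublocale P: domain P by (rule univ_poly_is_domain[OF carrier_is_subring])

lemma phi_zero: "\<phi> \<zero> = 0"
proof -
  have e: "\<phi> \<zero> = \<phi> \<zero> + \<phi> \<zero>" using hom_add[of \<zero> \<zero>] by simp
  show ?thesis by (rule add_cancel_right_right[THEN iffD1, OF e])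
qed

lemma phi_inj: "x \<in> carrier R \<Longrightarrow> y \<in> carrier R \<Longrightarrow> \<phi> x = \<phi> y \<longleftrightarrow> x = y"
  using bij unfolding bij_betw_def by (meson inj_onD)

lemma phi_one: "\<phi> \<one> = 1"
proof -
  have "\<phi> (\<one> \<otimes> \<one>) = \<phi> \<one> * \<phi> \<one>" by (rule hom_mult) simp_all
  moreover have "\<phi> \<one> \<noteq> 0" using phi_inj[of \<one> \<zero>] phi_zero one_not_zero by simp
  ultimately show ?thesis by simp
qed

lemma phi_finsum:
  assumes "finite A" "\<And>i. i \<in> A \<Longrightarrow> f i \<in> carrier R"
  shows "\<phi> (\<Oplus>i\<in>A. f i) = (\<Sum>i\<in>A. \<phi> (f i))"
  using assms
proof (induction A rule: finite_induct)
  case empty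
  then show ?case by (simp add: phi_zero)
next
  case (insert x F)
  have "(\<Oplus>i\<in>insert x F. f i) = f x \<oplus> (\<Oplus>i\<in>F. f i)"
    by (rule finsum_insert) (use insert in auto)
  moreover have "(\<Oplus>i\<in>F. f i) \<in> carrier R" by (rule finsum_closed) (use insert in auto)
  ultimately show ?case using insert by (simp add: hom_add)
qed

text \<open>Lists in \<open>poly_ring R\<close> start with the leading coefficient, whereas
  \<open>Poly\<close> expects the constant one first; hence the reversal.\<close>

definition \<Psi> :: "'a list \<Rightarrow> 'k poly" where "\<Psi> f = Poly (rev (map \<phi> f))"

lemma coeff_Psi: "poly.coeff (\<Psi> f) i = \<phi> (ring.coeff R f i)"
proof (induction f)
  case Nil
  then show ?case unfolding \<Psi>_def by (simp add: phi_zero)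
next
  case (Cons x xs)
  have IH: "nth_default 0 (rev (map \<phi> xs)) i = \<phi> (ring.coeff R xs i)" using Cons unfolding \<Psi>_def coeff_Poly_eq .
  have "nth_default 0 (rev (map \<phi> xs)) i = 0" if "length xs \<le> i" using that by (simp add: nth_default_beyond)
  then show ?case unfolding \<Psi>_def coeff_Poly_eq using IH
    by (auto simp: nth_default_append nth_default_Cons nth_default_def nth_append split: nat.splits)
qed

lemma P_carrier: "f \<in> carrier P \<Longrightarrow> set f \<subseteq> carrier R \<and> (f \<noteq> [] \<longrightarrow> hd f \<noteq> \<zero>)"
  unfolding univ_poly_carrier[symmetric] polynomial_def by auto

lemma Psi_add: "f \<in> carrier P \<Longrightarrow> g \<in> carrier P \<Longrightarrow> \<Psi> (f \<oplus>\<^bsub>P\<^esub> g) = \<Psi> f + \<Psi> g"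
proof (rule poly_eqI)
  fix i assume fg: "f \<in> carrier P" "g \<in> carrier P"
  have s: "set f \<subseteq> carrier R" "set g \<subseteq> carrier R" using P_carrier fg by auto
  show "poly.coeff (\<Psi> (f \<oplus>\<^bsub>P\<^esub> g)) i = poly.coeff (\<Psi> f + \<Psi> g) i"
    unfolding coeff_Psi univ_poly_add coeff_add poly_add_coeff[OF s]
    by (rule hom_add) (use coeff_in_carrier s in auto)
qed

lemma Psi_mult: "f \<in> carrier P \<Longrightarrow> g \<in> carrier P \<Longrightarrow> \<Psi> (f \<otimes>\<^bsub>P\<^esub> g) = \<Psi> f * \<Psi> g"
proof (rule poly_eqI)
  fix i assume fg: "f \<in> carrier P" "g \<in> carrier P"
  have s: "set f \<subseteq> carrier R" "set g \<subseteq> carrier R" using P_carrier fg by auto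
  have c: "ring.coeff R f k \<in> carrier R" "ring.coeff R g k \<in> carrier R" for k using coeff_in_carrier s by auto
  have "\<phi> (\<Oplus>k\<in>{..i}. ring.coeff R f k \<otimes> ring.coeff R g (i - k)) = (\<Sum>k\<le>i. \<phi> (ring.coeff R f k \<otimes> ring.coeff R g (i - k)))"
    by (rule phi_finsum) (use c in auto)
  then show "poly.coeff (\<Psi> (f \<otimes>\<^bsub>P\<^esub> g)) i = poly.coeff (\<Psi> f * \<Psi> g) i"
    unfolding coeff_Psi univ_poly_mult coeff_mult poly_mult_coeff[OF s] using c by (simp add: hom_mult)
qed

lemma Psi_one: "\<Psi> \<one>\<^bsub>P\<^esub> = 1"
  unfolding univ_poly_one \<Psi>_def by (simp add: phi_one one_pCons)

lemma Psi_inj: "inj_on \<Psi> (carrier P)"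
proof (rule inj_onI)
  fix f g assume fg: "f \<in> carrier P" "g \<in> carrier P" "\<Psi> f = \<Psi> g"
  have s: "set f \<subseteq> carrier R" "set g \<subseteq> carrier R" using P_carrier fg by auto
  have "ring.coeff R f i = ring.coeff R g i" for i
    using arg_cong[OF fg(3), of "\<lambda>p. poly.coeff p i"] phi_inj[of "ring.coeff R f i" "ring.coeff R g i"] coeff_in_carrier s
    unfolding coeff_Psi by auto
  then have "ring.coeff R f = ring.coeff R g" by (rule ext)
  then show "f = g" using coeff_iff_polynomial_cond[of "carrier R" f g] fg(1,2) unfolding univ_poly_carrier[symmetric] by auto
qed

lemma Psi_surj: "\<exists>f\<in>carrier P. \<Psi> f = p"
proof -
  define \<psi> where "\<psi> = inv_into (carrier R) \<phi>"
  have psi: "\<psi> z \<in> carrier R" "\<phi> (\<psi> z) = z" for z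
    using bij unfolding \<psi>_def bij_betw_def by (simp_all add: inv_into_into f_inv_into_f)
  define f where "f = map \<psi> (rev (coeffs p))"
  have "rev (map \<phi> f) = coeffs p" unfolding f_def by (simp add: rev_map psi(2) comp_def)
  then have "\<Psi> f = p" unfolding \<Psi>_def by simp
  moreover have "f \<in> carrier P"
  proof -
    have "set f \<subseteq> carrier R" unfolding f_def using psi(1) by auto
    moreover have "hd f \<noteq> \<zero>" if "f \<noteq> []"
    proof -
      have ne: "coeffs p \<noteq> []" using that unfolding f_def by simp
      then have "p \<noteq> 0" by auto
      have "hd f = \<psi> (last (coeffs p))" unfolding f_def using ne by (simp add: hd_map hd_rev)
      then have "\<phi> (hd f) = last (coeffs p)" using psi(2) by simp
      then show ?thesis using last_coeffs_eq_coeff_degree[OF \<open>p \<noteq> 0\<close>] \<open>p \<noteq> 0\<close> phi_zero by auto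
    qed
    ultimately show ?thesis unfolding univ_poly_carrier[symmetric] polynomial_def by blast
  qed
  ultimately show ?thesis by blast
qed

lemma Psi_lead:
  assumes f: "f \<in> carrier P" "f \<noteq> []"
  shows "degree (\<Psi> f) = length f - 1" "lead_coeff (\<Psi> f) = \<phi> (hd f)"
proof -
  have c: "set f \<subseteq> carrier R" "hd f \<noteq> \<zero>" using P_carrier[OF f(1)] f(2) by auto
  have hc: "hd f \<in> carrier R" using c(1) f(2) by auto
  have cf: "poly.coeff (\<Psi> f) (length f - 1) = \<phi> (hd f)" unfolding \<Psi>_def coeff_Poly_eq
    using f(2) by (cases f) (auto simp: nth_default_append)
  have n0: "\<phi> (hd f) \<noteq> 0" using phi_inj[OF hc, of \<zero>] phi_zero c(2) by simp
  have "degree (\<Psi> f) \<le> length f - 1"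
  proof (rule degree_le, intro allI impI)
    fix i assume "length f - 1 < i"
    then show "poly.coeff (\<Psi> f) i = 0" unfolding \<Psi>_def coeff_Poly_eq by (simp add: nth_default_beyond)
  qed
  moreover have "length f - 1 \<le> degree (\<Psi> f)" by (rule le_degree) (unfold cf, rule n0)
  ultimately show d: "degree (\<Psi> f) = length f - 1" by simp
  show "lead_coeff (\<Psi> f) = \<phi> (hd f)" unfolding d cf ..
qed

lemma Psi_zero_iff: "f \<in> carrier P \<Longrightarrow> \<Psi> f = 0 \<longleftrightarrow> f = []"
proof -
  assume f: "f \<in> carrier P"
  have "\<Psi> [] = 0" unfolding \<Psi>_def by simp
  moreover have "[] \<in> carrier P" using P.zero_closed unfolding univ_poly_zero .
  ultimately show ?thesis using inj_onD[OF Psi_inj, of f "[]"] f by auto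
qed

lemma Psi_degree: "f \<in> carrier P \<Longrightarrow> degree (\<Psi> f) = Polynomials.degree f"
  using Psi_lead(1)[of f] by (cases "f = []") (auto simp: \<Psi>_def)

lemma Psi_monic: "f \<in> monic_polys R \<longleftrightarrow> f \<in> carrier P \<and> lead_coeff (\<Psi> f) = 1"
proof (cases "f \<in> carrier P \<and> f \<noteq> []")
  case True
  then have "hd f \<in> carrier R" using P_carrier[of f] by auto
  then show ?thesis unfolding monic_polys_def univ_poly_zero using True Psi_lead(2)[of f] phi_inj[of "hd f" \<one>] phi_one by auto
next
  case False
  then show ?thesis unfolding monic_polys_def univ_poly_zero by (auto simp: \<Psi>_def)
qed

lemma Psi_dvd: "f \<in> carrier P \<Longrightarrow> g \<in> carrier P \<Longrightarrow> f pdivides g \<longleftrightarrow> \<Psi> f dvd \<Psi> g"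
proof
  assume fg: "f \<in> carrier P" "g \<in> carrier P"
  {
    assume "f pdivides g"
    then obtain c where "c \<in> carrier P" "g = f \<otimes>\<^bsub>P\<^esub> c" unfolding pdivides_def factor_def by blast
    then show "\<Psi> f dvd \<Psi> g" using Psi_mult[OF fg(1)] by simp
  }
  assume "\<Psi> f dvd \<Psi> g"
  then obtain p where p: "\<Psi> g = \<Psi> f * p" by blast
  obtain c where c: "c \<in> carrier P" "\<Psi> c = p" using Psi_surj by blast
  have "\<Psi> g = \<Psi> (f \<otimes>\<^bsub>P\<^esub> c)" using p c Psi_mult[OF fg(1)] by simp
  then have "g = f \<otimes>\<^bsub>P\<^esub> c" using inj_onD[OF Psi_inj _ fg(2)] P.m_closed[OF fg(1) c(1)] by blast
  then show "f pdivides g" unfolding pdivides_def factor_def using c(1) by blast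
qed

lemma Psi_unit: "f \<in> carrier P \<Longrightarrow> f \<in> Units P \<longleftrightarrow> \<Psi> f dvd 1"
proof -
  assume f: "f \<in> carrier P"
  have "f \<in> Units P \<longleftrightarrow> f pdivides \<one>\<^bsub>P\<^esub>"
    unfolding pdivides_def factor_def Units_def using f P.m_comm by auto metis+
  then show ?thesis using Psi_dvd[OF f P.one_closed] Psi_one by simp
qed

lemma Psi_irreducible: "f \<in> carrier P \<Longrightarrow> pirreducible (carrier R) f \<longleftrightarrow> irreducible (\<Psi> f)"
proof
  assume f: "f \<in> carrier P" and i: "pirreducible (carrier R) f"
  note E = pirreducibleE[OF carrier_is_subring f i]
  show "irreducible (\<Psi> f)"
  proof (rule irreducibleI)
    show "\<Psi> f \<noteq> 0" using E(1) Psi_zero_iff[OF f] by blast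
    show "\<not> \<Psi> f dvd 1" using E(2) Psi_unit[OF f] by blast
    fix a b assume ab: "\<Psi> f = a * b"
    obtain g where g: "g \<in> carrier P" "\<Psi> g = a" using Psi_surj by blast
    obtain h where h: "h \<in> carrier P" "\<Psi> h = b" using Psi_surj by blast
    have "\<Psi> f = \<Psi> (g \<otimes>\<^bsub>P\<^esub> h)" using ab g h Psi_mult by simp
    then have "f = g \<otimes>\<^bsub>P\<^esub> h" using inj_onD[OF Psi_inj _ f] P.m_closed[OF g(1) h(1)] by blast
    then show "a dvd 1 \<or> b dvd 1" using E(3)[OF g(1) h(1)] Psi_unit g h by blast
  qed
next
  assume f: "f \<in> carrier P" and i: "irreducible (\<Psi> f)"
  show "pirreducible (carrier R) f"
  proof (rule pirreducibleI[OF carrier_is_subring f])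
    show "f \<noteq> []" using i Psi_zero_iff[OF f] by auto
    show "f \<notin> Units P" using i Psi_unit[OF f] irreducible_not_unit by blast
    fix g h assume gh: "g \<in> carrier P" "h \<in> carrier P" "f = g \<otimes>\<^bsub>P\<^esub> h"
    then have "\<Psi> f = \<Psi> g * \<Psi> h" using Psi_mult by simp
    then show "g \<in> Units P \<or> h \<in> Units P" using irreducibleD[OF i] Psi_unit gh(1,2) by blast
  qed
qed

lemma Psi_prime: "p \<in> prime_polys R \<longleftrightarrow> p \<in> carrier P \<and> mirr (\<Psi> p)"
  unfolding prime_polys_def mirr_def using Psi_irreducible[of p] Psi_monic[of p] by auto

lemma Psi_prime_divisors:
  assumes f: "f \<in> carrier P" shows "bij_betw \<Psi> (prime_divisors R f) (pdivs (\<Psi> f))"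
  unfolding bij_betw_def
proof (intro conjI equalityI subsetI)
  have sub: "prime_divisors R f \<subseteq> carrier P" unfolding prime_divisors_def using Psi_prime by blast
  show "inj_on \<Psi> (prime_divisors R f)" by (rule inj_on_subset[OF Psi_inj sub])
  fix p assume "p \<in> \<Psi> ` prime_divisors R f"
  then show "p \<in> pdivs (\<Psi> f)" unfolding prime_divisors_def pdivs_def using Psi_prime Psi_dvd[OF _ f] by auto
next
  fix p assume p: "p \<in> pdivs (\<Psi> f)"
  obtain g where g: "g \<in> carrier P" "\<Psi> g = p" using Psi_surj by blast
  then have "g \<in> prime_divisors R f" using p Psi_prime[of g] Psi_dvd[OF g(1) f] unfolding prime_divisors_def pdivs_def by blast
  then show "p \<in> \<Psi> ` prime_divisors R f" using g(2) by blast
qed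

lemma small_omega_Psi: "f \<in> carrier P \<Longrightarrow> small_omega R f = somega (\<Psi> f)"
  unfolding small_omega_def somega_def by (rule bij_betw_same_card[OF Psi_prime_divisors])

lemma Psi_pow: "f \<in> carrier P \<Longrightarrow> \<Psi> (f [^]\<^bsub>P\<^esub> (e::nat)) = \<Psi> f ^ e"
  by (induction e) (simp_all add: Psi_one Psi_mult mult.commute)

lemma big_omega_Psi: "f \<in> carrier P \<Longrightarrow> big_omega R f = bomega (\<Psi> f)"
proof -
  assume f: "f \<in> carrier P"
  have "big_omega R f = (\<Sum>p\<in>prime_divisors R f. GREATEST e. \<Psi> p ^ e dvd \<Psi> f)"
    unfolding big_omega_def
  proof (rule sum.cong[OF refl])
    fix p assume "p \<in> prime_divisors R f"
    then have p: "p \<in> carrier P" unfolding prime_divisors_def using Psi_prime by blast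
    have "(p [^]\<^bsub>P\<^esub> e) pdivides f \<longleftrightarrow> \<Psi> p ^ e dvd \<Psi> f" for e :: nat
      using Psi_dvd[OF P.nat_pow_closed[OF p] f] Psi_pow[OF p] by simp
    then show "poly_multiplicity R p f = (GREATEST e. \<Psi> p ^ e dvd \<Psi> f)" unfolding poly_multiplicity_def by simp
  qed
  also have "\<dots> = bomega (\<Psi> f)" unfolding bomega_def
    by (rule sum.reindex_bij_betw[OF Psi_prime_divisors[OF f]])
  finally show ?thesis .
qed

lemma Psi_finprod:
  assumes "finite A" "\<And>i. i \<in> A \<Longrightarrow> g i \<in> carrier P"
  shows "\<Psi> (\<Otimes>\<^bsub>P\<^esub>i\<in>A. g i) = (\<Prod>i\<in>A. \<Psi> (g i))"
  using assms
proof (induction A rule: finite_induct)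
  case empty
  then show ?case by (simp add: Psi_one)
next
  case (insert x F)
  have "(\<Otimes>\<^bsub>P\<^esub>i\<in>insert x F. g i) = g x \<otimes>\<^bsub>P\<^esub> (\<Otimes>\<^bsub>P\<^esub>i\<in>F. g i)"
    by (rule P.finprod_insert) (use insert in auto)
  moreover have "(\<Otimes>\<^bsub>P\<^esub>i\<in>F. g i) \<in> carrier P" by (rule P.finprod_closed) (use insert in auto)
  ultimately show ?case using insert by (simp add: Psi_mult)
qed

lemma divisor_fun_Psi: "f \<in> carrier P \<Longrightarrow> divisor_fun k R f = divf k (\<Psi> f)"
proof -
  assume f: "f \<in> carrier P"
  define D where "D = {g \<in> {1..k} \<rightarrow>\<^sub>E monic_polys R. f = (\<Otimes>\<^bsub>P\<^esub>i\<in>{1..k}. g i)}"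
  define H where "H = (\<lambda>g. \<lambda>i\<in>{1..k}. \<Psi> (g i :: 'a list))"
  have mc: "monic_polys R \<subseteq> carrier P" unfolding monic_polys_def by blast
  have Dc: "g i \<in> carrier P" "lead_coeff (\<Psi> (g i)) = 1" if "g \<in> D" "i \<in> {1..k}" for g i
    using that Psi_monic[of "g i"] unfolding D_def PiE_iff by blast+
  have "bij_betw H D (divtuples k (\<Psi> f))"
    unfolding bij_betw_def
  proof (intro conjI equalityI)
    show "inj_on H D"
    proof (rule inj_onI)
      fix g h assume gh: "g \<in> D" "h \<in> D" "H g = H h"
      show "g = h"
      proof
        fix i
        show "g i = h i"
        proof (cases "i \<in> {1..k}")
          case True
          have "\<Psi> (g i) = \<Psi> (h i)" using fun_cong[OF gh(3), of i] True unfolding H_def by simp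
          then show ?thesis using inj_onD[OF Psi_inj] Dc(1)[OF gh(1) True] Dc(1)[OF gh(2) True] by blast
        next
          case False
          have "g \<in> extensional {1..k}" "h \<in> extensional {1..k}" using gh(1,2) unfolding D_def PiE_iff by blast+
          then show ?thesis using False by (simp add: extensional_def)
        qed
      qed
    qed
    show "H ` D \<subseteq> divtuples k (\<Psi> f)"
    proof (rule image_subsetI)
      fix g assume g: "g \<in> D"
      then have fp: "f = (\<Otimes>\<^bsub>P\<^esub>i\<in>{1..k}. g i)" unfolding D_def by blast
      have "\<Psi> f = (\<Prod>i\<in>{1..k}. \<Psi> (g i))" unfolding fp by (rule Psi_finprod) (use Dc(1)[OF g] in auto)
      also have "\<dots> = (\<Prod>i\<in>{1..k}. H g i)" unfolding H_def by (rule prod.cong) auto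
      finally have "\<Psi> f = (\<Prod>i\<in>{1..k}. H g i)" .
      moreover have "H g \<in> {1..k} \<rightarrow>\<^sub>E {h. lead_coeff h = 1}" unfolding H_def PiE_iff using Dc(2)[OF g] by auto
      ultimately show "H g \<in> divtuples k (\<Psi> f)" unfolding divtuples_def by blast
    qed
    show "divtuples k (\<Psi> f) \<subseteq> H ` D"
    proof
      fix h assume h: "h \<in> divtuples k (\<Psi> f)"
      obtain u where u: "\<And>p. u p \<in> carrier P \<and> \<Psi> (u p) = p" using Psi_surj by metis
      define g where "g = (\<lambda>i\<in>{1..k}. u (h i))"
      have h1: "h i = \<Psi> (g i) \<and> g i \<in> carrier P" if "i \<in> {1..k}" for i unfolding g_def using that u by simp
      have he: "h \<in> extensional {1..k}" "\<And>i. i \<in> {1..k} \<Longrightarrow> lead_coeff (h i) = 1" "\<Psi> f = (\<Prod>i\<in>{1..k}. h i)"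
        using h unfolding divtuples_def PiE_iff by auto
      have "\<Psi> f = (\<Prod>i\<in>{1..k}. \<Psi> (g i))" unfolding he(3) by (rule prod.cong) (use h1 in auto)
      also have "\<dots> = \<Psi> (\<Otimes>\<^bsub>P\<^esub>i\<in>{1..k}. g i)" by (rule Psi_finprod[symmetric]) (use h1 in auto)
      finally have "f = (\<Otimes>\<^bsub>P\<^esub>i\<in>{1..k}. g i)"
        by (rule inj_onD[OF Psi_inj _ f]) (rule P.finprod_closed, use h1 in auto)
      moreover have "g \<in> {1..k} \<rightarrow>\<^sub>E monic_polys R"
        unfolding PiE_iff Psi_monic using h1 he(2) by (auto simp: g_def)
      ultimately have "g \<in> D" unfolding D_def by blast
      moreover have "H g = h"
      proof
        fix i
        show "H g i = h i" using h1[of i] he(1) unfolding H_def by (cases "i \<in> {1..k}") (auto simp: extensional_def)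
      qed
      ultimately show "h \<in> H ` D" by blast
    qed
  qed
  then have "card D = card (divtuples k (\<Psi> f))" by (rule bij_betw_same_card)
  then show ?thesis unfolding divisor_fun_def divf_def D_def .
qed

text \<open>Shifts are numbered from 1 on the side of the ring and from 0 on the side of the type,
  which accounts for \<open>Suc\<close>.\<close>

lemma shift_count_Psi:
  assumes \<alpha>: "\<And>f. f \<in> carrier P \<Longrightarrow> \<alpha> R f = \<beta> (\<Psi> f)" and a: "\<And>j. j \<in> {1..r} \<Longrightarrow> a j \<in> carrier P"
  shows "shift_count \<alpha> R r a n = card (shifts_equal \<beta> r (\<lambda>j. \<Psi> (a (Suc j))) n)"
proof -
  define S where "S = {f \<in> monic_polys_deg R n. \<forall>i\<in>{1..r}. \<forall>j\<in>{1..r}. \<alpha> R (f \<oplus>\<^bsub>P\<^esub> a i) = \<alpha> R (f \<oplus>\<^bsub>P\<^esub> a j)}"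
  have mon: "f \<in> monic_polys_deg R n \<longleftrightarrow> f \<in> carrier P \<and> \<Psi> f \<in> Mon n" for f
    unfolding monic_polys_deg_def Mon_def using Psi_monic[of f] Psi_degree[of f] by auto
  have al: "\<alpha> R (f \<oplus>\<^bsub>P\<^esub> a j) = \<beta> (\<Psi> f + \<Psi> (a j))" if "f \<in> carrier P" "j \<in> {1..r}" for f j
    using \<alpha>[OF P.a_closed[OF that(1) a[OF that(2)]]] Psi_add[OF that(1) a[OF that(2)]] by simp
  have idx: "(\<forall>i\<in>{1..r}. \<forall>j\<in>{1..r}. Q i j) \<longleftrightarrow> (\<forall>i<r. \<forall>j<r. Q (Suc i) (Suc j))" for Q :: "nat \<Rightarrow> nat \<Rightarrow> bool"
  proof
    assume h: "\<forall>i<r. \<forall>j<r. Q (Suc i) (Suc j)"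
    show "\<forall>i\<in>{1..r}. \<forall>j\<in>{1..r}. Q i j"
    proof (intro ballI)
      fix i j assume "i \<in> {1..r}" "j \<in> {1..r}"
      then show "Q i j" using h[rule_format, of "i - 1" "j - 1"] by (auto simp: Suc_diff_1)
    qed
  qed auto
  have mem: "f \<in> S \<longleftrightarrow> f \<in> carrier P \<and> \<Psi> f \<in> shifts_equal \<beta> r (\<lambda>j. \<Psi> (a (Suc j))) n" for f
  proof (cases "f \<in> carrier P")
    case True
    have "(\<forall>i\<in>{1..r}. \<forall>j\<in>{1..r}. \<alpha> R (f \<oplus>\<^bsub>P\<^esub> a i) = \<alpha> R (f \<oplus>\<^bsub>P\<^esub> a j)) \<longleftrightarrow>
      (\<forall>i\<in>{1..r}. \<forall>j\<in>{1..r}. \<beta> (\<Psi> f + \<Psi> (a i)) = \<beta> (\<Psi> f + \<Psi> (a j)))" using al[OF True] by simp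
    then show ?thesis unfolding S_def shifts_equal_def idx using True mon[of f] by simp
  next
    case False
    then show ?thesis unfolding S_def using mon by blast
  qed
  have "bij_betw \<Psi> S (shifts_equal \<beta> r (\<lambda>j. \<Psi> (a (Suc j))) n)"
    unfolding bij_betw_def
  proof (intro conjI equalityI subsetI)
    show "inj_on \<Psi> S" by (rule inj_on_subset[OF Psi_inj]) (use mem in blast)
    fix p assume p: "p \<in> shifts_equal \<beta> r (\<lambda>j. \<Psi> (a (Suc j))) n"
    obtain g where g: "g \<in> carrier P" "\<Psi> g = p" using Psi_surj by blast
    then have "g \<in> S" using mem p by blast
    then show "p \<in> \<Psi> ` S" using g(2) by blast
  qed (use mem in blast)
  then show ?thesis unfolding shift_count_def S_def[symmetric] by (rule bij_betw_same_card)
qed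

lemma finite_card_rep: "finite (carrier R) \<Longrightarrow> finite (UNIV :: 'k set) \<and> card (UNIV :: 'k set) = card (carrier R)"
  using bij_betw_finite[OF bij] bij_betw_same_card[OF bij] by simp

end

text \<open>Everything except the field is quantified inside, in particular the function, the
  degree, the shifts and the precision. Failure is then a property of the field alone, so that a
  counterexample can be fixed by choice before a type is formed.\<close>

definition approx_claim :: "'a ring \<Rightarrow> bool" where
  "approx_claim R \<longleftrightarrow> (\<forall>\<alpha> n r a M0. (\<alpha> = small_omega \<or> \<alpha> = big_omega \<or> (\<exists>k\<ge>2. \<alpha> = divisor_fun k)) \<longrightarrow>
     1 \<le> n \<longrightarrow> (n = 2 \<longrightarrow> r \<le> 3) \<longrightarrow> 1 \<le> r \<longrightarrow> 0 < M0 \<longrightarrow> inj_on a {1..r} \<longrightarrow>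
     (\<forall>j\<in>{1..r}. a j \<in> carrier (poly_ring R) \<and> Polynomials.degree (a j) < n) \<longrightarrow>
     large_q n r M0 \<le> card (carrier R) \<longrightarrow>
     \<bar>real (shift_count \<alpha> R r a n) / real (card (carrier R)) ^ n - Llim n r\<bar> \<le> (13 + real (r * (n - 1) * (r * n * n))) / real M0)"

lemma (in field_rep) approx_claim_rep:
  assumes fin: "finite (carrier R)" and pp: "primepow (card (carrier R))"
  shows "approx_claim R"
  unfolding approx_claim_def
proof (intro allI impI)
  fix \<alpha> :: "'a ring \<Rightarrow> 'a list \<Rightarrow> nat" and n r M0 and a :: "nat \<Rightarrow> 'a list"
  assume \<alpha>: "\<alpha> = small_omega \<or> \<alpha> = big_omega \<or> (\<exists>k\<ge>2. \<alpha> = divisor_fun k)"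
    and n: "1 \<le> n" "n = 2 \<longrightarrow> r \<le> 3" and r: "1 \<le> r" and M0: "0 < M0" and inj: "inj_on a {1..r}"
    and a: "\<forall>j\<in>{1..r}. a j \<in> carrier (poly_ring R) \<and> Polynomials.degree (a j) < n"
    and big: "large_q n r M0 \<le> card (carrier R)"
  note U = finite_card_rep[OF fin]
  obtain \<beta> :: "'k poly \<Rightarrow> nat" where \<beta>: "nice \<beta>" "\<And>f. f \<in> carrier P \<Longrightarrow> \<alpha> R f = \<beta> (\<Psi> f)"
    using \<alpha>
  proof (elim disjE exE conjE)
    assume "\<alpha> = small_omega"
    then show ?thesis using that[OF nice_somega] small_omega_Psi by blast
  next
    assume "\<alpha> = big_omega"
    then show ?thesis using that[OF nice_bomega] big_omega_Psi by blast
  next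
    fix k assume "2 \<le> k" "\<alpha> = divisor_fun k"
    then show ?thesis using that[OF nice_divf[of k]] divisor_fun_Psi by blast
  qed
  have sc: "shift_count \<alpha> R r a n = card (shifts_equal \<beta> r (\<lambda>j. \<Psi> (a (Suc j))) n)"
    by (rule shift_count_Psi[where \<alpha> = \<alpha> and \<beta> = \<beta>, OF \<beta>(2)]) (use a in auto)
  have "\<bar>real (card (shifts_equal \<beta> r (\<lambda>j. \<Psi> (a (Suc j))) n)) / real (card (UNIV :: 'k set)) ^ n - Llim n r\<bar>
     \<le> (13 + real (r * (n - 1) * (r * n * n))) / real M0"
  proof (rule shifts_equal_asymptotics[OF _ _ n(1) _ r M0 _ _ _ \<beta>(1)])
    show "finite (UNIV :: 'k set)" "primepow (card (UNIV :: 'k set))" "large_q n r M0 \<le> card (UNIV :: 'k set)"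
      using U pp big by auto
    show "r \<le> 3" if "n = 2" using n(2) that by blast
    show "degree (\<Psi> (a (Suc j))) < n" if "j < r" for j
      using a[rule_format, of "Suc j"] that Psi_degree[of "a (Suc j)"] by simp
    show "inj_on (\<lambda>j. \<Psi> (a (Suc j))) {..<r}"
    proof (rule inj_onI)
      fix i j assume ij: "i \<in> {..<r}" "j \<in> {..<r}" "\<Psi> (a (Suc i)) = \<Psi> (a (Suc j))"
      then have m: "Suc i \<in> {1..r}" "Suc j \<in> {1..r}" by auto
      then have "a (Suc i) = a (Suc j)" using inj_onD[OF Psi_inj ij(3)] a by blast
      then show "i = j" using inj_onD[OF inj _ m] by blast
    qed
  qed
  then show "\<bar>real (shift_count \<alpha> R r a n) / real (card (carrier R)) ^ n - Llim n r\<bar> \<le> (13 + real (r * (n - 1) * (r * n * n))) / real M0"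
    unfolding sc using U by simp
qed

definition bad_field :: "'a ring \<Rightarrow> bool" where
  "bad_field R \<longleftrightarrow> field R \<and> finite (carrier R) \<and> primepow (card (carrier R)) \<and> \<not> approx_claim R"

text \<open>The results above need a field given as a type. A type cannot depend on the field \<open>R\<close> under
  consideration, but it can depend on a fixed counterexample, which suffices for a proof by contradiction;
  the rationals serve as default value if there is none.\<close>

definition cex_field :: "('a + rat) ring" where
  "cex_field = (if \<exists>R :: 'a ring. bad_field R then image_ring Inl (SOME R :: 'a ring. bad_field R)
     else image_ring Inr (ring_of_type_algebra :: rat ring))"

lemma field_cex_field: "field cex_field"
proof (cases "\<exists>R :: 'a ring. bad_field R")
  case True
  then have "bad_field (SOME R :: 'a ring. bad_field R)" by (rule someI_ex)
  then have "field (SOME R :: 'a ring. bad_field R)" unfolding bad_field_def by blast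
  then show ?thesis unfolding cex_field_def using True by (simp add: field.inj_imp_image_ring_is_field)
next
  case False
  show ?thesis unfolding cex_field_def if_not_P[OF False]
    by (rule field.inj_imp_image_ring_is_field[OF field_from_type_algebra]) simp
qed

typedef 'a cex_type = "carrier (cex_field :: ('a + rat) ring)"
proof -
  interpret field "cex_field :: ('a + rat) ring" by (rule field_cex_field)
  show ?thesis using zero_closed by blast
qed

instantiation cex_type :: (type) field
begin

definition "0 = Abs_cex_type \<zero>\<^bsub>cex_field\<^esub>"
definition "1 = Abs_cex_type \<one>\<^bsub>cex_field\<^esub>"
definition "x + y = Abs_cex_type (Rep_cex_type x \<oplus>\<^bsub>cex_field\<^esub> Rep_cex_type y)"
definition "x * y = Abs_cex_type (Rep_cex_type x \<otimes>\<^bsub>cex_field\<^esub> Rep_cex_type y)"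
definition "- x = Abs_cex_type (\<ominus>\<^bsub>cex_field\<^esub> Rep_cex_type x)"
definition "x - y = Abs_cex_type (Rep_cex_type x \<ominus>\<^bsub>cex_field\<^esub> Rep_cex_type y)"
definition "inverse x = (if x = 0 then 0 else Abs_cex_type (inv\<^bsub>cex_field\<^esub> Rep_cex_type x))"
definition "x div y = x * inverse (y :: 'a cex_type)"

instance
proof
  interpret K: field "cex_field :: ('a + rat) ring" by (rule field_cex_field)
  fix a b c :: "'a cex_type"
  note R = Rep_cex_type[of a] Rep_cex_type[of b] Rep_cex_type[of c]
  note D = zero_cex_type_def one_cex_type_def plus_cex_type_def times_cex_type_def uminus_cex_type_def minus_cex_type_def
  note I = Abs_cex_type_inverse Rep_cex_type_inverse
  show "a + b + c = a + (b + c)" unfolding D using R by (simp add: I K.a_assoc)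
  show "a + b = b + a" unfolding D using R by (simp add: K.a_comm)
  show "0 + a = a" unfolding D using R by (simp add: I)
  show "- a + a = 0" unfolding D using R by (simp add: I K.l_neg)
  show "a - b = a + - b" unfolding D using R by (simp add: I K.minus_eq)
  show "a * b * c = a * (b * c)" unfolding D using R by (simp add: I K.m_assoc)
  show "a * b = b * a" unfolding D using R by (simp add: K.m_comm)
  show "1 * a = a" unfolding D using R by (simp add: I)
  show "(a + b) * c = a * c + b * c" unfolding D using R by (simp add: I K.l_distr)
  show "(0 :: 'a cex_type) \<noteq> 1" unfolding D by (simp add: Abs_cex_type_inject)
  show "a div b = a * inverse b" by (rule divide_cex_type_def)
  show "inverse (0 :: 'a cex_type) = 0" by (simp add: inverse_cex_type_def)
  assume a0: "a \<noteq> 0"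
  then have "Rep_cex_type a \<noteq> \<zero>\<^bsub>cex_field\<^esub>" unfolding zero_cex_type_def using Rep_cex_type_inverse[of a] by auto
  then have "Rep_cex_type a \<in> Units cex_field" using R(1) K.field_Units by blast
  then have "inv\<^bsub>cex_field\<^esub> Rep_cex_type a \<in> carrier cex_field" "inv\<^bsub>cex_field\<^esub> Rep_cex_type a \<otimes>\<^bsub>cex_field\<^esub> Rep_cex_type a = \<one>\<^bsub>cex_field\<^esub>"
    by simp_all
  then show "inverse a * a = 1" using a0 unfolding inverse_cex_type_def times_cex_type_def one_cex_type_def by (simp add: I)
qed

end

theorem approx_claim_finite_field:
  fixes R0 :: "'a ring"
  assumes "field R0" "finite (carrier R0)" "primepow (card (carrier R0))"
  shows "approx_claim R0"
proof (rule ccontr)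
  assume "\<not> approx_claim R0"
  then have ex: "\<exists>R :: 'a ring. bad_field R" using assms unfolding bad_field_def by blast
  define R where "R = (SOME R :: 'a ring. bad_field R)"
  have bad: "bad_field R" unfolding R_def using ex by (rule someI_ex)
  have cex: "cex_field = image_ring (Inl :: 'a \<Rightarrow> 'a + rat) R" unfolding cex_field_def R_def using ex by simp
  interpret R: field R using bad unfolding bad_field_def by blast
  have iso: "Inl \<in> ring_iso R (cex_field :: ('a + rat) ring)" unfolding cex by (rule inj_imp_image_ring_iso) simp
  define \<phi> where "\<phi> = (\<lambda>x. Abs_cex_type (Inl x :: 'a + rat))"
  have inC: "Inl x \<in> carrier (cex_field :: ('a + rat) ring)" if "x \<in> carrier R" for x
    using that unfolding cex image_ring_carrier by blast
  have "field_rep R \<phi>"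
  proof unfold_locales
    show "bij_betw \<phi> (carrier R) UNIV"
      unfolding bij_betw_def
    proof (intro conjI inj_onI equalityI subsetI)
      fix x y assume "x \<in> carrier R" "y \<in> carrier R" "\<phi> x = \<phi> y"
      then show "x = y" unfolding \<phi>_def using Abs_cex_type_inject[OF inC inC] by blast
    next
      fix z :: "'a cex_type"
      have "Rep_cex_type z \<in> Inl ` carrier R" using Rep_cex_type[of z] unfolding cex image_ring_carrier .
      then obtain x where "x \<in> carrier R" "Rep_cex_type z = Inl x" by blast
      then have "z = \<phi> x" "x \<in> carrier R" unfolding \<phi>_def using Rep_cex_type_inverse[of z] by auto
      then show "z \<in> \<phi> ` carrier R" by blast
    qed simp
    fix x y assume xy: "x \<in> carrier R" "y \<in> carrier R"
    show "\<phi> (x \<oplus>\<^bsub>R\<^esub> y) = \<phi> x + \<phi> y" unfolding \<phi>_def plus_cex_type_def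
      using ring_iso_memE(3)[OF iso xy] by (simp add: Abs_cex_type_inverse[OF inC] xy)
    show "\<phi> (x \<otimes>\<^bsub>R\<^esub> y) = \<phi> x * \<phi> y" unfolding \<phi>_def times_cex_type_def
      using ring_iso_memE(2)[OF iso xy] by (simp add: Abs_cex_type_inverse[OF inC] xy)
  qed
  then have "approx_claim R" using field_rep.approx_claim_rep bad unfolding bad_field_def by blast
  then show False using bad unfolding bad_field_def by blast
qed

section \<open>The characteristic function of the number of cycles\<close>

definition cyc_prob :: "nat \<Rightarrow> nat \<Rightarrow> real" where "cyc_prob n c = real (stirling n c) / fact n"

definition cyc_char :: "nat \<Rightarrow> real \<Rightarrow> complex" where
  "cyc_char n \<theta> = (\<Prod>i<n. 1 + (iexp \<theta> - 1) / of_nat (Suc i))"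

lemma iexp_mult_nat: "iexp (\<theta> * real c) = iexp \<theta> ^ c"
  by (simp add: exp_of_nat_mult[symmetric] mult.commute mult.left_commute)

text \<open>The rising factorial is the generating function of the Stirling numbers; on the unit
  circle it gives the characteristic function, already factored.\<close>

lemma cyc_char_eq_sum: "cyc_char n \<theta> = (\<Sum>c\<le>n. of_real (cyc_prob n c) * iexp (\<theta> * real c))"
proof -
  have "(\<Sum>c\<le>n. of_real (cyc_prob n c) * iexp (\<theta> * real c)) = (\<Sum>c\<le>n. of_nat (stirling n c) * iexp \<theta> ^ c) / fact n"
    unfolding sum_divide_distrib iexp_mult_nat cyc_prob_def by (rule sum.cong) auto
  also have "\<dots> = pochhammer (iexp \<theta>) n / fact n" unfolding stirling_pochhammer ..
  also have "\<dots> = (\<Prod>i<n. iexp \<theta> + of_nat i) / (\<Prod>i<n. of_nat (Suc i))"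
    unfolding pochhammer_prod fact_prod_Suc of_nat_prod by (simp add: atLeast0LessThan)
  also have "\<dots> = (\<Prod>i<n. (iexp \<theta> + of_nat i) / of_nat (Suc i))" by (rule prod_dividef[symmetric])
  also have "\<dots> = cyc_char n \<theta>" unfolding cyc_char_def
  proof (rule prod.cong)
    fix i
    have "(of_nat (Suc i) :: complex) \<noteq> 0" by (simp del: of_nat_Suc)
    then show "(iexp \<theta> + of_nat i) / of_nat (Suc i) = 1 + (iexp \<theta> - 1) / of_nat (Suc i)" by (simp add: field_simps)
  qed simp
  finally show ?thesis by simp
qed

text \<open>Half angles reduce this to \<open>x / 2 \<le> sin x\<close> on
  \<open>0 \<le> x \<le> pi / 2\<close>, which follows from the cubic Taylor bound and
  \<open>x\<^sup>2 \<le> 3\<close>. The constant is not optimised; any positive one yields a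
  Gaussian majorant.\<close>

lemma one_minus_cos_ge:
  assumes "\<bar>\<theta>\<bar> \<le> pi" shows "\<theta>\<^sup>2 / 8 \<le> 1 - cos \<theta>"
proof -
  define x where "x = \<bar>\<theta>\<bar> / 2"
  have x: "0 \<le> x" "x \<le> pi / 2" using assms unfolding x_def by auto
  have "pi / 2 \<le> 1.65" using pi_approx(2) by simp
  then have "x \<le> 1.65" using x by linarith
  then have x2: "x\<^sup>2 \<le> 3" using power_mono[of x "1.65" 2] x(1) by (simp add: power2_eq_square)
  have "\<bar>sin x - (\<Sum>m<3. sin_coeff m * x ^ m)\<bar> \<le> inverse (fact 3) * \<bar>x\<bar> ^ 3" by (rule Maclaurin_sin_bound)
  moreover have "(\<Sum>m<3. sin_coeff m * x ^ m) = x" by (simp add: numeral_3_eq_3 sin_coeff_def)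
  moreover have "inverse (fact 3 :: real) = 1 / 6" by (simp add: fact_numeral)
  ultimately have "\<bar>sin x - x\<bar> \<le> x ^ 3 / 6" using x(1) by simp
  then have "x - x ^ 3 / 6 \<le> sin x" by linarith
  moreover have "x ^ 3 \<le> 3 * x" using mult_right_mono[OF x2 x(1)] by (simp add: power3_eq_cube power2_eq_square)
  ultimately have "x / 2 \<le> sin x" by linarith
  then have "(x / 2)\<^sup>2 \<le> (sin x)\<^sup>2" by (rule power_mono) (use x in simp)
  moreover have "cos \<theta> = cos (2 * x)" unfolding x_def by simp
  moreover have "cos (2 * x) = 1 - 2 * (sin x)\<^sup>2" by (rule cos_double_sin)
  moreover have "(x / 2)\<^sup>2 = \<theta>\<^sup>2 / 16" unfolding x_def by (simp add: power_divide)
  ultimately show ?thesis by linarith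
qed

lemma cyc_factor_norm:
  "(cmod (1 + (iexp \<theta> - 1) / of_nat (Suc i)))\<^sup>2 = 1 - 2 * (real i / (real (Suc i))\<^sup>2) * (1 - cos \<theta>)"
proof -
  let ?k = "real (Suc i)"
  have k: "?k \<noteq> 0" "?k = real i + 1" by auto
  have z: "1 + (iexp \<theta> - 1) / of_nat (Suc i) = Complex (1 + (cos \<theta> - 1) / ?k) (sin \<theta> / ?k)"
    by (simp add: complex_eq_iff exp_eq_polar cis.simps Re_divide_of_nat Im_divide_of_nat del: of_nat_Suc)
  have "(cmod (Complex (1 + (cos \<theta> - 1) / ?k) (sin \<theta> / ?k)))\<^sup>2 = (1 + (cos \<theta> - 1) / ?k)\<^sup>2 + (sin \<theta> / ?k)\<^sup>2"
    by (simp add: cmod_power2)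
  also have "\<dots> = ((?k + cos \<theta> - 1)\<^sup>2 + (sin \<theta>)\<^sup>2) / ?k\<^sup>2" using k(1) by (simp add: field_simps power2_eq_square del: of_nat_Suc)
  also have "(?k + cos \<theta> - 1)\<^sup>2 + (sin \<theta>)\<^sup>2 = ?k\<^sup>2 - 2 * real i * (1 - cos \<theta>)"
    unfolding sin_squared_eq k(2) by (simp add: algebra_simps power2_eq_square)
  also have "\<dots> / ?k\<^sup>2 = 1 - 2 * (real i / ?k\<^sup>2) * (1 - cos \<theta>)" using k(1) by (simp add: diff_divide_distrib del: of_nat_Suc)
  finally show ?thesis unfolding z .
qed

lemma cyc_factor_le_1: "cmod (1 + (iexp \<theta> - 1) / of_nat (Suc i)) \<le> 1"
proof -
  have "0 \<le> 2 * (real i / (real (Suc i))\<^sup>2) * (1 - cos \<theta>)" by (intro mult_nonneg_nonneg) auto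
  then have "(cmod (1 + (iexp \<theta> - 1) / of_nat (Suc i)))\<^sup>2 \<le> 1\<^sup>2" unfolding cyc_factor_norm by simp
  then show ?thesis by (rule power2_le_imp_le) simp
qed

text \<open>The factor number 0 has modulus one, and for \<open>i > 0\<close> the squared modulus is
  at most the exponential of \<open>- (1 - cos \<theta>) / (i + 1)\<close>. The sum of the exponents
  is governed by the harmonic number minus one.\<close>

lemma cyc_char_bound:
  assumes n: "1 \<le> n" and \<theta>: "\<bar>\<theta>\<bar> \<le> pi"
  shows "cmod (cyc_char n \<theta>) \<le> exp (- (\<theta>\<^sup>2 / 16) * (ln (real n) - 1))"
proof -
  define u where "u = 1 - cos \<theta>"
  have u: "0 \<le> u" "\<theta>\<^sup>2 / 8 \<le> u" using one_minus_cos_ge[OF \<theta>] unfolding u_def by auto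
  have fac: "(cmod (1 + (iexp \<theta> - 1) / of_nat (Suc i)))\<^sup>2 \<le> exp (- u * (if i = 0 then 0 else 1 / real (Suc i)))" for i
  proof (cases "i = 0")
    case True
    then show ?thesis unfolding cyc_factor_norm by simp
  next
    case False
    then have "real (Suc i) \<le> 2 * real i" by simp
    then have "1 / real (Suc i) \<le> 2 * (real i / (real (Suc i))\<^sup>2)"
      by (simp add: divide_simps power2_eq_square del: of_nat_Suc)
    then have "u * (1 / real (Suc i)) \<le> 2 * (real i / (real (Suc i))\<^sup>2) * u" using mult_left_mono[OF _ u(1)] by (metis mult.commute)
    moreover have "1 + (- u * (1 / real (Suc i))) \<le> exp (- u * (1 / real (Suc i)))" by (rule exp_ge_add_one_self)
    ultimately show ?thesis unfolding cyc_factor_norm u_def[symmetric] using False by simp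
  qed
  have "(cmod (cyc_char n \<theta>))\<^sup>2 = (\<Prod>i<n. (cmod (1 + (iexp \<theta> - 1) / of_nat (Suc i)))\<^sup>2)"
    unfolding cyc_char_def prod_norm[symmetric] prod_power_distrib ..
  also have "\<dots> \<le> (\<Prod>i<n. exp (- u * (if i = 0 then 0 else 1 / real (Suc i))))" by (rule prod_mono) (use fac in auto)
  also have "\<dots> = exp (\<Sum>i<n. - u * (if i = 0 then 0 else 1 / real (Suc i)))" by (simp add: exp_sum)
  also have "(\<Sum>i<n. - u * (if i = 0 then 0 else 1 / real (Suc i))) = - u * (\<Sum>i<n. if i = 0 then 0 else 1 / real (Suc i))"
    by (rule sum_distrib_left[symmetric])
  also have "(\<Sum>i<n. if i = 0 then 0 else 1 / real (Suc i)) = harm n - 1"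
  proof -
    obtain m where m: "n = Suc m" using n by (cases n) auto
    have "harm n = (\<Sum>i<n. 1 / real (Suc i))"
      unfolding harm_def by (rule sum.reindex_bij_witness[of _ Suc "\<lambda>k. k - 1"]) (auto simp: divide_inverse)
    then show ?thesis unfolding m sum.lessThan_Suc_shift by simp
  qed
  finally have "(cmod (cyc_char n \<theta>))\<^sup>2 \<le> exp (- u * (harm n - 1))" .
  also have "\<dots> \<le> exp (2 * (- (\<theta>\<^sup>2 / 16) * (ln (real n) - 1)))"
  proof (cases "1 \<le> ln (real n)")
    case True
    have "ln (real n) \<le> ln (real n + 1)" using n by simp
    then have "ln (real n) \<le> harm n" using ln_le_harm[of n] by linarith
    then have "(\<theta>\<^sup>2 / 8) * (ln (real n) - 1) \<le> u * (harm n - 1)" using True u by (intro mult_mono) auto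
    then have "- u * (harm n - 1) \<le> 2 * (- (\<theta>\<^sup>2 / 16) * (ln (real n) - 1))" by (simp add: mult.commute)
    then show ?thesis by (simp only: exp_le_cancel_iff)
  next
    case False
    have "(harm 1 :: real) \<le> harm n" by (rule harm_mono[OF n])
    then have "0 \<le> u * (harm n - 1)" using u(1) by (intro mult_nonneg_nonneg) (simp_all add: harm_def)
    then have "- u * (harm n - 1) \<le> 0" by simp
    moreover have "(\<theta>\<^sup>2 / 16) * (ln (real n) - 1) \<le> 0" using False by (intro mult_nonneg_nonpos) simp_all
    then have "0 \<le> 2 * (- (\<theta>\<^sup>2 / 16) * (ln (real n) - 1))" by (simp add: mult.commute)
    ultimately show ?thesis unfolding exp_le_cancel_iff by linarith
  qed
  also have "\<dots> = (exp (- (\<theta>\<^sup>2 / 16) * (ln (real n) - 1)))\<^sup>2" by (rule exp_double)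
  finally show ?thesis by (rule power2_le_imp_le) simp
qed

text \<open>Mean and variance of the number of cycles both grow like \<open>ln n\<close>, so the
  variable is centred at \<open>ln n\<close> and divided by its square root.\<close>

definition scaled_char :: "nat \<Rightarrow> real \<Rightarrow> complex" where
  "scaled_char n t = cyc_char n (t / sqrt (ln (real n))) * iexp (- (sqrt (ln (real n)) * t))"

text \<open>All factors lie in the closed unit disc, so the products differ by at most the sum of
  the differences of the factors, and these are of second order. The 6 is 3, a bound for
  \<open>exp 1\<close> in the Taylor remainder, times 2, a bound for the sum of the inverse
  squares.\<close>

lemma exp_harm_approx:
  assumes w: "cmod w \<le> 1" "Re w \<le> 0" and f: "\<And>i. cmod (1 + w / of_nat (Suc i)) \<le> 1"
  shows "cmod ((\<Prod>i<n. 1 + w / of_nat (Suc i)) - exp (w * of_real (harm n))) \<le> 6 * (cmod w)\<^sup>2"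
proof -
  have hs: "(harm n :: complex) = (\<Sum>i<n. 1 / of_nat (Suc i))"
    unfolding harm_def by (rule sum.reindex_bij_witness[of _ Suc "\<lambda>k. k - 1"]) (auto simp: divide_inverse)
  have "exp (w * of_real (harm n)) = exp (\<Sum>i<n. w / of_nat (Suc i))"
    unfolding of_real_harm hs sum_distrib_left by simp
  then have "exp (w * of_real (harm n)) = (\<Prod>i<n. exp (w / of_nat (Suc i)))" by (simp add: exp_sum)
  then have "cmod ((\<Prod>i<n. 1 + w / of_nat (Suc i)) - exp (w * of_real (harm n))) \<le> (\<Sum>i<n. cmod ((1 + w / of_nat (Suc i)) - exp (w / of_nat (Suc i))))"
  proof (simp only:, intro norm_prod_diff f)
    fix i
    have "Re (w / of_nat (Suc i)) \<le> 0" using w(2) by (simp add: Re_divide_of_nat divide_nonpos_pos del: of_nat_Suc)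
    then show "cmod (exp (w / of_nat (Suc i))) \<le> 1" by simp
  qed
  also have "\<dots> \<le> (\<Sum>i<n. 3 * (cmod w)\<^sup>2 * (1 / (real (Suc i))\<^sup>2))"
  proof (rule sum_mono)
    fix i
    define z where "z = w / of_nat (Suc i)"
    have zn: "cmod z = cmod w / real (Suc i)" unfolding z_def by (simp add: norm_divide del: of_nat_Suc)
    have "cmod z \<le> cmod w" unfolding zn by (simp add: divide_le_eq mult_le_cancel_left1)
    then have z1: "cmod z \<le> 1" using w(1) by linarith
    have "cmod (exp z - (\<Sum>k\<le>1. z ^ k / fact k)) \<le> exp \<bar>Re z\<bar> * cmod z ^ Suc 1 / fact 1" by (rule Taylor_exp)
    then have "cmod ((1 + z) - exp z) \<le> exp \<bar>Re z\<bar> * (cmod z)\<^sup>2"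
      by (simp add: norm_minus_commute power2_eq_square)
    also have "\<dots> \<le> 3 * (cmod z)\<^sup>2"
    proof (rule mult_right_mono)
      have "\<bar>Re z\<bar> \<le> 1" using abs_Re_le_cmod[of z] z1 by linarith
      then have "exp \<bar>Re z\<bar> \<le> exp 1" by simp
      then show "exp \<bar>Re z\<bar> \<le> 3" using exp_le by linarith
    qed simp
    also have "\<dots> = 3 * (cmod w)\<^sup>2 * (1 / (real (Suc i))\<^sup>2)" unfolding zn by (simp add: power_divide)
    finally show "cmod (1 + w / of_nat (Suc i) - exp (w / of_nat (Suc i))) \<le> 3 * (cmod w)\<^sup>2 * (1 / (real (Suc i))\<^sup>2)" unfolding z_def .
  qed
  also have "\<dots> = 3 * (cmod w)\<^sup>2 * (\<Sum>i<n. 1 / (real (Suc i))\<^sup>2)" by (rule sum_distrib_left[symmetric])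
  also have "\<dots> \<le> 3 * (cmod w)\<^sup>2 * 2"
  proof (rule mult_left_mono)
    have "(\<Sum>i<n. 1 / (real (Suc i))\<^sup>2) \<le> 2 - (if n = 0 then 0 else 1 / real n)"
    proof (induction n)
      case (Suc n)
      show ?case
      proof (cases "n = 0")
        case False
        have "1 / (real (Suc n))\<^sup>2 \<le> 1 / real n - 1 / real (Suc n)" using False by (simp add: divide_simps power2_eq_square)
        then show ?thesis using Suc False by simp
      qed simp
    qed simp
    moreover have "0 \<le> (if n = 0 then 0 else 1 / real n)" by simp
    ultimately show "(\<Sum>i<n. 1 / (real (Suc i))\<^sup>2) \<le> 2" by linarith
  qed simp
  finally show ?thesis by simp
qed

text \<open>With \<open>w = iexp \<theta> - 1\<close> the product is close to
  \<open>exp (w * harm n)\<close>. Expanding \<open>w\<close> to second order in \<theta> and using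
  that \<open>harm n - ln n\<close> stays bounded, the linear term cancels against the centring and
  the quadratic term gives the Gaussian.\<close>

lemma scaled_char_tendsto: "(\<lambda>n. scaled_char n t) \<longlonglongrightarrow> of_real (exp (- t\<^sup>2 / 2))"
proof -
  define s where "s = (\<lambda>n. sqrt (ln (real n)))"
  have s0: "(\<lambda>n. 1 / s n) \<longlonglongrightarrow> 0" unfolding s_def by real_asymp
  have s1: "\<forall>\<^sub>F n in sequentially. 1 \<le> s n" unfolding s_def by real_asymp
  define th where "th = (\<lambda>n. t / s n)"
  have th0: "th \<longlonglongrightarrow> 0" using tendsto_mult[OF tendsto_const s0, of t] unfolding th_def by simp
  define w where "w = (\<lambda>n. iexp (th n) - 1)"
  have wle: "cmod (w n) \<le> \<bar>th n\<bar>" for n using iexp_approx1[of "th n" 0] unfolding w_def by simp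
  have w0: "(\<lambda>n. cmod (w n)) \<longlonglongrightarrow> 0"
    by (rule tendsto_sandwich[OF _ _ tendsto_const tendsto_rabs_zero[OF th0]]) (auto intro!: always_eventually wle)
  \<comment> \<open>The exponent after centring; it tends to \<open>- t\<^sup>2 / 2\<close>, with
    error terms of order \<open>1 / s n\<close>.\<close>
  define E where "E = (\<lambda>n. w n * of_real (harm n) - \<i> * of_real (s n * t))"
  have "(\<lambda>n. E n + of_real (t\<^sup>2 / 2)) \<longlonglongrightarrow> 0"
  proof (rule Lim_null_comparison)
    show "\<forall>\<^sub>F n in sequentially. norm (E n + of_real (t\<^sup>2 / 2)) \<le> \<bar>th n\<bar> * \<bar>harm n - ln (real n)\<bar> + \<bar>t\<bar> ^ 3 * (1 / s n)"
      using s1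
    proof eventually_elim
      case (elim n)
      have lam: "ln (real n) = (s n)\<^sup>2" using elim unfolding s_def by (smt (verit) real_sqrt_le_0_iff real_sqrt_pow2)
      have sp: "s n > 0" using elim by simp
      have l1: "(s n)\<^sup>2 * th n = s n * t" unfolding th_def using sp by (simp add: power2_eq_square)
      have l2: "(s n)\<^sup>2 * (th n)\<^sup>2 = t\<^sup>2" unfolding th_def using sp by (simp add: power_divide)
      define v where "v = w n - (\<i> * of_real (th n) - of_real ((th n)\<^sup>2 / 2))"
      have "cmod (iexp (th n) - (\<Sum>k\<le>2. (\<i> * of_real (th n)) ^ k / fact k)) \<le> \<bar>th n\<bar> ^ Suc 2 / fact (Suc 2)" by (rule iexp_approx1)
      moreover have "iexp (th n) - (\<Sum>k\<le>2. (\<i> * of_real (th n)) ^ k / fact k) = v"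
        unfolding v_def w_def by (simp add: numeral_2_eq_2 algebra_simps power2_eq_square)
      moreover have "\<bar>th n\<bar> ^ Suc 2 / fact (Suc 2) \<le> \<bar>th n\<bar> ^ Suc 2 / 1" by (rule divide_left_mono) auto
      ultimately have vb: "cmod v \<le> \<bar>th n\<bar> ^ 3" by simp
      have ci: "of_real ((s n)\<^sup>2) * (\<i> * of_real (th n) - of_real ((th n)\<^sup>2 / 2)) = \<i> * of_real (s n * t) - complex_of_real (t\<^sup>2 / 2)"
        unfolding l1[symmetric] l2[symmetric] by (simp add: algebra_simps)
      have "E n + of_real (t\<^sup>2 / 2) = w n * of_real (harm n - ln (real n)) + of_real ((s n)\<^sup>2) * v
        + (of_real ((s n)\<^sup>2) * (\<i> * of_real (th n) - of_real ((th n)\<^sup>2 / 2)) - (\<i> * of_real (s n * t) - of_real (t\<^sup>2 / 2)))"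
        unfolding E_def v_def lam of_real_diff by (simp only: algebra_simps)
      then have "E n + of_real (t\<^sup>2 / 2) = w n * of_real (harm n - ln (real n)) + of_real ((s n)\<^sup>2) * v" unfolding ci by simp
      then have "cmod (E n + of_real (t\<^sup>2 / 2)) \<le> cmod (w n) * \<bar>harm n - ln (real n)\<bar> + (s n)\<^sup>2 * cmod v"
        by (metis norm_triangle_ineq norm_mult norm_of_real abs_power2)
      also have "\<dots> \<le> \<bar>th n\<bar> * \<bar>harm n - ln (real n)\<bar> + (s n)\<^sup>2 * \<bar>th n\<bar> ^ 3"
        by (intro add_mono mult_right_mono mult_left_mono wle vb) auto
      also have "(s n)\<^sup>2 * \<bar>th n\<bar> ^ 3 = \<bar>t\<bar> ^ 3 * (1 / s n)" unfolding th_def using sp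
        by (simp add: power_divide abs_divide power2_eq_square power3_eq_cube)
      finally show ?case .
    qed
    have "(\<lambda>n. \<bar>th n\<bar> * \<bar>harm n - ln (real n)\<bar> + \<bar>t\<bar> ^ 3 * (1 / s n)) \<longlonglongrightarrow> 0 * \<bar>euler_mascheroni\<bar> + \<bar>t\<bar> ^ 3 * 0"
      by (intro tendsto_add tendsto_mult tendsto_rabs_zero th0 tendsto_const s0 tendsto_rabs euler_mascheroni_LIMSEQ)
    then show "(\<lambda>n. \<bar>th n\<bar> * \<bar>harm n - ln (real n)\<bar> + \<bar>t\<bar> ^ 3 * (1 / s n)) \<longlonglongrightarrow> 0" by simp
  qed
  then have "(\<lambda>n. E n + of_real (t\<^sup>2 / 2) - of_real (t\<^sup>2 / 2)) \<longlonglongrightarrow> 0 - of_real (t\<^sup>2 / 2)" by (rule tendsto_diff[OF _ tendsto_const])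
  then have "E \<longlonglongrightarrow> of_real (- t\<^sup>2 / 2)" by simp
  then have e1: "(\<lambda>n. exp (E n)) \<longlonglongrightarrow> of_real (exp (- t\<^sup>2 / 2))" unfolding exp_of_real[symmetric] by (rule tendsto_exp)
  have "(\<lambda>n. scaled_char n t - exp (E n)) \<longlonglongrightarrow> 0"
  proof (rule Lim_null_comparison)
    have "\<forall>\<^sub>F n in sequentially. cmod (w n) < 1" using w0 by (rule order_tendstoD(2)) simp
    then show "\<forall>\<^sub>F n in sequentially. norm (scaled_char n t - exp (E n)) \<le> 6 * (cmod (w n))\<^sup>2"
    proof eventually_elim
      case (elim n)
      have "Re (w n) \<le> 0" unfolding w_def by (simp add: exp_eq_polar)
      then have "cmod ((\<Prod>i<n. 1 + w n / of_nat (Suc i)) - exp (w n * of_real (harm n))) \<le> 6 * (cmod (w n))\<^sup>2"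
        using exp_harm_approx[of "w n" n] elim cyc_factor_le_1[of "th n"] unfolding w_def by simp
      then have *: "cmod (cyc_char n (th n) - exp (w n * of_real (harm n))) \<le> 6 * (cmod (w n))\<^sup>2"
        unfolding cyc_char_def w_def .
      have "exp (E n) = exp (w n * of_real (harm n)) * iexp (- (s n * t))"
        unfolding E_def by (simp add: exp_diff exp_minus divide_inverse)
      then have "scaled_char n t - exp (E n) = (cyc_char n (th n) - exp (w n * of_real (harm n))) * iexp (- (s n * t))"
        unfolding scaled_char_def th_def s_def by (simp add: left_diff_distrib)
      then have "cmod (scaled_char n t - exp (E n)) = cmod (cyc_char n (th n) - exp (w n * of_real (harm n)))"
        by (simp add: norm_mult)
      then show ?case using * by simp
    qed
    have "(\<lambda>n. 6 * (cmod (w n))\<^sup>2) \<longlonglongrightarrow> 6 * 0\<^sup>2" by (intro tendsto_mult tendsto_const tendsto_power w0)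
    then show "(\<lambda>n. 6 * (cmod (w n))\<^sup>2) \<longlonglongrightarrow> 0" by simp
  qed
  from tendsto_add[OF this e1] show ?thesis by simp
qed

text \<open>The recurring bound 9 is the square of 3, which exceeds \<open>exp 1\<close>. From there
  on \<open>ln n - 1\<close> is at least \<open>ln n / 2\<close>.\<close>

lemma ln_ge_2: "9 \<le> n \<Longrightarrow> 2 \<le> ln (real n)"
proof -
  assume n: "9 \<le> n"
  have "exp 2 = (exp 1 :: real)\<^sup>2" using exp_double[of "1::real"] by simp
  also have "\<dots> \<le> 3\<^sup>2" by (rule power_mono[OF exp_le]) simp
  also have "\<dots> \<le> real n" using n by simp
  finally show ?thesis using ln_ge_iff[of "real n" 2] n by simp
qed

section \<open>The uniform local limit theorem\<close>

lemma integrable_gaussian: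
  assumes "0 < \<sigma>" shows "integrable lborel (\<lambda>x. exp (- x\<^sup>2 / (2 * \<sigma>\<^sup>2)))" "(\<integral>x. exp (- x\<^sup>2 / (2 * \<sigma>\<^sup>2)) \<partial>lborel) = sqrt (2 * pi * \<sigma>\<^sup>2)"
proof -
  have e: "exp (- x\<^sup>2 / (2 * \<sigma>\<^sup>2)) = sqrt (2 * pi * \<sigma>\<^sup>2) * normal_density 0 \<sigma> x" for x
    unfolding normal_density_def using assms by simp
  show "integrable lborel (\<lambda>x. exp (- x\<^sup>2 / (2 * \<sigma>\<^sup>2)))" unfolding e by (intro integrable_mult_right integrable_normal_density) (use assms in auto)
  show "(\<integral>x. exp (- x\<^sup>2 / (2 * \<sigma>\<^sup>2)) \<partial>lborel) = sqrt (2 * pi * \<sigma>\<^sup>2)"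
    unfolding e using integral_normal_density[OF assms, of 0] by simp
qed

definition cut_char :: "nat \<Rightarrow> real \<Rightarrow> complex" where
  "cut_char n t = indicator {-pi..pi} (t / sqrt (ln (real n))) *\<^sub>R scaled_char n t"

lemma measurable_scaled_char [measurable]: "scaled_char n \<in> borel_measurable borel"
  unfolding scaled_char_def cyc_char_def by measurable

lemma measurable_cut_char [measurable]: "cut_char n \<in> borel_measurable borel"
  unfolding cut_char_def by measurable

text \<open>On the range of angles used in Fourier inversion the decay of \<open>cyc_char\<close>
  gives one Gaussian majorant for all \<open>n\<close>. The constant 32 is 16 from
  \<open>cyc_char_bound\<close>, doubled by the estimate of \<open>ln n - 1\<close> from below by
  \<open>ln n / 2\<close>.\<close>

lemma cut_char_bound:
  assumes n: "9 \<le> n" shows "cmod (cut_char n t) \<le> exp (- t\<^sup>2 / 32)"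
proof (cases "t / sqrt (ln (real n)) \<in> {-pi..pi}")
  case True
  define l where "l = ln (real n)"
  define \<theta> where "\<theta> = t / sqrt l"
  have l2: "2 \<le> l" unfolding l_def by (rule ln_ge_2[OF n])
  have "\<bar>\<theta>\<bar> \<le> pi" using True unfolding \<theta>_def l_def by auto
  then have "cmod (cyc_char n \<theta>) \<le> exp (- (\<theta>\<^sup>2 / 16) * (l - 1))" using cyc_char_bound[of n \<theta>] n unfolding l_def by simp
  moreover have "- (\<theta>\<^sup>2 / 16) * (l - 1) \<le> - t\<^sup>2 / 32"
  proof -
    have "\<theta>\<^sup>2 * l = t\<^sup>2" unfolding \<theta>_def using l2 by (simp add: power_divide)
    moreover have "\<theta>\<^sup>2 * (l / 2) \<le> \<theta>\<^sup>2 * (l - 1)" using l2 by (intro mult_left_mono) auto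
    ultimately show ?thesis by simp
  qed
  ultimately have "cmod (cyc_char n \<theta>) \<le> exp (- t\<^sup>2 / 32)" by (meson exp_le_cancel_iff order_trans)
  then show ?thesis using True unfolding cut_char_def scaled_char_def \<theta>_def l_def by (simp add: norm_mult)
qed (simp add: cut_char_def)

text \<open>An integral distance to the Gaussian. It bounds the error of the local limit theorem for
  all \<open>c\<close> simultaneously, because \<open>c\<close> enters the inversion formula only
  through a factor of modulus one.\<close>

definition llt_error :: "nat \<Rightarrow> real" where
  "llt_error n = (\<integral>t. cmod (cut_char n t - of_real (exp (- t\<^sup>2 / 2))) \<partial>lborel)"

text \<open>Dominated convergence; for fixed \<open>t\<close> the cut at \<open>pi\<close> is
  inactive as soon as \<open>n\<close> is large.\<close>

lemma llt_error_tendsto: "(\<lambda>n. llt_error (n + 9)) \<longlonglongrightarrow> 0"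
proof -
  have g: "integrable lborel (\<lambda>t. exp (- t\<^sup>2 / 32) + exp (- t\<^sup>2 / 2) :: real)"
    using integrable_gaussian(1)[of 4] integrable_gaussian(1)[of 1] by (intro Bochner_Integration.integrable_add) simp_all
  have "(\<lambda>n. llt_error (n + 9)) \<longlonglongrightarrow> integral\<^sup>L lborel (\<lambda>t::real. 0::real)"
    unfolding llt_error_def
  proof (rule integral_dominated_convergence[where w = "\<lambda>t. exp (- t\<^sup>2 / 32) + exp (- t\<^sup>2 / 2)" and f = "\<lambda>t. 0" and s = "\<lambda>n t. cmod (cut_char (n + 9) t - of_real (exp (- t\<^sup>2 / 2)))"])
    show "integrable lborel (\<lambda>t. exp (- t\<^sup>2 / 32) + exp (- t\<^sup>2 / 2) :: real)" by (rule g)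
    show "AE t in lborel. (\<lambda>n. cmod (cut_char (n + 9) t - of_real (exp (- t\<^sup>2 / 2)))) \<longlonglongrightarrow> 0"
    proof (intro AE_I2 tendsto_norm_zero)
      fix t :: real
      have "(\<lambda>n. t / sqrt (ln (real n))) \<longlonglongrightarrow> 0"
      proof -
        have "(\<lambda>n. 1 / sqrt (ln (real n))) \<longlonglongrightarrow> 0" by real_asymp
        from tendsto_mult[OF tendsto_const this, of t] show ?thesis by simp
      qed
      then have "\<forall>\<^sub>F n in sequentially. -pi < t / sqrt (ln (real n)) \<and> t / sqrt (ln (real n)) < pi"
        by (intro eventually_conj order_tendstoD) auto
      then have "\<forall>\<^sub>F n in sequentially. scaled_char n t = cut_char n t"
        by eventually_elim (simp add: cut_char_def)
      then have "(\<lambda>n. cut_char n t) \<longlonglongrightarrow> of_real (exp (- t\<^sup>2 / 2))"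
        by (rule Lim_transform_eventually[OF scaled_char_tendsto])
      then have "(\<lambda>n. cut_char (n + 9) t) \<longlonglongrightarrow> of_real (exp (- t\<^sup>2 / 2))" by (rule LIMSEQ_ignore_initial_segment)
      then show "(\<lambda>n. cut_char (n + 9) t - of_real (exp (- t\<^sup>2 / 2))) \<longlonglongrightarrow> 0" by (rule LIM_zero)
    qed
    show "AE t in lborel. norm (cmod (cut_char (n + 9) t - of_real (exp (- t\<^sup>2 / 2)))) \<le> exp (- t\<^sup>2 / 32) + exp (- t\<^sup>2 / 2)" for n
    proof (rule AE_I2)
      fix t :: real
      have "cmod (cut_char (n + 9) t - of_real (exp (- t\<^sup>2 / 2))) \<le> cmod (cut_char (n + 9) t) + cmod (of_real (exp (- t\<^sup>2 / 2)))"
        by (rule norm_triangle_ineq4)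
      then show "norm (cmod (cut_char (n + 9) t - of_real (exp (- t\<^sup>2 / 2)))) \<le> exp (- t\<^sup>2 / 32) + exp (- t\<^sup>2 / 2)"
        using cut_char_bound[of "n + 9" t] by simp
    qed
  qed measurable
  then show ?thesis by simp
qed

lemma iexp_orthogonal:
  "has_bochner_integral lborel (\<lambda>\<theta>. indicator {-pi..pi} \<theta> *\<^sub>R iexp (\<theta> * of_int m)) (if m = 0 then of_real (2 * pi) else 0)"
proof (cases "m = 0")
  case True
  have "has_bochner_integral lborel (\<lambda>\<theta>. indicator {-pi..pi} \<theta> *\<^sub>R (1::complex)) (of_real pi - of_real (- pi))"
    by (rule has_bochner_integral_FTC_Icc) (auto intro!: derivative_eq_intros)
  then show ?thesis using True by simp
next
  case False
  define F where "F = (\<lambda>\<theta>. iexp (\<theta> * of_int m) / (\<i> * of_int m))"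
  have "has_bochner_integral lborel (\<lambda>\<theta>. indicator {-pi..pi} \<theta> *\<^sub>R iexp (\<theta> * of_int m)) (F pi - F (- pi))"
  proof (rule has_bochner_integral_FTC_Icc)
    fix x :: real
    have "(F has_vector_derivative (\<i> * of_int m * iexp (x * of_int m)) / (\<i> * of_int m)) (at x within {-pi..pi})"
      unfolding F_def by (rule has_vector_derivative_divide) (auto intro!: derivative_eq_intros has_vector_derivative_real_field exp_scaleR_has_vector_derivative_right)
    then show "(F has_vector_derivative iexp (x * of_int m)) (at x within {-pi..pi})" using False by simp
  qed (auto intro!: continuous_intros)
  moreover have "F pi - F (- pi) = 0"
  proof -
    have "sin (pi * of_int m) = 0" using sin_int_times_real by (metis mult.commute sin_npi_int)
    then have "iexp (pi * of_int m) = iexp (- pi * of_int m)" by (simp add: exp_eq_polar complex_eq_iff)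
    then show ?thesis unfolding F_def by simp
  qed
  ultimately show ?thesis using False by simp
qed

lemma cyc_prob_fourier:
  assumes c: "c \<le> n"
  shows "(\<integral>\<theta>. indicator {-pi..pi} \<theta> *\<^sub>R (cyc_char n \<theta> * iexp (- (\<theta> * real c))) \<partial>lborel) = of_real (2 * pi * cyc_prob n c)"
proof -
  have e: "indicator {-pi..pi} \<theta> *\<^sub>R (cyc_char n \<theta> * iexp (- (\<theta> * real c)))
    = (\<Sum>d\<le>n. of_real (cyc_prob n d) * (indicator {-pi..pi} \<theta> *\<^sub>R iexp (\<theta> * of_int (int d - int c))))" for \<theta>
  proof -
    have "iexp (\<theta> * real d) * iexp (- (\<theta> * real c)) = iexp (\<theta> * of_int (int d - int c))" for d
      unfolding exp_add[symmetric] by (simp add: algebra_simps)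
    then have "cyc_char n \<theta> * iexp (- (\<theta> * real c)) = (\<Sum>d\<le>n. of_real (cyc_prob n d) * iexp (\<theta> * of_int (int d - int c)))"
      unfolding cyc_char_eq_sum sum_distrib_right by (simp only: mult.assoc)
    then show ?thesis by (simp only: scaleR_sum_right mult_scaleR_right)
  qed
  have hb: "has_bochner_integral lborel (\<lambda>\<theta>. \<Sum>d\<le>n. of_real (cyc_prob n d) * (indicator {-pi..pi} \<theta> *\<^sub>R iexp (\<theta> * of_int (int d - int c))))
    (\<Sum>d\<le>n. of_real (cyc_prob n d) * (if int d - int c = 0 then of_real (2 * pi) else 0))"
    by (intro has_bochner_integral_sum has_bochner_integral_mult_right iexp_orthogonal)
  have sm: "(\<Sum>d\<le>n. of_real (cyc_prob n d) * (if int d - int c = 0 then of_real (2 * pi) else 0)) = complex_of_real (2 * pi * cyc_prob n c)"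
  proof -
    have "(\<Sum>d\<le>n. of_real (cyc_prob n d) * (if int d - int c = 0 then of_real (2 * pi) else 0))
      = (\<Sum>d\<le>n. if d = c then complex_of_real (2 * pi * cyc_prob n c) else 0)" by (rule sum.cong) auto
    then show ?thesis using c by simp
  qed
  show ?thesis unfolding e has_bochner_integral_integral_eq[OF hb] by (rule sm)
qed

lemma gaussian_fourier: "(\<integral>t. of_real (exp (- t\<^sup>2 / 2)) * iexp (- (x * t)) \<partial>lborel) = complex_of_real (sqrt (2 * pi) * exp (- x\<^sup>2 / 2))"
proof -
  have "complex_of_real (exp (- x\<^sup>2 / 2)) = char std_normal_distribution (- x)" unfolding char_std_normal_distribution by simp
  also have "\<dots> = (\<integral>t. iexp (- x * t) \<partial>density lborel std_normal_density)" unfolding char_def by simp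
  also have "\<dots> = (\<integral>t. std_normal_density t *\<^sub>R iexp (- x * t) \<partial>lborel)"
    by (rule integral_density) (auto simp: normal_density_nonneg)
  also have "\<dots> = (\<integral>t. of_real (1 / sqrt (2 * pi)) * (of_real (exp (- t\<^sup>2 / 2)) * iexp (- (x * t))) \<partial>lborel)"
    by (rule Bochner_Integration.integral_cong) (auto simp: normal_density_def scaleR_conv_of_real)
  also have "\<dots> = of_real (1 / sqrt (2 * pi)) * (\<integral>t. of_real (exp (- t\<^sup>2 / 2)) * iexp (- (x * t)) \<partial>lborel)"
    by (rule integral_mult_right_zero)
  finally have "complex_of_real (exp (- x\<^sup>2 / 2)) = of_real (1 / sqrt (2 * pi)) * (\<integral>t. of_real (exp (- t\<^sup>2 / 2)) * iexp (- (x * t)) \<partial>lborel)" .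
  then show ?thesis by (simp add: field_simps)
qed

definition std_pos :: "nat \<Rightarrow> real \<Rightarrow> real" where
  "std_pos n c = (c - ln (real n)) / sqrt (ln (real n))"

text \<open>Fourier inversion for the lattice variable and for the Gaussian, compared after the
  substitution \<open>\<theta> = t / sqrt (ln n)\<close>. The gain of a factor \<open>2 * pi\<close>
  is discarded.\<close>

lemma local_limit:
  assumes n: "9 \<le> n" and c: "c \<le> n"
  shows "\<bar>sqrt (ln (real n)) * cyc_prob n c - exp (- (std_pos n (real c))\<^sup>2 / 2) / sqrt (2 * pi)\<bar> \<le> llt_error n"
proof -
  define s where "s = sqrt (ln (real n))"
  define x where "x = std_pos n (real c)"
  have s0: "0 < s" unfolding s_def using ln_ge_2[OF n] by simp
  have lam: "ln (real n) = s\<^sup>2" unfolding s_def using ln_ge_2[OF n] by simp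
  have xe: "x = (real c - s\<^sup>2) / s" unfolding x_def std_pos_def lam using s0 by simp
  define f where "f = (\<lambda>\<theta>. indicator {-pi..pi} \<theta> *\<^sub>R (cyc_char n \<theta> * iexp (- (\<theta> * real c))))"
  have "of_real (2 * pi * cyc_prob n c) = integral\<^sup>L lborel f" unfolding f_def using cyc_prob_fourier[OF c] by simp
  also have "\<dots> = \<bar>1 / s\<bar> *\<^sub>R (\<integral>t. f (0 + (1 / s) * t) \<partial>lborel)" by (rule lborel_integral_real_affine) (use s0 in simp)
  finally have "complex_of_real (s * (2 * pi * cyc_prob n c)) = (\<integral>t. f (0 + (1 / s) * t) \<partial>lborel)"
    using s0 by (simp add: scaleR_conv_of_real field_simps)
  moreover have "f (0 + (1 / s) * t) = cut_char n t * iexp (- (x * t))" for t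
  proof -
    have "(t / s) * real c = s * t + x * t" unfolding xe using s0 by (simp add: field_simps power2_eq_square)
    then have "iexp (- ((t / s) * real c)) = iexp (- (s * t)) * iexp (- (x * t))"
      unfolding exp_add[symmetric] by (simp add: algebra_simps)
    then show ?thesis unfolding f_def cut_char_def scaled_char_def s_def[symmetric] by (simp add: mult.assoc)
  qed
  ultimately have A: "complex_of_real (s * (2 * pi * cyc_prob n c)) = (\<integral>t. cut_char n t * iexp (- (x * t)) \<partial>lborel)" by simp
  have i1: "integrable lborel (\<lambda>t. cut_char n t * iexp (- (x * t)))"
  proof (rule Bochner_Integration.integrable_bound)
    show "integrable lborel (\<lambda>t. exp (- t\<^sup>2 / 32) :: real)" using integrable_gaussian(1)[of 4] by simp
    show "AE t in lborel. norm (cut_char n t * iexp (- (x * t))) \<le> norm (exp (- t\<^sup>2 / 32) :: real)"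
      using cut_char_bound[OF n] by (simp add: norm_mult)
  qed measurable
  have i2: "integrable lborel (\<lambda>t. of_real (exp (- t\<^sup>2 / 2)) * iexp (- (x * t)))"
  proof (rule Bochner_Integration.integrable_bound)
    show "integrable lborel (\<lambda>t. exp (- t\<^sup>2 / 2) :: real)" using integrable_gaussian(1)[of 1] by simp
    show "AE t in lborel. norm (of_real (exp (- t\<^sup>2 / 2)) * iexp (- (x * t))) \<le> norm (exp (- t\<^sup>2 / 2) :: real)"
      by (simp add: norm_mult)
  qed measurable
  have "complex_of_real (s * (2 * pi * cyc_prob n c) - sqrt (2 * pi) * exp (- x\<^sup>2 / 2))
    = (\<integral>t. cut_char n t * iexp (- (x * t)) - of_real (exp (- t\<^sup>2 / 2)) * iexp (- (x * t)) \<partial>lborel)"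
    unfolding of_real_diff A gaussian_fourier[symmetric] by (rule Bochner_Integration.integral_diff[OF i1 i2, symmetric])
  also have "\<dots> = (\<integral>t. (cut_char n t - of_real (exp (- t\<^sup>2 / 2))) * iexp (- (x * t)) \<partial>lborel)" by (simp only: left_diff_distrib)
  finally have eq: "complex_of_real (s * (2 * pi * cyc_prob n c) - sqrt (2 * pi) * exp (- x\<^sup>2 / 2))
    = (\<integral>t. (cut_char n t - of_real (exp (- t\<^sup>2 / 2))) * iexp (- (x * t)) \<partial>lborel)" .
  have "cmod (complex_of_real (s * (2 * pi * cyc_prob n c) - sqrt (2 * pi) * exp (- x\<^sup>2 / 2)))
    \<le> (\<integral>t. cmod ((cut_char n t - of_real (exp (- t\<^sup>2 / 2))) * iexp (- (x * t))) \<partial>lborel)"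
    unfolding eq by (rule integral_norm_bound)
  also have "\<dots> = llt_error n" unfolding llt_error_def by (simp add: norm_mult)
  finally have b: "\<bar>s * (2 * pi * cyc_prob n c) - sqrt (2 * pi) * exp (- x\<^sup>2 / 2)\<bar> \<le> llt_error n" by (simp only: norm_of_real)
  have sq: "sqrt (2 * pi) * sqrt (2 * pi) = 2 * pi" by simp
  have "s * (2 * pi * cyc_prob n c) - sqrt (2 * pi) * exp (- x\<^sup>2 / 2) = (2 * pi) * (s * cyc_prob n c - exp (- x\<^sup>2 / 2) / sqrt (2 * pi))"
    using sq by (simp add: field_simps)
  then have u1: "(2 * pi) * \<bar>s * cyc_prob n c - exp (- x\<^sup>2 / 2) / sqrt (2 * pi)\<bar> \<le> llt_error n" using b by (simp add: abs_mult)
  have u2: "1 * \<bar>s * cyc_prob n c - exp (- x\<^sup>2 / 2) / sqrt (2 * pi)\<bar> \<le> (2 * pi) * \<bar>s * cyc_prob n c - exp (- x\<^sup>2 / 2) / sqrt (2 * pi)\<bar>"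
    using pi_gt3 by (intro mult_right_mono) auto
  show ?thesis using order_trans[OF u2 u1] unfolding s_def x_def by simp
qed

section \<open>Riemann sums of Gaussians and the asymptotics of the limit\<close>

text \<open>A Riemann sum of mesh \<open>1 / sqrt (ln n)\<close> for the integral of
  \<open>exp (- r * x\<^sup>2 / 2)\<close> over the line.\<close>

definition gauss_sum :: "nat \<Rightarrow> nat \<Rightarrow> real" where
  "gauss_sum r n = (\<Sum>c\<le>n. exp (- real r * (std_pos n (real c))\<^sup>2 / 2) / sqrt (ln (real n)))"

text \<open>The sum is the integral of a step function \<open>h n\<close> that takes on each cell
  the value at its left end, so dominated convergence applies on the whole line. A fixed point
  \<open>x\<close> lies in the cell numbered by the floor of \<open>ln n + x * sqrt (ln n)\<close>,
  which is between 0 and \<open>n\<close> for large \<open>n\<close>.\<close>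

lemma gauss_sum_tendsto:
  assumes r: "1 \<le> r" shows "(\<lambda>n. gauss_sum r (n + 9)) \<longlonglongrightarrow> sqrt (2 * pi / real r)"
proof -
  define g where "g = (\<lambda>x::real. exp (- real r * x\<^sup>2 / 2))"
  define I where "I = (\<lambda>n c. {std_pos n (real c)..<std_pos n (real c + 1)})"
  define h where "h = (\<lambda>n x. \<Sum>c\<le>n. indicator (I n c) x * g (std_pos n (real c)))"
  have sp: "1 \<le> sqrt (ln (real n))" if "9 \<le> n" for n using ln_ge_2[OF that] by simp
  have width: "std_pos n (y + 1) - std_pos n y = 1 / sqrt (ln (real n))" for n y
    unfolding std_pos_def by (simp add: diff_divide_distrib[symmetric])
  have intg: "integral\<^sup>L lborel (h n) = gauss_sum r n" if n: "9 \<le> n" for n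
  proof -
    have le: "std_pos n (real c) \<le> std_pos n (real c + 1)" for c using width[of n "real c"] sp[OF n]
      by (metis diff_ge_0_iff_ge divide_nonneg_nonneg le_numeral_extra(4) order_trans zero_le_one)
    have em: "emeasure lborel (I n c) < \<infinity>" for c unfolding I_def using le[of c] by simp
    have "integral\<^sup>L lborel (h n) = (\<Sum>c\<le>n. \<integral>x. indicator (I n c) x * g (std_pos n (real c)) \<partial>lborel)"
      unfolding h_def by (rule Bochner_Integration.integral_sum) (intro integrable_mult_left integrable_real_indicator; use em in \<open>simp add: I_def\<close>)
    also have "\<dots> = (\<Sum>c\<le>n. measure lborel (I n c) * g (std_pos n (real c)))" by simp
    also have "\<dots> = gauss_sum r n" unfolding gauss_sum_def
    proof (rule sum.cong)
      fix c
      have "measure lborel (I n c) = 1 / sqrt (ln (real n))" unfolding I_def using le[of c] width[of n "real c"] by simp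
      then show "measure lborel (I n c) * g (std_pos n (real c)) = exp (- real r * (std_pos n (real c))\<^sup>2 / 2) / sqrt (ln (real n))"
        unfolding g_def by simp
    qed simp
    finally show ?thesis .
  qed
  have memI: "x \<in> I n c \<longleftrightarrow> int c = \<lfloor>ln (real n) + x * sqrt (ln (real n))\<rfloor>" if n: "9 \<le> n" for n c x
  proof -
    have s: "0 < sqrt (ln (real n))" using sp[OF n] by linarith
    have "x \<in> I n c \<longleftrightarrow> real c \<le> ln (real n) + x * sqrt (ln (real n)) \<and> ln (real n) + x * sqrt (ln (real n)) < real c + 1"
      unfolding I_def std_pos_def atLeastLessThan_iff pos_divide_le_eq[OF s] pos_less_divide_eq[OF s] by linarith
    then show ?thesis by (simp add: floor_eq_iff eq_commute[of "int c"])
  qed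
  have near: "\<bar>std_pos n (real c) - x\<bar> \<le> 1 / sqrt (ln (real n))" if "x \<in> I n c" for n c x
    using that width[of n "real c"] unfolding I_def by auto
  \<comment> \<open>Written as a conditional equation: the else branch is \<open>h n x\<close>
    itself, so nothing is asserted unless \<open>c\<close> is the index of the cell of
    \<open>x\<close>.\<close>
  have hval: "h n x = (if int c = \<lfloor>ln (real n) + x * sqrt (ln (real n))\<rfloor> \<and> c \<le> n then g (std_pos n (real c)) else h n x)" if n: "9 \<le> n" for n x c
  proof -
    have "h n x = g (std_pos n (real c))" if c: "x \<in> I n c" "c \<le> n"
    proof -
      have "indicator (I n d) x * g (std_pos n (real d)) = (if d = c then g (std_pos n (real c)) else 0)" for d
        using memI[OF n, of x d] memI[OF n, of x c] c(1) by (auto simp: indicator_def)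
      then show ?thesis unfolding h_def using c(2) by simp
    qed
    then show ?thesis using memI[OF n, of x c] by auto
  qed
  \<comment> \<open>The left end \<open>y\<close> of the cell is within 1 of \<open>x\<close>, and
    \<open>x\<^sup>2 \<le> 2 * y\<^sup>2 + 2 * (y - x)\<^sup>2\<close> trades this for a wider
    Gaussian and a constant.\<close>
  have bound: "norm (h n x) \<le> exp (real r / 2) * exp (- real r * x\<^sup>2 / 4)" if n: "9 \<le> n" for n x
  proof (cases "\<exists>c\<le>n. x \<in> I n c")
    case True
    then obtain c where c: "c \<le> n" "x \<in> I n c" by blast
    define y where "y = std_pos n (real c)"
    have "1 / sqrt (ln (real n)) \<le> 1" using sp[OF n] by simp
    then have d: "\<bar>y - x\<bar> \<le> 1" using near[OF c(2)] unfolding y_def by linarith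
    then have "(y - x)\<^sup>2 \<le> 1" by (simp add: abs_square_le_1)
    moreover have "x\<^sup>2 \<le> 2 * y\<^sup>2 + 2 * (y - x)\<^sup>2"
    proof -
      have "2 * y\<^sup>2 + 2 * (y - x)\<^sup>2 - x\<^sup>2 = (2 * y - x)\<^sup>2" by (simp add: power2_eq_square algebra_simps)
      then show ?thesis using zero_le_power2[of "2 * y - x"] by linarith
    qed
    ultimately have "x\<^sup>2 / 4 - 1 / 2 \<le> y\<^sup>2 / 2" by linarith
    then have "real r * (x\<^sup>2 / 4 - 1 / 2) \<le> real r * (y\<^sup>2 / 2)" by (intro mult_left_mono) auto
    then have "- real r * y\<^sup>2 / 2 \<le> real r / 2 + - real r * x\<^sup>2 / 4" by (simp add: algebra_simps)
    then have "g y \<le> exp (real r / 2) * exp (- real r * x\<^sup>2 / 4)" unfolding g_def exp_add[symmetric] by simp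
    moreover have "h n x = g y" using hval[OF n, of x c] memI[OF n, of x c] c unfolding y_def by auto
    moreover have "0 \<le> g y" unfolding g_def by simp
    ultimately show ?thesis by simp
  next
    case False
    then have "h n x = 0" unfolding h_def by (intro sum.neutral) auto
    then show ?thesis by simp
  qed
  have lim: "(\<lambda>n. h (n + 9) x) \<longlonglongrightarrow> g x" for x
  proof -
    define m where "m = (\<lambda>n. nat \<lfloor>ln (real n) + x * sqrt (ln (real n))\<rfloor>)"
    have ev0: "\<forall>\<^sub>F n::nat in sequentially. 0 \<le> ln (real n) - \<bar>x\<bar> * sqrt (ln (real n))" by real_asymp
    have ev1: "\<forall>\<^sub>F n::nat in sequentially. ln (real n) + \<bar>x\<bar> * sqrt (ln (real n)) \<le> real n" by real_asymp
    have ev: "\<forall>\<^sub>F n in sequentially. x \<in> I n (m n) \<and> h n x = g (std_pos n (real (m n)))"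
      using ev0 ev1 eventually_ge_at_top[of 9]
    proof eventually_elim
      case (elim n)
      have s: "0 \<le> sqrt (ln (real n))" using sp[OF elim(3)] by linarith
      have a: "- (\<bar>x\<bar> * sqrt (ln (real n))) \<le> x * sqrt (ln (real n))" "x * sqrt (ln (real n)) \<le> \<bar>x\<bar> * sqrt (ln (real n))"
        using mult_right_mono[OF _ s, of "- \<bar>x\<bar>" x] mult_right_mono[OF _ s, of x "\<bar>x\<bar>"] by auto
      then have y: "0 \<le> ln (real n) + x * sqrt (ln (real n))" "ln (real n) + x * sqrt (ln (real n)) \<le> real n" using elim(1,2) by linarith+
      have im: "int (m n) = \<lfloor>ln (real n) + x * sqrt (ln (real n))\<rfloor>" unfolding m_def using y(1) by simp
      have "m n \<le> n" unfolding m_def using floor_mono[OF y(2)] by (simp add: nat_le_iff)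
      then show ?case using hval[OF elim(3), of x "m n"] memI[OF elim(3), of x "m n"] im by auto
    qed
    have "(\<lambda>n. std_pos n (real (m n))) \<longlonglongrightarrow> x"
    proof (rule LIM_zero_cancel, rule Lim_null_comparison)
      show "\<forall>\<^sub>F n in sequentially. norm (std_pos n (real (m n)) - x) \<le> 1 / sqrt (ln (real n))"
        using ev by eventually_elim (use near in auto)
      show "(\<lambda>n. 1 / sqrt (ln (real n))) \<longlonglongrightarrow> 0" by real_asymp
    qed
    then have "(\<lambda>n. g (std_pos n (real (m n)))) \<longlonglongrightarrow> g x" unfolding g_def by (intro tendsto_intros) auto
    moreover have "\<forall>\<^sub>F n in sequentially. g (std_pos n (real (m n))) = h n x" using ev by eventually_elim simp
    ultimately have "(\<lambda>n. h n x) \<longlonglongrightarrow> g x" by (rule Lim_transform_eventually)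
    then show ?thesis by (rule LIMSEQ_ignore_initial_segment)
  qed
  define \<sigma> where "\<sigma> = 1 / sqrt (real r)"
  have \<sigma>: "0 < \<sigma>" "\<sigma>\<^sup>2 = 1 / real r" unfolding \<sigma>_def using r by (auto simp: power_divide)
  define \<tau> where "\<tau> = sqrt (2 / real r)"
  have \<tau>: "0 < \<tau>" "\<tau>\<^sup>2 = 2 / real r" unfolding \<tau>_def using r by auto
  have dom: "integrable lborel (\<lambda>x. exp (real r / 2) * exp (- real r * x\<^sup>2 / 4))"
    using integrable_gaussian(1)[OF \<tau>(1)] unfolding \<tau>(2) by (intro integrable_mult_right) (simp add: mult.commute)
  have "(\<lambda>n. integral\<^sup>L lborel (h (n + 9))) \<longlonglongrightarrow> integral\<^sup>L lborel g"
  proof (rule integral_dominated_convergence[where w = "\<lambda>x. exp (real r / 2) * exp (- real r * x\<^sup>2 / 4)" and f = g and s = "\<lambda>n. h (n + 9)"])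
    show "integrable lborel (\<lambda>x. exp (real r / 2) * exp (- real r * x\<^sup>2 / 4))" by (rule dom)
    show "h (n + 9) \<in> borel_measurable lborel" for n unfolding h_def I_def by measurable
    show "g \<in> borel_measurable lborel" unfolding g_def by measurable
  qed (use lim bound in auto)
  moreover have "integral\<^sup>L lborel g = sqrt (2 * pi / real r)"
    using integrable_gaussian(2)[OF \<sigma>(1)] unfolding \<sigma>(2) g_def by (simp add: mult.commute)
  moreover have "integral\<^sup>L lborel (h (n + 9)) = gauss_sum r (n + 9)" for n by (rule intg) simp
  ultimately show ?thesis by simp
qed

text \<open>The factor \<open>s + g\<close> is kept on purpose: a uniform bound for the difference
  could not be summed over \<open>n\<close> many terms, whereas the sum of \<open>s + g\<close>,
  divided by the scale, stays bounded.\<close>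

lemma power_diff_bound:
  fixes s g B :: real
  assumes "0 \<le> s" "0 \<le> g" "s \<le> B" "g \<le> B"
  shows "\<bar>s ^ (m + 2) - g ^ (m + 2)\<bar> \<le> \<bar>s - g\<bar> * (s + g) * (real (m + 1) * B ^ m)"
proof (induction m)
  case 0
  have eq: "s * s - g * g = (s - g) * (s + g)" by (simp add: algebra_simps)
  have "\<bar>s * s - g * g\<bar> = \<bar>s - g\<bar> * (s + g)" unfolding eq abs_mult using assms by simp
  then show ?case by simp
next
  case (Suc m)
  define D where "D = \<bar>s - g\<bar> * (s + g)"
  have D: "0 \<le> D" "\<bar>s - g\<bar> * g \<le> D" unfolding D_def using assms by (auto intro!: mult_left_mono)
  have B0: "0 \<le> B" using assms by linarith
  have "s ^ (Suc m + 2) - g ^ (Suc m + 2) = s * (s ^ (m + 2) - g ^ (m + 2)) + (s - g) * g * g ^ (m + 1)" by (simp add: algebra_simps)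
  then have "\<bar>s ^ (Suc m + 2) - g ^ (Suc m + 2)\<bar> \<le> s * \<bar>s ^ (m + 2) - g ^ (m + 2)\<bar> + \<bar>s - g\<bar> * g * g ^ (m + 1)"
    using abs_triangle_ineq[of "s * (s ^ (m + 2) - g ^ (m + 2))" "(s - g) * g * g ^ (m + 1)"] assms by (simp add: abs_mult)
  also have "\<dots> \<le> B * (D * (real (m + 1) * B ^ m)) + D * B ^ (m + 1)"
  proof (rule add_mono)
    show "s * \<bar>s ^ (m + 2) - g ^ (m + 2)\<bar> \<le> B * (D * (real (m + 1) * B ^ m))"
      using Suc.IH assms B0 unfolding D_def by (intro mult_mono) auto
    show "\<bar>s - g\<bar> * g * g ^ (m + 1) \<le> D * B ^ (m + 1)"
      using D assms by (intro mult_mono power_mono) auto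
  qed
  also have "\<dots> = D * (real (Suc m + 1) * B ^ Suc m)" by (simp add: algebra_simps)
  finally show ?case unfolding D_def .
qed

lemma sum_cyc_prob: "(\<Sum>c\<le>n. cyc_prob n c) = 1"
proof -
  have "(\<Sum>c\<le>n. cyc_prob n c) = real (\<Sum>c\<le>n. stirling n c) / fact n"
    unfolding cyc_prob_def sum_divide_distrib of_nat_sum ..
  also have "\<dots> = 1" unfolding sum_stirling by simp
  finally show ?thesis .
qed

text \<open>The uniform local limit error multiplies the total of the probabilities plus a Gaussian
  sum, both bounded, so powers of the probabilities may be replaced by powers of the Gaussian
  density, whose sum is again a Gaussian Riemann sum.\<close>

theorem cyc_prob_power_sum_tendsto:
  assumes r: "2 \<le> r"
  shows "(\<lambda>n. (\<Sum>c\<le>n + 9. (sqrt (ln (real (n + 9))) * cyc_prob (n + 9) c) ^ r / sqrt (ln (real (n + 9)))))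
     \<longlonglongrightarrow> sqrt (2 * pi / real r) / sqrt (2 * pi) ^ r"
proof -
  obtain m where m: "r = m + 2" using r by (metis le_add_diff_inverse2)
  define l where "l = (\<lambda>n. sqrt (ln (real (n + 9))))"
  define s where "s = (\<lambda>n c. l n * cyc_prob (n + 9) c)"
  define g where "g = (\<lambda>n c. exp (- (std_pos (n + 9) (real c))\<^sup>2 / 2) / sqrt (2 * pi))"
  define e where "e = (\<lambda>n. llt_error (n + 9))"
  have e0: "e \<longlonglongrightarrow> 0" unfolding e_def by (rule llt_error_tendsto)
  have l1: "1 \<le> l n" for n unfolding l_def using ln_ge_2[of "n + 9"] by simp
  have lp: "0 < l n" for n using l1[of n] by linarith
  have sg: "\<bar>s n c - g n c\<bar> \<le> e n" if "c \<le> n + 9" for n c unfolding s_def g_def e_def l_def by (rule local_limit) (use that in auto)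
  have s0: "0 \<le> s n c" for n c unfolding s_def cyc_prob_def using lp[of n] by simp
  have g0: "0 \<le> g n c" "g n c \<le> 1" for n c
  proof -
    show "0 \<le> g n c" unfolding g_def by simp
    have "1 \<le> sqrt (2 * pi)" using pi_gt3 by simp
    moreover have "exp (- (std_pos (n + 9) (real c))\<^sup>2 / 2) \<le> 1" by simp
    ultimately have "exp (- (std_pos (n + 9) (real c))\<^sup>2 / 2) \<le> sqrt (2 * pi)" by linarith
    then show "g n c \<le> 1" unfolding g_def by (simp add: divide_le_eq)
  qed
  have G1: "(\<Sum>c\<le>n + 9. g n c / l n) = gauss_sum 1 (n + 9) / sqrt (2 * pi)" for n
    unfolding gauss_sum_def sum_divide_distrib g_def l_def by (rule sum.cong) auto
  have Gr: "(\<Sum>c\<le>n + 9. g n c ^ r / l n) = gauss_sum r (n + 9) / sqrt (2 * pi) ^ r" for n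
    unfolding gauss_sum_def sum_divide_distrib g_def l_def
    by (rule sum.cong) (auto simp: power_divide exp_of_nat_mult[symmetric])
  have S1: "(\<Sum>c\<le>n + 9. s n c / l n) = 1" for n unfolding s_def using lp[of n] sum_cyc_prob[of "n + 9"] by simp
  have "(\<lambda>n. (\<Sum>c\<le>n + 9. s n c ^ r / l n) - (\<Sum>c\<le>n + 9. g n c ^ r / l n)) \<longlonglongrightarrow> 0"
  proof (rule Lim_null_comparison)
    have "\<forall>\<^sub>F n in sequentially. e n < 1" using e0 by (rule order_tendstoD(2)) simp
    then show "\<forall>\<^sub>F n in sequentially. norm ((\<Sum>c\<le>n + 9. s n c ^ r / l n) - (\<Sum>c\<le>n + 9. g n c ^ r / l n))
      \<le> e n * ((real (m + 1) * 2 ^ m) * (1 + gauss_sum 1 (n + 9) / sqrt (2 * pi)))"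
    proof eventually_elim
      case (elim n)
      have "\<bar>(\<Sum>c\<le>n + 9. s n c ^ r / l n) - (\<Sum>c\<le>n + 9. g n c ^ r / l n)\<bar> \<le> (\<Sum>c\<le>n + 9. \<bar>s n c ^ r / l n - g n c ^ r / l n\<bar>)"
        unfolding sum_subtractf[symmetric] by (rule sum_abs)
      also have "\<dots> \<le> (\<Sum>c\<le>n + 9. (e n * (real (m + 1) * 2 ^ m)) * (s n c / l n + g n c / l n))"
      proof (rule sum_mono)
        fix c assume "c \<in> {..n + 9}"
        then have c: "\<bar>s n c - g n c\<bar> \<le> e n" using sg by simp
        have "s n c \<le> 2" using c g0(2)[of n c] elim by linarith
        then have "\<bar>s n c ^ r - g n c ^ r\<bar> \<le> \<bar>s n c - g n c\<bar> * (s n c + g n c) * (real (m + 1) * 2 ^ m)"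
          unfolding m using power_diff_bound[of "s n c" "g n c" 2 m] s0 g0[of n c] by simp
        also have "\<dots> \<le> e n * (s n c + g n c) * (real (m + 1) * 2 ^ m)"
          using c s0[of n c] g0(1)[of n c] by (intro mult_right_mono) auto
        finally have "\<bar>s n c ^ r - g n c ^ r\<bar> / l n \<le> e n * (s n c + g n c) * (real (m + 1) * 2 ^ m) / l n"
          using lp[of n] by (intro divide_right_mono) auto
        moreover have "\<bar>s n c ^ r / l n - g n c ^ r / l n\<bar> = \<bar>s n c ^ r - g n c ^ r\<bar> / l n"
          using lp[of n] by (simp add: diff_divide_distrib[symmetric])
        moreover have "e n * (s n c + g n c) * (real (m + 1) * 2 ^ m) / l n = (e n * (real (m + 1) * 2 ^ m)) * (s n c / l n + g n c / l n)"
          by (simp add: add_divide_distrib[symmetric])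
        ultimately show "\<bar>s n c ^ r / l n - g n c ^ r / l n\<bar> \<le> (e n * (real (m + 1) * 2 ^ m)) * (s n c / l n + g n c / l n)" by simp
      qed
      also have "\<dots> = (e n * (real (m + 1) * 2 ^ m)) * (1 + gauss_sum 1 (n + 9) / sqrt (2 * pi))"
        unfolding sum_distrib_left[symmetric] sum.distrib S1 G1 ..
      finally show ?case by (simp only: real_norm_def mult.assoc)
    qed
    have "(\<lambda>n. e n * ((real (m + 1) * 2 ^ m) * (1 + gauss_sum 1 (n + 9) / sqrt (2 * pi)))) \<longlonglongrightarrow> 0 * ((real (m + 1) * 2 ^ m) * (1 + sqrt (2 * pi / real 1) / sqrt (2 * pi)))"
      by (intro tendsto_mult tendsto_add tendsto_divide tendsto_const e0 gauss_sum_tendsto) auto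
    then show "(\<lambda>n. e n * ((real (m + 1) * 2 ^ m) * (1 + gauss_sum 1 (n + 9) / sqrt (2 * pi)))) \<longlonglongrightarrow> 0" by simp
  qed
  moreover have "(\<lambda>n. \<Sum>c\<le>n + 9. g n c ^ r / l n) \<longlonglongrightarrow> sqrt (2 * pi / real r) / sqrt (2 * pi) ^ r"
    unfolding Gr by (intro tendsto_divide tendsto_const gauss_sum_tendsto) (use r in auto)
  ultimately have "(\<lambda>n. ((\<Sum>c\<le>n + 9. s n c ^ r / l n) - (\<Sum>c\<le>n + 9. g n c ^ r / l n)) + (\<Sum>c\<le>n + 9. g n c ^ r / l n))
     \<longlonglongrightarrow> 0 + sqrt (2 * pi / real r) / sqrt (2 * pi) ^ r" by (rule tendsto_add)
  then show ?thesis unfolding s_def l_def by simp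
qed

lemma Llim_eq_sum_cyc_prob: "Llim n r = (\<Sum>c\<le>n. cyc_prob n c ^ r)"
  unfolding Llim_def cyc_prob_def of_nat_sum sum_divide_distrib by (rule sum.cong) (auto simp: power_divide)

lemma sqrt_power_eq_powr: "0 < x \<Longrightarrow> sqrt x ^ k = x powr (real k / 2)"
  by (simp add: powr_half_sqrt[symmetric] powr_realpow[symmetric] powr_powr)

text \<open>For \<open>r = 1\<close> both sides are 1 once \<open>n\<close> is large. Otherwise
  \<open>(sqrt l * p) ^ r / sqrt l\<close> equals \<open>l powr ((r - 1) / 2) * p ^ r\<close> with
  \<open>l = ln n\<close>, which is the source of the power of the logarithm.\<close>

theorem Llim_asymp:
  assumes r: "1 \<le> r"
  shows "(\<lambda>n. Llim n r) \<sim>[at_top] (\<lambda>n. 1 / ((2 * pi) powr ((real r - 1) / 2) * sqrt (real r)) / ln (real n) powr ((real r - 1) / 2))"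
proof (cases "r = 1")
  case True
  have "\<forall>\<^sub>F n in at_top. Llim n r = 1 / ((2 * pi) powr ((real r - 1) / 2) * sqrt (real r)) / ln (real n) powr ((real r - 1) / 2)"
    using eventually_ge_at_top[of 9]
  proof eventually_elim
    case (elim n)
    then show ?case using ln_ge_2[OF elim] sum_cyc_prob[of n] unfolding Llim_eq_sum_cyc_prob True by simp
  qed
  then show ?thesis by (rule asymp_equiv_refl_ev)
next
  case False
  then have r2: "2 \<le> r" using r by simp
  then obtain k where k: "r = Suc k" by (cases r) auto
  have kr: "(real r - 1) / 2 = real k / 2" unfolding k by simp
  define C where "C = 1 / ((2 * pi) powr ((real r - 1) / 2) * sqrt (real r))"
  have C0: "C \<noteq> 0" unfolding C_def using r by simp
  define T where "T = (\<lambda>n. \<Sum>c\<le>n. (sqrt (ln (real n)) * cyc_prob n c) ^ r / sqrt (ln (real n)))"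
  have "sqrt (2 * pi / real r) / sqrt (2 * pi) ^ r = C"
  proof -
    have "sqrt (2 * pi) ^ r = sqrt (2 * pi) * (2 * pi) powr (real k / 2)" unfolding k power_Suc using sqrt_power_eq_powr[of "2 * pi" k] by simp
    then show ?thesis unfolding C_def kr real_sqrt_divide using r by (simp add: field_simps)
  qed
  then have "(\<lambda>n. T (n + 9)) \<longlonglongrightarrow> C" using cyc_prob_power_sum_tendsto[OF r2] unfolding T_def by simp
  then have "T \<longlonglongrightarrow> C" by (rule LIMSEQ_offset)
  then have "(\<lambda>n. T n / C) \<longlonglongrightarrow> C / C" by (intro tendsto_divide tendsto_const C0)
  then have lim: "(\<lambda>n. T n / C) \<longlonglongrightarrow> 1" using C0 by simp
  have "\<forall>\<^sub>F n in sequentially. T n / C = Llim n r / (C / ln (real n) powr ((real r - 1) / 2))"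
    using eventually_ge_at_top[of 9]
  proof eventually_elim
    case (elim n)
    define l where "l = ln (real n)"
    have l: "0 < l" using ln_ge_2[OF elim] unfolding l_def by simp
    have "T n = (\<Sum>c\<le>n. l powr ((real r - 1) / 2) * cyc_prob n c ^ r)" unfolding T_def l_def[symmetric]
    proof (rule sum.cong)
      fix c
      have "(sqrt l * cyc_prob n c) ^ r / sqrt l = sqrt l ^ k * cyc_prob n c ^ r" unfolding k using l by (simp add: power_mult_distrib)
      then show "(sqrt l * cyc_prob n c) ^ r / sqrt l = l powr ((real r - 1) / 2) * cyc_prob n c ^ r"
        unfolding kr sqrt_power_eq_powr[OF l] .
    qed simp
    also have "\<dots> = l powr ((real r - 1) / 2) * Llim n r" unfolding Llim_eq_sum_cyc_prob sum_distrib_left ..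
    finally show ?case unfolding l_def by simp
  qed
  then have "(\<lambda>n. Llim n r / (C / ln (real n) powr ((real r - 1) / 2))) \<longlonglongrightarrow> 1" by (rule Lim_transform_eventually[OF lim])
  then show ?thesis unfolding C_def by (rule asymp_equivI')
qed

theorem theorem1p1:
  fixes r :: nat
    and \<alpha> :: "'a ring \<Rightarrow> 'a list \<Rightarrow> nat"
    and F :: "nat \<Rightarrow> 'a ring"
    and a :: "nat \<Rightarrow> nat \<Rightarrow> nat \<Rightarrow> 'a list"
  assumes "r \<ge> 1"
    and "\<alpha> = small_omega \<or> \<alpha> = big_omega \<or> (\<exists>k\<ge>2. \<alpha> = divisor_fun k)"
    and "\<And>q. primepow q \<Longrightarrow> field (F q) \<and> finite (carrier (F q)) \<and> card (carrier (F q)) = q"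
    and "\<And>n q. n \<ge> 1 \<Longrightarrow> primepow q \<Longrightarrow> r \<le> q ^ n \<Longrightarrow>
           inj_on (a n q) {1..r} \<and>
           (\<forall>j\<in>{1..r}. a n q j \<in> carrier (poly_ring (F q)) \<and> Polynomials.degree (a n q j) < n)"
  shows "\<exists>L :: nat \<Rightarrow> real.
           (\<forall>n\<ge>1. (n = 2 \<longrightarrow> r \<le> 3) \<longrightarrow>
              ((\<lambda>q. real (shift_count \<alpha> (F q) r (a n q) n) / real q ^ n) \<longlongrightarrow> L n)
                prime_powers_at_top) \<and>
           L \<sim>[at_top] (\<lambda>n. 1 / ((2 * pi) powr ((real r - 1) / 2) * sqrt (real r)) /
                              ln (real n) powr ((real r - 1) / 2))"
proof (intro exI[of _ "\<lambda>n. Llim n r"] conjI allI impI)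
  show "(\<lambda>n. Llim n r) \<sim>[at_top] (\<lambda>n. 1 / ((2 * pi) powr ((real r - 1) / 2) * sqrt (real r)) / ln (real n) powr ((real r - 1) / 2))"
    by (rule Llim_asymp[OF assms(1)])
  fix n :: nat assume n: "1 \<le> n" "n = 2 \<longrightarrow> r \<le> 3"
  show "((\<lambda>q. real (shift_count \<alpha> (F q) r (a n q) n) / real q ^ n) \<longlongrightarrow> Llim n r) prime_powers_at_top"
  proof (rule tendstoI)
    fix \<epsilon> :: real assume \<epsilon>: "0 < \<epsilon>"
    \<comment> \<open>The numerator of the error bound in \<open>approx_claim\<close>. It does not
      depend on \<open>q\<close>, so a precision \<open>M0\<close> with
      \<open>E / M0 < \<epsilon>\<close> can be fixed first, and \<open>large_q n r M0\<close> is
      then the threshold for \<open>q\<close>.\<close>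
    define E where "E = 13 + real (r * (n - 1) * (r * n * n))"
    obtain M0 :: nat where M0: "E / \<epsilon> < real M0" using reals_Archimedean2 by blast
    have "0 < E" unfolding E_def using of_nat_0_le_iff[of "r * (n - 1) * (r * n * n)"] by linarith
    then have "0 < E / \<epsilon>" using \<epsilon> by (intro divide_pos_pos)
    then have M00: "0 < M0" using M0 by (metis of_nat_0_less_iff order_less_trans)
    have EM: "E / real M0 < \<epsilon>" using M0 M00 \<epsilon> by (simp add: field_simps)
    show "\<forall>\<^sub>F q in prime_powers_at_top. dist (real (shift_count \<alpha> (F q) r (a n q) n) / real q ^ n) (Llim n r) < \<epsilon>"
      unfolding prime_powers_at_top_def eventually_inf_principal using eventually_ge_at_top[of "large_q n r M0"]
    proof eventually_elim
      case (elim q)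
      show ?case
      proof
        assume "q \<in> {q. primepow q}"
        then have pp: "primepow q" by simp
        note Fq = assms(3)[OF pp]
        \<comment> \<open>The shifts are only specified when \<open>r \<le> q ^ n\<close>, which is
          the condition that \<open>r\<close> distinct polynomials of degree below \<open>n\<close>
          exist; it holds above the threshold.\<close>
        have "r * 1 \<le> r * n" using n(1) by (intro mult_le_mono2)
        then have "r \<le> q" using elim unfolding large_q_def by linarith
        moreover have "q \<le> q ^ n" using n(1) by (cases "q = 0") (auto simp: self_le_power)
        ultimately have rq: "r \<le> q ^ n" by linarith
        note aq = assms(4)[OF n(1) pp rq]
        have "approx_claim (F q)" using approx_claim_finite_field[of "F q"] Fq pp by simp
        note c = this[unfolded approx_claim_def, THEN spec[of _ \<alpha>], THEN spec[of _ n], THEN spec[of _ r], THEN spec[of _ "a n q"], THEN spec[of _ M0]]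
        have lq: "large_q n r M0 \<le> card (carrier (F q))" using elim Fq by simp
        have "\<bar>real (shift_count \<alpha> (F q) r (a n q) n) / real (card (carrier (F q))) ^ n - Llim n r\<bar> \<le> E / real M0"
          unfolding E_def
          by (rule c[THEN mp, OF assms(2), THEN mp, OF n(1), THEN mp, OF n(2), THEN mp, OF assms(1), THEN mp, OF M00,
                THEN mp, OF conjunct1[OF aq], THEN mp, OF conjunct2[OF aq], THEN mp, OF lq])
        then show "dist (real (shift_count \<alpha> (F q) r (a n q) n) / real q ^ n) (Llim n r) < \<epsilon>"
          using EM Fq unfolding dist_real_def by simp
      qed
    qed
  qed
qed

end
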